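(* There exists a box space $X$ of a finitely generated residually finite group $\Gamma$ such that $X$ does not coarsely embed into any $L^p$-space for $1\le p<\infty$, but $X$ does not measured weakly contain any sequence of measured asymptotic expanders with uniformly bounded geometry. In fact, the group $\Gamma$ may also be chosen to be the free group $F_3$ of rank three.
   Context: Box space: for a finitely generated residually finite group $\Gamma$ with a finite generating set $S$ and a nested sequence of finite index normal subgroups $N_1\ge N_2\ge\cdots$ with $\bigcap_nN_n=\{e\}$, the box space is the coarse disjoint union $\bigsqcup_n\Gamma/N_n$, where $\Gamma/N_n$ has the word metric from the image of $S$. A coarse disjoint union of finite metric spaces $(X_n,d_n)$ is $X=\bigsqcup_nX_n$ with a metric $d$ restricting to $d_n$ on each $X_n$ and with $d(X_n,X_m)\to\infty$ as $n+m\to\infty$, $n\ne m$. An $L^p$-space is $L^p(Z,\nu)$ for some measure space. A map $f:X\to Y$ between metric spaces is a coarse embedding if there are non-decreasing unbounded $\rho_\pm:[0,\infty)\to[0,\infty)$ with $\rho_-(d_X(x,y))\le d_Y(f(x),f(y))\le\rho_+(d_X(x,y))$ for all $x,y$. A sequence of finite measured metric spaces $\{(X_n,d_n,m_n)\}_n$ consists of finite metric spaces with non-trivial finite measures $m_n$ on all subsets of $X_n$. It is a sequence of measured asymptotic expanders if for every $\alpha\in(0,\frac12]$ there exist $c_\alpha\in(0,1)$, $R_\alpha>0$ such that for every $n$ and $A\subseteq X_n$ with $\alpha m_n(X_n)\le m_n(A)\le\frac12m_n(X_n)$ one has $m_n(\partial_{R_\alpha}A)>c_\alpha m_n(A)$,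 where $\partial_RA=\{x\in X_n\setminus A:d_n(x,A)\le R\}$. It has uniformly bounded geometry if $\sup_n\sup_{x\in X_n}|B(x,R)|<\infty$ for all $R>0$. A metric space $Y$ measured weakly contains $\{(X_n,d_n,m_n)\}_n$ if there is a measured weak embedding of it into $Y$: maps $f_n:X_n\to Y$ such that (1) there is a non-decreasing unbounded $\rho_+:[0,\infty)\to[0,\infty)$ with $d_Y(f_n(x),f_n(y))\le\rho_+(d_n(x,y))$ for all $n$ and $x,y\in X_n$; (2) for every $R>0$, $\lim_{n\to\infty}\sup_{x\in X_n}\frac{m_n(f_n^{-1}(B(f_n(x),R)))}{m_n(X_n)}=0$, with $B(\cdot,R)$ the closed ball. *)

theory Defs
  imports "HOL-Analysis.Analysis" "HOL-Algebra.Generated_Groups"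
begin

section \<open>Maps between metric spaces\<close>

definition control_function :: "(real \<Rightarrow> real) \<Rightarrow> bool" where
  "control_function \<rho> \<longleftrightarrow>
     \<rho> \<in> {0..} \<rightarrow> {0..} \<and> mono_on {0..} \<rho> \<and> \<not> bdd_above (\<rho> ` {0..})"

definition coarse_embedding ::
    "'x set \<Rightarrow> ('x \<Rightarrow> 'x \<Rightarrow> real) \<Rightarrow> 'y set \<Rightarrow> ('y \<Rightarrow> 'y \<Rightarrow> real) \<Rightarrow> ('x \<Rightarrow> 'y) \<Rightarrow> bool" where
  "coarse_embedding X dX Y dY f \<longleftrightarrow> f \<in> X \<rightarrow> Y \<and>
     (\<exists>\<rho>1 \<rho>2. control_function \<rho>1 \<and> control_function \<rho>2 \<and>
       (\<forall>x\<in>X. \<forall>y\<in>X. \<rho>1 (dX x y) \<le> dY (f x) (f y) \<and> dY (f x) (f y) \<le> \<rho>2 (dX x y)))"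


section \<open>$L^p$-spaces\<close>

text \<open>
  As usual, elements of the real space $L^p(Z,\nu)$ are handled through representatives:
  \<open>Lp_dist\<close> is a pseudometric on \<open>Lp_funs\<close> whose metric quotient is $L^p(Z,\nu)$. A map into
  $L^p(Z,\nu)$ is a choice of representatives, and distances do not depend on that choice.
\<close>

definition Lp_funs :: "'z measure \<Rightarrow> real \<Rightarrow> ('z \<Rightarrow> real) set" where
  "Lp_funs M p = {f \<in> borel_measurable M. integrable M (\<lambda>z. \<bar>f z\<bar> powr p)}"

definition Lp_dist :: "'z measure \<Rightarrow> real \<Rightarrow> ('z \<Rightarrow> real) \<Rightarrow> ('z \<Rightarrow> real) \<Rightarrow> real" where
  "Lp_dist M p f g = (\<integral>z. \<bar>f z - g z\<bar> powr p \<partial>M) powr (1 / p)"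

text \<open>
  HOL cannot quantify over the type underlying the measure space inside a formula, so the
  definition below uses the type of all real functions on the points of \<open>X\<close>. This loses
  nothing: \<open>coarsely_embeds_into_LpI\<close> shows that a coarse embedding into $L^p(Z,\nu)$ over a
  measure space of any type yields one over this type (push $\nu$ forward along
  $z \mapsto (x \mapsto f(x)(z))$).
\<close>

definition coarsely_embeds_into_Lp :: "'x set \<Rightarrow> ('x \<Rightarrow> 'x \<Rightarrow> real) \<Rightarrow> real \<Rightarrow> bool" where
  "coarsely_embeds_into_Lp X d p \<longleftrightarrow>
     (\<exists>(M :: ('x \<Rightarrow> real) measure) f. coarse_embedding X d (Lp_funs M p) (Lp_dist M p) f)"

lemma coarsely_embeds_into_LpI:
  fixes M :: "'z measure" and X :: "'x set"
  assumes "coarse_embedding X d (Lp_funs M p) (Lp_dist M p) f"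
  shows "coarsely_embeds_into_Lp X d p"
proof -
  define P where "P = PiM (UNIV :: 'x set) (\<lambda>_. borel :: real measure)"
  define T where "T = (\<lambda>z x. if x \<in> X then f x z else 0)"
  define M' where "M' = distr M P T"
  define F where "F = (\<lambda>(x::'x) (\<phi>::'x \<Rightarrow> real). \<phi> x)"
  have f: "f x \<in> borel_measurable M" "integrable M (\<lambda>z. \<bar>f x z\<bar> powr p)" if "x \<in> X" for x
    using assms that by (auto simp: coarse_embedding_def Lp_funs_def)
  have T: "T \<in> measurable M P"
    unfolding P_def T_def
  proof (rule measurable_PiM_single')
    show "(\<lambda>z. if x \<in> X then f x z else 0) \<in> borel_measurable M" for x
      by (cases "x \<in> X") (simp_all add: f(1))
  qed simp
  have F: "F x \<in> borel_measurable P" for x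
    unfolding F_def P_def by measurable
  have TF: "F x (T z) = f x z" if "x \<in> X" for x z
    using that by (simp add: F_def T_def)
  have mem: "F x \<in> Lp_funs M' p" if x: "x \<in> X" for x
  proof -
    have "integrable M' (\<lambda>\<phi>. \<bar>F x \<phi>\<bar> powr p)"
      unfolding M'_def
      using T F[of x] f(2)[OF x] by (subst integrable_distr_eq) (simp_all add: TF[OF x])
    with F[of x] show ?thesis
      by (simp add: Lp_funs_def M'_def)
  qed
  have dist: "Lp_dist M' p (F x) (F y) = Lp_dist M p (f x) (f y)" if x: "x \<in> X" "y \<in> X" for x y
    unfolding Lp_dist_def M'_def
    using T F[of x] F[of y] by (subst integral_distr) (simp_all add: TF x)
  have "coarse_embedding X d (Lp_funs M' p) (Lp_dist M' p) F"
    using assms mem unfolding coarse_embedding_def by (auto simp: dist)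
  then show ?thesis
    unfolding coarsely_embeds_into_Lp_def by blast
qed


section \<open>Measured asymptotic expanders and measured weak containment\<close>

definition finite_measured_metric_spaces ::
    "(nat \<Rightarrow> 'a set) \<Rightarrow> (nat \<Rightarrow> 'a \<Rightarrow> 'a \<Rightarrow> real) \<Rightarrow> (nat \<Rightarrow> 'a measure) \<Rightarrow> bool" where
  "finite_measured_metric_spaces X d m \<longleftrightarrow>
     (\<forall>n. finite (X n) \<and> Metric_space (X n) (d n) \<and>
          space (m n) = X n \<and> sets (m n) = Pow (X n) \<and>
          finite_measure (m n) \<and> measure (m n) (X n) \<noteq> 0)"

definition outer_boundary ::
    "'a set \<Rightarrow> ('a \<Rightarrow> 'a \<Rightarrow> real) \<Rightarrow> real \<Rightarrow> 'a set \<Rightarrow> 'a set" where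
  "outer_boundary X d R A = {x \<in> X - A. (INF a\<in>A. d x a) \<le> R}"

definition measured_asymptotic_expanders ::
    "(nat \<Rightarrow> 'a set) \<Rightarrow> (nat \<Rightarrow> 'a \<Rightarrow> 'a \<Rightarrow> real) \<Rightarrow> (nat \<Rightarrow> 'a measure) \<Rightarrow> bool" where
  "measured_asymptotic_expanders X d m \<longleftrightarrow>
     finite_measured_metric_spaces X d m \<and>
     (\<forall>\<alpha>. 0 < \<alpha> \<and> \<alpha> \<le> 1/2 \<longrightarrow>
       (\<exists>c R. 0 < c \<and> c < 1 \<and> 0 < R \<and>
         (\<forall>n A. A \<subseteq> X n \<and>
              \<alpha> * measure (m n) (X n) \<le> measure (m n) A \<and>
              measure (m n) A \<le> 1/2 * measure (m n) (X n) \<longrightarrow>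
            measure (m n) (outer_boundary (X n) (d n) R A) > c * measure (m n) A)))"

definition uniformly_bounded_geometry ::
    "(nat \<Rightarrow> 'a set) \<Rightarrow> (nat \<Rightarrow> 'a \<Rightarrow> 'a \<Rightarrow> real) \<Rightarrow> bool" where
  "uniformly_bounded_geometry X d \<longleftrightarrow>
     (\<forall>R>0. \<exists>K. \<forall>n. \<forall>x\<in>X n. card {y \<in> X n. d n x y \<le> R} \<le> K)"

definition measured_weak_embedding ::
    "(nat \<Rightarrow> 'a set) \<Rightarrow> (nat \<Rightarrow> 'a \<Rightarrow> 'a \<Rightarrow> real) \<Rightarrow> (nat \<Rightarrow> 'a measure) \<Rightarrow>
     'y set \<Rightarrow> ('y \<Rightarrow> 'y \<Rightarrow> real) \<Rightarrow> (nat \<Rightarrow> 'a \<Rightarrow> 'y) \<Rightarrow> bool" where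
  "measured_weak_embedding X d m Y dY f \<longleftrightarrow>
     (\<forall>n. f n \<in> X n \<rightarrow> Y) \<and>
     (\<exists>\<rho>. control_function \<rho> \<and>
        (\<forall>n. \<forall>x\<in>X n. \<forall>y\<in>X n. dY (f n x) (f n y) \<le> \<rho> (d n x y))) \<and>
     (\<forall>R>0. (\<lambda>n. SUP x\<in>X n.
          measure (m n) {y \<in> X n. dY (f n x) (f n y) \<le> R} / measure (m n) (X n))
        \<longlonglongrightarrow> 0)"

definition measured_weakly_contains ::
    "'y set \<Rightarrow> ('y \<Rightarrow> 'y \<Rightarrow> real) \<Rightarrow>
     (nat \<Rightarrow> 'a set) \<Rightarrow> (nat \<Rightarrow> 'a \<Rightarrow> 'a \<Rightarrow> real) \<Rightarrow> (nat \<Rightarrow> 'a measure) \<Rightarrow> bool" where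
  "measured_weakly_contains Y dY X d m \<longleftrightarrow> (\<exists>f. measured_weak_embedding X d m Y dY f)"

text \<open>
  The points of the finite spaces are taken to be natural numbers, again because HOL cannot
  quantify over types; \<open>weakly_contains_some_expandersI\<close> covers sequences over any type.
\<close>

definition weakly_contains_some_expanders :: "'y set \<Rightarrow> ('y \<Rightarrow> 'y \<Rightarrow> real) \<Rightarrow> bool" where
  "weakly_contains_some_expanders Y dY \<longleftrightarrow>
     (\<exists>(X :: nat \<Rightarrow> nat set) d m.
        measured_asymptotic_expanders X d m \<and> uniformly_bounded_geometry X d \<and>
        measured_weakly_contains Y dY X d m)"

lemma weakly_contains_some_expandersI:
  fixes X :: "nat \<Rightarrow> 'a set"
  assumes exp: "measured_asymptotic_expanders X d m"
    and geo: "uniformly_bounded_geometry X d"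
    and cont: "measured_weakly_contains Y dY X d m"
  shows "weakly_contains_some_expanders Y dY"
proof -
  have fm: "finite (X n)" "Metric_space (X n) (d n)" "space (m n) = X n"
      "sets (m n) = Pow (X n)" "finite_measure (m n)" "measure (m n) (X n) \<noteq> 0" for n
    using exp by (auto simp: measured_asymptotic_expanders_def finite_measured_metric_spaces_def)
  have "\<exists>h. bij_betw h (X n) {0..<card (X n)}" for n
    using ex_bij_betw_finite_nat[OF fm(1)] .
  then obtain h where h: "bij_betw (h n) (X n) {0..<card (X n)}" for n by metis
  define X' where "X' = (\<lambda>n. {0..<card (X n)})"
  define g where "g = (\<lambda>n. inv_into (X n) (h n))"
  have g: "bij_betw (g n) (X' n) (X n)" for n
    using bij_betw_inv_into[OF h[of n]] by (simp add: g_def X'_def)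
  have gX: "g n ` X' n = X n" and gi: "inj_on (g n) (X' n)" for n
    using g[of n] by (auto simp: bij_betw_def)
  have gin: "g n i \<in> X n" if "i \<in> X' n" for n i using gX that by blast
  have hg: "h n (g n i) = i" if "i \<in> X' n" for n i
    using h[of n] that by (auto simp: g_def X'_def bij_betw_def f_inv_into_f)
  have gh: "g n (h n x) = x" and hin: "h n x \<in> X' n" if "x \<in> X n" for n x
    using h[of n] that by (auto simp: g_def X'_def bij_betw_def)
  define d' where "d' = (\<lambda>n i j. d n (g n i) (g n j))"
  define m' where "m' = (\<lambda>n. distr (m n) (count_space (X' n)) (h n))"
  have hm: "h n \<in> measurable (m n) (count_space (X' n))" for n
    by (rule measurableI) (auto simp: fm(3,4) hin)
  have meas: "measure (m' n) A = measure (m n) (g n ` A)" if A: "A \<subseteq> X' n" for n A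
  proof -
    have "h n -` A \<inter> space (m n) = g n ` A"
    proof
      show "h n -` A \<inter> space (m n) \<subseteq> g n ` A"
        by (auto simp: fm(3) image_iff) (metis gh)
      show "g n ` A \<subseteq> h n -` A \<inter> space (m n)"
        using A by (auto simp: fm(3) hg gin subset_iff)
    qed
    then show ?thesis
      unfolding m'_def using A by (subst measure_distr[OF hm]) auto
  qed
  have measX: "measure (m' n) (X' n) = measure (m n) (X n)" for n
    by (simp add: meas gX)
  have fin': "finite_measured_metric_spaces X' d' m'"
    unfolding finite_measured_metric_spaces_def
  proof (intro allI conjI)
    fix n
    interpret Metric_space "X n" "d n" by (rule fm(2))
    show "Metric_space (X' n) (d' n)"
    proof
      fix x y z
      show "0 \<le> d' n x y" by (simp add: d'_def)
      show "d' n x y = d' n y x" by (simp add: d'_def commute)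
      show "(d' n x y = 0) = (x = y)" if "x \<in> X' n" "y \<in> X' n"
        using that gi[of n] gin by (auto simp: d'_def inj_on_def)
      show "d' n x z \<le> d' n x y + d' n y z" if "x \<in> X' n" "y \<in> X' n" "z \<in> X' n"
        using that gin by (simp add: d'_def triangle)
    qed
    show "finite (X' n)" by (simp add: X'_def)
    show "space (m' n) = X' n" "sets (m' n) = Pow (X' n)" by (simp_all add: m'_def)
    show "finite_measure (m' n)"
      unfolding m'_def by (rule finite_measure.finite_measure_distr[OF fm(5) hm])
    show "measure (m' n) (X' n) \<noteq> 0" by (simp add: measX fm(6))
  qed
  have bd: "g n ` outer_boundary (X' n) (d' n) R A = outer_boundary (X n) (d n) R (g n ` A)"
    if A: "A \<subseteq> X' n" for n R A
  proof -
    have "g n i \<in> g n ` A \<longleftrightarrow> i \<in> A" if "i \<in> X' n" for i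
      using gi[of n] A that by (simp add: inj_on_image_mem_iff)
    then show ?thesis
      unfolding outer_boundary_def d'_def gX[of n, symmetric] by (auto simp: image_image)
  qed
  have exp': "measured_asymptotic_expanders X' d' m'"
    unfolding measured_asymptotic_expanders_def
  proof (intro conjI fin' allI impI)
    fix \<alpha> :: real assume "0 < \<alpha> \<and> \<alpha> \<le> 1/2"
    then obtain c R where c: "0 < c" "c < 1" "0 < R"
      and *: "\<And>n A. A \<subseteq> X n \<Longrightarrow> \<alpha> * measure (m n) (X n) \<le> measure (m n) A \<Longrightarrow>
          measure (m n) A \<le> 1/2 * measure (m n) (X n) \<Longrightarrow>
          measure (m n) (outer_boundary (X n) (d n) R A) > c * measure (m n) A"
      using exp unfolding measured_asymptotic_expanders_def by metis
    have "measure (m' n) (outer_boundary (X' n) (d' n) R A) > c * measure (m' n) A"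
      if A: "A \<subseteq> X' n" "\<alpha> * measure (m' n) (X' n) \<le> measure (m' n) A"
         "measure (m' n) A \<le> 1/2 * measure (m' n) (X' n)" for n A
    proof -
      have "outer_boundary (X' n) (d' n) R A \<subseteq> X' n" by (auto simp: outer_boundary_def)
      moreover have "g n ` A \<subseteq> X n" using A(1) gin by auto
      ultimately show ?thesis
        using *[of "g n ` A" n] A by (simp add: meas bd gX)
    qed
    with c show "\<exists>c R. 0 < c \<and> c < 1 \<and> 0 < R \<and>
        (\<forall>n A. A \<subseteq> X' n \<and> \<alpha> * measure (m' n) (X' n) \<le> measure (m' n) A \<and>
           measure (m' n) A \<le> 1/2 * measure (m' n) (X' n) \<longrightarrow>
           measure (m' n) (outer_boundary (X' n) (d' n) R A) > c * measure (m' n) A)"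
      by blast
  qed
  have geo': "uniformly_bounded_geometry X' d'"
    unfolding uniformly_bounded_geometry_def
  proof (intro allI impI)
    fix R :: real assume "0 < R"
    then obtain K where K: "\<And>n x. x \<in> X n \<Longrightarrow> card {y \<in> X n. d n x y \<le> R} \<le> K"
      using geo unfolding uniformly_bounded_geometry_def by metis
    have "card {j \<in> X' n. d' n i j \<le> R} \<le> K" if i: "i \<in> X' n" for n i
    proof -
      have "card {j \<in> X' n. d' n i j \<le> R} = card (g n ` {j \<in> X' n. d' n i j \<le> R})"
        by (rule card_image[symmetric]) (rule inj_on_subset[OF gi], auto)
      also have "g n ` {j \<in> X' n. d' n i j \<le> R} = {y \<in> X n. d n (g n i) y \<le> R}"
        unfolding gX[of n, symmetric] d'_def by auto
      finally show ?thesis using K[OF gin[OF i]] by simp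
    qed
    then show "\<exists>K. \<forall>n. \<forall>x\<in>X' n. card {y \<in> X' n. d' n x y \<le> R} \<le> K" by blast
  qed
  obtain f where f: "measured_weak_embedding X d m Y dY f"
    using cont by (auto simp: measured_weakly_contains_def)
  have S: "(SUP i\<in>X' n. measure (m' n) {j \<in> X' n. dY (f n (g n i)) (f n (g n j)) \<le> R}
        / measure (m' n) (X' n))
      = (SUP x\<in>X n. measure (m n) {y \<in> X n. dY (f n x) (f n y) \<le> R} / measure (m n) (X n))"
    for n R
  proof -
    have "g n ` {j \<in> X' n. dY (f n (g n i)) (f n (g n j)) \<le> R}
        = {y \<in> X n. dY (f n (g n i)) (f n y) \<le> R}" for i
      unfolding gX[of n, symmetric] by auto
    then have "measure (m' n) {j \<in> X' n. dY (f n (g n i)) (f n (g n j)) \<le> R}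
        = measure (m n) {y \<in> X n. dY (f n (g n i)) (f n y) \<le> R}" for i
      by (subst meas) auto
    then have "(SUP i\<in>X' n. measure (m' n) {j \<in> X' n. dY (f n (g n i)) (f n (g n j)) \<le> R}
        / measure (m' n) (X' n))
      = (SUP x\<in>g n ` X' n. measure (m n) {y \<in> X n. dY (f n x) (f n y) \<le> R}
        / measure (m n) (X n))"
      by (simp add: image_image measX)
    then show ?thesis by (simp add: gX)
  qed
  have "measured_weak_embedding X' d' m' Y dY (\<lambda>n i. f n (g n i))"
    using f unfolding measured_weak_embedding_def S
    by (auto simp: d'_def gin Pi_iff)
  then show ?thesis
    using exp' geo' unfolding weakly_contains_some_expanders_def measured_weakly_contains_def
    by blast
qed


section \<open>Box spaces\<close>

definition word_length :: "('g, 'b) monoid_scheme \<Rightarrow> 'g set \<Rightarrow> 'g \<Rightarrow> nat" where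
  "word_length G S g =
     (LEAST k. \<exists>ws. length ws = k \<and> set ws \<subseteq> S \<union> m_inv G ` S \<and>
        foldr (\<lambda>x y. x \<otimes>\<^bsub>G\<^esub> y) ws \<one>\<^bsub>G\<^esub> = g)"

definition word_metric :: "('g, 'b) monoid_scheme \<Rightarrow> 'g set \<Rightarrow> 'g \<Rightarrow> 'g \<Rightarrow> real" where
  "word_metric G S x y = real (word_length G S (inv\<^bsub>G\<^esub> x \<otimes>\<^bsub>G\<^esub> y))"

definition finite_generating_set :: "('g, 'b) monoid_scheme \<Rightarrow> 'g set \<Rightarrow> bool" where
  "finite_generating_set G S \<longleftrightarrow> finite S \<and> S \<subseteq> carrier G \<and> generate G S = carrier G"

definition finite_index_normal :: "'g set \<Rightarrow> ('g, 'b) monoid_scheme \<Rightarrow> bool" where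
  "finite_index_normal N G \<longleftrightarrow> N \<lhd> G \<and> finite (rcosets\<^bsub>G\<^esub> N)"

definition residually_finite :: "('g, 'b) monoid_scheme \<Rightarrow> bool" where
  "residually_finite G \<longleftrightarrow>
     (\<forall>g \<in> carrier G. g \<noteq> \<one>\<^bsub>G\<^esub> \<longrightarrow> (\<exists>N. finite_index_normal N G \<and> g \<notin> N))"

text \<open>
  \<open>X\<close> is the disjoint union of the sets \<open>Xs n\<close>, and \<open>d\<close> is a metric on it as in the definition
  of a coarse disjoint union; the last condition spells out $d(X_n,X_m) \to \infty$.
\<close>

definition coarse_disjoint_union ::
    "(nat \<Rightarrow> 'a set) \<Rightarrow> (nat \<Rightarrow> 'a \<Rightarrow> 'a \<Rightarrow> real) \<Rightarrow>
     (nat \<times> 'a) set \<Rightarrow> (nat \<times> 'a \<Rightarrow> nat \<times> 'a \<Rightarrow> real) \<Rightarrow> bool" where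
  "coarse_disjoint_union Xs ds X d \<longleftrightarrow>
     X = (SIGMA n:UNIV. Xs n) \<and> Metric_space X d \<and>
     (\<forall>n. \<forall>x\<in>Xs n. \<forall>y\<in>Xs n. d (n, x) (n, y) = ds n x y) \<and>
     (\<forall>R. \<exists>K. \<forall>n m. n \<noteq> m \<and> K \<le> n + m \<longrightarrow>
        (\<forall>x\<in>Xs n. \<forall>y\<in>Xs m. R \<le> d (n, x) (m, y)))"

definition box_space ::
    "('g, 'b) monoid_scheme \<Rightarrow> (nat \<times> 'g set) set \<Rightarrow>
     (nat \<times> 'g set \<Rightarrow> nat \<times> 'g set \<Rightarrow> real) \<Rightarrow> bool" where
  "box_space G X d \<longleftrightarrow>
     (\<exists>S N. finite_generating_set G S \<and>
        (\<forall>n. finite_index_normal (N n) G) \<and> (\<forall>n. N (Suc n) \<subseteq> N n) \<and>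
        (\<Inter>n. N n) = {\<one>\<^bsub>G\<^esub>} \<and>
        coarse_disjoint_union (\<lambda>n. carrier (G Mod N n))
          (\<lambda>n. word_metric (G Mod N n) ((\<lambda>s. N n #>\<^bsub>G\<^esub> s) ` S)) X d)"


section \<open>Free groups\<close>

text \<open>
  A letter \<open>(b, True)\<close> stands for the generator \<open>b\<close> and \<open>(b, False)\<close> for its inverse. Elements of
  the free group are reduced words; the product is concatenation followed by free reduction.
\<close>

definition inv_letter :: "'a \<times> bool \<Rightarrow> 'a \<times> bool" where
  "inv_letter l = (fst l, \<not> snd l)"

definition reduced_word :: "('a \<times> bool) list \<Rightarrow> bool" where
  "reduced_word w \<longleftrightarrow> successively (\<lambda>k l. l \<noteq> inv_letter k) w"

fun cons_reduce :: "'a \<times> bool \<Rightarrow> ('a \<times> bool) list \<Rightarrow> ('a \<times> bool) list" where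
  "cons_reduce k [] = [k]"
| "cons_reduce k (l # w) = (if l = inv_letter k then w else k # l # w)"

definition free_group :: "'a set \<Rightarrow> ('a \<times> bool) list monoid" where
  "free_group B =
     \<lparr>carrier = {w. fst ` set w \<subseteq> B \<and> reduced_word w},
      mult = foldr cons_reduce,
      one = []\<rparr>"

lemma inv_letter_inv_letter [simp]: "inv_letter (inv_letter l) = l"
  by (simp add: inv_letter_def)

lemma inv_letter_neq [simp]: "inv_letter l \<noteq> l" "l \<noteq> inv_letter l"
  by (auto simp: inv_letter_def prod_eq_iff)

lemma fst_inv_letter [simp]: "fst (inv_letter l) = fst l"
  by (simp add: inv_letter_def)

lemma reduced_word_Nil [simp]: "reduced_word []"
  by (simp add: reduced_word_def)

lemma reduced_word_Cons:
  "reduced_word (k # w) \<longleftrightarrow> reduced_word w \<and> (w = [] \<or> hd w \<noteq> inv_letter k)"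
  by (cases w) (auto simp: reduced_word_def)

lemma reduced_cons_reduce: "reduced_word w \<Longrightarrow> reduced_word (cons_reduce k w)"
  by (cases w) (auto simp: reduced_word_Cons)

lemma reduced_foldr: "reduced_word w \<Longrightarrow> reduced_word (foldr cons_reduce v w)"
  by (induction v) (auto simp: reduced_cons_reduce)

lemma cons_reduce_cancel:
  "reduced_word w \<Longrightarrow> cons_reduce k (cons_reduce (inv_letter k) w) = w"
  by (cases w; cases "tl w") (auto simp: reduced_word_Cons)

lemma foldr_reduced_Nil: "reduced_word w \<Longrightarrow> foldr cons_reduce w [] = w"
proof (induction w)
  case (Cons k w)
  then show ?case by (cases w) (auto simp: reduced_word_Cons)
qed simp

lemma foldr_cons_reduce:
  assumes "reduced_word w"
  shows "foldr cons_reduce (cons_reduce k v) w = cons_reduce k (foldr cons_reduce v w)"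
proof (cases v)
  case (Cons l u)
  then show ?thesis
    using cons_reduce_cancel[OF reduced_foldr[OF assms, of u], of k] by auto
qed simp

lemma foldr_assoc:
  assumes "reduced_word w"
  shows "foldr cons_reduce (foldr cons_reduce u v) w
    = foldr cons_reduce u (foldr cons_reduce v w)"
  by (induction u) (simp_all add: foldr_cons_reduce[OF assms])

lemma letters_cons_reduce: "fst ` set (cons_reduce k w) \<subseteq> insert (fst k) (fst ` set w)"
  by (cases w) auto

lemma letters_foldr: "fst ` set (foldr cons_reduce v w) \<subseteq> fst ` set v \<union> fst ` set w"
proof (induction v)
  case (Cons k v)
  have "fst ` set (foldr cons_reduce (k # v) w) \<subseteq>
      insert (fst k) (fst ` set (foldr cons_reduce v w))"
    using letters_cons_reduce by simp
  also have "\<dots> \<subseteq> insert (fst k) (fst ` set v \<union> fst ` set w)"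
    using Cons by blast
  finally show ?case by simp
qed simp

lemma foldr_inverse:
  "reduced_word w \<Longrightarrow> foldr cons_reduce (rev (map inv_letter w)) w = []"
  by (induction w) (auto simp: reduced_word_Cons)

lemma group_free_group: "group (free_group B)"
proof (rule groupI)
  fix x assume x: "x \<in> carrier (free_group B)"
  define y where "y = foldr cons_reduce (rev (map inv_letter x)) []"
  have "fst ` set y \<subseteq> fst ` set x"
    using letters_foldr[of "rev (map inv_letter x)" "[]"] by (auto simp: y_def image_image)
  moreover have "foldr cons_reduce y x = []"
    using x foldr_inverse[of x] foldr_assoc[of x "rev (map inv_letter x)" "[]"]
    by (simp add: free_group_def y_def)
  ultimately show "\<exists>y\<in>carrier (free_group B). y \<otimes>\<^bsub>free_group B\<^esub> x = \<one>\<^bsub>free_group B\<^esub>"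
    using x by (intro bexI[of _ y]) (auto simp: free_group_def y_def reduced_foldr)
next
  fix x y assume "x \<in> carrier (free_group B)" "y \<in> carrier (free_group B)"
  then show "x \<otimes>\<^bsub>free_group B\<^esub> y \<in> carrier (free_group B)"
    using subset_trans[OF letters_foldr[of x y], of B] by (simp add: free_group_def reduced_foldr)
qed (simp_all add: free_group_def foldr_assoc)

end

theory Submission
  imports Defs "HOL-Computational_Algebra.Primes" "HOL-Number_Theory.Cong"
    "HOL-Algebra.Multiplicative_Group"
begin

text \<open>
  The free group of rank three acts through the integral quaternions $1 \pm 2i$, $1 \pm 2j$,
  $1 \pm 2k$ of norm 5, and \<open>cong_ker n\<close> is the kernel of its reduction modulo $13^n$ and scalars.
  The box space is formed by the quotients by $N_n = K_{t_n} \cap M_n$ with \<open>K\<^sub>t = cong_ker t\<close>, where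
  $M_n$ is the intersection of the kernels of the mod 2 homology covers of the Cayley graphs of
  the quotients by $K_1, \dots, K_{n+1}$, and $t_n$ is large compared with the index of $M_n$.

  Counting lattice points on spheres and circles bounds the return probability of the random walk
  on the quotient by $N_n$. A function on which a suitable element of $M_n$ acts by a root of
  unity of large order has a large orbit under conjugation, hence the high multiplicity of the
  corresponding eigenvalues of the walk gives a spectral gap relative to $M_n$. It yields
  an $L^p$ inequality which bounds the mean displacement of a map under some $\zeta \in M_n \setminus K_{t_n}$
  by its mean displacement under words of length 600. But $\zeta$ moves every point at
  least as far as the girth of $K_{n+1}$, so that no map to $L^p$ can be a coarse embedding.

  The edges of the Cayley graph of the quotient by $K_{n+1}$ are walls for its homology cover: the
  number of walls that separate two points is at most their distance, with equality below the girth.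
  In a sequence of expanders that maps to the box space, the random cut which selects every
  wall with a small probability has a small boundary, so it cannot be balanced; therefore almost
  all points are separated from some point by boundedly many walls. Chains of small steps among
  these points have bounded diameter in the box space, hence small measure, and unions of
  such components contradict the expansion.
\<close>

text \<open>The two demands pull against each other: quotients with a spectral gap for all functions
  would be expanders. Hence the gap is sought only for functions of mean zero along the orbits of
  \<zeta>, and \<zeta> is taken inside the covers, where walls are available. The gap rests on a
  budget. The quotient has order about \<open>13 ^ (3 * t)\<close> and the multiplicity is about
  \<open>13 ^ t\<close>, so the collision probability after \<open>m\<close> steps must drop below
  about \<open>13 ^ (- 2 * t) * 4 ^ (- m)\<close>. The trivial count of lattice points on spheres
  just fails to give this; lowering its exponent by a quarter suffices. Steps have length 600
  because each step loses a factor polynomial in its length. The primes: divisibility by 5 makes the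
  quaternions of norm 5 free; 5 is no square modulo 13, so kernel words have even length and square
  norm; -1 is a square modulo 13, which provides unipotent elements that a generator conjugates to
  many of their powers. All finite \<open>p\<close> come from the gap in \<open>L^2\<close>:
  indicator functions turn it into an \<open>L^1\<close> inequality, the Mazur map turns this into
  one for \<open>L^p\<close>.\<close>

lemma mult_free_group [simp]: "u \<otimes>\<^bsub>free_group B\<^esub> v = foldr cons_reduce u v"
  by (simp add: free_group_def)

lemma one_free_group [simp]: "\<one>\<^bsub>free_group B\<^esub> = []"
  by (simp add: free_group_def)

lemma carrier_free_group: "w \<in> carrier (free_group B) \<longleftrightarrow> fst ` set w \<subseteq> B \<and> reduced_word w"
  by (simp add: free_group_def)

definition inv_word :: "('a \<times> bool) list \<Rightarrow> ('a \<times> bool) list" where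
  "inv_word w = rev (map inv_letter w)"

lemma length_inv_word [simp]: "length (inv_word w) = length w"
  by (simp add: inv_word_def)

lemma inv_letter_inject [simp]: "inv_letter k = inv_letter l \<longleftrightarrow> k = l"
  by (metis inv_letter_inv_letter)

lemma reduced_inv_word: "reduced_word w \<Longrightarrow> reduced_word (inv_word w)"
  unfolding reduced_word_def inv_word_def successively_rev successively_map
  by (erule successively_mono) (metis inv_letter_inv_letter)

lemma inv_word_carrier: "w \<in> carrier (free_group B) \<Longrightarrow> inv_word w \<in> carrier (free_group B)"
  by (simp add: carrier_free_group reduced_inv_word) (simp add: inv_word_def image_image)

lemma inv_free_group:
  assumes "w \<in> carrier (free_group B)"
  shows "inv\<^bsub>free_group B\<^esub> w = inv_word w"
proof -
  interpret group "free_group B" by (rule group_free_group)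
  show ?thesis
    using assms foldr_inverse[of w]
    by (intro inv_equality inv_word_carrier) (auto simp: carrier_free_group inv_word_def[symmetric])
qed

lemma reduced_append_Cons:
  "reduced_word (x @ [k]) \<Longrightarrow> reduced_word (k # w) \<Longrightarrow> reduced_word (x @ k # w)"
  by (simp add: reduced_word_def successively_append_iff)

lemma foldr_reduced_append:
  "reduced_word (x @ w) \<Longrightarrow> foldr cons_reduce x w = x @ w"
proof (induction x)
  case (Cons k x)
  then have "reduced_word (x @ w)" "x @ w = [] \<or> hd (x @ w) \<noteq> inv_letter k"
    by (auto simp: reduced_word_Cons)
  with Cons.IH show ?case
    by (cases "x @ w") auto
qed simp

text \<open>Here \<open>c\<close> is the number of cancelling pairs. The induction peels letters off
  the end of \<open>x\<close>, since these are the ones that meet \<open>w\<close> first.\<close>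

lemma foldr_cancellation:
  assumes "reduced_word x" "reduced_word w"
  shows "\<exists>c\<le>length x. c \<le> length w \<and> take c w = take c (inv_word x) \<and>
           length (foldr cons_reduce x w) + 2 * c = length x + length w"
  using assms
proof (induction x arbitrary: w rule: rev_induct)
  case Nil
  show ?case by (intro exI[of _ 0]) simp
next
  case (snoc k x)
  have rx: "reduced_word x"
    using snoc.prems(1) by (simp add: reduced_word_def successively_append_iff)
  show ?case
  proof (cases "w \<noteq> [] \<and> hd w = inv_letter k")
    case True
    then obtain w' where w: "w = inv_letter k # w'" by (cases w) auto
    then have "reduced_word w'" using snoc.prems(2) by (simp add: reduced_word_Cons)
    from snoc.IH[OF rx this] obtain c where
      c: "c \<le> length x" "c \<le> length w'" "take c w' = take c (inv_word x)"
         "length (foldr cons_reduce x w') + 2 * c = length x + length w'" by blast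
    show ?thesis
      by (intro exI[of _ "Suc c"]) (use c w in \<open>auto simp: inv_word_def\<close>)
  next
    case False
    then have cw: "cons_reduce k w = k # w" by (cases w) auto
    have "reduced_word (k # w)"
      using False snoc.prems(2) by (auto simp: reduced_word_Cons)
    then have "foldr cons_reduce (x @ [k]) w = x @ k # w"
      using reduced_append_Cons[OF snoc.prems(1)] by (simp add: cw foldr_reduced_append)
    then show ?thesis by (intro exI[of _ 0]) simp
  qed
qed

lemma length_foldr_le:
  "length (foldr cons_reduce x w) \<le> length x + length w"
proof (induction x)
  case (Cons k x)
  have "length (cons_reduce k v) \<le> Suc (length v)" for v by (cases v) auto
  from this[of "foldr cons_reduce x w"] Cons show ?case by simp
qed simp

section \<open>Spheres in free groups\<close>

definition sphere_words :: "'a set \<Rightarrow> nat \<Rightarrow> ('a \<times> bool) list set" where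
  "sphere_words B n = {w \<in> carrier (free_group B). length w = n}"

lemma finite_sphere_words: "finite B \<Longrightarrow> finite (sphere_words B n)"
proof -
  assume "finite B"
  then have "finite {w. set w \<subseteq> B \<times> (UNIV :: bool set) \<and> length w = n}"
    by (intro finite_lists_length_eq) auto
  moreover have "sphere_words B n \<subseteq> {w. set w \<subseteq> B \<times> UNIV \<and> length w = n}"
    by (auto simp: sphere_words_def carrier_free_group)
  ultimately show ?thesis
    by (rule finite_subset[rotated])
qed

text \<open>Excluding one first letter models the letter in front of the word: every position then
  has \<open>2 * card B - 1\<close> choices, the first included, so the induction closes with a pure
  power.\<close>

lemma card_words_avoiding:
  assumes "finite B" "fst l \<in> B"
  shows "card {w \<in> sphere_words B n. w = [] \<or> hd w \<noteq> l} = (2 * card B - 1) ^ n"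
  using assms(2)
proof (induction n arbitrary: l)
  case 0
  have "{w \<in> sphere_words B 0. w = [] \<or> hd w \<noteq> l} = {[]}"
    by (auto simp: sphere_words_def carrier_free_group)
  then show ?case by simp
next
  case (Suc n)
  let ?A = "\<lambda>k. {w \<in> sphere_words B n. w = [] \<or> hd w \<noteq> inv_letter k}"
  have eq: "{w \<in> sphere_words B (Suc n). w = [] \<or> hd w \<noteq> l}
      = (\<Union>k \<in> (B \<times> UNIV) - {l}. (#) k ` ?A k)"
  proof (rule Set.set_eqI)
    fix w show "w \<in> {w \<in> sphere_words B (Suc n). w = [] \<or> hd w \<noteq> l}
      \<longleftrightarrow> w \<in> (\<Union>k \<in> (B \<times> UNIV) - {l}. (#) k ` ?A k)"
      by (cases w) (auto simp: sphere_words_def carrier_free_group reduced_word_Cons)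
  qed
  have "card {w \<in> sphere_words B (Suc n). w = [] \<or> hd w \<noteq> l}
      = (\<Sum>k \<in> (B \<times> UNIV) - {l}. card ((#) k ` ?A k))"
    unfolding eq
    by (rule card_UN_disjoint) (use assms(1) finite_sphere_words[OF assms(1)] in auto)
  also have "\<dots> = (\<Sum>k \<in> (B \<times> (UNIV :: bool set)) - {l}. (2 * card B - 1) ^ n)"
    by (intro sum.cong refl) (auto simp: card_image Suc.IH)
  also have "\<dots> = (2 * card B - 1) * (2 * card B - 1) ^ n"
    using assms(1) Suc.prems
    by (cases l) (simp add: card_Diff_singleton_if card_cartesian_product mult.commute)
  finally show ?case by simp
qed

lemma card_sphere_words:
  assumes "finite B"
  shows "card (sphere_words B (Suc n)) = 2 * card B * (2 * card B - 1) ^ n"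
proof -
  let ?A = "\<lambda>k. {w \<in> sphere_words B n. w = [] \<or> hd w \<noteq> inv_letter k}"
  have eq: "sphere_words B (Suc n) = (\<Union>k \<in> (B \<times> UNIV). (#) k ` ?A k)"
  proof (rule Set.set_eqI)
    fix w show "w \<in> sphere_words B (Suc n) \<longleftrightarrow> w \<in> (\<Union>k \<in> B \<times> UNIV. (#) k ` ?A k)"
      by (cases w) (auto simp: sphere_words_def carrier_free_group reduced_word_Cons image_iff
          simp del: split_paired_All split_paired_Ex)
  qed
  have "card (sphere_words B (Suc n)) = (\<Sum>k \<in> B \<times> UNIV. card ((#) k ` ?A k))"
    unfolding eq by (rule card_UN_disjoint) (use assms finite_sphere_words[OF assms] in auto)
  also have "\<dots> = (\<Sum>k \<in> B \<times> (UNIV :: bool set). (2 * card B - 1) ^ n)"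
    by (intro sum.cong refl) (auto simp: card_image card_words_avoiding assms)
  finally show ?thesis by (simp add: card_cartesian_product)
qed

text \<open>What follows a prefix avoids the inverse of its last letter. An empty prefix would leave
  \<open>2 * card B\<close> choices for the next letter, hence \<open>1 \<le> c\<close>.\<close>

lemma card_sphere_words_prefix:
  assumes B: "finite B" and c: "1 \<le> c" "c \<le> n"
  shows "card {w \<in> sphere_words B n. take c w = p} \<le> (2 * card B - 1) ^ (n - c)"
proof (cases "\<exists>v \<in> sphere_words B n. take c v = p")
  case False
  then have "{w \<in> sphere_words B n. take c w = p} = {}" by blast
  then show ?thesis by (metis card.empty zero_le)
next
  case True
  then obtain v where v: "v \<in> sphere_words B n" "take c v = p" by blast
  then have lp: "length p = c" and p0: "p \<noteq> []" using c by (auto simp: sphere_words_def)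
  have "set p \<subseteq> set v" using v set_take_subset by metis
  then have "last p \<in> set v" using p0 by auto
  then have lB: "fst (inv_letter (last p)) \<in> B"
    using v(1) by (auto simp: sphere_words_def carrier_free_group)
  have "drop c ` {w \<in> sphere_words B n. take c w = p}
      \<subseteq> {w \<in> sphere_words B (n - c). w = [] \<or> hd w \<noteq> inv_letter (last p)}"
  proof (rule image_subsetI)
    fix w assume "w \<in> {w \<in> sphere_words B n. take c w = p}"
    then have w: "w \<in> sphere_words B n" "p = take c w" by auto
    have "w = take c w @ drop c w" by simp
    then have r: "reduced_word (take c w @ drop c w)"
      using w(1) by (simp add: sphere_words_def carrier_free_group)
    then have r': "reduced_word (drop c w)" "drop c w = [] \<or> hd (drop c w) \<noteq> inv_letter (last (take c w))"
      using p0 w(2) unfolding reduced_word_def successively_append_iff by auto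
    have "drop c w \<in> sphere_words B (n - c)"
      using w(1) r' set_drop_subset[of c w] by (fastforce simp: sphere_words_def carrier_free_group)
    with r' show "drop c w \<in> {w \<in> sphere_words B (n - c). w = [] \<or> hd w \<noteq> inv_letter (last p)}"
      using w(2) by blast
  qed
  moreover have "inj_on (drop c) {w \<in> sphere_words B n. take c w = p}"
    by (rule inj_onI) (metis (mono_tags, lifting) append_take_drop_id mem_Collect_eq)
  ultimately have "card {w \<in> sphere_words B n. take c w = p}
      \<le> card {w \<in> sphere_words B (n - c). w = [] \<or> hd w \<noteq> inv_letter (last p)}"
    using finite_sphere_words[OF B, of "n - c"] by (intro card_inj_on_le) auto
  then show ?thesis by (simp add: card_words_avoiding[OF B lB])
qed

text \<open>The potential $s^{|x|}$ with $s = (2k-1)^{-1/2}$ is nearly an eigenfunction of every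
  sphere average, with the eigenvalue that governs return probabilities on the tree.\<close>

lemma sum_sphere_potential:
  fixes s :: real
  assumes B: "finite B" "B \<noteq> {}" and s: "0 < s" "s\<^sup>2 * real (2 * card B - 1) = 1"
    and x: "x \<in> carrier (free_group B)" and n: "n > 0"
  shows "(\<Sum>w\<in>sphere_words B n. s ^ length (foldr cons_reduce x w))
      \<le> real (Suc n) * real (card (sphere_words B n)) * s ^ n * s ^ length x"
proof -
  define k where "k = real (2 * card B - 1)"
  have cB: "card B \<ge> 1" using B by (simp add: Suc_leI card_gt_0_iff)
  have k: "k \<ge> 1" using cB by (simp add: k_def)
  have sk: "s\<^sup>2 = 1 / k" using s k by (simp add: k_def field_simps)
  let ?S = "sphere_words B n" and ?P = "\<lambda>c w. c \<le> length x \<and> take c w = take c (inv_word x)"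
  have fS: "finite ?S" using B by (simp add: finite_sphere_words)
  \<comment> \<open>Every word is accounted for in the summand of its own number \<open>c\<close> of
    cancellations. The other summands only add to the bound; all of them together cost the factor
    \<open>Suc n\<close>.\<close>
  have le1: "s ^ length (foldr cons_reduce x w)
      \<le> (\<Sum>c\<le>n. if ?P c w then s ^ (length x + n - 2 * c) else 0)" if w: "w \<in> ?S" for w
  proof -
    obtain c where c: "c \<le> length x" "c \<le> length w" "take c w = take c (inv_word x)"
      "length (foldr cons_reduce x w) + 2 * c = length x + length w"
      using foldr_cancellation[of x w] x w by (auto simp: sphere_words_def carrier_free_group)
    then have "length (foldr cons_reduce x w) = length x + n - 2 * c" "c \<le> n"
      using w by (auto simp: sphere_words_def)
    then have "s ^ length (foldr cons_reduce x w) = (if ?P c w then s ^ (length x + n - 2 * c) else 0)"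
      using c by simp
    also have "\<dots> \<le> (\<Sum>c\<le>n. if ?P c w then s ^ (length x + n - 2 * c) else 0)"
      by (rule member_le_sum) (use \<open>c \<le> n\<close> s in auto)
    finally show ?thesis .
  qed
  \<comment> \<open>A prescribed prefix of length \<open>c\<close> has proportion at most
    \<open>s ^ (2 * c)\<close>. This offsets exactly what \<open>c\<close> cancellations gain in the
    potential, so that all values of \<open>c\<close> contribute the same bound.\<close>
  have cnt: "real (card {w \<in> ?S. take c w = take c (inv_word x)}) \<le> real (card ?S) * s ^ (2 * c)"
    if c: "c \<le> n" for c
  proof (cases "c = 0")
    case True then show ?thesis by simp
  next
    case False
    obtain m where m: "n = Suc m" using n by (cases n) auto
    have "real (card {w \<in> ?S. take c w = take c (inv_word x)}) \<le> k ^ (n - c)"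
      using card_sphere_words_prefix[OF B(1), of c n "take c (inv_word x)"] c False
      unfolding k_def of_nat_power[symmetric] by (simp del: of_nat_power)
    also have "\<dots> = k ^ n / k ^ c" using c k by (simp add: power_diff)
    also have "\<dots> \<le> (2 * real (card B)) * k ^ m / k ^ c"
    proof -
      have "k \<le> 2 * real (card B)" using cB by (simp add: k_def)
      then show ?thesis using k m by (intro divide_right_mono) (auto intro: mult_right_mono)
    qed
    also have "\<dots> = real (card ?S) * s ^ (2 * c)"
      unfolding m card_sphere_words[OF B(1)] power_mult sk by (simp add: k_def power_divide)
    finally show ?thesis .
  qed
  have "(\<Sum>w\<in>?S. s ^ length (foldr cons_reduce x w))
      \<le> (\<Sum>w\<in>?S. \<Sum>c\<le>n. if ?P c w then s ^ (length x + n - 2 * c) else 0)"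
    by (rule sum_mono) (rule le1)
  also have "\<dots> = (\<Sum>c\<le>n. \<Sum>w\<in>?S. if ?P c w then s ^ (length x + n - 2 * c) else 0)"
    by (rule sum.swap)
  also have "\<dots> \<le> (\<Sum>c\<le>n. real (card ?S) * s ^ n * s ^ length x)"
  proof (rule sum_mono)
    fix c assume "c \<in> {..n}" then have c: "c \<le> n" by simp
    show "(\<Sum>w\<in>?S. if ?P c w then s ^ (length x + n - 2 * c) else 0) \<le> real (card ?S) * s ^ n * s ^ length x"
    proof (cases "c \<le> length x")
      case False then show ?thesis using s by simp
    next
      case True
      then have "(\<Sum>w\<in>?S. if ?P c w then s ^ (length x + n - 2 * c) else 0)
          = real (card {w \<in> ?S. take c w = take c (inv_word x)}) * s ^ (length x + n - 2 * c)"
        using fS by (simp add: sum.If_cases Int_def)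
      also have "\<dots> \<le> real (card ?S) * s ^ (2 * c) * s ^ (length x + n - 2 * c)"
        using cnt[OF c] s by (intro mult_right_mono) auto
      also have "\<dots> = real (card ?S) * s ^ (2 * c + (length x + n - 2 * c))"
        by (simp only: power_add mult.assoc)
      also have "2 * c + (length x + n - 2 * c) = n + length x" using True c by simp
      finally show ?thesis by (simp add: power_add)
    qed
  qed
  also have "\<dots> = real (Suc n) * real (card (sphere_words B n)) * s ^ n * s ^ length x" by simp
  finally show ?thesis .
qed

section \<open>Products of lists of words from a sphere\<close>

definition word_lists :: "'a set \<Rightarrow> nat \<Rightarrow> 'a list set" where
  "word_lists S m = {vs. set vs \<subseteq> S \<and> length vs = m}"

lemma word_lists_0 [simp]: "word_lists S 0 = {[]}"
  by (auto simp: word_lists_def)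

lemma finite_word_lists: "finite S \<Longrightarrow> finite (word_lists S m)"
  by (simp add: word_lists_def finite_lists_length_eq)

lemma sum_word_lists_Suc:
  assumes "finite S"
  shows "(\<Sum>vs\<in>word_lists S (Suc m). f vs) = (\<Sum>w\<in>S. \<Sum>vs\<in>word_lists S m. f (w # vs))"
proof -
  have "word_lists S (Suc m) = (\<lambda>(w, vs). w # vs) ` (S \<times> word_lists S m)"
  proof (rule Set.set_eqI)
    fix vs show "vs \<in> word_lists S (Suc m) \<longleftrightarrow> vs \<in> (\<lambda>(w, vs). w # vs) ` (S \<times> word_lists S m)"
      by (cases vs) (auto simp: word_lists_def)
  qed
  then have "(\<Sum>vs\<in>word_lists S (Suc m). f vs) = (\<Sum>p\<in>S \<times> word_lists S m. f (fst p # snd p))"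
    by (simp add: sum.reindex inj_on_def case_prod_beta)
  also have "\<dots> = (\<Sum>w\<in>S. \<Sum>vs\<in>word_lists S m. f (w # vs))"
    by (simp add: sum.cartesian_product case_prod_beta)
  finally show ?thesis .
qed

definition list_prod :: "('g, 'b) monoid_scheme \<Rightarrow> 'g list \<Rightarrow> 'g" where
  "list_prod G vs = foldr (\<lambda>x y. x \<otimes>\<^bsub>G\<^esub> y) vs \<one>\<^bsub>G\<^esub>"

lemma list_prod_simps [simp]:
  "list_prod G [] = \<one>\<^bsub>G\<^esub>" "list_prod G (w # vs) = w \<otimes>\<^bsub>G\<^esub> list_prod G vs"
  by (simp_all add: list_prod_def)

lemma (in group) list_prod_closed: "set vs \<subseteq> carrier G \<Longrightarrow> list_prod G vs \<in> carrier G"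
  by (induction vs) auto

lemma sphere_words_subset: "sphere_words B n \<subseteq> carrier (free_group B)"
  by (auto simp: sphere_words_def)

lemma length_list_prod_le:
  "vs \<in> word_lists (sphere_words B n) m \<Longrightarrow> length (list_prod (free_group B) vs) \<le> m * n"
proof (induction vs arbitrary: m)
  case (Cons w vs)
  then have "vs \<in> word_lists (sphere_words B n) (m - 1)" "length w = n" "m > 0"
    by (auto simp: word_lists_def sphere_words_def)
  with Cons.IH have "length (list_prod (free_group B) vs) \<le> (m - 1) * n" by blast
  with length_foldr_le[of w "list_prod (free_group B) vs"] \<open>length w = n\<close> \<open>m > 0\<close>
  have "length (foldr cons_reduce w (list_prod (free_group B) vs)) \<le> n + (m - 1) * n" by simp
  also have "n + (m - 1) * n = m * n" using \<open>m > 0\<close> by (cases m) auto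
  finally show ?case by simp
qed simp

lemma sum_word_lists_potential:
  fixes s :: real
  assumes B: "finite B" "B \<noteq> {}" and s: "0 < s" "s\<^sup>2 * real (2 * card B - 1) = 1"
    and n: "n > 0" and x: "x \<in> carrier (free_group B)"
  shows "(\<Sum>vs\<in>word_lists (sphere_words B n) m.
            s ^ length (x \<otimes>\<^bsub>free_group B\<^esub> list_prod (free_group B) vs))
      \<le> (real (Suc n) * real (card (sphere_words B n)) * s ^ n) ^ m * s ^ length x"
  using x
proof (induction m arbitrary: x)
  case 0
  then show ?case by (simp add: carrier_free_group foldr_reduced_Nil)
next
  case (Suc m)
  interpret group "free_group B" by (rule group_free_group)
  let ?K = "real (Suc n) * real (card (sphere_words B n)) * s ^ n"
  let ?S = "sphere_words B n"
  have assoc: "x \<otimes>\<^bsub>free_group B\<^esub> list_prod (free_group B) (w # vs)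
      = (x \<otimes>\<^bsub>free_group B\<^esub> w) \<otimes>\<^bsub>free_group B\<^esub> list_prod (free_group B) vs"
    if "w \<in> ?S" "vs \<in> word_lists ?S m" for w vs
    unfolding list_prod_simps
    using that Suc.prems sphere_words_subset[of B n] list_prod_closed[of vs]
    by (intro m_assoc[symmetric]) (auto simp: word_lists_def simp del: mult_free_group)
  have "(\<Sum>vs\<in>word_lists ?S (Suc m). s ^ length (x \<otimes>\<^bsub>free_group B\<^esub> list_prod (free_group B) vs))
      = (\<Sum>w\<in>?S. \<Sum>vs\<in>word_lists ?S m.
          s ^ length ((x \<otimes>\<^bsub>free_group B\<^esub> w) \<otimes>\<^bsub>free_group B\<^esub> list_prod (free_group B) vs))"
    unfolding sum_word_lists_Suc[OF finite_sphere_words[OF B(1)]]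
    by (intro sum.cong refl) (simp only: assoc)
  also have "\<dots> \<le> (\<Sum>w\<in>?S. ?K ^ m * s ^ length (x \<otimes>\<^bsub>free_group B\<^esub> w))"
    using Suc.prems sphere_words_subset[of B n]
    by (intro sum_mono Suc.IH m_closed) auto
  also have "\<dots> = ?K ^ m * (\<Sum>w\<in>?S. s ^ length (foldr cons_reduce x w))"
    by (simp add: sum_distrib_left)
  also have "\<dots> \<le> ?K ^ m * (?K * s ^ length x)"
    using sum_sphere_potential[OF B s Suc.prems n] s by (intro mult_left_mono) auto
  finally show ?case by (simp add: mult_ac)
qed

text \<open>A pair counted here is a collision modulo \<open>N\<close>. Summing the potential over
  the first list and then over the second costs a factor \<open>?K ^ m\<close> each time, and only
  the weight \<open>s ^ length \<gamma>\<close> of the element that relates the two products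
  remains.\<close>

lemma card_word_list_pairs_le:
  fixes s :: real and m :: nat
  assumes B: "finite B" "B \<noteq> {}" and s: "0 < s" "s\<^sup>2 * real (2 * card B - 1) = 1"
    and n: "n > 0" and N: "N \<subseteq> carrier (free_group B)"
  defines "W \<equiv> word_lists (sphere_words B n) m"
  shows "real (card {p \<in> W \<times> W. \<exists>\<gamma>\<in>N. list_prod (free_group B) (fst p)
              = \<gamma> \<otimes>\<^bsub>free_group B\<^esub> list_prod (free_group B) (snd p)})
      \<le> (real (Suc n) * real (card (sphere_words B n)) * s ^ n) ^ (2 * m)
         * (\<Sum>\<gamma> | \<gamma> \<in> N \<and> length \<gamma> \<le> 2 * (m * n). s ^ length \<gamma>)"
proof -
  interpret group "free_group B" by (rule group_free_group)
  let ?F = "free_group B"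
  let ?K = "real (Suc n) * real (card (sphere_words B n)) * s ^ n"
  let ?N = "{\<gamma>. \<gamma> \<in> N \<and> length \<gamma> \<le> 2 * (m * n)}"
  have fW: "finite W" unfolding W_def by (intro finite_word_lists finite_sphere_words B)
  have Wc: "list_prod ?F vs \<in> carrier ?F" if "vs \<in> W" for vs
    using that list_prod_closed[of vs] sphere_words_subset[of B n] by (auto simp: W_def word_lists_def)
  have fN: "finite ?N"
  proof (rule finite_subset)
    show "?N \<subseteq> {w. set w \<subseteq> B \<times> UNIV \<and> length w \<le> 2 * (m * n)}"
      using N by (force simp: carrier_free_group subset_iff)
    show "finite {w. set w \<subseteq> B \<times> (UNIV :: bool set) \<and> length w \<le> 2 * (m * n)}"
      using B by (intro finite_lists_length_le) auto
  qed
  \<comment> \<open>The potential centred at \<gamma> equals 1 on the lists whose product is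
    \<gamma>, so it dominates their indicator function.\<close>
  have fib: "real (card {vs \<in> W. list_prod ?F vs = \<gamma>}) \<le> ?K ^ m * s ^ length \<gamma>"
    if g: "\<gamma> \<in> carrier ?F" for \<gamma>
  proof -
    have "real (card {vs \<in> W. list_prod ?F vs = \<gamma>})
        = (\<Sum>vs | vs \<in> W \<and> list_prod ?F vs = \<gamma>. s ^ length (inv\<^bsub>?F\<^esub> \<gamma> \<otimes>\<^bsub>?F\<^esub> list_prod ?F vs))"
      using g by (simp del: mult_free_group add: l_inv)
    also have "\<dots> \<le> (\<Sum>vs\<in>W. s ^ length (inv\<^bsub>?F\<^esub> \<gamma> \<otimes>\<^bsub>?F\<^esub> list_prod ?F vs))"
      by (rule sum_mono2) (use fW s in auto)
    also have "\<dots> \<le> ?K ^ m * s ^ length (inv\<^bsub>?F\<^esub> \<gamma>)"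
      unfolding W_def by (rule sum_word_lists_potential[OF B s n]) (use g in simp)
    finally show ?thesis using g by (simp add: inv_free_group)
  qed
  have "{p \<in> W \<times> W. \<exists>\<gamma>\<in>N. list_prod ?F (fst p) = \<gamma> \<otimes>\<^bsub>?F\<^esub> list_prod ?F (snd p)}
      \<subseteq> (\<Union>\<gamma>\<in>?N. \<Union>vs'\<in>W. {vs \<in> W. list_prod ?F vs = \<gamma> \<otimes>\<^bsub>?F\<^esub> list_prod ?F vs'} \<times> {vs'})"
  proof safe
    fix vs vs' \<gamma> assume a: "vs \<in> W" "vs' \<in> W" "\<gamma> \<in> N"
      "list_prod ?F (fst (vs, vs')) = \<gamma> \<otimes>\<^bsub>?F\<^esub> list_prod ?F (snd (vs, vs'))"
    then have eq: "list_prod ?F vs = \<gamma> \<otimes>\<^bsub>?F\<^esub> list_prod ?F vs'" by simp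
    have "\<gamma> = list_prod ?F vs \<otimes>\<^bsub>?F\<^esub> inv\<^bsub>?F\<^esub> (list_prod ?F vs')"
      using eq a N Wc by (simp del: mult_free_group add: inv_solve_right subset_iff)
    also have "\<dots> = foldr cons_reduce (list_prod ?F vs) (inv_word (list_prod ?F vs'))"
      using Wc[OF a(2)] by (simp add: inv_free_group)
    finally have "length \<gamma> \<le> length (list_prod ?F vs) + length (list_prod ?F vs')"
      using length_foldr_le[of "list_prod ?F vs" "inv_word (list_prod ?F vs')"] by simp
    also have "\<dots> \<le> 2 * (m * n)"
      using length_list_prod_le[of vs B n m] length_list_prod_le[of vs' B n m] a by (simp add: W_def)
    finally show "(vs, vs') \<in> (\<Union>\<gamma>\<in>?N. \<Union>vs'\<in>W. {vs \<in> W. list_prod ?F vs = \<gamma> \<otimes>\<^bsub>?F\<^esub> list_prod ?F vs'} \<times> {vs'})"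
      using a eq by auto
  qed
  then have "card {p \<in> W \<times> W. \<exists>\<gamma>\<in>N. list_prod ?F (fst p) = \<gamma> \<otimes>\<^bsub>?F\<^esub> list_prod ?F (snd p)}
      \<le> card (\<Union>\<gamma>\<in>?N. \<Union>vs'\<in>W. {vs \<in> W. list_prod ?F vs = \<gamma> \<otimes>\<^bsub>?F\<^esub> list_prod ?F vs'} \<times> {vs'})"
    using fN fW by (intro card_mono) auto
  also have "\<dots> \<le> (\<Sum>\<gamma>\<in>?N. card (\<Union>vs'\<in>W. {vs \<in> W. list_prod ?F vs = \<gamma> \<otimes>\<^bsub>?F\<^esub> list_prod ?F vs'} \<times> {vs'}))"
    by (rule card_UN_le[OF fN])
  also have "\<dots> \<le> (\<Sum>\<gamma>\<in>?N. \<Sum>vs'\<in>W. card ({vs \<in> W. list_prod ?F vs = \<gamma> \<otimes>\<^bsub>?F\<^esub> list_prod ?F vs'} \<times> {vs'}))"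
    by (intro sum_mono card_UN_le fW)
  finally have "card {p \<in> W \<times> W. \<exists>\<gamma>\<in>N. list_prod ?F (fst p) = \<gamma> \<otimes>\<^bsub>?F\<^esub> list_prod ?F (snd p)}
      \<le> (\<Sum>\<gamma>\<in>?N. \<Sum>vs'\<in>W. card {vs \<in> W. list_prod ?F vs = \<gamma> \<otimes>\<^bsub>?F\<^esub> list_prod ?F vs'})"
    by (simp add: card_cartesian_product del: mult_free_group)
  then have "real (card {p \<in> W \<times> W. \<exists>\<gamma>\<in>N. list_prod ?F (fst p) = \<gamma> \<otimes>\<^bsub>?F\<^esub> list_prod ?F (snd p)})
      \<le> (\<Sum>\<gamma>\<in>?N. \<Sum>vs'\<in>W. real (card {vs \<in> W. list_prod ?F vs = \<gamma> \<otimes>\<^bsub>?F\<^esub> list_prod ?F vs'}))"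
    by (metis (no_types, lifting) of_nat_le_iff of_nat_sum sum.cong)
  also have "\<dots> \<le> (\<Sum>\<gamma>\<in>?N. \<Sum>vs'\<in>W. ?K ^ m * s ^ length (\<gamma> \<otimes>\<^bsub>?F\<^esub> list_prod ?F vs'))"
    using N Wc by (intro sum_mono fib m_closed) auto
  also have "\<dots> = (\<Sum>\<gamma>\<in>?N. ?K ^ m * (\<Sum>vs'\<in>W. s ^ length (\<gamma> \<otimes>\<^bsub>?F\<^esub> list_prod ?F vs')))"
    by (simp add: sum_distrib_left)
  also have "\<dots> \<le> (\<Sum>\<gamma>\<in>?N. ?K ^ m * (?K ^ m * s ^ length \<gamma>))"
    unfolding W_def using N s
    by (intro sum_mono mult_left_mono sum_word_lists_potential[OF B s n]) auto
  also have "\<dots> = ?K ^ (2 * m) * (\<Sum>\<gamma>\<in>?N. s ^ length \<gamma>)"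
    by (simp only: sum_distrib_left power_add mult_2 mult.assoc)
  finally show ?thesis .
qed

section \<open>Integral quaternions\<close>

datatype quat = Quat (q0: int) (q1: int) (q2: int) (q3: int)

instantiation quat :: ring_1
begin

definition "0 = Quat 0 0 0 0"
definition "1 = Quat 1 0 0 0"
definition "x + y = Quat (q0 x + q0 y) (q1 x + q1 y) (q2 x + q2 y) (q3 x + q3 y)"
definition "x - y = Quat (q0 x - q0 y) (q1 x - q1 y) (q2 x - q2 y) (q3 x - q3 y)"
definition "- x = Quat (- q0 x) (- q1 x) (- q2 x) (- q3 x)"
definition "x * y = Quat
  (q0 x * q0 y - q1 x * q1 y - q2 x * q2 y - q3 x * q3 y)
  (q0 x * q1 y + q1 x * q0 y + q2 x * q3 y - q3 x * q2 y)
  (q0 x * q2 y - q1 x * q3 y + q2 x * q0 y + q3 x * q1 y)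
  (q0 x * q3 y + q1 x * q2 y - q2 x * q1 y + q3 x * q0 y)"

instance
  by standard
    (auto simp: zero_quat_def one_quat_def plus_quat_def minus_quat_def uminus_quat_def
      times_quat_def algebra_simps)

end

lemma quat_eq_iff: "x = y \<longleftrightarrow> q0 x = q0 y \<and> q1 x = q1 y \<and> q2 x = q2 y \<and> q3 x = q3 y"
  by (cases x; cases y) auto

lemma quat_sel [simp]:
  "q0 0 = 0" "q1 0 = 0" "q2 0 = 0" "q3 0 = 0"
  "q0 1 = 1" "q1 1 = 0" "q2 1 = 0" "q3 1 = 0"
  "q0 (x + y) = q0 x + q0 y" "q1 (x + y) = q1 x + q1 y"
  "q2 (x + y) = q2 x + q2 y" "q3 (x + y) = q3 x + q3 y"
  "q0 (x - y) = q0 x - q0 y" "q1 (x - y) = q1 x - q1 y"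
  "q2 (x - y) = q2 x - q2 y" "q3 (x - y) = q3 x - q3 y"
  "q0 (- x) = - q0 x" "q1 (- x) = - q1 x" "q2 (- x) = - q2 x" "q3 (- x) = - q3 x"
  by (simp_all add: zero_quat_def one_quat_def plus_quat_def minus_quat_def uminus_quat_def)

lemma quat_sel_times:
  "q0 (x * y) = q0 x * q0 y - q1 x * q1 y - q2 x * q2 y - q3 x * q3 y"
  "q1 (x * y) = q0 x * q1 y + q1 x * q0 y + q2 x * q3 y - q3 x * q2 y"
  "q2 (x * y) = q0 x * q2 y - q1 x * q3 y + q2 x * q0 y + q3 x * q1 y"
  "q3 (x * y) = q0 x * q3 y + q1 x * q2 y - q2 x * q1 y + q3 x * q0 y"
  by (simp_all add: times_quat_def)

lemma of_nat_quat: "of_nat n = Quat (int n) 0 0 0"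
  by (induction n) (auto simp: quat_eq_iff)

lemma of_int_quat: "of_int a = Quat a 0 0 0"
proof (cases a)
  case (nonneg n)
  then show ?thesis by (simp add: of_nat_quat)
next
  case (neg n)
  then show ?thesis by (simp add: of_nat_quat quat_eq_iff)
qed

lemma quat_sel_of_int [simp]:
  "q0 (of_int a) = a" "q1 (of_int a) = 0" "q2 (of_int a) = 0" "q3 (of_int a) = 0"
  by (simp_all add: of_int_quat)

lemma quat_sel_of_int_times [simp]:
  "q0 (of_int a * x) = a * q0 x" "q1 (of_int a * x) = a * q1 x"
  "q2 (of_int a * x) = a * q2 x" "q3 (of_int a * x) = a * q3 x"
  by (simp_all add: quat_sel_times)

lemma of_int_quat_commute: "of_int a * x = x * (of_int a :: quat)"
  by (simp add: quat_eq_iff quat_sel_times)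

definition qnorm :: "quat \<Rightarrow> int" where
  "qnorm x = (q0 x)\<^sup>2 + (q1 x)\<^sup>2 + (q2 x)\<^sup>2 + (q3 x)\<^sup>2"

definition qcnj :: "quat \<Rightarrow> quat" where
  "qcnj x = Quat (q0 x) (- q1 x) (- q2 x) (- q3 x)"

lemma qnorm_mult: "qnorm (x * y) = qnorm x * qnorm y"
  unfolding qnorm_def quat_sel_times by (simp add: power2_eq_square algebra_simps)

lemma qcnj_mult_self: "qcnj x * x = of_int (qnorm x)"
  by (simp add: quat_eq_iff quat_sel_times qcnj_def qnorm_def power2_eq_square)

definition qdvd :: "int \<Rightarrow> quat \<Rightarrow> bool" where
  "qdvd m x \<longleftrightarrow> m dvd q0 x \<and> m dvd q1 x \<and> m dvd q2 x \<and> m dvd q3 x"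

lemma qdvd_0 [simp]: "qdvd m 0"
  by (simp add: qdvd_def)

lemma qdvd_add: "qdvd m x \<Longrightarrow> qdvd m y \<Longrightarrow> qdvd m (x + y)"
  by (simp add: qdvd_def)

lemma qdvd_diff: "qdvd m x \<Longrightarrow> qdvd m y \<Longrightarrow> qdvd m (x - y)"
  by (simp add: qdvd_def)

lemma qdvd_mult_left: "qdvd m x \<Longrightarrow> qdvd m (y * x)"
  by (simp add: qdvd_def quat_sel_times)

lemma qdvd_mult_right: "qdvd m x \<Longrightarrow> qdvd m (x * y)"
  by (simp add: qdvd_def quat_sel_times)

lemma qdvd_of_int: "m dvd a \<Longrightarrow> qdvd m (of_int a)"
  by (simp add: qdvd_def)

lemma qdvd_iff: "qdvd m x \<longleftrightarrow> (\<exists>y. x = of_int m * y)"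
proof
  assume "qdvd m x"
  then obtain a b c d where "q0 x = m * a" "q1 x = m * b" "q2 x = m * c" "q3 x = m * d"
    unfolding qdvd_def by (auto elim!: dvdE)
  then have "x = of_int m * Quat a b c d" by (simp add: quat_eq_iff)
  then show "\<exists>y. x = of_int m * y" by blast
qed (auto simp: qdvd_def)

lemma qdvd_trans: "m dvd n \<Longrightarrow> qdvd n x \<Longrightarrow> qdvd m x"
  by (auto simp: qdvd_def)

section \<open>The free group of rank three in the quaternions\<close>

definition letter_quat :: "nat \<times> bool \<Rightarrow> quat" where
  "letter_quat l = (let a = (if snd l then 2 else - 2) in
     if fst l = 0 then Quat 1 a 0 0 else if fst l = 1 then Quat 1 0 a 0 else Quat 1 0 0 a)"

definition word_quat :: "(nat \<times> bool) list \<Rightarrow> quat" where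
  "word_quat w = prod_list (map letter_quat w)"

lemma word_quat_simps [simp]:
  "word_quat [] = 1" "word_quat (l # w) = letter_quat l * word_quat w"
  by (simp_all add: word_quat_def)

lemma qnorm_letter_quat: "qnorm (letter_quat l) = 5"
  by (simp add: letter_quat_def qnorm_def Let_def)

lemma qnorm_one [simp]: "qnorm 1 = 1"
  by (simp add: qnorm_def)

lemma qnorm_word_quat: "qnorm (word_quat w) = 5 ^ length w"
  by (induction w) (simp_all add: qnorm_mult qnorm_letter_quat)

lemma letter_quat_inv: "letter_quat (inv_letter l) = qcnj (letter_quat l)"
  by (auto simp: letter_quat_def inv_letter_def qcnj_def Let_def)

lemma letter_quat_inv_mult: "letter_quat (inv_letter l) * letter_quat l = of_int 5"
  by (simp add: letter_quat_inv qcnj_mult_self qnorm_letter_quat)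

lemma letter_quat_mult_inv: "letter_quat l * letter_quat (inv_letter l) = of_int 5"
  using letter_quat_inv_mult[of "inv_letter l"] by simp

text \<open>A cancelled pair of letters leaves the scalar 5, so words are represented only up to
  powers of 5. Since 5 is prime to 13, this is harmless in the projective congruences below.\<close>

lemma word_quat_cons_reduce:
  "\<exists>k. letter_quat l * word_quat w = of_int (5 ^ k) * word_quat (cons_reduce l w)"
proof (cases w)
  case Nil
  then show ?thesis by (intro exI[of _ 0]) simp
next
  case (Cons k v)
  show ?thesis
  proof (cases "k = inv_letter l")
    case True
    have "letter_quat l * word_quat w = (letter_quat l * letter_quat (inv_letter l)) * word_quat v"
      using Cons True by (simp add: mult.assoc)
    then have "letter_quat l * word_quat w = of_int (5 ^ 1) * word_quat (cons_reduce l w)"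
      using Cons True by (simp only: letter_quat_mult_inv) simp
    then show ?thesis by blast
  next
    case False
    then show ?thesis using Cons by (intro exI[of _ 0]) simp
  qed
qed

lemma word_quat_mult:
  "\<exists>k. word_quat u * word_quat v = of_int (5 ^ k) * word_quat (foldr cons_reduce u v)"
proof (induction u)
  case Nil
  show ?case by (intro exI[of _ 0]) simp
next
  case (Cons l u)
  then obtain k where k: "word_quat u * word_quat v = of_int (5 ^ k) * word_quat (foldr cons_reduce u v)"
    by blast
  obtain j where j: "letter_quat l * word_quat (foldr cons_reduce u v)
      = of_int (5 ^ j) * word_quat (cons_reduce l (foldr cons_reduce u v))"
    using word_quat_cons_reduce by blast
  have "word_quat (l # u) * word_quat v = letter_quat l * (word_quat u * word_quat v)"
    by (simp add: mult.assoc)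
  also have "\<dots> = of_int (5 ^ k) * (letter_quat l * word_quat (foldr cons_reduce u v))"
    unfolding k by (metis mult.assoc of_int_quat_commute)
  also have "\<dots> = of_int (5 ^ (k + j)) * word_quat (foldr cons_reduce (l # u) v)"
    unfolding j by (simp add: power_add mult.assoc)
  finally show ?case by blast
qed

definition F3 :: "(nat \<times> bool) list monoid" where
  "F3 = free_group {0, 1, 2}"

lemma group_F3: "group F3"
  by (simp only: F3_def group_free_group)

lemma mult_F3: "u \<otimes>\<^bsub>F3\<^esub> v = foldr cons_reduce u v"
  by (simp add: F3_def)

lemma one_F3: "\<one>\<^bsub>F3\<^esub> = []"
  by (simp add: F3_def)

lemma carrier_F3: "w \<in> carrier F3 \<longleftrightarrow> fst ` set w \<subseteq> {0, 1, 2} \<and> reduced_word w"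
  by (simp only: F3_def carrier_free_group)

lemma inv_F3: "w \<in> carrier F3 \<Longrightarrow> inv\<^bsub>F3\<^esub> w = inv_word w"
  by (simp only: F3_def inv_free_group)

text \<open>Distinct letters generate right ideals modulo 5 with trivial intersection, because the
  difference of their conjugates has norm 8 or 16.\<close>

lemma qdvd_two_letters:
  assumes "qdvd 5 (letter_quat s * x)" "qdvd 5 (letter_quat t * x)" "s \<noteq> t"
    "fst s \<in> {0, 1, 2}" "fst t \<in> {0, 1, 2}"
  shows "qdvd 5 x"
proof -
  let ?d = "letter_quat s - letter_quat t"
  have "qnorm ?d \<in> {8, 16}"
    using assms(3-) by (cases s; cases t) (auto simp: letter_quat_def qnorm_def Let_def)
  moreover have "qdvd 5 (qcnj ?d * (?d * x))"
    using qdvd_diff[OF assms(1,2)] by (intro qdvd_mult_left[of 5 "?d * x"]) (simp add: left_diff_distrib)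
  then have "qdvd 5 (of_int (qnorm ?d) * x)"
    by (simp add: mult.assoc[symmetric] qcnj_mult_self)
  moreover have "5 dvd 8 * a \<longleftrightarrow> 5 dvd a" "5 dvd 16 * a \<longleftrightarrow> 5 dvd a" for a :: int
    by presburger+
  ultimately show ?thesis
    by (elim insertE emptyE) (simp_all only: qdvd_def quat_sel_of_int_times)
qed

text \<open>In a reduced word \<open>s # t # v\<close>, the inverse of \<open>t\<close> carries
  \<open>word_quat (t # v)\<close> into the multiples of 5. If \<open>s\<close> did so as well,
  \<open>qdvd_two_letters\<close> would make \<open>word_quat (t # v)\<close> itself divisible by
  5.\<close>

lemma word_quat_primitive:
  assumes "w \<in> carrier F3" "w \<noteq> []"
  shows "\<not> qdvd 5 (word_quat w)"
  using assms
proof (induction w)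
  case (Cons s w)
  have w: "w \<in> carrier F3" and s: "fst s \<in> {0, 1, 2}"
    using Cons.prems by (auto simp: carrier_F3 reduced_word_Cons)
  show ?case
  proof (cases w)
    case Nil
    then show ?thesis by (auto simp: qdvd_def letter_quat_def Let_def)
  next
    case (Cons t v)
    have t: "fst t \<in> {0, 1, 2}" "t \<noteq> inv_letter s"
      using \<open>s # w \<in> carrier F3\<close> Cons by (auto simp: carrier_F3 reduced_word_Cons)
    have "letter_quat (inv_letter t) * word_quat w = of_int 5 * word_quat v"
      by (simp only: Cons word_quat_simps mult.assoc[symmetric] letter_quat_inv_mult)
    then have "qdvd 5 (letter_quat (inv_letter t) * word_quat w)"
      unfolding qdvd_iff by blast
    moreover have "s \<noteq> inv_letter t" using t(2) by auto
    moreover have "\<not> qdvd 5 (word_quat w)" using Cons.IH w Cons by blast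
    ultimately show ?thesis
      using qdvd_two_letters[of s "word_quat w" "inv_letter t"] s t(1) by auto
  qed
qed simp

text \<open>The first letter can be read off modulo 5: only its inverse carries the quaternion of
  the word into the multiples of 5. Through this injectivity kernel words are counted as lattice
  points.\<close>

lemma word_quat_inj:
  assumes "v \<in> carrier F3" "w \<in> carrier F3" "length v = length w" "word_quat v = word_quat w"
  shows "v = w"
  using assms(3,1,2,4)
proof (induction v w rule: list_induct2)
  case (Cons s v t w)
  have st: "letter_quat (inv_letter s) * word_quat (s # v) = of_int 5 * word_quat v"
    "letter_quat (inv_letter t) * word_quat (t # w) = of_int 5 * word_quat w"
    by (simp_all only: word_quat_simps mult.assoc[symmetric] letter_quat_inv_mult)
  have "s = t"
  proof (rule ccontr)
    assume "s \<noteq> t"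
    then have "qdvd 5 (word_quat (s # v))"
      using st Cons.prems qdvd_two_letters[of "inv_letter s" "word_quat (s # v)" "inv_letter t"]
      by (auto simp: qdvd_iff carrier_F3 simp del: word_quat_simps)
    then show False using word_quat_primitive[OF Cons.prems(1)] by simp
  qed
  then have "of_int 5 * word_quat v = of_int 5 * word_quat w"
    using st Cons.prems(3) by simp
  then have "word_quat v = word_quat w"
    unfolding quat_eq_iff quat_sel_of_int_times by simp
  moreover have "v \<in> carrier F3" "w \<in> carrier F3"
    using Cons.prems by (auto simp: carrier_F3 reduced_word_Cons)
  ultimately show ?case using Cons.IH \<open>s = t\<close> by simp
qed simp

section \<open>Projective congruence of quaternions modulo powers of 13\<close>

text \<open>Equality up to scalars prime to 13. Scalars are allowed on both sides so that symmetry
  and transitivity need no inverses modulo \<open>13 ^ n\<close>.\<close>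

definition proj_cong :: "nat \<Rightarrow> quat \<Rightarrow> quat \<Rightarrow> bool" where
  "proj_cong n x y \<longleftrightarrow>
     (\<exists>a b. \<not> 13 dvd a \<and> \<not> 13 dvd b \<and> qdvd (13 ^ n) (of_int a * x - of_int b * y))"

lemma prime_13: "prime (13 :: int)"
  by (simp add: prime_int_numeral_eq)

lemma not_13_dvd_mult: "\<not> 13 dvd a \<Longrightarrow> \<not> 13 dvd b \<Longrightarrow> \<not> (13 :: int) dvd a * b"
  using prime_13 prime_dvd_mult_iff by blast

lemma not_13_dvd_power5: "\<not> (13 :: int) dvd 5 ^ k"
  using prime_dvd_power[OF prime_13, of 5 k] by auto

lemma proj_cong_refl [simp]: "proj_cong n x x"
  unfolding proj_cong_def by (intro exI[of _ 1]) simp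

lemma proj_cong_scale: "\<not> 13 dvd a \<Longrightarrow> \<not> 13 dvd b \<Longrightarrow> of_int a * x = of_int b * y \<Longrightarrow> proj_cong n x y"
  unfolding proj_cong_def by (metis diff_self qdvd_0)

lemma proj_cong_sym: "proj_cong n x y \<Longrightarrow> proj_cong n y x"
proof -
  assume "proj_cong n x y"
  then obtain a b where ab: "\<not> 13 dvd a" "\<not> 13 dvd b" "qdvd (13 ^ n) (of_int a * x - of_int b * y)"
    by (auto simp: proj_cong_def)
  have "qdvd (13 ^ n) (of_int b * y - of_int a * x)"
    using qdvd_diff[OF qdvd_0 ab(3)] by simp
  with ab show ?thesis by (auto simp: proj_cong_def)
qed

lemma proj_cong_trans: "proj_cong n x y \<Longrightarrow> proj_cong n y z \<Longrightarrow> proj_cong n x z"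
proof -
  assume "proj_cong n x y" "proj_cong n y z"
  then obtain a b c d where ab: "\<not> 13 dvd a" "\<not> 13 dvd b" "qdvd (13 ^ n) (of_int a * x - of_int b * y)"
    and cd: "\<not> 13 dvd c" "\<not> 13 dvd d" "qdvd (13 ^ n) (of_int c * y - of_int d * z)"
    by (auto simp: proj_cong_def)
  have "of_int (c * a) * x - of_int (b * d) * z
      = of_int c * (of_int a * x - of_int b * y) + of_int b * (of_int c * y - of_int d * z)"
    by (simp add: quat_eq_iff algebra_simps del: of_int_mult)
  then have "qdvd (13 ^ n) (of_int (c * a) * x - of_int (b * d) * z)"
    using ab cd by (simp only:) (intro qdvd_add qdvd_mult_left)
  then show ?thesis
    unfolding proj_cong_def using ab cd not_13_dvd_mult by blast
qed

lemma proj_cong_mult: "proj_cong n x y \<Longrightarrow> proj_cong n u v \<Longrightarrow> proj_cong n (x * u) (y * v)"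
proof -
  assume "proj_cong n x y" "proj_cong n u v"
  then obtain a b c d where ab: "\<not> 13 dvd a" "\<not> 13 dvd b" "qdvd (13 ^ n) (of_int a * x - of_int b * y)"
    and cd: "\<not> 13 dvd c" "\<not> 13 dvd d" "qdvd (13 ^ n) (of_int c * u - of_int d * v)"
    by (auto simp: proj_cong_def)
  have "of_int (a * c) * (x * u) - of_int (b * d) * (y * v)
      = (of_int a * x - of_int b * y) * (of_int c * u) + of_int b * y * (of_int c * u - of_int d * v)"
    by (simp add: quat_eq_iff quat_sel_times algebra_simps del: of_int_mult)
  then have "qdvd (13 ^ n) (of_int (a * c) * (x * u) - of_int (b * d) * (y * v))"
    using ab cd by (simp only:) (intro qdvd_add qdvd_mult_left qdvd_mult_right)
  then show ?thesis
    unfolding proj_cong_def using ab cd not_13_dvd_mult by blast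
qed

lemma proj_cong_mono: "proj_cong n x y \<Longrightarrow> m \<le> n \<Longrightarrow> proj_cong m x y"
  unfolding proj_cong_def by (meson le_imp_power_dvd qdvd_trans)

lemma proj_cong_word_mult:
  "proj_cong n (word_quat (foldr cons_reduce u v)) (word_quat u * word_quat v)"
proof -
  obtain k where "word_quat u * word_quat v = of_int (5 ^ k) * word_quat (foldr cons_reduce u v)"
    using word_quat_mult by blast
  then show ?thesis
    by (intro proj_cong_scale[of "5 ^ k" 1]) (auto simp: not_13_dvd_power5 simp del: of_int_power)
qed

lemma proj_cong_word_mult_eq:
  "proj_cong n (word_quat u) x \<Longrightarrow> proj_cong n (word_quat v) y \<Longrightarrow>
     proj_cong n (word_quat (foldr cons_reduce u v)) (x * y)"
  by (meson proj_cong_mult proj_cong_trans proj_cong_word_mult)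

lemma not_13_dvd_qnorm_word: "\<not> 13 dvd qnorm (word_quat w)"
  by (simp add: qnorm_word_quat not_13_dvd_power5)

text \<open>The real part serves as the scalar: for \<open>n > 0\<close> it is prime to 13 because
  the norm is and the imaginary part is not. For \<open>n = 0\<close> both sides hold
  trivially.\<close>

lemma proj_cong_one_iff:
  assumes "\<not> 13 dvd qnorm x"
  shows "proj_cong n x 1 \<longleftrightarrow> 13 ^ n dvd q1 x \<and> 13 ^ n dvd q2 x \<and> 13 ^ n dvd q3 x"
proof
  assume "proj_cong n x 1"
  then obtain a b where ab: "\<not> 13 dvd a" "qdvd (13 ^ n) (of_int a * x - of_int b * 1)"
    by (auto simp: proj_cong_def)
  have "coprime (13 :: int) a" using ab(1) prime_13 prime_imp_coprime by blast
  then have "coprime (13 ^ n) a" by simp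
  moreover have "13 ^ n dvd a * q1 x" "13 ^ n dvd a * q2 x" "13 ^ n dvd a * q3 x"
    using ab(2) by (auto simp: qdvd_def)
  ultimately show "13 ^ n dvd q1 x \<and> 13 ^ n dvd q2 x \<and> 13 ^ n dvd q3 x"
    by (simp add: coprime_dvd_mult_right_iff)
next
  assume d: "13 ^ n dvd q1 x \<and> 13 ^ n dvd q2 x \<and> 13 ^ n dvd q3 x"
  show "proj_cong n x 1"
  proof (cases "n = 0")
    case True
    then show ?thesis
      unfolding proj_cong_def by (intro exI[of _ 1]) (simp add: qdvd_def)
  next
    case False
    then have "13 dvd q1 x" "13 dvd q2 x" "13 dvd q3 x"
      using d by (meson dvd_power dvd_trans gr0I)+
    then have "\<not> 13 dvd q0 x"
      using assms by (auto simp: qnorm_def power2_eq_square)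
    moreover have "qdvd (13 ^ n) (of_int 1 * x - of_int (q0 x) * 1)"
      using d by (simp add: qdvd_def)
    ultimately show ?thesis
      unfolding proj_cong_def by (intro exI[of _ 1] exI[of _ "q0 x"]) auto
  qed
qed

text \<open>The four affine charts of projective 3-space over the integers modulo
  \<open>13 ^ n\<close>. Points in several charts are listed repeatedly, which costs only a constant
  factor in the index bound.\<close>

definition normal_forms :: "nat \<Rightarrow> quat set" where
  "normal_forms n = (let I = {0..<13 ^ n} in
     (\<lambda>(a, b, c). Quat 1 a b c) ` (I \<times> I \<times> I) \<union> (\<lambda>(a, b, c). Quat a 1 b c) ` (I \<times> I \<times> I) \<union>
     (\<lambda>(a, b, c). Quat a b 1 c) ` (I \<times> I \<times> I) \<union> (\<lambda>(a, b, c). Quat a b c 1) ` (I \<times> I \<times> I))"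

lemma card_normal_forms: "finite (normal_forms n)" "card (normal_forms n) \<le> 4 * 13 ^ (3 * n)"
proof -
  let ?I = "{0..<13 ^ n} :: int set"
  have c: "card (?I \<times> ?I \<times> ?I) = 13 ^ (3 * n)"
    by (simp add: card_cartesian_product power_mult power3_eq_cube nat_power_eq flip: power_mult_distrib)
  have f: "finite (?I \<times> ?I \<times> ?I)" by auto
  show "finite (normal_forms n)" by (simp add: normal_forms_def Let_def)
  have "card (A \<union> B \<union> C \<union> D) \<le> card A + card B + card C + card D" for A B C D :: "quat set"
    by (meson add_mono card_Un_le le_refl le_trans)
  then have "card (normal_forms n) \<le> card ((\<lambda>(a, b, c). Quat 1 a b c) ` (?I \<times> ?I \<times> ?I))
     + card ((\<lambda>(a, b, c). Quat a 1 b c) ` (?I \<times> ?I \<times> ?I))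
     + card ((\<lambda>(a, b, c). Quat a b 1 c) ` (?I \<times> ?I \<times> ?I))
     + card ((\<lambda>(a, b, c). Quat a b c 1) ` (?I \<times> ?I \<times> ?I))"
    unfolding normal_forms_def Let_def .
  also have "\<dots> \<le> 13 ^ (3 * n) + 13 ^ (3 * n) + 13 ^ (3 * n) + 13 ^ (3 * n)"
    by (intro add_mono) (use card_image_le[OF f] c in metis)+
  finally show "card (normal_forms n) \<le> 4 * 13 ^ (3 * n)" by simp
qed

text \<open>As the norm is prime to 13, some coordinate is; its inverse modulo \<open>13 ^ n\<close>
  scales the quaternion into the corresponding chart.\<close>

lemma proj_cong_normal_form:
  assumes "\<not> 13 dvd qnorm x" "n > 0"
  shows "\<exists>t\<in>normal_forms n. proj_cong n x t"
proof -
  let ?q = "13 ^ n :: int"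
  have inv: "\<exists>v. \<not> 13 dvd v \<and> ?q dvd v * a - 1" if "\<not> 13 dvd a" for a
  proof -
    have "coprime a (13 :: int)"
      using that prime_13 prime_imp_coprime coprime_commute by blast
    then have "coprime a ?q" by simp
    then obtain v where v: "[a * v = 1] (mod ?q)" using cong_solve_coprime_int by blast
    then have d: "?q dvd v * a - 1" by (simp add: cong_iff_dvd_diff mult.commute)
    have "(13 :: int) dvd ?q" using assms(2) by (simp add: dvd_power)
    from dvd_trans[OF this d] have "13 dvd v * a - 1" .
    have "\<not> 13 dvd v"
    proof
      assume "13 dvd v"
      then have "13 dvd v * a" by simp
      from dvd_diff[OF this \<open>13 dvd v * a - 1\<close>] show False by simp
    qed
    then show ?thesis using d by blast
  qed
  have m: "?q dvd z - z mod ?q" "z mod ?q \<in> {0..<?q}" for z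
    by (simp_all add: minus_mod_eq_mult_div)
  have nf1: "Quat 1 a b c \<in> normal_forms n"
    if "a \<in> {0..<?q}" "b \<in> {0..<?q}" "c \<in> {0..<?q}" for a b c
    unfolding normal_forms_def Let_def
    by (rule UnI1, rule UnI1, rule UnI1, rule image_eqI[where x = "(a, b, c)"]) (use that in auto)
  have nf2: "Quat a 1 b c \<in> normal_forms n"
    if "a \<in> {0..<?q}" "b \<in> {0..<?q}" "c \<in> {0..<?q}" for a b c
    unfolding normal_forms_def Let_def
    by (rule UnI1, rule UnI1, rule UnI2, rule image_eqI[where x = "(a, b, c)"]) (use that in auto)
  have nf3: "Quat a b 1 c \<in> normal_forms n"
    if "a \<in> {0..<?q}" "b \<in> {0..<?q}" "c \<in> {0..<?q}" for a b c
    unfolding normal_forms_def Let_def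
    by (rule UnI1, rule UnI2, rule image_eqI[where x = "(a, b, c)"]) (use that in auto)
  have nf4: "Quat a b c 1 \<in> normal_forms n"
    if "a \<in> {0..<?q}" "b \<in> {0..<?q}" "c \<in> {0..<?q}" for a b c
    unfolding normal_forms_def Let_def
    by (rule UnI2, rule image_eqI[where x = "(a, b, c)"]) (use that in auto)
  have step: ?thesis if "\<not> 13 dvd v" "t \<in> normal_forms n"
    "qdvd ?q (of_int v * x - t)" for v t
  proof -
    have "qdvd ?q (of_int v * x - of_int 1 * t)" using that(3) by simp
    then have "proj_cong n x t"
      unfolding proj_cong_def using that(1) by (intro exI[of _ v] exI[of _ 1]) auto
    then show ?thesis using that(2) by blast
  qed
  have "\<not> 13 dvd q0 x \<or> \<not> 13 dvd q1 x \<or> \<not> 13 dvd q2 x \<or> \<not> 13 dvd q3 x"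
    using assms(1) by (auto simp: qnorm_def power2_eq_square)
  then consider "\<not> 13 dvd q0 x" | "\<not> 13 dvd q1 x" | "\<not> 13 dvd q2 x" | "\<not> 13 dvd q3 x" by blast
  then show ?thesis
  proof cases
    case 1
    obtain v where v: "\<not> 13 dvd v" "?q dvd v * q0 x - 1" using inv[OF 1] by blast
    let ?f = "\<lambda>z. v * z mod ?q"
    show ?thesis
    proof (rule step[OF v(1)])
      show "Quat 1 (?f (q1 x)) (?f (q2 x)) (?f (q3 x)) \<in> normal_forms n"
        by (rule nf1) (rule m(2))+
    qed (use v(2) m(1) in \<open>simp add: qdvd_def\<close>)
  next
    case 2
    obtain v where v: "\<not> 13 dvd v" "?q dvd v * q1 x - 1" using inv[OF 2] by blast
    let ?f = "\<lambda>z. v * z mod ?q"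
    show ?thesis
    proof (rule step[OF v(1)])
      show "Quat (?f (q0 x)) 1 (?f (q2 x)) (?f (q3 x)) \<in> normal_forms n"
        by (rule nf2) (rule m(2))+
    qed (use v(2) m(1) in \<open>simp add: qdvd_def\<close>)
  next
    case 3
    obtain v where v: "\<not> 13 dvd v" "?q dvd v * q2 x - 1" using inv[OF 3] by blast
    let ?f = "\<lambda>z. v * z mod ?q"
    show ?thesis
    proof (rule step[OF v(1)])
      show "Quat (?f (q0 x)) (?f (q1 x)) 1 (?f (q3 x)) \<in> normal_forms n"
        by (rule nf3) (rule m(2))+
    qed (use v(2) m(1) in \<open>simp add: qdvd_def\<close>)
  next
    case 4
    obtain v where v: "\<not> 13 dvd v" "?q dvd v * q3 x - 1" using inv[OF 4] by blast
    let ?f = "\<lambda>z. v * z mod ?q"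
    show ?thesis
    proof (rule step[OF v(1)])
      show "Quat (?f (q0 x)) (?f (q1 x)) (?f (q2 x)) 1 \<in> normal_forms n"
        by (rule nf4) (rule m(2))+
    qed (use v(2) m(1) in \<open>simp add: qdvd_def\<close>)
  qed
qed

section \<open>Lattice points on circles and spheres\<close>

lemma card_le_fibres:
  assumes "finite A" "finite T" "f ` A \<subseteq> T" "\<And>t. t \<in> T \<Longrightarrow> card {x \<in> A. f x = t} \<le> k"
  shows "card A \<le> k * card T"
proof -
  have "A = (\<Union>t\<in>T. {x \<in> A. f x = t})" using assms(3) by auto
  then have "card A \<le> (\<Sum>t\<in>T. card {x \<in> A. f x = t})"
    using card_UN_le[OF assms(2), of "\<lambda>t. {x \<in> A. f x = t}"] by simp
  also have "\<dots> \<le> (\<Sum>t\<in>T. k)" by (rule sum_mono) (rule assms(4))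
  finally show ?thesis by (simp add: mult.commute)
qed

lemma card_int_abs_le:
  assumes "0 \<le> (r :: real)"
  shows "finite {x :: int. \<bar>real_of_int x\<bar> \<le> r}" "real (card {x :: int. \<bar>real_of_int x\<bar> \<le> r}) \<le> 2 * r + 1"
proof -
  have eq: "{x :: int. \<bar>real_of_int x\<bar> \<le> r} = {- \<lfloor>r\<rfloor>..\<lfloor>r\<rfloor>}"
    by (auto simp: le_floor_iff abs_le_iff) linarith+
  show "finite {x :: int. \<bar>real_of_int x\<bar> \<le> r}" unfolding eq by simp
  have "0 \<le> \<lfloor>r\<rfloor>" using assms by simp
  then have "real (card {- \<lfloor>r\<rfloor>..\<lfloor>r\<rfloor>}) = 2 * real_of_int \<lfloor>r\<rfloor> + 1" by simp
  then show "real (card {x :: int. \<bar>real_of_int x\<bar> \<le> r}) \<le> 2 * r + 1"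
    unfolding eq by linarith
qed

text \<open>The product of the sides of a triangle is four times the area times the circumradius, and a
  lattice triangle has area at least one half.\<close>

lemma lattice_triangle_on_circle:
  fixes x1 :: int
  assumes "x1\<^sup>2 + y1\<^sup>2 = n" "x2\<^sup>2 + y2\<^sup>2 = n" "x3\<^sup>2 + y3\<^sup>2 = n"
    and "(x1, y1) \<noteq> (x2, y2)" "(x1, y1) \<noteq> (x3, y3)" "(x2, y2) \<noteq> (x3, y3)"
  shows "4 * n \<le> ((x1 - x2)\<^sup>2 + (y1 - y2)\<^sup>2) * ((x1 - x3)\<^sup>2 + (y1 - y3)\<^sup>2) * ((x2 - x3)\<^sup>2 + (y2 - y3)\<^sup>2)"
proof -
  define D where "D = (x2 - x1) * (y3 - y1) - (x3 - x1) * (y2 - y1)"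
  let ?P = "((x1 - x2)\<^sup>2 + (y1 - y2)\<^sup>2) * ((x1 - x3)\<^sup>2 + (y1 - y3)\<^sup>2) * ((x2 - x3)\<^sup>2 + (y2 - y3)\<^sup>2)"
  have eq: "?P = 4 * n * D\<^sup>2"
  proof -
    define p q r s where pq: "p = x2 - x1" "q = y2 - y1" "r = x3 - x1" "s = y3 - y1"
    define A C where AC: "A = p\<^sup>2 + q\<^sup>2" "C = r\<^sup>2 + s\<^sup>2"
    \<comment> \<open>With the first point as origin the centre of the circle is
      \<open>(- x1, - y1)\<close>. These are the equations of two perpendicular bisectors through
      it; Cramer's rule with determinant \<open>D\<close> solves them.\<close>
    have "2 * (x1 * p + y1 * q) = - A" "2 * (x1 * r + y1 * s) = - C"
      using assms(1-3) by (simp_all add: pq AC power2_eq_square algebra_simps)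
    then have "2 * x1 * D = C * q - A * s" "2 * y1 * D = A * r - C * p"
      unfolding D_def pq[symmetric] by Groebner_Basis.algebra+
    moreover have "4 * n * D\<^sup>2 = (2 * x1 * D)\<^sup>2 + (2 * y1 * D)\<^sup>2"
      unfolding assms(1)[symmetric] by (simp add: power2_eq_square algebra_simps)
    ultimately have "4 * n * D\<^sup>2 = (C * q - A * s)\<^sup>2 + (A * r - C * p)\<^sup>2" by simp
    also have "\<dots> = A * C * ((p - r)\<^sup>2 + (q - s)\<^sup>2)" unfolding AC by (simp add: power2_eq_square algebra_simps)
    also have "\<dots> = ?P" unfolding AC pq by (simp add: power2_commute)
    finally show ?thesis by simp
  qed
  have pos: "0 < (a - b)\<^sup>2 + (c - d)\<^sup>2" if "(a, c) \<noteq> (b, d)" for a b c d :: int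
    using that by (auto simp: sum_power2_gt_zero_iff)
  have "0 < ?P" using assms(4-6) by (intro mult_pos_pos pos)
  then have "D \<noteq> 0" using eq by auto
  then have "1 \<le> D\<^sup>2" using zero_less_power2[of D] by linarith
  moreover have "0 \<le> n" using assms(1) by (metis sum_power2_ge_zero)
  ultimately have "4 * n * 1 \<le> 4 * n * D\<^sup>2" by (intro mult_left_mono) auto
  then show ?thesis using eq by simp
qed

lemma floor_div_diff_less:
  assumes "0 < (W :: real)" "\<lfloor>a / W\<rfloor> = \<lfloor>b / W\<rfloor>"
  shows "\<bar>a - b\<bar> < W"
proof -
  have "\<bar>a / W - b / W\<bar> < 1" using assms(2) by linarith
  then show ?thesis using assms(1) by (simp add: diff_divide_distrib[symmetric] abs_divide)
qed

text \<open>In a quadrant the circle is the graph of a decreasing function, so the grid cell \<open>(i, j)\<close> of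
  a point is determined by \<open>i - j\<close>; a cell of side \<open>W\<close> contains at most two points.\<close>

lemma card_circle_points:
  assumes W: "1 \<le> (W :: real)" and n: "0 \<le> n" "real_of_int n \<le> W ^ 8"
  shows "finite {(x, y). x\<^sup>2 + y\<^sup>2 = (n :: int)}"
    "real (card {(x, y). x\<^sup>2 + y\<^sup>2 = (n :: int)}) \<le> 24 * W ^ 3"
proof -
  let ?C = "{(x, y). x\<^sup>2 + y\<^sup>2 = n}"
  define r where "r = sqrt (real_of_int n)"
  have r0: "0 \<le> r" and r2: "r\<^sup>2 = real_of_int n" using n by (simp_all add: r_def)
  have W3: "1 \<le> W ^ 3" using W by (rule one_le_power)
  have bd: "\<bar>real_of_int x\<bar> \<le> r" "\<bar>real_of_int y\<bar> \<le> r" if "(x, y) \<in> ?C" for x y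
  proof -
    have "real_of_int x ^ 2 + real_of_int y ^ 2 = r\<^sup>2"
      unfolding r2 using that by (metis (mono_tags, lifting) case_prodD mem_Collect_eq of_int_add of_int_power)
    then show "\<bar>real_of_int x\<bar> \<le> r" "\<bar>real_of_int y\<bar> \<le> r"
      using r0 zero_le_power2[of "real_of_int x"] zero_le_power2[of "real_of_int y"]
      by (intro power2_le_imp_le[of "\<bar>real_of_int x\<bar>"] power2_le_imp_le[of "\<bar>real_of_int y\<bar>"];
          simp only: power2_abs; linarith)+
  qed
  let ?X = "{x :: int. \<bar>real_of_int x\<bar> \<le> r}"
  note X = card_int_abs_le[OF r0]
  have sub: "?C \<subseteq> ?X \<times> ?X" using bd by auto
  show fin: "finite ?C" using finite_subset[OF sub] X(1) by simp
  define c where "c = card ?C"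
  have "real c \<le> 24 * W ^ 3"
  \<comment> \<open>Below \<open>2 * W ^ 6\<close> the radius is at most \<open>2 * W ^ 3\<close>,
    and two values of \<open>y\<close> for each \<open>x\<close> are few enough. Above it, three
    points in a cell of side \<open>W\<close> would have mutual squared distances below
    \<open>2 * W\<^sup>2\<close>, against the triangle estimate.\<close>
  proof (cases "real_of_int n < 2 * W ^ 6")
    case True
    let ?f = "\<lambda>(x, y). (x, 0 \<le> y)"
    have "inj_on ?f ?C"
    proof (rule inj_onI)
      fix p p' assume "p \<in> ?C" "p' \<in> ?C" "?f p = ?f p'"
      then obtain x y y' where p: "p = (x, y)" "p' = (x, y')" "x\<^sup>2 + y\<^sup>2 = n" "x\<^sup>2 + y'\<^sup>2 = n"
        "(0 \<le> y) = (0 \<le> y')" by auto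
      then have "y\<^sup>2 = y'\<^sup>2" by linarith
      then show "p = p'" using p by (auto simp: power2_eq_iff)
    qed
    moreover have "?f ` ?C \<subseteq> ?X \<times> UNIV" using bd by auto
    ultimately have "card ?C \<le> card (?X \<times> (UNIV :: bool set))"
      using X(1) by (intro card_inj_on_le) auto
    also have "\<dots> = 2 * card ?X" by (simp add: card_cartesian_product)
    finally have "real c \<le> 4 * r + 2" using X(2) unfolding c_def[symmetric] by linarith
    moreover have "r \<le> 2 * W ^ 3"
    proof (rule power2_le_imp_le)
      have "r\<^sup>2 \<le> 4 * W ^ 6" using True zero_le_power[of W 6] W unfolding r2 by linarith
      also have "\<dots> = (2 * W ^ 3)\<^sup>2" by (simp add: power_mult_distrib flip: power_mult)
      finally show "r\<^sup>2 \<le> (2 * W ^ 3)\<^sup>2" .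
    qed (use W in simp)
    ultimately show ?thesis using W3 by linarith
  next
    case False
    define g where "g = (\<lambda>x :: int. \<lfloor>\<bar>real_of_int x\<bar> / W\<rfloor>)"
    define f where "f = (\<lambda>(x, y). (0 \<le> x, 0 \<le> y, g x - g y))"
    let ?T = "(UNIV :: bool set) \<times> (UNIV :: bool set) \<times> {z :: int. \<bar>real_of_int z\<bar> \<le> r / W}"
    have rW: "0 \<le> r / W" using r0 W by simp
    have gle: "0 \<le> g x \<and> real_of_int (g x) \<le> r / W" if "\<bar>real_of_int x\<bar> \<le> r" for x
    proof -
      have "real_of_int (g x) \<le> \<bar>real_of_int x\<bar> / W" by (simp add: g_def)
      also have "\<dots> \<le> r / W" using that W by (simp add: divide_right_mono)
      finally show ?thesis using W by (simp add: g_def)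
    qed
    have cell: "\<bar>real_of_int (x - x')\<bar> < W \<and> \<bar>real_of_int (y - y')\<bar> < W"
      if "(x, y) \<in> ?C" "(x', y') \<in> ?C" "f (x, y) = f (x', y')" for x y x' y'
    proof -
      have s: "(0 \<le> x) = (0 \<le> x')" "(0 \<le> y) = (0 \<le> y')" "g x - g y = g x' - g y'"
        using that(3) by (auto simp: f_def)
      have mono: "g a \<le> g b" if "\<bar>a\<bar> \<le> \<bar>b\<bar>" for a b
        unfolding g_def using that W by (intro floor_mono divide_right_mono) auto
      have e: "x\<^sup>2 + y\<^sup>2 = x'\<^sup>2 + y'\<^sup>2" using that by simp
      have "g x = g x' \<and> g y = g y'"
      proof (cases "\<bar>x\<bar> \<le> \<bar>x'\<bar>")
        case True
        then have "x\<^sup>2 \<le> x'\<^sup>2" by (simp add: abs_le_square_iff)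
        then have "\<bar>y'\<bar> \<le> \<bar>y\<bar>" using e by (simp add: abs_le_square_iff)
        then show ?thesis using mono[OF True] mono[of y' y] s(3) by linarith
      next
        case False
        then have "\<bar>x'\<bar> \<le> \<bar>x\<bar>" by simp
        then have "x'\<^sup>2 \<le> x\<^sup>2" by (simp add: abs_le_square_iff)
        then have "\<bar>y\<bar> \<le> \<bar>y'\<bar>" using e by (simp add: abs_le_square_iff)
        then show ?thesis using mono[of x' x] mono[of y y'] \<open>\<bar>x'\<bar> \<le> \<bar>x\<bar>\<close> s(3) by linarith
      qed
      then have "\<bar>\<bar>real_of_int x\<bar> - \<bar>real_of_int x'\<bar>\<bar> < W" "\<bar>\<bar>real_of_int y\<bar> - \<bar>real_of_int y'\<bar>\<bar> < W"
        using W by (auto simp: g_def intro!: floor_div_diff_less)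
      then show ?thesis using s(1,2) by (cases "0 \<le> x"; cases "0 \<le> y") auto
    qed
    have near: "real_of_int ((x - x')\<^sup>2 + (y - y')\<^sup>2) < 2 * W\<^sup>2"
      if "(x, y) \<in> ?C" "(x', y') \<in> ?C" "f (x, y) = f (x', y')" for x y x' y'
    proof -
      have "\<bar>real_of_int (x - x')\<bar>\<^sup>2 < W\<^sup>2" "\<bar>real_of_int (y - y')\<bar>\<^sup>2 < W\<^sup>2"
        using cell[OF that] W by (intro power_strict_mono; simp)+
      then show ?thesis by simp
    qed
    have "card {p \<in> ?C. f p = t} \<le> 2" for t
    proof (rule ccontr)
      assume "\<not> card {p \<in> ?C. f p = t} \<le> 2"
      then have "3 \<le> card {p \<in> ?C. f p = t}" by simp
      then obtain S where "S \<subseteq> {p \<in> ?C. f p = t}" "card S = 3"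
        by (meson obtain_subset_with_card_n)
      then obtain p1 p2 p3 where p: "p1 \<in> ?C" "p2 \<in> ?C" "p3 \<in> ?C" "f p1 = t" "f p2 = t" "f p3 = t"
        "p1 \<noteq> p2" "p1 \<noteq> p3" "p2 \<noteq> p3"
        by (auto simp: card_3_iff)
      obtain x1 y1 x2 y2 x3 y3 where xy: "p1 = (x1, y1)" "p2 = (x2, y2)" "p3 = (x3, y3)"
        by (metis surj_pair)
      let ?a = "(x1 - x2)\<^sup>2 + (y1 - y2)\<^sup>2" and ?b = "(x1 - x3)\<^sup>2 + (y1 - y3)\<^sup>2" and ?c = "(x2 - x3)\<^sup>2 + (y2 - y3)\<^sup>2"
      have "4 * n \<le> ?a * ?b * ?c"
        using p xy by (intro lattice_triangle_on_circle) auto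
      then have "4 * real_of_int n \<le> real_of_int ?a * real_of_int ?b * real_of_int ?c"
        by (metis (mono_tags, lifting) of_int_le_iff of_int_mult of_int_numeral)
      also have "\<dots> < 2 * W\<^sup>2 * (2 * W\<^sup>2) * (2 * W\<^sup>2)"
      proof -
        have "real_of_int ?a < 2 * W\<^sup>2" "real_of_int ?b < 2 * W\<^sup>2" "real_of_int ?c < 2 * W\<^sup>2"
          using p near[of x1 y1 x2 y2] near[of x1 y1 x3 y3] near[of x2 y2 x3 y3] unfolding xy by simp_all
        moreover have "0 \<le> real_of_int ?a" "0 \<le> real_of_int ?b" "0 \<le> real_of_int ?c" by simp_all
        ultimately show ?thesis by (intro mult_strict_mono' mult_nonneg_nonneg) auto
      qed
      also have "\<dots> = 8 * W ^ 6" by (simp add: power2_eq_square power_def numeral_eq_Suc)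
      finally show False using False by simp
    qed
    moreover have "f ` ?C \<subseteq> ?T"
    proof (rule image_subsetI)
      fix p assume "p \<in> ?C"
      then obtain x y where p: "p = (x, y)" "x\<^sup>2 + y\<^sup>2 = n" by auto
      then have "\<bar>real_of_int (g x - g y)\<bar> \<le> r / W"
        using gle[of x] gle[of y] bd[of x y] by auto
      then show "f p \<in> ?T" by (simp add: f_def p)
    qed
    moreover have "finite ?T" using card_int_abs_le(1)[OF rW] by simp
    ultimately have "card ?C \<le> 2 * card ?T"
      using fin by (intro card_le_fibres[of ?C ?T f 2]) blast+
    also have "\<dots> = 8 * card {z :: int. \<bar>real_of_int z\<bar> \<le> r / W}" by (simp add: card_cartesian_product)
    finally have "real c \<le> 16 * (r / W) + 8"
      using card_int_abs_le(2)[OF rW] unfolding c_def[symmetric] by linarith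
    moreover have "r / W \<le> W ^ 3"
    proof -
      have "r \<le> W ^ 4"
        by (rule power2_le_imp_le) (use n(2) W r2 in \<open>simp_all flip: power_mult\<close>)
      then show ?thesis using W by (simp add: divide_le_eq power4_eq_xxxx power3_eq_cube)
    qed
    ultimately show ?thesis using W3 by linarith
  qed
  then show "real (card ?C) \<le> 24 * W ^ 3" by (simp add: c_def)
qed

text \<open>Slicing by the first coordinate gives at most \<open>3 * W ^ 4\<close> circles. With the
  trivial count on circles the exponent would be 8; the spectral gap needs one below 8.\<close>

lemma card_sphere_points:
  assumes W: "1 \<le> (W :: real)" and n: "real_of_int n \<le> W ^ 8"
  shows "finite {(x, y, z). x\<^sup>2 + y\<^sup>2 + z\<^sup>2 = (n :: int)}"
    "real (card {(x, y, z). x\<^sup>2 + y\<^sup>2 + z\<^sup>2 = (n :: int)}) \<le> 72 * W ^ 7"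
proof -
  let ?S = "{(x, y, z). x\<^sup>2 + y\<^sup>2 + z\<^sup>2 = n}"
  let ?X = "{x :: int. \<bar>real_of_int x\<bar> \<le> W ^ 4 \<and> x\<^sup>2 \<le> n}"
  let ?C = "\<lambda>x. {(y, z). y\<^sup>2 + z\<^sup>2 = n - x\<^sup>2}"
  have W4: "1 \<le> W ^ 4" using W by (rule one_le_power)
  have fX: "finite ?X" using card_int_abs_le(1)[of "W ^ 4"] W4 by auto
  have cX: "real (card ?X) \<le> 3 * W ^ 4"
  proof -
    have "card ?X \<le> card {x :: int. \<bar>real_of_int x\<bar> \<le> W ^ 4}"
      using card_int_abs_le(1)[of "W ^ 4"] W4 by (intro card_mono) auto
    then show ?thesis using card_int_abs_le(2)[of "W ^ 4"] W4 by linarith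
  qed
  have C: "finite (?C x)" "real (card (?C x)) \<le> 24 * W ^ 3" if "x \<in> ?X" for x
  proof -
    have "real_of_int (n - x\<^sup>2) \<le> real_of_int n" by simp
    then have "real_of_int (n - x\<^sup>2) \<le> W ^ 8" using n by linarith
    moreover have "0 \<le> n - x\<^sup>2" using that by simp
    ultimately show "finite (?C x)" "real (card (?C x)) \<le> 24 * W ^ 3"
      using card_circle_points[OF W] by auto
  qed
  have "?S = Sigma ?X ?C"
  proof (intro Set.set_eqI iffI)
    fix p assume "p \<in> ?S"
    then obtain x y z where p: "p = (x, y, z)" "x\<^sup>2 + y\<^sup>2 + z\<^sup>2 = n" by auto
    then have le: "x\<^sup>2 \<le> n" using zero_le_power2[of y] zero_le_power2[of z] by linarith
    then have "real_of_int (x\<^sup>2) \<le> real_of_int n" by (simp only: of_int_le_iff)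
    then have "real_of_int (x\<^sup>2) \<le> W ^ 8" using n by linarith
    then have "\<bar>real_of_int x\<bar>\<^sup>2 \<le> (W ^ 4)\<^sup>2" by (simp flip: power_mult)
    then have "\<bar>real_of_int x\<bar> \<le> W ^ 4" by (rule power2_le_imp_le) (use W4 in simp)
    then show "p \<in> Sigma ?X ?C" using p le by auto
  qed auto
  then have S: "finite ?S" "card ?S = (\<Sum>x\<in>?X. card (?C x))"
    using fX C(1) by (auto simp: card_SigmaI)
  then show "finite ?S" by simp
  have "real (card ?S) \<le> (\<Sum>x\<in>?X. 24 * W ^ 3)"
    unfolding S(2) of_nat_sum by (rule sum_mono) (rule C(2))
  also have "\<dots> = real (card ?X) * (24 * W ^ 3)" by simp
  also have "\<dots> \<le> 3 * W ^ 4 * (24 * W ^ 3)" using cX W by (intro mult_right_mono) auto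
  also have "\<dots> = 72 * W ^ 7" by (simp flip: power_add)
  finally show "real (card ?S) \<le> 72 * W ^ 7" .
qed

section \<open>The congruence kernels\<close>

lemma (in group) rcosets_finite_invariant:
  assumes "subgroup N G" "finite T" "\<And>x. x \<in> carrier G \<Longrightarrow> f x \<in> T"
    "\<And>x y. x \<in> carrier G \<Longrightarrow> y \<in> carrier G \<Longrightarrow> f x = f y \<Longrightarrow> x \<otimes> inv y \<in> N"
  shows "finite (rcosets N)" "card (rcosets N) \<le> card T"
proof -
  define r where "r = (\<lambda>C. SOME x. x \<in> carrier G \<and> C = N #> x)"
  have r: "r C \<in> carrier G" "C = N #> r C" if "C \<in> rcosets N" for C
    using someI_ex[of "\<lambda>x. x \<in> carrier G \<and> C = N #> x"] that
    by (auto simp: r_def RCOSETS_def)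
  have inj: "inj_on (\<lambda>C. f (r C)) (rcosets N)"
  proof (rule inj_onI)
    fix C D assume CD: "C \<in> rcosets N" "D \<in> rcosets N" "f (r C) = f (r D)"
    then have "r C \<otimes> inv (r D) \<in> N" using r assms(4) by blast
    then have "r C \<in> N #> r D"
      using r(1) CD assms(1) by (simp add: subgroup.rcos_module_rev is_group)
    then have e: "N #> r D = N #> r C" using r(1)[OF CD(2)] assms(1) by (intro repr_independence)
    have "C = N #> r C" by (rule r(2)[OF CD(1)])
    also have "\<dots> = D" unfolding e[symmetric] by (rule r(2)[OF CD(2), symmetric])
    finally show "C = D" .
  qed
  have sub: "(\<lambda>C. f (r C)) ` (rcosets N) \<subseteq> T" using r(1) assms(3) by auto
  show "finite (rcosets N)" using inj_on_finite[OF inj sub assms(2)] .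
  show "card (rcosets N) \<le> card T" using card_inj_on_le[OF inj sub assms(2)] .
qed

definition cong_ker :: "nat \<Rightarrow> (nat \<times> bool) list set" where
  "cong_ker n = {w \<in> carrier F3. proj_cong n (word_quat w) 1}"

lemma cong_ker_eq:
  "cong_ker n = {w \<in> carrier F3. 13 ^ n dvd q1 (word_quat w) \<and> 13 ^ n dvd q2 (word_quat w)
      \<and> 13 ^ n dvd q3 (word_quat w)}"
  unfolding cong_ker_def by (simp add: proj_cong_one_iff not_13_dvd_qnorm_word)

lemma proj_cong_inv:
  assumes "w \<in> carrier F3"
  shows "proj_cong n (word_quat w * word_quat (inv\<^bsub>F3\<^esub> w)) 1"
proof -
  interpret group F3 by (rule group_F3)
  have "foldr cons_reduce w (inv\<^bsub>F3\<^esub> w) = []"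
    using r_inv[OF assms] by (simp add: mult_F3 one_F3)
  then show ?thesis
    using proj_cong_word_mult[of n w "inv\<^bsub>F3\<^esub> w"] by (simp add: proj_cong_sym)
qed

lemma cong_ker_iff_cong:
  assumes "v \<in> carrier F3" "w \<in> carrier F3"
  shows "v \<otimes>\<^bsub>F3\<^esub> inv\<^bsub>F3\<^esub> w \<in> cong_ker n \<longleftrightarrow> proj_cong n (word_quat v) (word_quat w)"
proof -
  interpret group F3 by (rule group_F3)
  let ?u = "v \<otimes>\<^bsub>F3\<^esub> inv\<^bsub>F3\<^esub> w"
  have u: "?u \<in> carrier F3" using assms by (intro m_closed inv_closed)
  have 1: "proj_cong n (word_quat ?u) (word_quat v * word_quat (inv\<^bsub>F3\<^esub> w))"
    using proj_cong_word_mult by (simp add: mult_F3)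
  have 2: "proj_cong n (word_quat (?u \<otimes>\<^bsub>F3\<^esub> w)) (word_quat ?u * word_quat w)"
    using proj_cong_word_mult by (simp add: mult_F3)
  have 3: "?u \<otimes>\<^bsub>F3\<^esub> w = v" using assms by (simp add: m_assoc)
  show ?thesis
  proof
    assume "?u \<in> cong_ker n"
    then have "proj_cong n (word_quat ?u * word_quat w) (1 * word_quat w)"
      by (intro proj_cong_mult) (auto simp: cong_ker_def)
    then show "proj_cong n (word_quat v) (word_quat w)"
      using 2 unfolding 3 by (simp add: proj_cong_trans)
  next
    assume "proj_cong n (word_quat v) (word_quat w)"
    then have "proj_cong n (word_quat v * word_quat (inv\<^bsub>F3\<^esub> w)) (word_quat w * word_quat (inv\<^bsub>F3\<^esub> w))"
      by (intro proj_cong_mult) auto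
    then have "proj_cong n (word_quat ?u) 1"
      using 1 proj_cong_inv[OF assms(2)] proj_cong_trans by blast
    then show "?u \<in> cong_ker n" using u by (simp add: cong_ker_def)
  qed
qed

lemma normal_cong_ker: "cong_ker n \<lhd> F3"
proof -
  interpret group F3 by (rule group_F3)
  have sg: "subgroup (cong_ker n) F3"
  proof (rule subgroupI)
    show "cong_ker n \<subseteq> carrier F3" by (auto simp: cong_ker_def)
    show "cong_ker n \<noteq> {}" using one_closed by (force simp: cong_ker_def one_F3)
  next
    fix v assume v: "v \<in> cong_ker n"
    then have "proj_cong n (word_quat v * word_quat (inv\<^bsub>F3\<^esub> v)) (1 * word_quat (inv\<^bsub>F3\<^esub> v))"
      by (intro proj_cong_mult) (auto simp: cong_ker_def)
    moreover have "v \<in> carrier F3" using v by (simp add: cong_ker_def)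
    ultimately have "proj_cong n (word_quat (inv\<^bsub>F3\<^esub> v)) 1"
      using proj_cong_inv[of v n] by (metis mult_1 proj_cong_sym proj_cong_trans)
    then show "inv\<^bsub>F3\<^esub> v \<in> cong_ker n"
      using \<open>v \<in> carrier F3\<close> by (simp add: cong_ker_def)
  next
    fix v w assume vw: "v \<in> cong_ker n" "w \<in> cong_ker n"
    then have "v \<otimes>\<^bsub>F3\<^esub> w \<in> carrier F3" by (intro m_closed) (auto simp: cong_ker_def)
    then show "v \<otimes>\<^bsub>F3\<^esub> w \<in> cong_ker n"
      using vw proj_cong_word_mult_eq[of n v 1 w 1] by (simp add: cong_ker_def mult_F3)
  qed
  moreover have "x \<otimes>\<^bsub>F3\<^esub> h \<otimes>\<^bsub>F3\<^esub> inv\<^bsub>F3\<^esub> x \<in> cong_ker n" if "x \<in> carrier F3" "h \<in> cong_ker n" for x h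
  proof -
    have h: "h \<in> carrier F3" "proj_cong n (word_quat h) 1" using that by (auto simp: cong_ker_def)
    have "proj_cong n (word_quat (x \<otimes>\<^bsub>F3\<^esub> h)) (word_quat x * 1)"
      using h(2) proj_cong_word_mult_eq[of n x "word_quat x" h 1] by (simp add: mult_F3)
    then show ?thesis
      using cong_ker_iff_cong[OF m_closed[OF that(1) h(1)] that(1)] by simp
  qed
  ultimately show ?thesis unfolding normal_inv_iff by blast
qed

definition coset_form :: "nat \<Rightarrow> (nat \<times> bool) list \<Rightarrow> quat" where
  "coset_form n w = (SOME t. t \<in> normal_forms n \<and> proj_cong n (word_quat w) t)"

lemma coset_form:
  assumes "n > 0"
  shows "coset_form n w \<in> normal_forms n" "proj_cong n (word_quat w) (coset_form n w)"
  using someI_ex[of "\<lambda>t. t \<in> normal_forms n \<and> proj_cong n (word_quat w) t"]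
    proj_cong_normal_form[OF not_13_dvd_qnorm_word assms, of w]
  by (auto simp: coset_form_def)

lemma coset_form_eq:
  assumes "n > 0" "v \<in> carrier F3" "w \<in> carrier F3" "coset_form n v = coset_form n w"
  shows "v \<otimes>\<^bsub>F3\<^esub> inv\<^bsub>F3\<^esub> w \<in> cong_ker n"
  unfolding cong_ker_iff_cong[OF assms(2,3)]
  by (rule proj_cong_trans[OF coset_form(2)[OF assms(1)]])
    (simp only: assms(4) proj_cong_sym[OF coset_form(2)[OF assms(1)]])

lemma cong_ker_mono: "m \<le> n \<Longrightarrow> cong_ker n \<subseteq> cong_ker m"
  by (auto simp: cong_ker_def intro: proj_cong_mono)

text \<open>If the imaginary part vanished, the square of the real part would be a positive power of
  5, and 5 would divide the whole quaternion, against primitivity. So some imaginary coordinate is a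
  nonzero multiple of \<open>13 ^ n\<close>, and its square is at most the norm.\<close>

lemma cong_ker_length:
  assumes "w \<in> cong_ker n" "w \<noteq> []"
  shows "13 ^ (2 * n) \<le> (5 :: int) ^ length w"
proof -
  let ?x = "word_quat w"
  have w: "w \<in> carrier F3" "13 ^ n dvd q1 ?x" "13 ^ n dvd q2 ?x" "13 ^ n dvd q3 ?x"
    using assms(1) by (auto simp: cong_ker_eq)
  have nrm: "(q0 ?x)\<^sup>2 + (q1 ?x)\<^sup>2 + (q2 ?x)\<^sup>2 + (q3 ?x)\<^sup>2 = 5 ^ length w"
    using qnorm_word_quat[of w] by (simp add: qnorm_def)
  have nz: "\<not> (q1 ?x = 0 \<and> q2 ?x = 0 \<and> q3 ?x = 0)"
  proof
    assume z: "q1 ?x = 0 \<and> q2 ?x = 0 \<and> q3 ?x = 0"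
    then have "(q0 ?x)\<^sup>2 = 5 ^ length w" using nrm by simp
    moreover have "(5 :: int) dvd 5 ^ length w" using assms(2) by simp
    ultimately have "5 dvd (q0 ?x)\<^sup>2" by simp
    then have "5 dvd q0 ?x" using prime_dvd_power[of 5 "q0 ?x" 2] by (simp add: prime_int_numeral_eq)
    then show False using word_quat_primitive[OF w(1) assms(2)] z by (simp add: qdvd_def)
  qed
  have big: "13 ^ (2 * n) \<le> a\<^sup>2" if "13 ^ n dvd a" "a \<noteq> 0" for a :: int
  proof -
    have "(13 :: int) ^ n \<le> \<bar>a\<bar>" using that dvd_imp_le_int[of a "13 ^ n"] by simp
    then have "(13 ^ n)\<^sup>2 \<le> \<bar>a\<bar>\<^sup>2" by (intro power_mono) auto
    then show ?thesis by (simp add: power_even_eq)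
  qed
  have p: "0 \<le> (q0 ?x)\<^sup>2" "0 \<le> (q1 ?x)\<^sup>2" "0 \<le> (q2 ?x)\<^sup>2" "0 \<le> (q3 ?x)\<^sup>2" by simp_all
  from nz consider "q1 ?x \<noteq> 0" | "q2 ?x \<noteq> 0" | "q3 ?x \<noteq> 0" by blast
  then have "\<exists>a\<in>{q1 ?x, q2 ?x, q3 ?x}. 13 ^ (2 * n) \<le> a\<^sup>2"
    using big w by cases blast+
  then show ?thesis
    unfolding nrm[symmetric] by (elim bexE insertE emptyE; hypsubst; use p in linarith)
qed

lemma five_nonresidue_13:
  fixes a c :: int
  assumes "13 dvd 5 * a\<^sup>2 - c\<^sup>2"
  shows "13 dvd c"
proof -
  have "[5 * (a mod 13)\<^sup>2 - (c mod 13)\<^sup>2 = 5 * a\<^sup>2 - c\<^sup>2] (mod 13)"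
    by (intro cong_diff cong_mult cong_pow cong_refl) (simp_all add: cong_def)
  then have "13 dvd 5 * (a mod 13)\<^sup>2 - (c mod 13)\<^sup>2"
    using assms by (meson cong_dvd_iff dvd_refl)
  moreover have sq: "\<forall>a\<in>set [0..12]. \<forall>c\<in>set [0..12::int]. 13 dvd 5 * a\<^sup>2 - c\<^sup>2 \<longrightarrow> c = 0"
    by code_simp
  have "a mod 13 \<in> set [0..12]" "c mod 13 \<in> set [0..12]"
    unfolding set_upto by simp_all
  from sq[THEN bspec, OF this(1), THEN bspec, OF this(2)] calculation have "c mod 13 = 0"
    by (rule mp)
  then show ?thesis by (simp add: dvd_eq_mod_eq_0)
qed

text \<open>Modulo 13 a kernel element is a scalar, so its norm \<open>5 ^ length w\<close> is a
  square there; an odd length would make 5 a quadratic residue modulo 13.\<close>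

lemma cong_ker_even_length:
  assumes "w \<in> cong_ker n" "n > 0"
  shows "even (length w)"
proof (rule ccontr)
  assume "odd (length w)"
  then obtain i where i: "length w = 2 * i + 1" using oddE by blast
  let ?x = "word_quat w"
  have d: "13 dvd q1 ?x" "13 dvd q2 ?x" "13 dvd q3 ?x"
  proof -
    have "(13 :: int) dvd 13 ^ n" using assms(2) by (simp add: dvd_power)
    moreover have "13 ^ n dvd q1 ?x" "13 ^ n dvd q2 ?x" "13 ^ n dvd q3 ?x"
      using assms(1) by (simp_all add: cong_ker_eq)
    ultimately show "13 dvd q1 ?x" "13 dvd q2 ?x" "13 dvd q3 ?x"
      by (blast intro: dvd_trans[of 13 "13 ^ n"])+
  qed
  have "(q0 ?x)\<^sup>2 + (q1 ?x)\<^sup>2 + (q2 ?x)\<^sup>2 + (q3 ?x)\<^sup>2 = 5 * (5 ^ i)\<^sup>2"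
    using qnorm_word_quat[of w] by (simp add: qnorm_def i power_even_eq)
  then have "5 * (5 ^ i)\<^sup>2 - (q0 ?x)\<^sup>2 = (q1 ?x)\<^sup>2 + (q2 ?x)\<^sup>2 + (q3 ?x)\<^sup>2" by linarith
  moreover have "13 dvd (q1 ?x)\<^sup>2 + (q2 ?x)\<^sup>2 + (q3 ?x)\<^sup>2" using d by (simp add: power2_eq_square)
  ultimately have "13 dvd 5 * (5 ^ i)\<^sup>2 - (q0 ?x)\<^sup>2" by (simp only:)
  from five_nonresidue_13[OF this] have "13 dvd q0 ?x" .
  then show False
    using not_13_dvd_qnorm_word[of w] d by (simp add: qnorm_def power2_eq_square)
qed

section \<open>Counting kernel words of a given length\<close>

lemma card_int_interval_le:
  assumes "l \<le> u + (1 :: real)"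
  shows "finite {t :: int. l \<le> real_of_int t \<and> real_of_int t \<le> u}"
    "real (card {t :: int. l \<le> real_of_int t \<and> real_of_int t \<le> u}) \<le> u - l + 1"
proof -
  have eq: "{t :: int. l \<le> real_of_int t \<and> real_of_int t \<le> u} = {\<lceil>l\<rceil>..\<lfloor>u\<rfloor>}"
    by (auto simp: le_floor_iff ceiling_le_iff)
  show "finite {t :: int. l \<le> real_of_int t \<and> real_of_int t \<le> u}" unfolding eq by simp
  show "real (card {t :: int. l \<le> real_of_int t \<and> real_of_int t \<le> u}) \<le> u - l + 1"
    unfolding eq using assms by simp linarith
qed

lemma card_int_residue_le:
  fixes A M a :: int
  assumes "0 \<le> A" "0 < M"
  shows "finite {x. \<bar>x\<bar> \<le> A \<and> M dvd x - a}"
    "real (card {x. \<bar>x\<bar> \<le> A \<and> M dvd x - a}) \<le> 2 * (real_of_int A / real_of_int M) + 1"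
proof -
  let ?X = "{x. \<bar>x\<bar> \<le> A \<and> M dvd x - a}"
  define l u where lu: "l = real_of_int (- A - a) / real_of_int M" "u = real_of_int (A - a) / real_of_int M"
  have "l \<le> u" unfolding lu using assms by (intro divide_right_mono) auto
  note I = card_int_interval_le[of l u]
  show fin: "finite ?X"
    by (rule finite_subset[of _ "{-A..A}"]) auto
  have inj: "inj_on (\<lambda>x. (x - a) div M) ?X"
    by (rule inj_onI) (metis (mono_tags, lifting) mem_Collect_eq dvd_mult_div_cancel diff_add_cancel)
  have sub: "(\<lambda>x. (x - a) div M) ` ?X \<subseteq> {t. l \<le> real_of_int t \<and> real_of_int t \<le> u}"
  proof (rule image_subsetI)
    fix x assume x: "x \<in> ?X"
    then have "real_of_int ((x - a) div M) = real_of_int (x - a) / real_of_int M"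
      by (simp add: real_of_int_div)
    moreover have "l \<le> real_of_int (x - a) / real_of_int M" "real_of_int (x - a) / real_of_int M \<le> u"
      unfolding lu using x assms by (auto intro!: divide_right_mono)
    ultimately show "(x - a) div M \<in> {t. l \<le> real_of_int t \<and> real_of_int t \<le> u}" by simp
  qed
  have "card ?X \<le> card {t. l \<le> real_of_int t \<and> real_of_int t \<le> u}"
    using inj sub I(1) \<open>l \<le> u\<close> by (intro card_inj_on_le) auto
  then have "real (card ?X) \<le> u - l + 1" using I(2) \<open>l \<le> u\<close> by linarith
  also have "u - l = 2 * (real_of_int A / real_of_int M)"
    unfolding lu using assms by (simp add: field_simps)
  finally show "real (card ?X) \<le> 2 * (real_of_int A / real_of_int M) + 1" .
qed

text \<open>The imaginary part enters the norm through squares, so the product of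
  \<open>q0 - 5 ^ i\<close> and \<open>q0 + 5 ^ i\<close> is divisible by
  \<open>13 ^ (2 * n)\<close>, twice the exponent of the kernel. As 13 does not divide
  \<open>2 * 5 ^ i\<close>, one of the two factors takes the whole power.\<close>

lemma cong_ker_real_part:
  assumes "w \<in> cong_ker n" "length w = 2 * i"
  shows "\<bar>q0 (word_quat w)\<bar> \<le> 5 ^ i"
    "13 ^ (2 * n) dvd q0 (word_quat w) - 5 ^ i \<or> 13 ^ (2 * n) dvd q0 (word_quat w) - - (5 ^ i)"
    "\<exists>y1 y2 y3. q1 (word_quat w) = 13 ^ n * y1 \<and> q2 (word_quat w) = 13 ^ n * y2 \<and>
       q3 (word_quat w) = 13 ^ n * y3 \<and>
       (5 ^ i)\<^sup>2 - (q0 (word_quat w))\<^sup>2 = 13 ^ (2 * n) * (y1\<^sup>2 + y2\<^sup>2 + y3\<^sup>2)"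
proof -
  let ?x = "word_quat w" and ?A = "5 ^ i :: int"
  obtain y1 y2 y3 where y: "q1 ?x = 13 ^ n * y1" "q2 ?x = 13 ^ n * y2" "q3 ?x = 13 ^ n * y3"
    using assms(1) by (auto simp: cong_ker_eq elim!: dvdE)
  have nrm: "(q0 ?x)\<^sup>2 + (q1 ?x)\<^sup>2 + (q2 ?x)\<^sup>2 + (q3 ?x)\<^sup>2 = ?A\<^sup>2"
    using qnorm_word_quat[of w] by (simp add: qnorm_def assms(2) power_even_eq)
  have e: "?A\<^sup>2 - (q0 ?x)\<^sup>2 = 13 ^ (2 * n) * (y1\<^sup>2 + y2\<^sup>2 + y3\<^sup>2)"
    using nrm unfolding y by (simp add: power_mult_distrib power_even_eq distrib_left)
  with y show "\<exists>y1 y2 y3. q1 ?x = 13 ^ n * y1 \<and> q2 ?x = 13 ^ n * y2 \<and> q3 ?x = 13 ^ n * y3 \<and>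
       ?A\<^sup>2 - (q0 ?x)\<^sup>2 = 13 ^ (2 * n) * (y1\<^sup>2 + y2\<^sup>2 + y3\<^sup>2)" by blast
  have "(q0 ?x)\<^sup>2 \<le> ?A\<^sup>2"
    using nrm zero_le_power2[of "q1 ?x"] zero_le_power2[of "q2 ?x"] zero_le_power2[of "q3 ?x"] by linarith
  then show "\<bar>q0 ?x\<bar> \<le> 5 ^ i" by (simp add: abs_le_square_iff[symmetric])
  have d: "13 ^ (2 * n) dvd (q0 ?x - ?A) * (q0 ?x - - ?A)"
  proof -
    have "(q0 ?x - ?A) * (q0 ?x - - ?A) = - (?A\<^sup>2 - (q0 ?x)\<^sup>2)" by (simp add: power2_eq_square algebra_simps)
    then show ?thesis unfolding e by simp
  qed
  have cop: "coprime (13 ^ (2 * n)) z" if "\<not> 13 dvd z" for z :: int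
    using prime_imp_coprime[OF prime_13 that] by simp
  show "13 ^ (2 * n) dvd q0 ?x - ?A \<or> 13 ^ (2 * n) dvd q0 ?x - - ?A"
  proof (cases "13 dvd q0 ?x - ?A")
    case True
    have "\<not> 13 dvd q0 ?x - - ?A"
    proof
      assume "13 dvd q0 ?x - - ?A"
      from dvd_diff[OF this True] have "13 dvd 2 * ?A" by simp
      then show False using not_13_dvd_mult[of 2 ?A] not_13_dvd_power5[of i] by simp
    qed
    then show ?thesis using d cop coprime_dvd_mult_left_iff by blast
  next
    case False
    then show ?thesis using d cop coprime_dvd_mult_right_iff by blast
  qed
qed

lemma finite_F3_length: "finite {w \<in> carrier F3. length w \<le> l}"
proof (rule finite_subset)
  show "{w \<in> carrier F3. length w \<le> l} \<subseteq> {w. set w \<subseteq> {0, 1, 2} \<times> UNIV \<and> length w \<le> l}"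
    by (force simp: carrier_F3 subset_iff)
  show "finite {w. set w \<subseteq> {0, 1, 2 :: nat} \<times> (UNIV :: bool set) \<and> length w \<le> l}"
    by (intro finite_lists_length_le) auto
qed

text \<open>Once the modulus exceeds \<open>2 * 5 ^ i\<close>, the real part can only be
  \<open>5 ^ i\<close> or its negative. Then the imaginary part vanishes and 5 divides the
  quaternion, against primitivity.\<close>

lemma cong_ker_sphere_empty:
  assumes "0 < i" "2 * 5 ^ i < (13 :: int) ^ (2 * n)"
  shows "{w \<in> cong_ker n. length w = 2 * i} = {}"
proof -
  have False if w: "w \<in> cong_ker n" "length w = 2 * i" for w
  proof -
    let ?x = "word_quat w" and ?A = "5 ^ i :: int"
    note r = cong_ker_real_part[OF w]
    have z: "z = 0" if "13 ^ (2 * n) dvd z" "\<bar>z\<bar> \<le> 2 * ?A" for z :: int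
      using that assms(2) dvd_imp_le_int[of z "13 ^ (2 * n)"] by fastforce
    have "\<bar>q0 ?x - ?A\<bar> \<le> 2 * ?A" "\<bar>q0 ?x - - ?A\<bar> \<le> 2 * ?A" using r(1) by linarith+
    then have x0: "q0 ?x = ?A \<or> q0 ?x = - ?A" using r(2) z by fastforce
    then have "?A\<^sup>2 - (q0 ?x)\<^sup>2 = 0" by auto
    then obtain y1 y2 y3 where y: "q1 ?x = 13 ^ n * y1" "q2 ?x = 13 ^ n * y2" "q3 ?x = 13 ^ n * y3"
      "13 ^ (2 * n) * (y1\<^sup>2 + y2\<^sup>2 + y3\<^sup>2) = 0" using r(3) by metis
    then have "y1\<^sup>2 + y2\<^sup>2 + y3\<^sup>2 = 0" by simp
    then have "y1 = 0 \<and> y2 = 0 \<and> y3 = 0"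
      using zero_le_power2[of y1] zero_le_power2[of y2] zero_le_power2[of y3]
      by (metis add_nonneg_eq_0_iff add_nonneg_nonneg zero_eq_power2)
    then have "qdvd 5 ?x" using y x0 assms(1) by (auto simp: qdvd_def)
    moreover have "w \<noteq> []" "w \<in> carrier F3" using w assms(1) by (auto simp: cong_ker_def)
    ultimately show False using word_quat_primitive by blast
  qed
  then show ?thesis by blast
qed

text \<open>The real part lies in two residue classes modulo \<open>13 ^ (2 * n)\<close>, and for
  each value the imaginary part divided by \<open>13 ^ n\<close> lies on a sphere of squared radius
  at most \<open>W ^ 8\<close>. The hypothesis on \<open>i\<close> absorbs the rounding terms in the
  count of real parts.\<close>

lemma card_cong_ker_sphere:
  fixes W :: real
  assumes W: "1 \<le> W" "W ^ 4 = 5 ^ i / 13 ^ n" and i: "13 ^ (2 * n) \<le> 2 * (5 :: int) ^ i"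
  shows "real (card {w \<in> cong_ker n. length w = 2 * i}) \<le> 576 * (5 ^ i / 13 ^ (2 * n)) * W ^ 7"
proof -
  let ?A = "5 ^ i :: int" and ?M = "13 ^ (2 * n) :: int"
  define X where "X = {x. \<bar>x\<bar> \<le> ?A \<and> ?M dvd x - ?A} \<union> {x. \<bar>x\<bar> \<le> ?A \<and> ?M dvd x - - ?A}"
  define C where "C = (\<lambda>x. {(y1, y2, y3). y1\<^sup>2 + y2\<^sup>2 + y3\<^sup>2 = (?A\<^sup>2 - x\<^sup>2) div ?M})"
  define f where "f = (\<lambda>w. (q0 (word_quat w), q1 (word_quat w) div 13 ^ n, q2 (word_quat w) div 13 ^ n, q3 (word_quat w) div 13 ^ n))"
  define Z where "Z = {w \<in> cong_ker n. length w = 2 * i}"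
  have M1: "1 \<le> 2 * (real_of_int ?A / real_of_int ?M)"
  proof -
    have "real_of_int ?M \<le> real_of_int (2 * ?A)" using i by (simp only: of_int_le_iff)
    then show ?thesis by (simp add: field_simps)
  qed
  have fX: "finite X" and cX: "real (card X) \<le> 8 * (5 ^ i / 13 ^ (2 * n))"
  proof -
    note 1 = card_int_residue_le[of ?A ?M ?A] and 2 = card_int_residue_le[of ?A ?M "- ?A"]
    show "finite X" unfolding X_def using 1(1) 2(1) by simp
    have "card X \<le> card {x. \<bar>x\<bar> \<le> ?A \<and> ?M dvd x - ?A} + card {x. \<bar>x\<bar> \<le> ?A \<and> ?M dvd x - - ?A}"
      unfolding X_def by (rule card_Un_le)
    then have "real (card X) \<le> 4 * (real_of_int ?A / real_of_int ?M) + 2" using 1(2) 2(2) by simp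
    then have "real (card X) \<le> 8 * (real_of_int ?A / real_of_int ?M)" using M1 by linarith
    then show "real (card X) \<le> 8 * (5 ^ i / 13 ^ (2 * n))" by simp
  qed
  have C: "finite (C x)" "real (card (C x)) \<le> 72 * W ^ 7" for x
  proof -
    have "real_of_int ((?A\<^sup>2 - x\<^sup>2) div ?M) \<le> real_of_int (?A\<^sup>2 - x\<^sup>2) / real_of_int ?M"
      by (rule real_of_int_div4)
    also have "\<dots> \<le> real_of_int (?A\<^sup>2) / real_of_int ?M" by (intro divide_right_mono) auto
    also have "\<dots> = (5 ^ i / 13 ^ n)\<^sup>2" by (simp add: power_divide power_even_eq)
    also have "\<dots> = W ^ 8" unfolding W(2)[symmetric] by (simp flip: power_mult)
    finally show "finite (C x)" "real (card (C x)) \<le> 72 * W ^ 7"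
      unfolding C_def using card_sphere_points[OF W(1)] by blast+
  qed
  have "inj_on f Z"
  proof (rule inj_onI)
    fix v w assume vw: "v \<in> Z" "w \<in> Z" "f v = f w"
    then have d: "13 ^ n dvd q1 (word_quat v)" "13 ^ n dvd q2 (word_quat v)" "13 ^ n dvd q3 (word_quat v)"
      "13 ^ n dvd q1 (word_quat w)" "13 ^ n dvd q2 (word_quat w)" "13 ^ n dvd q3 (word_quat w)"
      by (auto simp: Z_def cong_ker_eq)
    have "word_quat v = word_quat w"
      using vw(3) d unfolding f_def quat_eq_iff by (metis Pair_inject dvd_div_mult_self)
    then show "v = w" using vw(1,2) by (intro word_quat_inj) (auto simp: Z_def cong_ker_def)
  qed
  moreover have "f ` Z \<subseteq> Sigma X C"
  proof (rule image_subsetI)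
    fix w assume "w \<in> Z"
    then have w: "w \<in> cong_ker n" "length w = 2 * i" by (auto simp: Z_def)
    note r = cong_ker_real_part[OF w]
    obtain y1 y2 y3 where y: "q1 (word_quat w) = 13 ^ n * y1" "q2 (word_quat w) = 13 ^ n * y2"
      "q3 (word_quat w) = 13 ^ n * y3" "?A\<^sup>2 - (q0 (word_quat w))\<^sup>2 = ?M * (y1\<^sup>2 + y2\<^sup>2 + y3\<^sup>2)"
      using r(3) by blast
    have "f w = (q0 (word_quat w), y1, y2, y3)" by (simp add: f_def y(1-3))
    moreover have "q0 (word_quat w) \<in> X" using r(1,2) unfolding X_def by blast
    moreover have "(y1, y2, y3) \<in> C (q0 (word_quat w))" by (simp add: C_def y(4))
    ultimately show "f w \<in> Sigma X C" by simp
  qed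
  ultimately have "card Z \<le> card (Sigma X C)"
    using fX C(1) by (intro card_inj_on_le finite_SigmaI) auto
  also have "\<dots> = (\<Sum>x\<in>X. card (C x))" using fX C(1) by simp
  finally have "real (card Z) \<le> (\<Sum>x\<in>X. real (card (C x)))" by (simp flip: of_nat_sum)
  also have "\<dots> \<le> (\<Sum>x\<in>X. 72 * W ^ 7)" by (rule sum_mono) (rule C(2))
  also have "\<dots> = real (card X) * (72 * W ^ 7)" by simp
  also have "\<dots> \<le> 8 * (5 ^ i / 13 ^ (2 * n)) * (72 * W ^ 7)"
    using cX W(1) by (intro mult_right_mono) auto
  finally show ?thesis by (simp add: Z_def)
qed

text \<open>For length \<open>2 * i\<close> the weight is \<open>(1 / 5) ^ i\<close>, which cancels
  the growth of the number of real parts; what is left is the sphere count, whose bound is largest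
  at \<open>i = M\<close>. The leading 1 is the empty word, and short nonempty words do not
  occur.\<close>

lemma sum_cong_ker_potential:
  fixes s :: real
  assumes n: "n > 0" and s: "s > 0" "s\<^sup>2 = 1 / 5"
  shows "(\<Sum>\<gamma> | \<gamma> \<in> cong_ker n \<and> length \<gamma> \<le> 2 * M. s ^ length \<gamma>)
     \<le> 1 + real M * (576 / 13 ^ (2 * n) * (5 ^ M / 13 ^ n) powr (7 / 4))"
proof -
  let ?Z = "\<lambda>i. {\<gamma> \<in> cong_ker n. length \<gamma> = 2 * i}"
  let ?b = "576 / 13 ^ (2 * n) * (5 ^ M / 13 ^ n) powr (7 / 4) :: real"
  have fin: "finite (?Z i)" for i
    by (rule finite_subset[OF _ finite_F3_length[of "2 * i"]]) (auto simp: cong_ker_def)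
  have eq: "{\<gamma>. \<gamma> \<in> cong_ker n \<and> length \<gamma> \<le> 2 * M} = (\<Union>i\<in>{..M}. ?Z i)"
  proof (intro Set.set_eqI iffI)
    fix \<gamma> assume g: "\<gamma> \<in> {\<gamma>. \<gamma> \<in> cong_ker n \<and> length \<gamma> \<le> 2 * M}"
    then have "even (length \<gamma>)" using cong_ker_even_length[OF _ n] by blast
    then obtain i where "length \<gamma> = 2 * i" by (rule evenE)
    then show "\<gamma> \<in> (\<Union>i\<in>{..M}. ?Z i)" using g by (intro UN_I[of i]) auto
  qed auto
  have "(\<Sum>\<gamma> | \<gamma> \<in> cong_ker n \<and> length \<gamma> \<le> 2 * M. s ^ length \<gamma>) = (\<Sum>i\<le>M. \<Sum>\<gamma>\<in>?Z i. s ^ length \<gamma>)"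
    unfolding eq by (rule sum.UNION_disjoint) (use fin in auto)
  also have "\<dots> = (\<Sum>i\<le>M. real (card (?Z i)) * (1 / 5) ^ i)"
    by (intro sum.cong refl) (simp add: power_mult s)
  also have "\<dots> = real (card (?Z 0)) * (1 / 5) ^ 0 + (\<Sum>i\<in>{1..M}. real (card (?Z i)) * (1 / 5) ^ i)"
  proof -
    have "{..M} = insert 0 {1..M}" by auto
    then show ?thesis by (simp only: sum.insert finite_atLeastAtMost) simp
  qed
  also have "\<dots> \<le> 1 + (\<Sum>i\<in>{1..M}. ?b)"
  proof (intro add_mono sum_mono)
    have "?Z 0 \<subseteq> {[]}" by auto
    then have "card (?Z 0) \<le> 1" using card_mono[of "{[]}" "?Z 0"] by simp
    then show "real (card (?Z 0)) * (1 / 5) ^ 0 \<le> 1" by simp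
  next
    fix i assume i: "i \<in> {1..M}"
    show "real (card (?Z i)) * (1 / 5) ^ i \<le> ?b"
    proof (cases "2 * 5 ^ i < (13 :: int) ^ (2 * n)")
      case True
      have e: "?Z i = {}" by (rule cong_ker_sphere_empty) (use True i in auto)
      show ?thesis unfolding e by simp
    next
      case False
      then have le: "13 ^ (2 * n) \<le> 2 * (5 :: int) ^ i" by simp
      \<comment> \<open>The fourth root of the largest radius that occurs at this length;
        \<open>1 \<le> W\<close> holds because shorter words have just been excluded.\<close>
      define W where "W = (5 ^ i / 13 ^ n :: real) powr (1 / 4)"
      have ge: "1 \<le> (5 ^ i / 13 ^ n :: real)"
      proof -
        have "real_of_int (13 ^ (2 * n)) \<le> real_of_int (2 * 5 ^ i)" using le by (simp only: of_int_le_iff)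
        then have "(13 :: real) ^ n * 13 ^ n \<le> 2 * 5 ^ i" by (simp add: power_even_eq power2_eq_square)
        moreover have "(2 :: real) \<le> 13 ^ n" using n power_increasing[of 1 n "13 :: real"] by simp
        then have "2 * (13 :: real) ^ n \<le> 13 ^ n * 13 ^ n" by (intro mult_right_mono) auto
        ultimately have "(13 :: real) ^ n \<le> 5 ^ i" by linarith
        then show ?thesis by simp
      qed
      have W: "1 \<le> W" "W ^ 4 = 5 ^ i / 13 ^ n" "W ^ 7 = (5 ^ i / 13 ^ n) powr (7 / 4)"
        unfolding W_def using ge by (simp_all add: ge_one_powr_ge_zero powr_power)
      have "real (card (?Z i)) * (1 / 5) ^ i \<le> 576 * (5 ^ i / 13 ^ (2 * n)) * W ^ 7 * (1 / 5) ^ i"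
        by (intro mult_right_mono card_cong_ker_sphere W(1,2) le) auto
      also have "\<dots> = 576 / 13 ^ (2 * n) * W ^ 7"
      proof -
        have "c * (u / v) * d * (1 / u) = c / v * d" if "u \<noteq> 0" for c d u v :: real
          using that by simp
        from this[of "5 ^ i"] show ?thesis by (simp only: power_one_over) simp
      qed
      also have "\<dots> \<le> ?b"
      proof -
        have "(5 :: real) ^ i / 13 ^ n \<le> 5 ^ M / 13 ^ n"
          using i by (intro divide_right_mono power_increasing) auto
        then have "(5 ^ i / 13 ^ n :: real) powr (7 / 4) \<le> (5 ^ M / 13 ^ n) powr (7 / 4)"
          by (intro powr_mono2) auto
        then show ?thesis unfolding W(3) by (rule mult_left_mono) simp
      qed
      finally show ?thesis .
    qed
  qed
  also have "\<dots> = 1 + real M * ?b" by simp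
  finally show ?thesis .
qed

section \<open>Approximation along the 13-adic congruence filtration\<close>

lemma power_one_plus_ring:
  fixes w :: "'a :: ring_1"
  shows "\<exists>y. (1 + w) ^ k = 1 + of_nat k * w + of_nat (\<Sum>{..<k}) * w\<^sup>2 + w ^ 3 * y"
proof (induction k)
  case 0
  show ?case by (intro exI[of _ 0]) simp
next
  case (Suc k)
  then obtain y where y: "(1 + w) ^ k = 1 + of_nat k * w + of_nat (\<Sum>{..<k}) * w\<^sup>2 + w ^ 3 * y" by blast
  have c: "of_nat n * w ^ 3 = w ^ 3 * of_nat n" for n by (rule mult_of_nat_commute)
  have "(1 + w) ^ Suc k = (1 + of_nat k * w + of_nat (\<Sum>{..<k}) * w\<^sup>2 + w ^ 3 * y) * (1 + w)"
    by (simp add: y power_Suc2 del: power_Suc)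
  also have "\<dots> = 1 + of_nat (Suc k) * w + of_nat (\<Sum>{..<Suc k}) * w\<^sup>2
      + w ^ 3 * (of_nat (\<Sum>{..<k}) + y * (1 + w))"
    unfolding distrib_left c[symmetric]
    by (simp add: distrib_left distrib_right power2_eq_square power3_eq_cube mult.assoc)
  finally show ?case by blast
qed

text \<open>Raising to the 13th power moves an element of level \<open>m\<close> of the 13-adic congruence filtration
  to level \<open>m + 1\<close> and keeps its leading term.\<close>

lemma power_13_level:
  fixes z :: "'a :: ring_1"
  shows "\<exists>y. (1 + 13 * z) ^ (e * 13 ^ d) = 1 + 13 ^ (d + 1) * (of_nat e * z) + 13 ^ (d + 2) * y"
proof (induction d)
  case 0
  obtain y where y: "(1 + 13 * z) ^ e = 1 + of_nat e * (13 * z) + of_nat (\<Sum>{..<e}) * (13 * z)\<^sup>2 + (13 * z) ^ 3 * y"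
    using power_one_plus_ring by blast
  have 13: "13 * x = x * (13 :: 'a)" for x
    using mult_of_nat_commute[of 13 x] by simp
  have 1: "of_nat e * (13 * z) = 13 * (of_nat e * z)" by (metis 13 mult.assoc)
  have 2: "(13 * z)\<^sup>2 = 13\<^sup>2 * z\<^sup>2" unfolding power2_eq_square by (metis 13 mult.assoc)
  have 3: "(13 * z) ^ 3 = 13\<^sup>2 * (z\<^sup>2 * (13 * z))"
  proof -
    have "(13 * z) ^ 3 = (13 * z)\<^sup>2 * (13 * z)" by (simp only: power3_eq_cube power2_eq_square)
    then show ?thesis by (simp only: 2 mult.assoc)
  qed
  have 4: "of_nat (\<Sum>{..<e}) * 13\<^sup>2 = 13\<^sup>2 * (of_nat (\<Sum>{..<e}) :: 'a)"
    by (rule mult_of_nat_commute)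
  have "(1 + 13 * z) ^ e = 1 + 13 * (of_nat e * z) + 13\<^sup>2 * (of_nat (\<Sum>{..<e}) * z\<^sup>2 + z\<^sup>2 * (13 * z) * y)"
    unfolding y 1 2 3 distrib_left by (simp only: mult.assoc[symmetric] 4 add.assoc)
  then show ?case unfolding power_0 mult_1_right add_0_left power_one_right by blast
next
  case (Suc d)
  then obtain y where y: "(1 + 13 * z) ^ (e * 13 ^ d) = 1 + 13 ^ (d + 1) * (of_nat e * z) + 13 ^ (d + 2) * y"
    by blast
  define P where "P = (13 :: 'a) ^ (d + 1)"
  define v where "v = of_nat e * z + 13 * y"
  have Pc: "P * x = x * P" for x
  proof -
    have "P = of_nat (13 ^ (d + 1))" by (simp add: P_def)
    then show ?thesis by (simp only: mult_of_nat_commute)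
  qed
  have "(1 + 13 * z) ^ (e * 13 ^ d) = 1 + P * v"
    unfolding y v_def P_def by (simp add: distrib_left power_Suc2 mult.assoc del: power_Suc)
  then have "(1 + 13 * z) ^ (e * 13 ^ Suc d) = (1 + P * v) ^ 13"
    by (metis power_Suc2 mult.assoc power_mult)
  also obtain y' where "(1 + P * v) ^ 13 = 1 + of_nat 13 * (P * v) + of_nat (\<Sum>{..<13}) * (P * v)\<^sup>2 + (P * v) ^ 3 * y'"
    using power_one_plus_ring by blast
  \<comment> \<open>This is the binomial coefficient 13 over 2. Its factor 13 lifts the quadratic
    term from level \<open>2 * d + 2\<close> to \<open>2 * d + 3\<close>, which is at least
    \<open>d + 3\<close> even when \<open>d = 0\<close>.\<close>
  also have "(\<Sum>{..<13 :: nat}) = 78" by (simp add: lessThan_nat_numeral)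
  also have "(P * v)\<^sup>2 = P\<^sup>2 * v\<^sup>2" unfolding power2_eq_square by (metis Pc mult.assoc)
  also have "(P * v) ^ 3 = P ^ 3 * v ^ 3" unfolding power3_eq_cube by (metis Pc mult.assoc)
  also have "of_nat 78 * (P\<^sup>2 * v\<^sup>2) = (of_nat 13 * P\<^sup>2) * (6 * v\<^sup>2)"
  proof -
    have "of_nat 78 * (P\<^sup>2 * v\<^sup>2) = (13 * 6) * (P\<^sup>2 * v\<^sup>2)" by simp
    also have "6 * P\<^sup>2 = P\<^sup>2 * 6" using mult_of_nat_commute[of 6 "P\<^sup>2"] by simp
    then have "(13 * 6) * (P\<^sup>2 * v\<^sup>2) = (of_nat 13 * P\<^sup>2) * (6 * v\<^sup>2)"
      by (simp only: mult.assoc[symmetric]) (simp only: mult.assoc of_nat_numeral)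
    finally show ?thesis .
  qed
  also have "of_nat 13 * P\<^sup>2 = (13 :: 'a) ^ (d + 3) * 13 ^ d"
  proof -
    have "of_nat 13 * P\<^sup>2 = 13 ^ Suc ((d + 1) * 2)" by (simp only: P_def power_mult power_Suc of_nat_numeral)
    also have "Suc ((d + 1) * 2) = (d + 3) + d" by simp
    finally show ?thesis by (simp only: power_add)
  qed
  also have "P ^ 3 = (13 :: 'a) ^ (d + 3) * 13 ^ (2 * d)"
  proof -
    have "P ^ 3 = 13 ^ ((d + 1) * 3)" by (simp only: P_def power_mult)
    also have "(d + 1) * 3 = (d + 3) + 2 * d" by simp
    finally show ?thesis by (simp only: power_add)
  qed
  also have "of_nat 13 * (P * v) = 13 ^ (d + 2) * (of_nat e * z) + 13 ^ (d + 3) * y"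
  proof -
    have 1: "of_nat 13 * P = 13 ^ (d + 2)" by (simp add: P_def)
    have "d + 3 = Suc (d + 2)" by simp
    then have 2: "(13 :: 'a) ^ (d + 2) * 13 = 13 ^ (d + 3)" by (simp only: power_Suc2)
    have "of_nat 13 * (P * v) = 13 ^ (d + 2) * v" by (simp only: mult.assoc[symmetric] 1)
    also have "\<dots> = 13 ^ (d + 2) * (of_nat e * z) + 13 ^ (d + 2) * 13 * y"
      by (simp only: v_def distrib_left mult.assoc)
    finally show ?thesis by (simp only: 2)
  qed
  finally have "(1 + 13 * z) ^ (e * 13 ^ Suc d) = 1 + 13 ^ (d + 2) * (of_nat e * z)
      + 13 ^ (d + 3) * (y + 13 ^ d * (6 * v\<^sup>2) + 13 ^ (2 * d) * v ^ 3 * y')"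
    by (simp only: distrib_left mult.assoc add.assoc)
  then show ?case by (auto simp: numeral_3_eq_3 numeral_2_eq_2)
qed

definition qaxis :: "nat \<Rightarrow> quat" where
  "qaxis b = (if b = 0 then Quat 0 1 0 0 else if b = 1 then Quat 0 0 1 0 else Quat 0 0 0 1)"

text \<open>12 is the order of the multiplicative group modulo 13, over which the generator is
  diagonalisable since -1 is a square; hence its 12th power is 1 modulo 13. That 792 is prime to 13
  later makes the coefficient of the axis adjustable.\<close>

lemma letter_quat_power_12:
  "letter_quat (b, True) ^ 12 = 1 + 13 * (of_int 904 + of_int 792 * qaxis b)"
proof -
  define L where "L a t = of_int a + of_int t * qaxis b" for a t
  have LL: "L a t * L c u = L (a * c - t * u) (a * u + t * c)" for a t c u
    by (simp add: quat_eq_iff quat_sel_times L_def qaxis_def)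
  have x: "letter_quat (b, True) = L 1 2"
    by (simp add: quat_eq_iff L_def qaxis_def letter_quat_def del: of_int_numeral)
  have p2: "x ^ 2 = x * x" and p4: "x ^ 4 = x\<^sup>2 * x\<^sup>2" and p12: "x ^ 12 = x ^ 4 * x ^ 4 * x ^ 4" for x :: quat
    by (simp_all add: numeral_eq_Suc mult.assoc)
  have "L 1 2 ^ 2 = L (-3) 4" unfolding p2 LL by simp
  then have "L 1 2 ^ 4 = L (-7) (-24)" unfolding p4 by (simp only: LL) simp
  then have "L 1 2 ^ 12 = L 11753 10296" unfolding p12 by (simp only: LL) simp
  moreover have "L 11753 10296 = 1 + of_int 13 * (of_int 904 + of_int 792 * qaxis b)"
    unfolding L_def quat_eq_iff by (simp add: qaxis_def del: of_int_numeral)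
  ultimately show ?thesis by (simp only: x of_int_numeral)
qed

definition qcong :: "nat \<Rightarrow> quat \<Rightarrow> quat \<Rightarrow> bool" where
  "qcong n x y \<longleftrightarrow> qdvd (13 ^ n) (x - y)"

lemma qcong_imp_proj_cong: "qcong n x y \<Longrightarrow> proj_cong n x y"
  unfolding qcong_def proj_cong_def by (intro exI[of _ 1]) simp

lemma proj_cong_word_power:
  assumes "g \<in> carrier F3"
  shows "proj_cong n (word_quat (g [^]\<^bsub>F3\<^esub> (k :: nat))) (word_quat g ^ k)"
proof (induction k)
  case 0
  interpret group F3 by (rule group_F3)
  show ?case by (simp add: nat_pow_0 one_F3)
next
  case (Suc k)
  interpret group F3 by (rule group_F3)
  show ?case
    unfolding nat_pow_Suc mult_F3 power_Suc2
    by (rule proj_cong_word_mult_eq[OF Suc.IH proj_cong_refl])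
qed

lemma proj_cong_word_power_eq:
  assumes "g \<in> carrier F3" "proj_cong n (word_quat g) x"
  shows "proj_cong n (word_quat (g [^]\<^bsub>F3\<^esub> (k :: nat))) (x ^ k)"
proof -
  have "proj_cong n (word_quat g ^ k) (x ^ k)"
    by (induction k) (auto intro: proj_cong_mult assms(2))
  then show ?thesis using proj_cong_word_power[OF assms(1)] proj_cong_trans by blast
qed

lemma solve_cong_13:
  assumes "\<not> 13 dvd (a :: int)"
  shows "\<exists>k :: nat. 13 dvd a * int k - t"
proof -
  have "coprime a 13" using prime_imp_coprime[OF prime_13 assms] by (simp add: coprime_commute)
  then obtain v where v: "[a * v = 1] (mod 13)" using cong_solve_coprime_int by blast
  have "[a * ((v * t) mod 13) = a * (v * t)] (mod 13)" by (intro cong_mult cong_refl) (simp add: cong_def)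
  also have "a * (v * t) = a * v * t" by simp
  also have "[a * v * t = 1 * t] (mod 13)" by (intro cong_mult v cong_refl)
  finally have "13 dvd a * int (nat ((v * t) mod 13)) - t" by (simp add: cong_iff_dvd_diff)
  then show ?thesis by blast
qed

text \<open>To be applied with the index of \<open>R\<close> written as \<open>13 ^ b * e'\<close>.
  Only the power of 13 in the index costs levels of the filtration, because \<open>e'\<close> is
  invertible modulo 13.\<close>

context
  fixes R e' b
  assumes R: "subgroup R F3" and e': "\<not> (13 :: nat) dvd e'"
    and pow: "\<And>g. g \<in> carrier F3 \<Longrightarrow> g [^]\<^bsub>F3\<^esub> (13 ^ b * e') \<in> R"
begin

interpretation group F3 by (rule group_F3)

text \<open>A power of the generator whose exponent is a multiple of \<open>13 ^ b * e'\<close> lies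
  in \<open>R\<close>. The exponent 12 reaches level 1 and \<open>13 ^ d\<close> lifts this to level
  \<open>m\<close>; the factor \<open>k\<close> then tunes the leading coefficient, as
  \<open>e' * 792\<close> is prime to 13.\<close>

lemma axis_level:
  assumes m: "b + 1 \<le> m" and c: "c \<in> {0, 1, 2}"
  shows "\<exists>g\<in>R. \<exists>s. proj_cong (m + 1) (word_quat g) (1 + of_int (13 ^ m) * (of_int s + of_int t * qaxis c))"
proof -
  let ?g = "[(c, True)]"
  obtain d where d: "m = d + 1" "b \<le> d" using m by (intro that[of "m - 1"]) auto
  have g: "?g \<in> carrier F3" using c by (auto simp: carrier_F3 reduced_word_Cons)
  have "\<not> 13 dvd int e'" using e' by (metis int_dvd_int_iff of_nat_numeral)
  then have "\<not> 13 dvd int e' * 792" by (rule not_13_dvd_mult) simp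
  then obtain k :: nat where k: "13 dvd int e' * 792 * int k - t" using solve_cong_13 by blast
  then obtain j where j: "int e' * 792 * int k - t = 13 * j" by (auto elim: dvdE)
  let ?h = "?g [^]\<^bsub>F3\<^esub> (12 * ((e' * k) * 13 ^ d))"
  have "12 * ((e' * k) * 13 ^ d) = (13 ^ b * e') * (12 * k * 13 ^ (d - b))"
    using d(2) by (simp add: mult_ac flip: power_add)
  then have "?h = (?g [^]\<^bsub>F3\<^esub> (13 ^ b * e')) [^]\<^bsub>F3\<^esub> (12 * k * 13 ^ (d - b))"
    using g by (simp only: nat_pow_pow)
  moreover have "(r [^]\<^bsub>F3\<^esub> (i :: nat)) \<in> R" if "r \<in> R" for r i
    by (induction i) (use that R in \<open>auto simp: subgroup.one_closed subgroup.m_closed\<close>)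
  ultimately have h: "?h \<in> R" using pow[OF g] by simp
  obtain y where y: "(1 + 13 * (of_int 904 + of_int 792 * qaxis c)) ^ ((e' * k) * 13 ^ d)
      = 1 + 13 ^ (d + 1) * (of_nat (e' * k) * (of_int 904 + of_int 792 * qaxis c)) + 13 ^ (d + 2) * y"
    using power_13_level by blast
  let ?s = "int (e' * k) * 904"
  have "word_quat ?g ^ (12 * ((e' * k) * 13 ^ d)) = 1 + 13 ^ (d + 1) * (of_nat (e' * k) * (of_int 904 + of_int 792 * qaxis c)) + 13 ^ (d + 2) * y"
    by (simp only: power_mult word_quat_simps mult_1_right letter_quat_power_12 y[symmetric])
  also have "\<dots> = 1 + of_int (13 ^ m) * (of_int ?s + of_int t * qaxis c)
      + of_int (13 ^ (m + 1)) * (of_int j * qaxis c + y)"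
  proof -
    have 1: "of_nat (e' * k) * (of_int 904 + of_int 792 * qaxis c)
        = of_int ?s + of_int t * qaxis c + of_int 13 * (of_int j * qaxis c)"
    proof -
      define N where "N = int (e' * k)"
      have N: "N * 792 = t + 13 * j" using j by (simp add: N_def)
      have e: "(of_nat (e' * k) :: quat) = of_int N" by (simp only: N_def of_int_of_nat_eq)
      show ?thesis
        unfolding e N_def[symmetric] unfolding quat_eq_iff using N
        by (simp add: qaxis_def distrib_left del: of_int_numeral)
    qed
    have 2: "(13 :: quat) ^ (d + 1) = of_int (13 ^ m)" "(13 :: quat) ^ (d + 2) = of_int (13 ^ (m + 1))"
      by (simp_all add: d)
    show ?thesis
      unfolding 1 2 unfolding quat_eq_iff by (simp add: algebra_simps del: of_int_mult of_int_numeral of_int_power)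
  qed
  finally have "qcong (m + 1) (word_quat ?g ^ (12 * ((e' * k) * 13 ^ d)))
      (1 + of_int (13 ^ m) * (of_int ?s + of_int t * qaxis c))"
    unfolding qcong_def qdvd_iff by (intro exI[of _ "of_int j * qaxis c + y"]) (simp only: add_diff_cancel_left')
  then have "proj_cong (m + 1) (word_quat ?h) (1 + of_int (13 ^ m) * (of_int ?s + of_int t * qaxis c))"
    using proj_cong_word_power[OF g] qcong_imp_proj_cong proj_cong_trans by blast
  then show ?thesis using h by blast
qed

text \<open>Modulo level \<open>m + 1\<close>, elements of level \<open>m\<close> multiply like
  vectors add: the cross term has level \<open>2 * m\<close>.\<close>

lemma qcong_level_mult:
  assumes "1 \<le> m"
  shows "proj_cong (m + 1) ((1 + of_int (13 ^ m) * u) * (1 + of_int (13 ^ m) * v)) (1 + of_int (13 ^ m) * (u + v))"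
proof (rule qcong_imp_proj_cong)
  have "(1 + of_int (13 ^ m) * u) * (1 + of_int (13 ^ m) * v) - (1 + of_int (13 ^ m) * (u + v))
      = of_int (13 ^ m * 13 ^ m) * (u * v)"
    unfolding quat_eq_iff by (simp add: quat_sel_times algebra_simps del: of_int_mult of_int_power)
  moreover have "(13 :: int) ^ (m + 1) dvd 13 ^ m * 13 ^ m"
    unfolding power_add[symmetric] by (rule le_imp_power_dvd) (use assms in simp)
  then have "qdvd (13 ^ (m + 1)) (of_int (13 ^ m * 13 ^ m) * (u * v))"
    by (intro qdvd_mult_right qdvd_of_int)
  ultimately show "qcong (m + 1) ((1 + of_int (13 ^ m) * u) * (1 + of_int (13 ^ m) * v)) (1 + of_int (13 ^ m) * (u + v))"
    unfolding qcong_def by (simp only:)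
qed

lemma level_realised:
  assumes m: "b + 1 \<le> m"
  shows "\<exists>g\<in>R. \<exists>s. proj_cong (m + 1) (word_quat g) (1 + of_int (13 ^ m) * Quat s y1 y2 y3)"
proof -
  obtain g1 s1 where 1: "g1 \<in> R" "proj_cong (m + 1) (word_quat g1) (1 + of_int (13 ^ m) * (of_int s1 + of_int y1 * qaxis 0))"
    using axis_level[OF m, of 0] by blast
  obtain g2 s2 where 2: "g2 \<in> R" "proj_cong (m + 1) (word_quat g2) (1 + of_int (13 ^ m) * (of_int s2 + of_int y2 * qaxis 1))"
    using axis_level[OF m, of 1] by blast
  obtain g3 s3 where 3: "g3 \<in> R" "proj_cong (m + 1) (word_quat g3) (1 + of_int (13 ^ m) * (of_int s3 + of_int y3 * qaxis 2))"
    using axis_level[OF m, of 2] by blast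
  have m1: "1 \<le> m" using m by simp
  have 12: "proj_cong (m + 1) (word_quat (g1 \<otimes>\<^bsub>F3\<^esub> g2))
      (1 + of_int (13 ^ m) * ((of_int s1 + of_int y1 * qaxis 0) + (of_int s2 + of_int y2 * qaxis 1)))"
    unfolding mult_F3
    by (rule proj_cong_trans[OF proj_cong_word_mult_eq[OF 1(2) 2(2)] qcong_level_mult[OF m1]])
  have 123: "proj_cong (m + 1) (word_quat (g1 \<otimes>\<^bsub>F3\<^esub> g2 \<otimes>\<^bsub>F3\<^esub> g3))
      (1 + of_int (13 ^ m) * ((of_int s1 + of_int y1 * qaxis 0) + (of_int s2 + of_int y2 * qaxis 1)
         + (of_int s3 + of_int y3 * qaxis 2)))"
    using proj_cong_trans[OF proj_cong_word_mult_eq[OF 12 3(2)] qcong_level_mult[OF m1]]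
    by (simp only: mult_F3)
  have "(of_int s1 + of_int y1 * qaxis 0) + (of_int s2 + of_int y2 * qaxis 1) + (of_int s3 + of_int y3 * qaxis 2)
      = Quat (s1 + s2 + s3) y1 y2 y3"
    by (simp add: quat_eq_iff qaxis_def)
  moreover have "g1 \<otimes>\<^bsub>F3\<^esub> g2 \<otimes>\<^bsub>F3\<^esub> g3 \<in> R" using 1(1) 2(1) 3(1) R by (simp add: subgroup.m_closed)
  ultimately show ?thesis using 123 by auto
qed

text \<open>Successive approximation: an error at level \<open>m\<close> is corrected by an element of \<open>R\<close> of that
  level; its uncontrolled real part only changes the scalar factor.\<close>

lemma strong_approximation:
  assumes "b + 1 \<le> m" "q0 X = 0"
  shows "\<exists>r\<in>R. proj_cong m (word_quat r) (1 + of_int (13 ^ (b + 1)) * X)"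
  using assms(1)
proof (induction m rule: dec_induct)
  case base
  have "proj_cong (b + 1) (word_quat []) (1 + of_int (13 ^ (b + 1)) * X)"
    by (rule proj_cong_sym, rule qcong_imp_proj_cong) (auto simp: qcong_def qdvd_iff simp del: of_int_power)
  moreover have "[] \<in> R" using subgroup.one_closed[OF R] by (simp add: one_F3)
  ultimately show ?case by blast
next
  case (step m)
  let ?Y = "1 + of_int (13 ^ (b + 1)) * X"
  obtain r where r: "r \<in> R" "proj_cong m (word_quat r) ?Y" using step.IH by blast
  then obtain \<alpha> \<beta> where ab: "\<not> 13 dvd \<alpha>" "\<not> 13 dvd \<beta>" "qdvd (13 ^ m) (of_int \<alpha> * word_quat r - of_int \<beta> * ?Y)"
    by (auto simp: proj_cong_def)
  then obtain E where E: "of_int \<alpha> * word_quat r = of_int \<beta> * ?Y + of_int (13 ^ m) * E"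
    unfolding qdvd_iff by (metis add.commute diff_add_cancel)
  \<comment> \<open>The correction has to cancel the imaginary part of the error \<open>E\<close>
    modulo 13.\<close>
  obtain k1 k2 k3 :: nat where k: "13 dvd \<beta> * int k1 - - q1 E" "13 dvd \<beta> * int k2 - - q2 E" "13 dvd \<beta> * int k3 - - q3 E"
    using solve_cong_13[OF ab(2)] by metis
  obtain j1 j2 j3 where j: "\<beta> * int k1 + q1 E = 13 * j1" "\<beta> * int k2 + q2 E = 13 * j2" "\<beta> * int k3 + q3 E = 13 * j3"
    using k by (auto elim!: dvdE)
  obtain g s where g: "g \<in> R" "proj_cong (m + 1) (word_quat g) (1 + of_int (13 ^ m) * Quat s (int k1) (int k2) (int k3))"
    using level_realised step.hyps by blast
  define V where "V = Quat s (int k1) (int k2) (int k3)"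
  \<comment> \<open>The real part of the corrected error moves into the scalar, which stays prime to
    13 because \<open>m\<close> is positive.\<close>
  define \<beta>' where "\<beta>' = \<beta> + 13 ^ m * (q0 E + \<beta> * s)"
  have m1: "1 \<le> m" using step.hyps by simp
  have "\<not> 13 dvd \<beta>'"
  proof
    assume "13 dvd \<beta>'"
    moreover have "(13 :: int) dvd 13 ^ m * (q0 E + \<beta> * s)" using m1 by (simp add: dvd_power)
    ultimately show False using ab(2) unfolding \<beta>'_def by (simp add: dvd_add_left_iff)
  qed
  have dv: "(13 :: int) ^ (m + 1) dvd 13 ^ m * 13 ^ (b + 1)" "(13 :: int) ^ (m + 1) dvd 13 ^ m * 13 ^ m"
    "(13 :: int) ^ (m + 1) dvd 13 ^ m * 13"
    unfolding power_add[symmetric] power_Suc2[symmetric]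
    by (rule le_imp_power_dvd, use m1 in simp)+
  have "of_int \<alpha> * (word_quat r * (1 + of_int (13 ^ m) * V)) - of_int \<beta>' * ?Y
     = of_int (13 ^ m * 13) * Quat 0 j1 j2 j3
       + of_int (13 ^ m * 13 ^ m) * (E * V)
       + of_int (13 ^ m * 13 ^ (b + 1)) * (of_int \<beta> * X * V - of_int (q0 E + \<beta> * s) * X)"
  proof -
    have EV: "of_int \<beta> * V + E = of_int (q0 E + \<beta> * s) + of_int 13 * Quat 0 j1 j2 j3"
      using j by (simp add: quat_eq_iff V_def del: of_int_numeral)
    have "of_int \<alpha> * (word_quat r * (1 + of_int (13 ^ m) * V))
        = (of_int \<beta> * ?Y + of_int (13 ^ m) * E) * (1 + of_int (13 ^ m) * V)"
      unfolding E[symmetric] by (simp only: mult.assoc)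
    also have "\<dots> = of_int \<beta> * ?Y + of_int (13 ^ m) * (of_int \<beta> * V + E)
        + of_int (13 ^ m * 13 ^ (b + 1)) * (of_int \<beta> * X * V) + of_int (13 ^ m * 13 ^ m) * (E * V)"
      unfolding quat_eq_iff by (simp add: quat_sel_times algebra_simps del: of_int_mult of_int_power of_int_numeral)
    also have "of_int (13 ^ m) * (of_int \<beta> * V + E) = of_int (13 ^ m * (q0 E + \<beta> * s)) + of_int (13 ^ m * 13) * Quat 0 j1 j2 j3"
      unfolding EV quat_eq_iff by (simp add: algebra_simps del: of_int_mult of_int_power of_int_numeral)
    finally show ?thesis
      unfolding quat_eq_iff \<beta>'_def
      by (simp add: quat_sel_times algebra_simps del: of_int_mult of_int_power of_int_numeral)
  qed
  moreover have "qdvd (13 ^ (m + 1)) \<dots>"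
    using dv by (intro qdvd_add qdvd_mult_right qdvd_of_int)
  ultimately have "qdvd (13 ^ (m + 1)) (of_int \<alpha> * (word_quat r * (1 + of_int (13 ^ m) * V)) - of_int \<beta>' * ?Y)"
    by (simp only:)
  then have "proj_cong (m + 1) (word_quat r * (1 + of_int (13 ^ m) * V)) ?Y"
    unfolding proj_cong_def using ab(1) \<open>\<not> 13 dvd \<beta>'\<close> by blast
  moreover have "proj_cong (m + 1) (word_quat (r \<otimes>\<^bsub>F3\<^esub> g)) (word_quat r * (1 + of_int (13 ^ m) * V))"
    unfolding mult_F3 V_def by (rule proj_cong_word_mult_eq[OF proj_cong_refl g(2)])
  ultimately have "proj_cong (Suc m) (word_quat (r \<otimes>\<^bsub>F3\<^esub> g)) ?Y"
    using proj_cong_trans by (metis Suc_eq_plus1)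
  then show ?case using r(1) g(1) R subgroup.m_closed by metis
qed

end

text \<open>Hensel lifting from 70, whose square plus 1 is \<open>29 * 169\<close>. The second
  conjunct records which of the two roots is followed, so that quantities built from \<iota> are
  known modulo 169.\<close>

lemma sqrt_minus_one_13:
  assumes "2 \<le> n"
  shows "\<exists>\<iota> :: int. 13 ^ n dvd \<iota>\<^sup>2 + 1 \<and> 169 dvd \<iota> - 70"
  using assms
proof (induction n rule: dec_induct)
  case base
  show ?case by (intro exI[of _ 70]) simp
next
  case (step n)
  then obtain \<iota> :: int where i: "13 ^ n dvd \<iota>\<^sup>2 + 1" "169 dvd \<iota> - 70" by blast
  then obtain c where c: "\<iota>\<^sup>2 + 1 = 13 ^ n * c" by (auto elim: dvdE)
  obtain j where j: "\<iota> = 70 + 169 * j" using i(2) by (auto elim!: dvdE simp: algebra_simps)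
  define P where "P = (13 :: int) ^ (n - 1)"
  have P: "13 ^ n = 13 * P" using step.hyps by (simp add: P_def power_eq_if)
  \<comment> \<open>The Newton correction: \<open>8 * \<iota>\<close> is 1 modulo 13, since \<iota>
    is 5 there.\<close>
  let ?k = "\<iota> + 13 ^ n * (- (4 * c))"
  have "?k\<^sup>2 + 1 = 13 ^ n * c * (1 - 8 * \<iota>) + 13 ^ n * 13 ^ n * (16 * c\<^sup>2)"
    using c by (simp add: power2_eq_square algebra_simps)
  also have "1 - 8 * \<iota> = 13 * (- 43 - 104 * j)" by (simp add: j)
  also have "13 ^ n * c * (13 * (- 43 - 104 * j)) + 13 ^ n * 13 ^ n * (16 * c\<^sup>2)
      = 13 ^ Suc n * (c * (- 43 - 104 * j) + P * (16 * c\<^sup>2))"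
    by (simp add: P algebra_simps)
  finally have "13 ^ Suc n dvd ?k\<^sup>2 + 1" by simp
  moreover have "(169 :: int) dvd 13 ^ n" using step.hyps le_imp_power_dvd[of 2 n "13 :: int"] by simp
  then have "169 dvd (\<iota> - 70) + 13 ^ n * (- (4 * c))" using i(2) by (intro dvd_add dvd_mult2)
  then have "169 dvd ?k - 70" by (simp add: algebra_simps)
  ultimately show ?case by blast
qed

lemma coprime_13_power: "\<not> 13 dvd (a :: int) \<Longrightarrow> coprime a (13 ^ n)"
  using prime_imp_coprime[OF prime_13, of a] by (simp add: coprime_commute)

text \<open>An exponent that is a multiple of \<open>13 ^ c\<close> but not of \<open>13 ^ (c + 1)\<close> brings
  \<open>1 + 13 * w\<close> exactly to level \<open>c + 1\<close>.\<close>

lemma power_cong_one_13: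
  assumes w: "\<not> 13 dvd (w :: int)" and d: "13 ^ s dvd (1 + 13 * w) ^ d - 1"
  shows "13 ^ (s - 1) dvd d"
proof (cases "d = 0")
  case False
  obtain e where e: "\<not> 13 dvd e" "d = 13 ^ multiplicity 13 d * e"
    using multiplicity_decompose'[of d 13] False by (auto simp: prime_nat_numeral_eq)
  define c where "c = multiplicity 13 d"
  have de: "d = e * 13 ^ c" using e(2) by (simp add: c_def mult.commute)
  obtain y where y: "(1 + 13 * w) ^ d = 1 + 13 ^ (c + 1) * (of_nat e * w) + 13 ^ (c + 2) * y"
    unfolding de using power_13_level by blast
  have "s \<le> c + 1"
  proof (rule ccontr)
    assume "\<not> s \<le> c + 1"
    then have "(13 :: int) ^ (c + 2) dvd 13 ^ s" by (intro le_imp_power_dvd) simp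
    then have "13 ^ (c + 2) dvd (1 + 13 * w) ^ d - 1" using d by (rule dvd_trans)
    then have "13 ^ (c + 2) dvd 13 ^ (c + 1) * (of_nat e * w) + 13 ^ (c + 2) * y"
      unfolding y by (simp only: add.assoc add_diff_cancel_left')
    then have "13 ^ (c + 2) dvd 13 ^ (c + 1) * (of_nat e * w)"
      by (simp only: dvd_add_times_triv_right_iff mult.commute[of "13 ^ (c + 2)" y])
    moreover have "(13 :: int) ^ (c + 2) = 13 ^ (c + 1) * 13" by simp
    ultimately have "13 dvd of_nat e * w" by (simp only: dvd_mult_cancel_left) simp
    moreover have "\<not> (13 :: int) dvd of_nat e" using e(1) by (metis int_dvd_int_iff of_nat_numeral)
    ultimately show False using not_13_dvd_mult w by blast
  qed
  then have "13 ^ (s - 1) dvd (13 :: nat) ^ c" by (intro le_imp_power_dvd) simp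
  then show ?thesis unfolding de by (rule dvd_mult)
qed simp

text \<open>Modulo 169 the 12th power of 11 is 131, that is \<open>1 + 13 * 10\<close>. So
  \<open>\<kappa> ^ 12\<close> differs from 1 exactly at the first level, and by
  \<open>power_cong_one_13\<close> its powers return to 1 modulo \<open>13 ^ s\<close> only at
  multiples of \<open>13 ^ (s - 1)\<close>.\<close>

lemma power_kappa_cong:
  assumes k: "169 dvd int \<kappa> - 11" and c: "[\<kappa> ^ t1 = \<kappa> ^ t2] (mod 13 ^ s)" "t1 \<le> t2"
  shows "13 ^ (s - 1) dvd t2 - t1"
proof -
  obtain j where j: "int \<kappa> = 11 + 169 * j" using k by (auto elim!: dvdE simp: algebra_simps)
  have n13: "\<not> 13 dvd int \<kappa>"
  proof
    assume "13 dvd int \<kappa>"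
    then have "13 dvd int \<kappa> - 13 * (13 * j)" by (intro dvd_diff dvd_triv_left)
    then show False by (simp add: j)
  qed
  have "int (\<kappa> ^ t2) = int (\<kappa> ^ t1) * int \<kappa> ^ (t2 - t1)" using c(2) by (simp flip: power_add)
  moreover have "13 ^ s dvd int (\<kappa> ^ t2) - int (\<kappa> ^ t1)"
    using c(1) by (metis cong_iff_dvd_diff cong_int_iff cong_sym_eq of_nat_numeral of_nat_power)
  ultimately have "13 ^ s dvd int \<kappa> ^ t1 * (int \<kappa> ^ (t2 - t1) - 1)" by (simp add: algebra_simps)
  moreover have "coprime (int \<kappa> ^ t1) (13 ^ s)" using coprime_13_power[OF n13] by simp
  ultimately have 1: "13 ^ s dvd int \<kappa> ^ (t2 - t1) - 1"
    by (simp add: coprime_dvd_mult_right_iff coprime_commute)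
  have "(int \<kappa> ^ (t2 - t1) - 1) dvd (int \<kappa> ^ (t2 - t1)) ^ 12 - 1 ^ 12"
    using power_diff_1_eq[of "int \<kappa> ^ (t2 - t1)" 12] by simp
  from dvd_trans[OF 1 this] have "13 ^ s dvd (int \<kappa> ^ (t2 - t1)) ^ 12 - 1" by simp
  then have 2: "13 ^ s dvd (int \<kappa> ^ 12) ^ (t2 - t1) - 1"
    by (simp only: power_mult[symmetric] mult.commute[of 12])
  have "[int \<kappa> = 11] (mod 169)" using k by (simp add: cong_iff_dvd_diff)
  then have "[int \<kappa> ^ 12 = 11 ^ 12] (mod 169)" by (rule cong_pow)
  also have "[11 ^ 12 = 131] (mod (169 :: int))" by (simp add: cong_def)
  finally obtain i where "int \<kappa> ^ 12 - 131 = 169 * i" by (auto simp: cong_iff_dvd_diff elim: dvdE)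
  then have w: "int \<kappa> ^ 12 = 1 + 13 * (10 + 13 * i)" by simp
  have "\<not> 13 dvd 10 + 13 * i" by presburger
  from power_cong_one_13[OF this] 2 show ?thesis unfolding w by blast
qed

lemma (in group) power_index_mem:
  assumes "N \<lhd> G" "finite (rcosets N)" "g \<in> carrier G"
  shows "g [^] card (rcosets N) \<in> N"
proof -
  interpret N: normal N G by (rule assms(1))
  interpret Q: group "G Mod N" by (rule N.factorgroup_is_group)
  have c: "N #> g \<in> carrier (G Mod N)" using assms(3) by (auto simp: FactGroup_def RCOSETS_def)
  have "(N #> g) [^]\<^bsub>G Mod N\<^esub> (n :: nat) = N #> (g [^] n)" for n
    by (induction n) (use assms(3) in \<open>auto simp: FactGroup_def N.rcos_sum coset_mult_one N.subset\<close>)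
  moreover have "(N #> g) [^]\<^bsub>G Mod N\<^esub> order (G Mod N) = \<one>\<^bsub>G Mod N\<^esub>"
    using c by (rule Q.pow_order_eq_1)
  ultimately have "N #> (g [^] card (rcosets N)) = N" by (simp add: order_def FactGroup_def)
  then show ?thesis using assms(3) rcos_self[OF _ N.subgroup_axioms] by (metis nat_pow_closed)
qed

text \<open>The square of \<open>Quat 0 0 1 \<iota>\<close> is minus
  \<open>1 + \<iota>\<^sup>2\<close>, hence it is nilpotent modulo \<open>13 ^ t\<close> and the
  binomial expansion stops after the linear term.\<close>

lemma unipotent_power:
  assumes i: "13 ^ t dvd \<iota>\<^sup>2 + 1"
  shows "qcong t ((1 + of_int P * Quat 0 0 1 \<iota>) ^ k) (1 + of_int (int k * P) * Quat 0 0 1 \<iota>)"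
proof (induction k)
  case 0
  show ?case by (simp add: qcong_def quat_eq_iff qdvd_def)
next
  case (Suc k)
  let ?X = "Quat 0 0 1 \<iota>"
  have "(1 + of_int P * ?X) ^ Suc k - (1 + of_int (int (Suc k) * P) * ?X)
      = ((1 + of_int P * ?X) ^ k - (1 + of_int (int k * P) * ?X)) * (1 + of_int P * ?X)
        - of_int (int k * P * P * (\<iota>\<^sup>2 + 1))"
    unfolding power_Suc2 quat_eq_iff
    by (simp add: quat_sel_times algebra_simps power2_eq_square del: of_int_mult of_int_add of_int_power)
  moreover have "qdvd (13 ^ t) \<dots>"
    by (rule qdvd_diff[OF qdvd_mult_right[OF Suc.IH[unfolded qcong_def]] qdvd_of_int[OF dvd_mult[OF i]]])
  ultimately show ?case unfolding qcong_def by (simp only:)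
qed

text \<open>\<open>r\<close> approximates the unipotent \<open>1 + 13 ^ J * X\<close> with the
  nilpotent \<open>X = Quat 0 0 1 \<iota>\<close>. Multiplying \<open>X\<close> by the generator
  \<open>Quat 1 2 0 0\<close> on the left scales it by \<open>1 - 2 * \<iota>\<close>, on the right
  by \<open>1 + 2 * \<iota>\<close>; so conjugation raises \<open>r\<close> to the quotient \<kappa>
  of these, modulo the kernel.\<close>

lemma metacyclic_pair:
  assumes R: "R \<lhd> F3" and fin: "finite (rcosets\<^bsub>F3\<^esub> R)"
  shows "\<exists>J. \<forall>t\<ge>J + 2. \<exists>r\<in>R. \<exists>\<kappa> :: nat.
    (\<forall>k :: nat. r [^]\<^bsub>F3\<^esub> k \<in> cong_ker t \<longleftrightarrow> 13 ^ (t - J) dvd k) \<and>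
    proj_cong t (word_quat ([(0, True)] \<otimes>\<^bsub>F3\<^esub> r)) (word_quat (r [^]\<^bsub>F3\<^esub> \<kappa> \<otimes>\<^bsub>F3\<^esub> [(0, True)])) \<and>
    169 dvd int \<kappa> - 11"
proof -
  interpret group F3 by (rule group_F3)
  interpret N: normal R F3 by (rule R)
  let ?e = "card (rcosets\<^bsub>F3\<^esub> R)"
  have "R #>\<^bsub>F3\<^esub> \<one>\<^bsub>F3\<^esub> \<in> rcosets\<^bsub>F3\<^esub> R" by (intro rcosetsI N.subset one_closed)
  then have "?e \<noteq> 0" using fin by auto
  then obtain e' where e': "\<not> 13 dvd e'" "?e = 13 ^ multiplicity 13 ?e * e'"
    using multiplicity_decompose'[of ?e 13] by (auto simp: prime_nat_numeral_eq)
  define b where "b = multiplicity 13 ?e"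
  have pow: "g [^]\<^bsub>F3\<^esub> (13 ^ b * e') \<in> R" if "g \<in> carrier F3" for g
    using power_index_mem[OF R fin that] e'(2) by (simp add: b_def)
  define J where "J = b + 1"
  have "\<exists>r\<in>R. \<exists>\<kappa> :: nat. (\<forall>k :: nat. r [^]\<^bsub>F3\<^esub> k \<in> cong_ker t \<longleftrightarrow> 13 ^ (t - J) dvd k) \<and>
    proj_cong t (word_quat ([(0, True)] \<otimes>\<^bsub>F3\<^esub> r)) (word_quat (r [^]\<^bsub>F3\<^esub> \<kappa> \<otimes>\<^bsub>F3\<^esub> [(0, True)])) \<and>
    169 dvd int \<kappa> - 11" if t: "J + 2 \<le> t" for t
  proof -
    obtain \<iota> :: int where i: "13 ^ t dvd \<iota>\<^sup>2 + 1" "169 dvd \<iota> - 70"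
      using sqrt_minus_one_13[of t] t by auto
    define X where "X = Quat 0 0 1 \<iota>"
    define P where "P = (13 :: int) ^ J"
    obtain r where r: "r \<in> R" "proj_cong t (word_quat r) (1 + of_int P * X)"
      using strong_approximation[OF N.subgroup_axioms e'(1) pow, of t X] t by (auto simp: J_def P_def X_def)
    have rc: "r \<in> carrier F3" using r(1) N.subset by blast
    have rk: "proj_cong t (word_quat (r [^]\<^bsub>F3\<^esub> k)) (1 + of_int (int k * P) * X)" for k :: nat
      using proj_cong_word_power_eq[OF rc r(2)] qcong_imp_proj_cong[OF unipotent_power[OF i(1)]] proj_cong_trans
      unfolding X_def by blast
    have J1: "13 dvd P" by (simp add: P_def J_def)
    have "r [^]\<^bsub>F3\<^esub> k \<in> cong_ker t \<longleftrightarrow> 13 ^ (t - J) dvd k" for k :: nat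
    proof -
      let ?x = "1 + of_int (int k * P) * X"
      have "r [^]\<^bsub>F3\<^esub> k \<in> cong_ker t \<longleftrightarrow> proj_cong t ?x 1"
        unfolding cong_ker_def using rc rk proj_cong_trans proj_cong_sym by blast
      also have "\<dots> \<longleftrightarrow> 13 ^ t dvd q1 ?x \<and> 13 ^ t dvd q2 ?x \<and> 13 ^ t dvd q3 ?x"
      proof (rule proj_cong_one_iff)
        have "qnorm ?x = 1 + 13 * (int k * int k * (P div 13) * P * (1 + \<iota>\<^sup>2))"
          using J1 by (simp add: qnorm_def X_def power2_eq_square algebra_simps del: of_int_mult)
        then show "\<not> 13 dvd qnorm ?x" by presburger
      qed
      also have "\<dots> \<longleftrightarrow> 13 ^ t dvd int k * P"
        by (auto simp: X_def simp del: of_int_mult)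
      also have "(13 :: int) ^ t = 13 ^ (t - J) * P" using t by (simp add: P_def flip: power_add)
      also have "13 ^ (t - J) * P dvd int k * P \<longleftrightarrow> 13 ^ (t - J) dvd int k" by (simp add: P_def)
      also have "\<dots> \<longleftrightarrow> 13 ^ (t - J) dvd k" by (metis int_dvd_int_iff of_nat_numeral of_nat_power)
      finally show ?thesis .
    qed
    moreover
    obtain j where j: "\<iota> = 70 + 169 * j" using i(2) by (auto elim!: dvdE simp: algebra_simps)
    have "\<not> 13 dvd 1 + 2 * \<iota>" unfolding j by presburger
    then have "coprime (1 + 2 * \<iota>) (13 ^ t)" by (rule coprime_13_power)
    then obtain v where v: "[(1 + 2 * \<iota>) * v = 1] (mod 13 ^ t)" using cong_solve_coprime_int by blast
    define \<kappa> where "\<kappa> = nat ((v * (1 - 2 * \<iota>)) mod 13 ^ t)"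
    have kint: "int \<kappa> = (v * (1 - 2 * \<iota>)) mod 13 ^ t" by (simp add: \<kappa>_def)
    have kc: "[(1 + 2 * \<iota>) * int \<kappa> = 1 - 2 * \<iota>] (mod 13 ^ t)"
    proof -
      have "[(1 + 2 * \<iota>) * int \<kappa> = (1 + 2 * \<iota>) * (v * (1 - 2 * \<iota>))] (mod 13 ^ t)"
        unfolding kint by (intro cong_mult cong_refl) (simp add: cong_def)
      also have "(1 + 2 * \<iota>) * (v * (1 - 2 * \<iota>)) = ((1 + 2 * \<iota>) * v) * (1 - 2 * \<iota>)" by simp
      also have "[((1 + 2 * \<iota>) * v) * (1 - 2 * \<iota>) = 1 * (1 - 2 * \<iota>)] (mod 13 ^ t)"
        by (intro cong_mult v cong_refl)
      finally show ?thesis by simp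
    qed
    then have kd: "13 ^ t dvd (1 + 2 * \<iota>) * int \<kappa> - (1 - 2 * \<iota>)" by (simp add: cong_iff_dvd_diff)
    have "proj_cong t (word_quat ([(0, True)] \<otimes>\<^bsub>F3\<^esub> r)) (word_quat (r [^]\<^bsub>F3\<^esub> \<kappa> \<otimes>\<^bsub>F3\<^esub> [(0, True)]))"
    proof -
      let ?a = "letter_quat (0, True)"
      have a: "?a = Quat 1 2 0 0" by (simp add: letter_quat_def)
      have "qcong t (?a * (1 + of_int P * X)) ((1 + of_int (int \<kappa> * P) * X) * ?a)"
      proof -
        let ?D = "(1 + 2 * \<iota>) * int \<kappa> - (1 - 2 * \<iota>)"
        have "?a * (1 + of_int P * X) - (1 + of_int (int \<kappa> * P) * X) * ?a
          = of_int (P * ?D) * Quat 0 0 (- 1) (- \<iota>) + of_int ((\<iota>\<^sup>2 + 1) * P) * Quat 0 0 0 (2 + 2 * int \<kappa>)"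
          unfolding a X_def quat_eq_iff
          by (simp add: quat_sel_times algebra_simps power2_eq_square power3_eq_cube del: of_int_mult of_int_add of_int_power of_int_diff)
        moreover have "qdvd (13 ^ t) \<dots>"
          using kd i(1) by (intro qdvd_add qdvd_mult_right qdvd_of_int dvd_mult dvd_mult2)
        ultimately show ?thesis unfolding qcong_def by (simp only:)
      qed
      then have 1: "proj_cong t (?a * (1 + of_int P * X)) ((1 + of_int (int \<kappa> * P) * X) * ?a)"
        by (rule qcong_imp_proj_cong)
      have aa: "proj_cong t (word_quat [(0, True)]) ?a" by simp
      have 2: "proj_cong t (word_quat ([(0, True)] \<otimes>\<^bsub>F3\<^esub> r)) (?a * (1 + of_int P * X))"
        unfolding mult_F3 by (rule proj_cong_word_mult_eq[OF aa r(2)])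
      have 3: "proj_cong t (word_quat (r [^]\<^bsub>F3\<^esub> \<kappa> \<otimes>\<^bsub>F3\<^esub> [(0, True)])) ((1 + of_int (int \<kappa> * P) * X) * ?a)"
        unfolding mult_F3 by (rule proj_cong_word_mult_eq[OF rk aa])
      show ?thesis using 1 2 3 proj_cong_trans proj_cong_sym by blast
    qed
    moreover have "169 dvd int \<kappa> - 11"
    proof -
      have "(169 :: int) dvd 13 ^ t" using t le_imp_power_dvd[of 2 t "13 :: int"] by simp
      then have "169 dvd (1 + 2 * \<iota>) * int \<kappa> - (1 - 2 * \<iota>)" using kd dvd_trans by blast
      then obtain c where c: "(1 + 2 * \<iota>) * int \<kappa> - (1 - 2 * \<iota>) = 169 * c" by (auto elim: dvdE)
      \<comment> \<open>Modulo 169, \<iota> is 70 and 6 inverts \<open>1 + 2 * 70\<close>; 11 is the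
        resulting solution for \<kappa>.\<close>
      have "int \<kappa> - 11 = 169 * (6 * c - 2 * j * int \<kappa> * 6 - 5 * int \<kappa> - 5 - 12 * j)"
        using c unfolding j by (simp add: algebra_simps)
      then show ?thesis by (metis dvd_triv_left)
    qed
    ultimately show ?thesis using r(1) by blast
  qed
  then show ?thesis by blast
qed

section \<open>Functions on finite groups\<close>

definition inner_on :: "'a set \<Rightarrow> ('a \<Rightarrow> complex) \<Rightarrow> ('a \<Rightarrow> complex) \<Rightarrow> complex" where
  "inner_on X f g = (\<Sum>x\<in>X. f x * cnj (g x))"

definition norm2_on :: "'a set \<Rightarrow> ('a \<Rightarrow> complex) \<Rightarrow> real" where
  "norm2_on X f = (\<Sum>x\<in>X. (cmod (f x))\<^sup>2)"

lemma norm2_on_nonneg [simp]: "0 \<le> norm2_on X f"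
  by (simp add: norm2_on_def sum_nonneg)

lemma inner_on_self: "inner_on X f f = complex_of_real (norm2_on X f)"
  by (simp add: inner_on_def norm2_on_def complex_norm_square[symmetric] del: of_real_power)

lemma inner_on_sum_left: "inner_on X (\<lambda>x. \<Sum>b\<in>B. f b x) g = (\<Sum>b\<in>B. inner_on X (f b) g)"
  unfolding inner_on_def sum_distrib_right by (rule sum.swap)

lemma inner_on_sum_right: "inner_on X g (\<lambda>x. \<Sum>b\<in>B. f b x) = (\<Sum>b\<in>B. inner_on X g (f b))"
  unfolding inner_on_def cnj_sum sum_distrib_left by (rule sum.swap)

lemma inner_on_Cauchy_Schwarz: "(cmod (inner_on X f g))\<^sup>2 \<le> norm2_on X f * norm2_on X g"
proof -
  have "cmod (inner_on X f g) \<le> (\<Sum>x\<in>X. cmod (f x) * cmod (g x))"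
    unfolding inner_on_def by (rule order_trans[OF norm_sum]) (simp add: norm_mult)
  then have "(cmod (inner_on X f g))\<^sup>2 \<le> (\<Sum>x\<in>X. cmod (f x) * cmod (g x))\<^sup>2"
    by (rule power_mono) simp
  also have "\<dots> \<le> norm2_on X f * norm2_on X g"
    unfolding norm2_on_def by (rule Cauchy_Schwarz_ineq_sum)
  finally show ?thesis .
qed

lemma norm2_on_orthogonal_sum:
  assumes "finite B" "\<And>b c. b \<in> B \<Longrightarrow> c \<in> B \<Longrightarrow> b \<noteq> c \<Longrightarrow> inner_on X (f b) (f c) = 0"
  shows "norm2_on X (\<lambda>x. \<Sum>b\<in>B. f b x) = (\<Sum>b\<in>B. norm2_on X (f b))"
proof -
  have "complex_of_real (norm2_on X (\<lambda>x. \<Sum>b\<in>B. f b x)) = (\<Sum>b\<in>B. \<Sum>c\<in>B. inner_on X (f b) (f c))"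
    by (simp only: inner_on_self[symmetric] inner_on_sum_left inner_on_sum_right)
  also have "\<dots> = (\<Sum>b\<in>B. inner_on X (f b) (f b))"
  proof (rule sum.cong[OF refl])
    fix b assume b: "b \<in> B"
    have "(\<Sum>c\<in>B. inner_on X (f b) (f c)) = (\<Sum>c\<in>B. if c = b then inner_on X (f b) (f b) else 0)"
      using assms(2) b by (intro sum.cong refl) auto
    then show "(\<Sum>c\<in>B. inner_on X (f b) (f c)) = inner_on X (f b) (f b)"
      using assms(1) b by simp
  qed
  also have "\<dots> = complex_of_real (\<Sum>b\<in>B. norm2_on X (f b))" by (simp add: inner_on_self)
  finally show ?thesis by (simp only: of_real_eq_iff)
qed

text \<open>Bessel's inequality without normalisation, so that families of zero vectors are
  included. It is Cauchy-Schwarz for \<open>k\<close> and the combination \<open>v\<close> of the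
  family with the coefficients of \<open>k\<close>.\<close>

lemma Bessel_on:
  assumes T: "finite T" "\<And>s t. s \<in> T \<Longrightarrow> t \<in> T \<Longrightarrow> s \<noteq> t \<Longrightarrow> inner_on X (g s) (g t) = 0"
    and c: "\<And>t. t \<in> T \<Longrightarrow> norm2_on X (g t) = c" and c0: "0 \<le> c"
  shows "(\<Sum>t\<in>T. (cmod (inner_on X k (g t)))\<^sup>2) \<le> c * norm2_on X k"
proof -
  define a where "a t = inner_on X k (g t)" for t
  define A where "A = (\<Sum>t\<in>T. (cmod (a t))\<^sup>2)"
  define v where "v = (\<lambda>x. \<Sum>t\<in>T. a t * g t x)"
  have sc: "inner_on X (\<lambda>x. p * f x) (\<lambda>x. q * h x) = p * cnj q * inner_on X f h" for p q f h
    by (simp add: inner_on_def sum_distrib_left mult_ac)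
  have "norm2_on X v = (\<Sum>t\<in>T. norm2_on X (\<lambda>x. a t * g t x))"
    unfolding v_def by (rule norm2_on_orthogonal_sum[OF T(1)]) (simp add: sc T(2))
  also have "\<dots> = (\<Sum>t\<in>T. (cmod (a t))\<^sup>2 * c)"
    by (rule sum.cong) (simp_all add: norm2_on_def norm_mult power_mult_distrib c[symmetric] flip: sum_distrib_left)
  finally have nv: "norm2_on X v = A * c" by (simp add: A_def sum_distrib_right)
  have "inner_on X k v = (\<Sum>t\<in>T. inner_on X k (\<lambda>x. a t * g t x))"
    unfolding v_def by (rule inner_on_sum_right)
  also have "\<dots> = (\<Sum>t\<in>T. cnj (a t) * a t)"
  proof (rule sum.cong[OF refl])
    fix t
    have "inner_on X (\<lambda>x. 1 * k x) (\<lambda>x. a t * g t x) = 1 * cnj (a t) * inner_on X k (g t)" by (rule sc)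
    then show "inner_on X k (\<lambda>x. a t * g t x) = cnj (a t) * a t" by (simp add: a_def)
  qed
  also have "\<dots> = complex_of_real A"
    by (simp add: A_def complex_norm_square mult.commute del: of_real_power)
  finally have "cmod (inner_on X k v) = \<bar>A\<bar>" by (simp only: norm_of_real)
  then have "cmod (inner_on X k v) = A" by (simp add: A_def sum_nonneg)
  then have "A\<^sup>2 \<le> norm2_on X k * (A * c)" using inner_on_Cauchy_Schwarz[of X k v] nv by simp
  then have "A * A \<le> A * (c * norm2_on X k)" by (simp add: power2_eq_square mult_ac)
  moreover have "0 \<le> A" by (simp add: A_def sum_nonneg)
  ultimately have "A \<le> c * norm2_on X k"
    using c0 by (cases "A = 0") (auto simp: mult_le_cancel_left)
  then show ?thesis by (simp add: A_def a_def)
qed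

section \<open>Characters of cyclic groups and convolution\<close>

definition root_char :: "nat \<Rightarrow> nat \<Rightarrow> complex" where
  "root_char N r = cis (2 * pi * real r / real N)"

lemma root_char_0 [simp]: "root_char N 0 = 1"
  by (simp add: root_char_def)

lemma root_char_add: "root_char N (r + s) = root_char N r * root_char N s"
  by (simp add: root_char_def cis_mult add_divide_distrib distrib_left)

lemma root_char_power: "root_char N r ^ k = root_char N (r * k)"
  unfolding root_char_def Complex.DeMoivre by (simp add: mult_ac)

lemma cmod_root_char [simp]: "cmod (root_char N r) = 1"
  by (simp add: root_char_def)

lemma root_char_cnj_mult [simp]: "cnj (root_char N r) * root_char N r = 1"
  using complex_norm_square[of "root_char N r"] by (simp add: mult.commute)

lemma root_char_eq_1_iff:
  assumes "N > 0"
  shows "root_char N r = 1 \<longleftrightarrow> N dvd r"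
proof -
  have "root_char N r = 1 \<longleftrightarrow> cos (2 * pi * real r / real N) = 1"
    by (auto simp: root_char_def complex_eq_iff) (metis abs_1 cos_one_sin_zero)
  also have "\<dots> \<longleftrightarrow> (\<exists>n :: int. 2 * pi * real r / real N = of_int n * 2 * pi)"
    by (rule cos_one_2pi_int)
  also have "\<dots> \<longleftrightarrow> (\<exists>n :: int. int r = n * int N)"
  proof (intro ex_cong1)
    fix n :: int
    have "2 * pi * real r / real N = of_int n * 2 * pi \<longleftrightarrow> real r = of_int n * real N"
      using assms by (simp add: field_simps)
    also have "\<dots> \<longleftrightarrow> real_of_int (int r) = real_of_int (n * int N)" by simp
    also have "\<dots> \<longleftrightarrow> int r = n * int N" by (simp only: of_int_eq_iff)
    finally show "2 * pi * real r / real N = of_int n * 2 * pi \<longleftrightarrow> int r = n * int N" .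
  qed
  also have "\<dots> \<longleftrightarrow> N dvd r"
    unfolding int_dvd_int_iff[symmetric] by (auto simp: dvd_def mult.commute)
  finally show ?thesis .
qed

lemma root_char_eq_iff:
  assumes "N > 0"
  shows "root_char N r = root_char N s \<longleftrightarrow> [r = s] (mod N)"
proof -
  have *: "root_char N r = root_char N s \<longleftrightarrow> [r = s] (mod N)" if "s \<le> r" for r s
  proof -
    have "root_char N r = root_char N s * root_char N (r - s)"
      using that by (simp flip: root_char_add)
    moreover have "root_char N s \<noteq> 0" by (metis cmod_root_char norm_zero zero_neq_one)
    ultimately have "root_char N r = root_char N s \<longleftrightarrow> N dvd (r - s)"
      using root_char_eq_1_iff[OF assms] by auto
    also have "\<dots> \<longleftrightarrow> [r = s] (mod N)" using that by (metis cong_altdef_nat)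
    finally show ?thesis .
  qed
  show ?thesis using *[of s r] *[of r s] cong_sym_eq by (metis nat_le_linear)
qed

lemma sum_root_char:
  assumes "N > 0"
  shows "(\<Sum>b<N. cnj (root_char N (b * j))) = (if N dvd j then of_nat N else 0)"
proof -
  let ?w = "cnj (root_char N j)"
  have eq: "cnj (root_char N (b * j)) = ?w ^ b" for b
    by (simp add: root_char_power mult.commute flip: complex_cnj_power)
  show ?thesis
  proof (cases "N dvd j")
    case True
    then have "?w = 1" using root_char_eq_1_iff[OF assms] by simp
    then show ?thesis using True by (simp add: eq)
  next
    case False
    then have "root_char N j \<noteq> 1" using root_char_eq_1_iff[OF assms] by simp
    then have "?w \<noteq> 1" by (metis complex_cnj_cnj complex_cnj_one)
    moreover have "?w ^ N = 1"
      using root_char_eq_1_iff[OF assms, of "j * N"] by (simp add: root_char_power flip: complex_cnj_power)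
    ultimately show ?thesis using False by (simp add: eq geometric_sum)
  qed
qed

context group
begin

text \<open>The average is taken on the right, so that it commutes with the left translations which
  decompose functions into eigenspaces.\<close>

definition conv :: "('a \<Rightarrow> real) \<Rightarrow> ('a \<Rightarrow> complex) \<Rightarrow> 'a \<Rightarrow> complex" where
  "conv \<mu> f x = (\<Sum>g\<in>carrier G. complex_of_real (\<mu> g) * f (x \<otimes> g))"

lemma sum_left_translate:
  assumes "a \<in> carrier G"
  shows "(\<Sum>x\<in>carrier G. F (a \<otimes> x)) = (\<Sum>x\<in>carrier G. F x)"
proof (rule sum.reindex_bij_betw)
  show "bij_betw ((\<otimes>) a) (carrier G) (carrier G)"
    by (rule bij_betw_byWitness[where f' = "(\<otimes>) (inv a)"])
      (use assms in \<open>auto simp: m_assoc[symmetric]\<close>)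
qed

lemma sum_right_translate:
  assumes "a \<in> carrier G"
  shows "(\<Sum>x\<in>carrier G. F (x \<otimes> a)) = (\<Sum>x\<in>carrier G. F x)"
proof (rule sum.reindex_bij_betw)
  show "bij_betw (\<lambda>x. x \<otimes> a) (carrier G) (carrier G)"
    by (rule bij_betw_byWitness[where f' = "\<lambda>x. x \<otimes> inv a"])
      (use assms in \<open>auto simp: m_assoc\<close>)
qed

lemma conv_left_translate:
  assumes "a \<in> carrier G" "x \<in> carrier G"
  shows "conv \<mu> (\<lambda>y. f (a \<otimes> y)) x = conv \<mu> f (a \<otimes> x)"
  unfolding conv_def using assms by (intro sum.cong refl) (simp add: m_assoc)

lemma conv_sum: "conv \<mu> (\<lambda>x. \<Sum>b\<in>B. f b x) x = (\<Sum>b\<in>B. conv \<mu> (f b) x)"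
  unfolding conv_def sum_distrib_left by (rule sum.swap)

lemma conv_eq_inner:
  assumes "x \<in> carrier G"
  shows "conv \<mu> f x = inner_on (carrier G) f (\<lambda>y. complex_of_real (\<mu> (inv x \<otimes> y)))"
proof -
  have "inner_on (carrier G) f (\<lambda>y. complex_of_real (\<mu> (inv x \<otimes> y)))
      = (\<Sum>y\<in>carrier G. complex_of_real (\<mu> (inv x \<otimes> y)) * f y)"
    by (simp add: inner_on_def mult.commute)
  also have "\<dots> = (\<Sum>g\<in>carrier G. complex_of_real (\<mu> (inv x \<otimes> (x \<otimes> g))) * f (x \<otimes> g))"
    by (rule sum_left_translate[OF assms, symmetric])
  also have "\<dots> = conv \<mu> f x"
    unfolding conv_def using assms by (intro sum.cong refl) (simp add: m_assoc[symmetric])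
  finally show ?thesis by simp
qed

lemma eigenfunctions_orthogonal:
  assumes u: "u \<in> carrier G" and l: "cmod l = 1" "cmod m = 1" "l \<noteq> m"
    and f: "\<And>x. x \<in> carrier G \<Longrightarrow> f (u \<otimes> x) = l * f x"
    and g: "\<And>x. x \<in> carrier G \<Longrightarrow> g (u \<otimes> x) = m * g x"
  shows "inner_on (carrier G) f g = 0"
proof -
  let ?i = "inner_on (carrier G) f g"
  have "?i = (\<Sum>x\<in>carrier G. f (u \<otimes> x) * cnj (g (u \<otimes> x)))"
    unfolding inner_on_def by (rule sum_left_translate[OF u, symmetric])
  also have "\<dots> = l * cnj m * ?i"
    unfolding inner_on_def sum_distrib_left by (intro sum.cong refl) (simp add: f g)
  finally have "?i * (1 - l * cnj m) = 0" by (simp add: algebra_simps)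
  moreover have "l * cnj m \<noteq> 1"
  proof
    assume "l * cnj m = 1"
    then have "l * (cnj m * m) = m" by (simp add: mult.assoc[symmetric])
    moreover have "cnj m * m = 1" using complex_norm_square[of m] l(2) by (simp add: mult.commute)
    ultimately show False using l(3) by simp
  qed
  ultimately show ?thesis by simp
qed

text \<open>The projection to the eigenspace of left translation by \<open>u\<close> with eigenvalue
  \<open>root_char N b\<close>, provided that the order of \<open>u\<close> divides
  \<open>N\<close>.\<close>

definition fourier :: "nat \<Rightarrow> 'a \<Rightarrow> nat \<Rightarrow> ('a \<Rightarrow> complex) \<Rightarrow> 'a \<Rightarrow> complex" where
  "fourier N u b f x = (\<Sum>j<N. cnj (root_char N (b * j)) * f (u [^] j \<otimes> x)) / of_nat N"

context
  fixes N :: nat and u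
  assumes N: "N > 0" and u: "u \<in> carrier G" "u [^] N = \<one>"
begin

lemma fourier_eigen:
  assumes x: "x \<in> carrier G"
  shows "fourier N u b f (u \<otimes> x) = root_char N b * fourier N u b f x"
proof -
  let ?F = "\<lambda>j. cnj (root_char N (b * j)) * f (u [^] j \<otimes> x)"
  have "cnj (root_char N (b * j)) * f (u [^] j \<otimes> (u \<otimes> x)) = root_char N b * ?F (Suc j)" for j
  proof -
    have "u [^] j \<otimes> (u \<otimes> x) = u [^] Suc j \<otimes> x" using u x by (simp add: m_assoc)
    moreover have "cnj (root_char N (b * j)) = root_char N b * cnj (root_char N (b * Suc j))"
      using root_char_cnj_mult[of N b] by (simp add: root_char_add mult_ac)
    ultimately show ?thesis by (simp add: mult.assoc)
  qed
  then have "(\<Sum>j<N. cnj (root_char N (b * j)) * f (u [^] j \<otimes> (u \<otimes> x))) = root_char N b * (\<Sum>j<N. ?F (Suc j))"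
    by (simp add: sum_distrib_left)
  also have "(\<Sum>j<N. ?F (Suc j)) = (\<Sum>j<N. ?F j)"
  proof -
    have "root_char N (b * N) = 1" using root_char_eq_1_iff[OF N] by simp
    then have "?F N = ?F 0" using u by simp
    then show ?thesis
      using sum.lessThan_Suc_shift[of ?F N] by simp
  qed
  finally show ?thesis by (simp add: fourier_def)
qed

lemma fourier_eigen_power:
  assumes x: "x \<in> carrier G"
  shows "fourier N u b f (u [^] (k :: nat) \<otimes> x) = root_char N (b * k) * fourier N u b f x"
proof (induction k)
  case (Suc k)
  have "u [^] Suc k \<otimes> x = u \<otimes> (u [^] k \<otimes> x)"
    using u x by (simp add: m_assoc[symmetric] nat_pow_Suc2[symmetric])
  then show ?case using Suc fourier_eigen[of "u [^] k \<otimes> x" b f] u x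
    by (simp add: root_char_add mult_ac)
qed (use x in simp)

lemma sum_fourier:
  assumes x: "x \<in> carrier G"
  shows "(\<Sum>b<N. fourier N u b f x) = f x"
proof -
  have "(\<Sum>b<N. fourier N u b f x) = (\<Sum>j<N. (\<Sum>b<N. cnj (root_char N (b * j))) * f (u [^] j \<otimes> x)) / of_nat N"
    unfolding fourier_def sum_divide_distrib[symmetric] sum_distrib_right by (subst sum.swap) simp
  also have "\<dots> = (\<Sum>j<N. if j = 0 then of_nat N * f x else 0) / of_nat N"
  proof -
    have "N dvd j \<longleftrightarrow> j = 0" if "j < N" for j using that nat_dvd_not_less by blast
    then show ?thesis
      using x by (intro arg_cong2[of _ _ _ _ "(/)"] refl sum.cong) (auto simp: sum_root_char[OF N])
  qed
  also have "\<dots> = f x" using N by simp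
  finally show ?thesis .
qed

text \<open>When \<open>d\<close> divides \<open>b\<close>, the power \<open>u [^] M\<close> acts on
  the component by \<open>root_char N (b * M)\<close>, which is 1. The component thus equals its own
  mean over \<open>d\<close> translates, and \<open>avg\<close> makes this mean vanish.\<close>

lemma fourier_periodic:
  fixes d M :: nat
  assumes x: "x \<in> carrier G" and d: "d > 0" "N = d * M" "d dvd b"
    and avg: "\<And>x. x \<in> carrier G \<Longrightarrow> (\<Sum>i<d. f ((u [^] M) [^] i \<otimes> x)) = 0"
  shows "fourier N u b f x = 0"
proof -
  let ?z = "u [^] M"
  have zc: "?z \<in> carrier G" using u by simp
  have "fourier N u b f (?z [^] i \<otimes> x) = fourier N u b f x" for i :: nat
  proof -
    have "?z [^] i = u [^] (M * i)" using u by (simp add: nat_pow_pow)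
    moreover have "N dvd b * (M * i)" using d by (auto simp: mult_ac elim!: dvdE)
    then have "root_char N (b * (M * i)) = 1" using root_char_eq_1_iff[OF N] by blast
    ultimately show ?thesis using fourier_eigen_power[OF x] by simp
  qed
  then have "of_nat d * fourier N u b f x = (\<Sum>i<d. fourier N u b f (?z [^] i \<otimes> x))" by simp
  also have "\<dots> = (\<Sum>j<N. cnj (root_char N (b * j)) * (\<Sum>i<d. f (u [^] j \<otimes> (?z [^] i \<otimes> x)))) / of_nat N"
    unfolding fourier_def sum_divide_distrib[symmetric] sum_distrib_left by (subst sum.swap) simp
  also have "(\<lambda>j :: nat. \<Sum>i<d. f (u [^] j \<otimes> (?z [^] i \<otimes> x))) = (\<lambda>j. 0)"
  proof
    fix j :: nat
    have "u [^] j \<otimes> (?z [^] i \<otimes> x) = ?z [^] i \<otimes> (u [^] j \<otimes> x)" for i :: nat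
    proof -
      have "u [^] j \<otimes> (?z [^] i \<otimes> x) = u [^] (j + M * i) \<otimes> x"
        using u x by (simp add: m_assoc[symmetric] nat_pow_pow nat_pow_mult)
      also have "\<dots> = ?z [^] i \<otimes> (u [^] j \<otimes> x)"
        using u x by (simp add: m_assoc[symmetric] nat_pow_pow nat_pow_mult add.commute)
      finally show ?thesis .
    qed
    then have "(\<Sum>i<d. f (u [^] j \<otimes> (?z [^] i \<otimes> x))) = (\<Sum>i<d. f (?z [^] i \<otimes> (u [^] j \<otimes> x)))" by simp
    also have "\<dots> = 0" by (rule avg) (use u x in simp)
    finally show "(\<Sum>i<d. f (u [^] j \<otimes> (?z [^] i \<otimes> x))) = 0" .
  qed
  finally show ?thesis using d(1) by simp
qed

end

text \<open>The quasirandomness bound: the translates of a \<open>u\<close>-eigenfunction by powers of \<open>a\<close> are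
  pairwise orthogonal, because they belong to different eigenvalues, and convolution does not
  distinguish them.\<close>

lemma conv_quasirandom:
  fixes \<kappa> s D :: nat
  assumes fin: "finite (carrier G)" and u: "u \<in> carrier G" "u [^] (13 ^ s :: nat) = \<one>" and s: "s > 0"
    and a: "a \<in> carrier G" "a \<otimes> u = u [^] \<kappa> \<otimes> a"
    and D: "\<And>t t'. t < D \<Longrightarrow> t' < D \<Longrightarrow> [\<kappa> ^ t = \<kappa> ^ t'] (mod 13 ^ s) \<Longrightarrow> t = t'"
    and avg: "\<And>x. x \<in> carrier G \<Longrightarrow> (\<Sum>i<13. f ((u [^] (13 ^ (s - 1) :: nat)) [^] (i :: nat) \<otimes> x)) = 0"
  shows "real D * norm2_on (carrier G) (conv \<mu> f)
      \<le> real (card (carrier G)) * (\<Sum>g\<in>carrier G. (\<mu> g)\<^sup>2) * norm2_on (carrier G) f"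
proof -
  let ?N = "13 ^ s :: nat" and ?X = "carrier G"
  let ?\<mu>2 = "\<Sum>g\<in>?X. (\<mu> g)\<^sup>2"
  have N: "?N > 0" by simp
  define F where "F b = fourier ?N u b f" for b
  have eig: "F b (u \<otimes> x) = root_char ?N b * F b x" if "x \<in> ?X" for b x
    unfolding F_def by (rule fourier_eigen[OF N u that])
  have eigp: "F b (u [^] (k :: nat) \<otimes> x) = root_char ?N (b * k) * F b x" if "x \<in> ?X" for b k x
    unfolding F_def by (rule fourier_eigen_power[OF N u that])
  have at: "a [^] (t :: nat) \<otimes> u = u [^] (\<kappa> ^ t) \<otimes> a [^] t" for t
  proof (induction t)
    case (Suc t)
    have auk: "a \<otimes> u [^] (k :: nat) = u [^] (\<kappa> * k) \<otimes> a" for k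
    proof (induction k)
      case (Suc k)
      have "a \<otimes> u [^] Suc k = (a \<otimes> u [^] k) \<otimes> u" using u a by (simp add: m_assoc)
      also have "\<dots> = u [^] (\<kappa> * k) \<otimes> (a \<otimes> u)" using Suc u a by (simp add: m_assoc)
      also have "\<dots> = u [^] (\<kappa> * k) \<otimes> u [^] \<kappa> \<otimes> a" using u a by (simp add: m_assoc)
      also have "\<dots> = u [^] (\<kappa> * Suc k) \<otimes> a" using u by (simp add: nat_pow_mult add.commute)
      finally show ?case .
    qed (use a in simp)
    have "a [^] Suc t \<otimes> u = a \<otimes> (a [^] t \<otimes> u)" using u a by (simp add: m_assoc[symmetric] nat_pow_Suc2[symmetric])
    also have "\<dots> = (a \<otimes> u [^] (\<kappa> ^ t)) \<otimes> a [^] t" unfolding Suc using u a by (simp add: m_assoc)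
    also have "\<dots> = u [^] (\<kappa> ^ Suc t) \<otimes> (a \<otimes> a [^] t)" unfolding auk using u a by (simp add: m_assoc)
    also have "a \<otimes> a [^] t = a [^] Suc t" using a by (simp add: nat_pow_Suc2[symmetric])
    finally show ?case .
  qed (use u in simp)
  \<comment> \<open>Components with \<open>13 dvd b\<close> vanish by the averaging hypothesis. For
    the others \<open>b\<close> is invertible modulo \<open>13 ^ s\<close>, so the residues
    \<open>b * \<kappa> ^ t\<close> with \<open>t < D\<close> stay distinct.\<close>
  have comp: "real D * norm2_on ?X (conv \<mu> (F b)) \<le> real (card ?X) * ?\<mu>2 * norm2_on ?X (F b)"
    for b
  proof (cases "13 dvd b")
    case True
    have "F b x = 0" if "x \<in> ?X" for x
      unfolding F_def
      by (rule fourier_periodic[OF N u that, of 13 "13 ^ (s - 1)"])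
        (use True s avg in \<open>auto simp: power_eq_if\<close>)
    then have "conv \<mu> (F b) x = 0" if "x \<in> ?X" for x using that by (simp add: conv_def)
    then have "norm2_on ?X (conv \<mu> (F b)) = 0" by (simp add: norm2_on_def)
    then show ?thesis by (simp add: sum_nonneg)
  next
    case False
    define g where "g t = (\<lambda>x. F b (a [^] (t :: nat) \<otimes> x))" for t
    have ge: "g t (u \<otimes> x) = root_char ?N (b * \<kappa> ^ t) * g t x" if "x \<in> ?X" for t x
    proof -
      have "a [^] t \<otimes> (u \<otimes> x) = u [^] (\<kappa> ^ t) \<otimes> (a [^] t \<otimes> x)"
        using at[of t] u a that by (simp add: m_assoc[symmetric])
      then show ?thesis using eigp[of "a [^] t \<otimes> x"] a that by (simp add: g_def)
    qed
    have orth: "inner_on ?X (g t) (g t') = 0" if "t \<in> {..<D}" "t' \<in> {..<D}" "t \<noteq> t'" for t t'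
    proof (rule eigenfunctions_orthogonal[where l = "root_char ?N (b * \<kappa> ^ t)" and m = "root_char ?N (b * \<kappa> ^ t')",
          OF u(1) cmod_root_char cmod_root_char])
      have "prime (13 :: nat)" by (simp add: prime_nat_numeral_eq)
      from prime_imp_coprime[OF this False] have "coprime b ?N" by (simp add: coprime_commute)
      then have "\<not> [b * \<kappa> ^ t = b * \<kappa> ^ t'] (mod ?N)"
        using D that by (auto simp: cong_mult_lcancel_nat)
      then show "root_char ?N (b * \<kappa> ^ t) \<noteq> root_char ?N (b * \<kappa> ^ t')" using root_char_eq_iff[OF N] by blast
    qed (rule ge, assumption)+
    have nrm: "norm2_on ?X (g t) = norm2_on ?X (F b)" for t
      unfolding norm2_on_def g_def using sum_left_translate[of "a [^] t" "\<lambda>x. (cmod (F b x))\<^sup>2"] a by simp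
    have "norm2_on ?X (conv \<mu> (g t)) = norm2_on ?X (conv \<mu> (F b))" for t
    proof -
      have "norm2_on ?X (conv \<mu> (g t)) = (\<Sum>x\<in>?X. (cmod (conv \<mu> (F b) (a [^] t \<otimes> x)))\<^sup>2)"
        unfolding norm2_on_def g_def using a by (intro sum.cong refl) (simp add: conv_left_translate)
      then show ?thesis
        unfolding norm2_on_def using sum_left_translate[of "a [^] t" "\<lambda>x. (cmod (conv \<mu> (F b) x))\<^sup>2"] a by simp
    qed
    then have "real D * norm2_on ?X (conv \<mu> (F b)) = (\<Sum>t<D. norm2_on ?X (conv \<mu> (g t)))" by simp
    also have "\<dots> = (\<Sum>x\<in>?X. \<Sum>t<D. (cmod (conv \<mu> (g t) x))\<^sup>2)"
      unfolding norm2_on_def by (rule sum.swap)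
    \<comment> \<open>At a fixed \<open>x\<close> the values \<open>conv \<mu> (g t) x\<close> are,
      up to conjugation, inner products of one translate of \<mu> with the orthogonal family
      \<open>g\<close>. Bessel bounds all of them at once, which gains the factor
      \<open>D\<close>.\<close>
    also have "\<dots> \<le> (\<Sum>x\<in>?X. norm2_on ?X (F b) * ?\<mu>2)"
    proof (rule sum_mono)
      fix x assume x: "x \<in> ?X"
      let ?k = "\<lambda>y. complex_of_real (\<mu> (inv x \<otimes> y))"
      have "cmod (conv \<mu> (g t) x) = cmod (inner_on ?X ?k (g t))" for t
      proof -
        have "inner_on ?X (g t) ?k = cnj (inner_on ?X ?k (g t))"
          by (simp add: inner_on_def mult.commute)
        then show ?thesis unfolding conv_eq_inner[OF x] by (simp only: complex_mod_cnj)
      qed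
      then have "(\<Sum>t<D. (cmod (conv \<mu> (g t) x))\<^sup>2) = (\<Sum>t<D. (cmod (inner_on ?X ?k (g t)))\<^sup>2)" by simp
      also have "\<dots> \<le> norm2_on ?X (F b) * norm2_on ?X ?k"
        by (rule Bessel_on[OF _ orth nrm norm2_on_nonneg]) auto
      also have "norm2_on ?X ?k = (\<Sum>y\<in>?X. (\<mu> (inv x \<otimes> y))\<^sup>2)" by (simp add: norm2_on_def)
      also have "\<dots> = ?\<mu>2" using sum_left_translate[of "inv x" "\<lambda>y. (\<mu> y)\<^sup>2"] x by simp
      finally show "(\<Sum>t<D. (cmod (conv \<mu> (g t) x))\<^sup>2) \<le> norm2_on ?X (F b) * ?\<mu>2" .
    qed
    finally show ?thesis by (simp add: mult_ac)
  qed
  have orthF: "inner_on ?X h h' = 0" if "b < ?N" "b' < ?N" "b \<noteq> b'"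
    "\<And>x. x \<in> ?X \<Longrightarrow> h (u \<otimes> x) = root_char ?N b * h x" "\<And>x. x \<in> ?X \<Longrightarrow> h' (u \<otimes> x) = root_char ?N b' * h' x" for b b' h h'
  proof (rule eigenfunctions_orthogonal[where l = "root_char ?N b" and m = "root_char ?N b'",
        OF u(1) cmod_root_char cmod_root_char])
    show "root_char ?N b \<noteq> root_char ?N b'"
      unfolding root_char_eq_iff[OF N] using that(1-3) by (simp add: cong_def)
  qed (rule that(4,5), assumption)+
  have ce: "conv \<mu> (F b) (u \<otimes> x) = root_char ?N b * conv \<mu> (F b) x" if "x \<in> ?X" for b x
  proof -
    have "conv \<mu> (F b) (u \<otimes> x) = conv \<mu> (\<lambda>y. F b (u \<otimes> y)) x" using u that by (simp add: conv_left_translate)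
    also have "\<dots> = root_char ?N b * conv \<mu> (F b) x"
      unfolding conv_def sum_distrib_left using that by (intro sum.cong refl) (simp add: eig)
    finally show ?thesis .
  qed
  have 1: "norm2_on ?X f = (\<Sum>b<?N. norm2_on ?X (F b))"
  proof -
    have "norm2_on ?X f = norm2_on ?X (\<lambda>x. \<Sum>b<?N. F b x)"
      unfolding norm2_on_def F_def by (intro sum.cong refl) (simp add: sum_fourier[OF N u])
    also have "\<dots> = (\<Sum>b<?N. norm2_on ?X (F b))"
    proof (rule norm2_on_orthogonal_sum)
      fix b c assume "b \<in> {..<?N}" "c \<in> {..<?N}" "b \<noteq> c"
      then show "inner_on ?X (F b) (F c) = 0"
        by (intro orthF[of b c] eig) auto
    qed simp
    finally show ?thesis .
  qed
  have 2: "norm2_on ?X (conv \<mu> f) = (\<Sum>b<?N. norm2_on ?X (conv \<mu> (F b)))"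
  proof -
    have "conv \<mu> f x = (\<Sum>b<?N. conv \<mu> (F b) x)" if x: "x \<in> ?X" for x
    proof -
      have "conv \<mu> f x = conv \<mu> (\<lambda>x. \<Sum>b<?N. F b x) x"
        unfolding conv_def F_def using x by (intro sum.cong refl) (simp add: sum_fourier[OF N u])
      then show ?thesis by (simp add: conv_sum)
    qed
    then have "norm2_on ?X (conv \<mu> f) = norm2_on ?X (\<lambda>x. \<Sum>b<?N. conv \<mu> (F b) x)"
      unfolding norm2_on_def by (intro sum.cong refl) simp
    also have "\<dots> = (\<Sum>b<?N. norm2_on ?X (conv \<mu> (F b)))"
    proof (rule norm2_on_orthogonal_sum)
      fix b c assume "b \<in> {..<?N}" "c \<in> {..<?N}" "b \<noteq> c"
      then show "inner_on ?X (conv \<mu> (F b)) (conv \<mu> (F c)) = 0"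
        by (intro orthF[of b c] ce) auto
    qed simp
    finally show ?thesis .
  qed
  have "real D * norm2_on ?X (conv \<mu> f) = (\<Sum>b<?N. real D * norm2_on ?X (conv \<mu> (F b)))"
    unfolding 2 by (rule sum_distrib_left)
  also have "\<dots> \<le> (\<Sum>b<?N. real (card ?X) * ?\<mu>2 * norm2_on ?X (F b))"
    by (rule sum_mono) (rule comp)
  also have "\<dots> = real (card ?X) * ?\<mu>2 * norm2_on ?X f"
    unfolding 1 by (rule sum_distrib_left[symmetric])
  finally show ?thesis .
qed

end

section \<open>Poincare inequalities\<close>

text \<open>Log-convexity keeps the ratios of consecutive terms from decreasing, so
  \<open>a m\<close> is at least \<open>a 0\<close> times the \<open>m\<close>-th power of the first
  ratio. Thus decay after many steps of a self-adjoint walk gives decay after one.\<close>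

lemma norm2_on_log_convex_bound:
  fixes a :: "nat \<Rightarrow> real"
  assumes nn: "\<And>k. 0 \<le> a k" and lc: "\<And>k. (a (Suc k))\<^sup>2 \<le> a k * a (Suc (Suc k))"
    and m: "0 < m" and B: "0 \<le> B" "a m \<le> B ^ m * a 0"
  shows "a 1 \<le> B * a 0"
proof (cases "a 0 = 0")
  case True
  then have "(a 1)\<^sup>2 \<le> 0" using lc[of 0] by simp
  then show ?thesis using True by simp
next
  case False
  then have a0: "0 < a 0" using nn[of 0] by simp
  have ratio: "a 1 * a k \<le> a 0 * a (Suc k)" for k
  proof (induction k)
    case (Suc k)
    show ?case
    proof (cases "a k = 0")
      case True
      then have "a (Suc k) = 0" using lc[of k] by simp
      then show ?thesis using nn a0 by simp
    next
      case False
      then have ak: "0 < a k" using nn[of k] by simp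
      have "a k * (a 1 * a (Suc k)) = (a 1 * a k) * a (Suc k)" by simp
      also have "\<dots> \<le> (a 0 * a (Suc k)) * a (Suc k)" using Suc nn by (intro mult_right_mono)
      also have "\<dots> = a 0 * (a (Suc k))\<^sup>2" by (simp add: power2_eq_square)
      also have "\<dots> \<le> a 0 * (a k * a (Suc (Suc k)))" using lc a0 by (intro mult_left_mono) auto
      finally have "a k * (a 1 * a (Suc k)) \<le> a k * (a 0 * a (Suc (Suc k)))" by (simp add: mult_ac)
      then show ?thesis using ak by simp
    qed
  qed simp
  have "(a 1 / a 0) ^ k * a 0 \<le> a k" for k
  proof (induction k)
    case (Suc k)
    have "(a 1 / a 0) ^ Suc k * a 0 = (a 1 / a 0) * ((a 1 / a 0) ^ k * a 0)" by simp
    also have "\<dots> \<le> (a 1 / a 0) * a k" using Suc nn by (intro mult_left_mono) auto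
    also have "\<dots> \<le> a (Suc k)" using ratio[of k] a0 by (simp add: field_simps)
    finally show ?case .
  qed simp
  from this[of m] B(2) have "(a 1 / a 0) ^ m * a 0 \<le> B ^ m * a 0" by linarith
  then have "(a 1 / a 0) ^ m \<le> B ^ m" using a0 by simp
  then have "a 1 / a 0 \<le> B" using power_mono_iff[of "a 1 / a 0" B m] nn B(1) m by simp
  then show ?thesis using a0 by (simp add: field_simps)
qed

text \<open>Inequalities between sums of \<open>|h x - h y|\<close> need only be checked for indicator functions:
  peel off the level set of the maximum.\<close>

lemma coarea_sum:
  fixes h :: "'x \<Rightarrow> real" and a b :: "'p \<Rightarrow> 'x" and c d :: "'q \<Rightarrow> 'x"
  assumes X: "finite X" "a ` P \<subseteq> X" "b ` P \<subseteq> X" "c ` Q \<subseteq> X" "d ` Q \<subseteq> X" and K: "0 \<le> K"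
    and ind: "\<And>A. (\<Sum>p\<in>P. \<bar>indicator A (a p) - indicator A (b p) :: real\<bar>)
        \<le> K * (\<Sum>q\<in>Q. \<bar>indicator A (c q) - indicator A (d q)\<bar>)"
  shows "(\<Sum>p\<in>P. \<bar>h (a p) - h (b p)\<bar>) \<le> K * (\<Sum>q\<in>Q. \<bar>h (c q) - h (d q)\<bar>)"
proof (induction "card (h ` X)" arbitrary: h rule: less_induct)
  case (less h)
  show ?case
  proof (cases "\<exists>v. h ` X \<subseteq> {v}")
    case True
    then obtain v where "\<And>x. x \<in> X \<Longrightarrow> h x = v" by blast
    then have "\<And>p. p \<in> P \<Longrightarrow> h (a p) - h (b p) = 0" using X(2,3) by (simp add: image_subset_iff)
    then have "(\<Sum>p\<in>P. \<bar>h (a p) - h (b p)\<bar>) = 0" by simp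
    then show ?thesis using K by (simp add: sum_nonneg)
  next
    case False
    define v where "v = Max (h ` X)"
    have fh: "finite (h ` X)" using X(1) by simp
    have ne: "h ` X \<noteq> {}" using False by auto
    have vin: "v \<in> h ` X" unfolding v_def using fh ne by (rule Max_in)
    have ne': "h ` X - {v} \<noteq> {}" using False by blast
    define v' where "v' = Max (h ` X - {v})"
    have v'in: "v' \<in> h ` X - {v}" unfolding v'_def using fh ne' by (intro Max_in) auto
    have le: "h x \<le> v" if "x \<in> X" for x unfolding v_def using fh that by (intro Max_ge) auto
    have le': "h x \<le> v'" if "x \<in> X" "h x \<noteq> v" for x unfolding v'_def using fh that by (intro Max_ge) auto
    have vv: "v' < v" using v'in le by force
    define A where "A = {x. h x = v}"
    define h' where "h' = (\<lambda>x. if h x = v then v' else h x)"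
    have split: "\<bar>h x - h y\<bar> = \<bar>h' x - h' y\<bar> + (v - v') * \<bar>indicator A x - indicator A y\<bar>"
      if "x \<in> X" "y \<in> X" for x y
      using le'[OF that(1)] le'[OF that(2)] vv by (auto simp: h'_def A_def indicator_def)
    have "h' ` X \<subseteq> h ` X - {v}" using v'in by (auto simp: h'_def)
    then have "card (h' ` X) < card (h ` X)"
      using fh vin by (intro psubset_card_mono) auto
    from less[OF this] have IH: "(\<Sum>p\<in>P. \<bar>h' (a p) - h' (b p)\<bar>) \<le> K * (\<Sum>q\<in>Q. \<bar>h' (c q) - h' (d q)\<bar>)" .
    have "(\<Sum>p\<in>P. \<bar>h (a p) - h (b p)\<bar>)
        = (\<Sum>p\<in>P. \<bar>h' (a p) - h' (b p)\<bar> + (v - v') * \<bar>indicator A (a p) - indicator A (b p)\<bar>)"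
      using X by (intro sum.cong refl split) auto
    also have "\<dots> = (\<Sum>p\<in>P. \<bar>h' (a p) - h' (b p)\<bar>)
        + (v - v') * (\<Sum>p\<in>P. \<bar>indicator A (a p) - indicator A (b p)\<bar>)"
      by (simp add: sum.distrib sum_distrib_left)
    also have "\<dots> \<le> K * (\<Sum>q\<in>Q. \<bar>h' (c q) - h' (d q)\<bar>)
        + (v - v') * (K * (\<Sum>q\<in>Q. \<bar>indicator A (c q) - indicator A (d q)\<bar>))"
      using IH ind[of A] vv by (intro add_mono mult_left_mono) auto
    also have "\<dots> = K * (\<Sum>q\<in>Q. \<bar>h' (c q) - h' (d q)\<bar> + (v - v') * \<bar>indicator A (c q) - indicator A (d q)\<bar>)"
      by (simp only: sum.distrib sum_distrib_left[symmetric] distrib_left mult.left_commute)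
    also have "\<dots> = K * (\<Sum>q\<in>Q. \<bar>h (c q) - h (d q)\<bar>)"
      using X by (intro arg_cong[where f = "(*) K"] sum.cong refl split[symmetric]) auto
    finally show ?thesis .
  qed
qed

text \<open>The Mazur map, through which \<open>L^1\<close> inequalities become inequalities between
  \<open>p\<close>-th powers.\<close>

definition signed_powr :: "real \<Rightarrow> real \<Rightarrow> real" where
  "signed_powr p a = sgn a * \<bar>a\<bar> powr p"

lemma abs_signed_powr: "\<bar>signed_powr p a\<bar> = \<bar>a\<bar> powr p"
  by (cases "a = 0") (auto simp: signed_powr_def abs_mult)

text \<open>For equal signs, either the difference is at least the fraction \<delta> of the larger
  value, and its power dominates, or the two powers differ by at most a fraction \<epsilon>. For
  opposite signs the difference is at least as large as either value. The \<epsilon>-term is there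
  to be absorbed.\<close>

lemma signed_powr_diff:
  assumes p: "1 \<le> p" and d: "0 < \<delta>" "\<delta> < 1" "1 - (1 - \<delta>) powr p \<le> \<epsilon>"
  shows "\<bar>signed_powr p a - signed_powr p b\<bar>
    \<le> \<epsilon> * (\<bar>a\<bar> powr p + \<bar>b\<bar> powr p) + 2 * (1 / \<delta>) powr p * \<bar>a - b\<bar> powr p"
proof -
  have d1: "1 \<le> (1 / \<delta>) powr p" using d p by (intro ge_one_powr_ge_zero) auto
  have "(1 - \<delta>) powr p \<le> 1" using d p by (intro powr_le1) auto
  then have e0: "0 \<le> \<epsilon>" using d(3) by linarith
  have same: "A powr p - B powr p \<le> \<epsilon> * (A powr p + B powr p) + 2 * (1 / \<delta>) powr p * (A - B) powr p"
    if AB: "0 \<le> B" "B \<le> A" for A B :: real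
  proof (cases "\<delta> * A \<le> A - B")
    case True
    have "A powr p \<le> ((1 / \<delta>) * (A - B)) powr p"
      using True AB d p by (intro powr_mono2) (auto simp: field_simps)
    also have "\<dots> = (1 / \<delta>) powr p * (A - B) powr p" using AB d by (intro powr_mult)
    finally have "A powr p \<le> (1 / \<delta>) powr p * (A - B) powr p" .
    moreover have "0 \<le> (1 / \<delta>) powr p * (A - B) powr p" by simp
    ultimately have "A powr p \<le> 2 * (1 / \<delta>) powr p * (A - B) powr p" by (simp only: mult.assoc)
    moreover have "0 \<le> \<epsilon> * (A powr p + B powr p)" using e0 by simp
    ultimately show ?thesis using powr_ge_zero[of B p] by linarith
  next
    case False
    then have "(1 - \<delta>) * A \<le> B" by (simp add: algebra_simps)
    then have "((1 - \<delta>) * A) powr p \<le> B powr p" using AB d p by (intro powr_mono2) auto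
    then have "(1 - \<delta>) powr p * A powr p \<le> B powr p" using AB d by (simp add: powr_mult)
    moreover have "(1 - (1 - \<delta>) powr p) * A powr p \<le> \<epsilon> * A powr p" using d(3) by (intro mult_right_mono) auto
    ultimately have "A powr p - B powr p \<le> \<epsilon> * A powr p" by (simp add: algebra_simps)
    also have "\<dots> \<le> \<epsilon> * (A powr p + B powr p)" using e0 by (intro mult_left_mono) auto
    also have "\<dots> \<le> \<epsilon> * (A powr p + B powr p) + 2 * (1 / \<delta>) powr p * (A - B) powr p" by simp
    finally show ?thesis .
  qed
  show ?thesis
  proof (cases "0 \<le> a * b")
    case True
    have "\<bar>signed_powr p a - signed_powr p b\<bar> = \<bar>\<bar>a\<bar> powr p - \<bar>b\<bar> powr p\<bar>"
      using True by (auto simp: signed_powr_def zero_le_mult_iff sgn_if)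
    moreover have ab: "\<bar>a - b\<bar> = \<bar>\<bar>a\<bar> - \<bar>b\<bar>\<bar>" using True by (auto simp: zero_le_mult_iff)
    moreover have "\<bar>\<bar>a\<bar> powr p - \<bar>b\<bar> powr p\<bar> \<le> \<epsilon> * (\<bar>a\<bar> powr p + \<bar>b\<bar> powr p)
        + 2 * (1 / \<delta>) powr p * \<bar>\<bar>a\<bar> - \<bar>b\<bar>\<bar> powr p"
    proof (cases "\<bar>b\<bar> \<le> \<bar>a\<bar>")
      case True
      then have "\<bar>b\<bar> powr p \<le> \<bar>a\<bar> powr p" using p by (intro powr_mono2) auto
      then show ?thesis using same[of "\<bar>b\<bar>" "\<bar>a\<bar>"] True by simp
    next
      case False
      then have "\<bar>a\<bar> powr p \<le> \<bar>b\<bar> powr p" using p by (intro powr_mono2) auto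
      then show ?thesis using same[of "\<bar>a\<bar>" "\<bar>b\<bar>"] False by (simp add: add.commute)
    qed
    ultimately show ?thesis by simp
  next
    case False
    then have ab: "\<bar>a - b\<bar> = \<bar>a\<bar> + \<bar>b\<bar>" by (auto simp: not_le mult_less_0_iff)
    have "\<bar>signed_powr p a - signed_powr p b\<bar> \<le> \<bar>a\<bar> powr p + \<bar>b\<bar> powr p"
      using abs_triangle_ineq4[of "signed_powr p a" "signed_powr p b"] by (simp add: abs_signed_powr)
    also have "\<dots> \<le> 2 * \<bar>a - b\<bar> powr p"
    proof -
      have "\<bar>a\<bar> powr p \<le> \<bar>a - b\<bar> powr p" "\<bar>b\<bar> powr p \<le> \<bar>a - b\<bar> powr p"
        unfolding ab using p by (auto intro!: powr_mono2)
      then show ?thesis by linarith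
    qed
    also have "\<dots> \<le> 2 * (1 / \<delta>) powr p * \<bar>a - b\<bar> powr p"
      using d1 by (intro mult_right_mono) auto
    also have "\<dots> \<le> \<epsilon> * (\<bar>a\<bar> powr p + \<bar>b\<bar> powr p) + 2 * (1 / \<delta>) powr p * \<bar>a - b\<bar> powr p"
      using e0 by simp
    finally show ?thesis .
  qed
qed

lemma abs_diff_powr_le:
  assumes "1 \<le> (p :: real)"
  shows "\<bar>a - b\<bar> powr p \<le> 2 powr p * (\<bar>a\<bar> powr p + \<bar>b\<bar> powr p)"
proof -
  have "\<bar>a - b\<bar> powr p \<le> (2 * max \<bar>a\<bar> \<bar>b\<bar>) powr p"
    using assms by (intro powr_mono2) auto
  also have "\<dots> = 2 powr p * (max \<bar>a\<bar> \<bar>b\<bar>) powr p" by (rule powr_mult)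
  also have "\<dots> \<le> 2 powr p * (\<bar>a\<bar> powr p + \<bar>b\<bar> powr p)"
    by (intro mult_left_mono) (auto simp: max_def)
  finally show ?thesis .
qed

text \<open>The factors arise in \<open>poincare_powr\<close>: \<open>2 * 104\<close> and the power
  of \<open>1 / \<delta>\<close> come from the Mazur map, \<open>2 * 2 powr p\<close> from passing
  from the increments of \<open>F\<close> along \<open>z\<close> back to \<open>F\<close>.\<close>

definition poincare_const :: "real \<Rightarrow> real" where
  "poincare_const p = 208 * (208 * real (nat \<lceil>p\<rceil>)) powr p * (2 * 2 powr p)"

section \<open>Random walks with a gap relative to a cyclic subgroup\<close>

context group
begin

definition walk :: "'i set \<Rightarrow> ('i \<Rightarrow> 'a) \<Rightarrow> ('a \<Rightarrow> complex) \<Rightarrow> 'a \<Rightarrow> complex" where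
  "walk I g f x = (\<Sum>i\<in>I. f (x \<otimes> g i)) / of_nat (card I)"

definition walk_weight :: "'i set \<Rightarrow> ('i \<Rightarrow> 'a) \<Rightarrow> nat \<Rightarrow> 'a \<Rightarrow> real" where
  "walk_weight I g m h = real (card {vs \<in> word_lists I m. list_prod G (map g vs) = h}) / real (card I) ^ m"

context
  fixes I :: "'i set" and g :: "'i \<Rightarrow> 'a"
  assumes fin: "finite (carrier G)" and I: "finite I" "I \<noteq> {}" and g: "g ` I \<subseteq> carrier G"
begin

lemma walk_power:
  assumes "x \<in> carrier G"
  shows "(walk I g ^^ m) f x
    = (\<Sum>vs\<in>word_lists I m. f (x \<otimes> list_prod G (map g vs))) / of_nat (card I) ^ m"
  using assms
proof (induction m arbitrary: x)
  case (Suc m)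
  have gI: "g i \<in> carrier G" if "i \<in> I" for i using g that by blast
  have lp: "list_prod G (map g vs) \<in> carrier G" if "vs \<in> word_lists I m" for vs
    using that g by (intro list_prod_closed) (auto simp: word_lists_def)
  have "(walk I g ^^ Suc m) f x = (\<Sum>i\<in>I. (walk I g ^^ m) f (x \<otimes> g i)) / of_nat (card I)"
    by (simp add: walk_def)
  also have "\<dots> = (\<Sum>i\<in>I. (\<Sum>vs\<in>word_lists I m. f (x \<otimes> g i \<otimes> list_prod G (map g vs))) / of_nat (card I) ^ m) / of_nat (card I)"
    using Suc gI by simp
  also have "\<dots> = (\<Sum>i\<in>I. \<Sum>vs\<in>word_lists I m. f (x \<otimes> list_prod G (map g (i # vs)))) / of_nat (card I) ^ Suc m"
    unfolding sum_divide_distrib[symmetric]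
    using gI lp Suc.prems by (simp add: m_assoc mult.commute)
  finally show ?case unfolding sum_word_lists_Suc[OF I(1)] .
qed simp

lemma list_prod_word_lists:
  "vs \<in> word_lists I m \<Longrightarrow> list_prod G (map g vs) \<in> carrier G"
  using g by (intro list_prod_closed) (auto simp: word_lists_def)

lemma walk_power_eq_conv:
  assumes x: "x \<in> carrier G"
  shows "(walk I g ^^ m) f x = conv (walk_weight I g m) f x"
proof -
  let ?W = "word_lists I m" and ?p = "\<lambda>vs. list_prod G (map g vs)"
  have "(\<Sum>vs\<in>?W. f (x \<otimes> ?p vs)) = (\<Sum>h\<in>carrier G. \<Sum>vs | vs \<in> ?W \<and> ?p vs = h. f (x \<otimes> ?p vs))"
    by (rule sum.group[symmetric]) (use fin I list_prod_word_lists in \<open>auto simp: finite_word_lists\<close>)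
  also have "\<dots> = (\<Sum>h\<in>carrier G. of_nat (card {vs \<in> ?W. ?p vs = h}) * f (x \<otimes> h))"
    by (intro sum.cong refl) simp
  finally show ?thesis
    unfolding walk_power[OF x] conv_def walk_weight_def by (simp add: sum_divide_distrib)
qed

text \<open>The squared norm of the distribution after \<open>m\<close> steps is the probability
  that two independent walks collide.\<close>

lemma sum_walk_weight_squared:
  "(\<Sum>h\<in>carrier G. (walk_weight I g m h)\<^sup>2) = real (card {p \<in> word_lists I m \<times> word_lists I m.
      list_prod G (map g (fst p)) = list_prod G (map g (snd p))}) / real (card I) ^ (2 * m)"
proof -
  let ?W = "word_lists I m" and ?p = "\<lambda>vs. list_prod G (map g vs)"
  let ?A = "\<lambda>h. {vs \<in> ?W. ?p vs = h}"
  have fW: "finite ?W" using I by (simp add: finite_word_lists)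
  have "{p \<in> ?W \<times> ?W. ?p (fst p) = ?p (snd p)} = (\<Union>h\<in>carrier G. ?A h \<times> ?A h)"
    using list_prod_word_lists by auto
  then have "card {p \<in> ?W \<times> ?W. ?p (fst p) = ?p (snd p)} = (\<Sum>h\<in>carrier G. card (?A h \<times> ?A h))"
    using fin fW by (simp only:) (rule card_UN_disjoint, auto)
  also have "\<dots> = (\<Sum>h\<in>carrier G. (card (?A h))\<^sup>2)" by (simp add: card_cartesian_product power2_eq_square)
  finally have "real (card {p \<in> ?W \<times> ?W. ?p (fst p) = ?p (snd p)}) = (\<Sum>h\<in>carrier G. (real (card (?A h)))\<^sup>2)"
    by simp
  then show ?thesis
    unfolding walk_weight_def power_divide sum_divide_distrib[symmetric] by (simp add: mult.commute flip: power_mult)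
qed

context
  fixes \<sigma> :: "'i \<Rightarrow> 'i"
  assumes sym: "bij_betw \<sigma> I I" "\<And>i. i \<in> I \<Longrightarrow> g (\<sigma> i) = inv (g i)"
begin

lemma walk_self_adjoint: "inner_on (carrier G) (walk I g f) h = inner_on (carrier G) f (walk I g h)"
proof -
  let ?X = "carrier G"
  have gI: "g i \<in> carrier G" if "i \<in> I" for i using g that by blast
  have "(\<Sum>x\<in>?X. (\<Sum>i\<in>I. f (x \<otimes> g i)) * cnj (h x)) = (\<Sum>i\<in>I. \<Sum>x\<in>?X. f (x \<otimes> g i) * cnj (h x))"
    unfolding sum_distrib_right by (rule sum.swap)
  also have "\<dots> = (\<Sum>i\<in>I. \<Sum>x\<in>?X. f x * cnj (h (x \<otimes> inv (g i))))"
  proof (rule sum.cong[OF refl])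
    fix i assume i: "i \<in> I"
    have "(\<Sum>x\<in>?X. f (x \<otimes> g i) * cnj (h x)) = (\<Sum>x\<in>?X. f (x \<otimes> inv (g i) \<otimes> g i) * cnj (h (x \<otimes> inv (g i))))"
      by (rule sum_right_translate[symmetric]) (use gI[OF i] in simp)
    also have "\<dots> = (\<Sum>x\<in>?X. f x * cnj (h (x \<otimes> inv (g i))))"
      using gI[OF i] by (intro sum.cong refl) (simp add: m_assoc)
    finally show "(\<Sum>x\<in>?X. f (x \<otimes> g i) * cnj (h x)) = (\<Sum>x\<in>?X. f x * cnj (h (x \<otimes> inv (g i))))" .
  qed
  also have "\<dots> = (\<Sum>i\<in>I. \<Sum>x\<in>?X. f x * cnj (h (x \<otimes> g (\<sigma> i))))" by (simp add: sym(2))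
  also have "\<dots> = (\<Sum>i\<in>I. \<Sum>x\<in>?X. f x * cnj (h (x \<otimes> g i)))"
    by (rule sum.reindex_bij_betw[OF sym(1)])
  also have "\<dots> = (\<Sum>x\<in>?X. f x * cnj (\<Sum>i\<in>I. h (x \<otimes> g i)))"
    unfolding cnj_sum sum_distrib_left by (rule sum.swap)
  finally show ?thesis
    unfolding inner_on_def walk_def by (simp flip: sum_divide_distrib)
qed

lemma walk_gap:
  assumes m: "0 < m" and B: "0 \<le> B" "norm2_on (carrier G) ((walk I g ^^ m) f) \<le> B ^ m * norm2_on (carrier G) f"
  shows "norm2_on (carrier G) (walk I g f) \<le> B * norm2_on (carrier G) f"
proof -
  define a where "a k = norm2_on (carrier G) ((walk I g ^^ k) f)" for k
  have "(a (Suc k))\<^sup>2 \<le> a k * a (Suc (Suc k))" for k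
  proof -
    let ?h = "(walk I g ^^ k) f"
    have "complex_of_real (a (Suc k)) = inner_on (carrier G) ?h (walk I g (walk I g ?h))"
      by (simp add: a_def inner_on_self[symmetric] walk_self_adjoint)
    then have "\<bar>a (Suc k)\<bar> = cmod (inner_on (carrier G) ?h (walk I g (walk I g ?h)))"
      by (metis norm_of_real)
    then have "(a (Suc k))\<^sup>2 = (cmod (inner_on (carrier G) ?h (walk I g (walk I g ?h))))\<^sup>2"
      by (metis power2_abs)
    also have "\<dots> \<le> a k * a (Suc (Suc k))"
      using inner_on_Cauchy_Schwarz[of "carrier G" ?h "walk I g (walk I g ?h)"] by (simp add: a_def)
    finally show ?thesis .
  qed
  then have "a 1 \<le> B * a 0"
    using norm2_on_log_convex_bound[of a m B] m B by (simp add: a_def)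
  then show ?thesis by (simp add: a_def)
qed

end

text \<open>Since \<open>norm2_on\<close> is a squared norm, the constant 1/4 means that the walk
  contracts by 1/2 on functions whose sums along the orbits of \<open>z\<close> vanish. Nothing is
  assumed about other functions.\<close>

context
  fixes z :: 'a
  assumes z: "z \<in> carrier G" "z [^] (13 :: nat) = \<one>"
    and gap: "\<And>f. (\<And>x. x \<in> carrier G \<Longrightarrow> (\<Sum>i<13. f (z [^] (i :: nat) \<otimes> x)) = 0) \<Longrightarrow>
        norm2_on (carrier G) (walk I g f) \<le> 1 / 4 * norm2_on (carrier G) f"
begin

lemma sum_orbit_shift:
  assumes x: "x \<in> carrier G"
  shows "(\<Sum>i<13. F (z [^] (i :: nat) \<otimes> (z [^] (k :: nat) \<otimes> x))) = (\<Sum>i<13. F (z [^] (i :: nat) \<otimes> x) :: real)"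
proof (induction k)
  case 0
  then show ?case using x by simp
next
  case (Suc k)
  let ?F = "\<lambda>i :: nat. F (z [^] i \<otimes> (z [^] k \<otimes> x))"
  have "z [^] i \<otimes> (z [^] Suc k \<otimes> x) = z [^] Suc i \<otimes> (z [^] k \<otimes> x)" for i :: nat
  proof -
    have "z [^] i \<otimes> (z [^] Suc k \<otimes> x) = z [^] (i + Suc k) \<otimes> x"
      using z x by (simp only: m_assoc[symmetric] nat_pow_closed nat_pow_mult)
    also have "\<dots> = z [^] Suc i \<otimes> (z [^] k \<otimes> x)"
      using z x by (simp only: m_assoc[symmetric] nat_pow_closed nat_pow_mult add_Suc add_Suc_right)
    finally show ?thesis .
  qed
  then have "(\<Sum>i<13. F (z [^] (i :: nat) \<otimes> (z [^] Suc k \<otimes> x))) = (\<Sum>i<13. ?F (Suc i))"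
    by (simp only:)
  also have "\<dots> = (\<Sum>i<13. ?F i)"
  proof -
    have "?F 13 = ?F 0" using z x by simp
    then show ?thesis using sum.lessThan_Suc_shift[of ?F 13] sum.lessThan_Suc[of ?F 13] by linarith
  qed
  also note Suc
  finally show ?case .
qed

lemma gap_energy:
  fixes \<phi> :: "'a \<Rightarrow> real"
  assumes "\<And>x. x \<in> carrier G \<Longrightarrow> (\<Sum>i<13. \<phi> (z [^] (i :: nat) \<otimes> x)) = 0"
  shows "real (card I) * (\<Sum>x\<in>carrier G. (\<phi> x)\<^sup>2) \<le> (\<Sum>i\<in>I. \<Sum>x\<in>carrier G. (\<phi> x - \<phi> (x \<otimes> g i))\<^sup>2)"
proof -
  let ?X = "carrier G"
  define T where "T x = (\<Sum>i\<in>I. \<phi> (x \<otimes> g i)) / real (card I)" for x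
  define n where "n = (\<Sum>x\<in>?X. (\<phi> x)\<^sup>2)"
  have cI: "0 < real (card I)" using I by (simp add: card_gt_0_iff)
  have "walk I g (\<lambda>x. complex_of_real (\<phi> x)) = (\<lambda>x. complex_of_real (T x))"
    by (simp add: walk_def T_def fun_eq_iff)
  moreover have "norm2_on ?X (walk I g (\<lambda>x. complex_of_real (\<phi> x))) \<le> 1 / 4 * norm2_on ?X (\<lambda>x. complex_of_real (\<phi> x))"
    by (rule gap) (use assms in \<open>simp flip: of_real_sum\<close>)
  ultimately have T: "(\<Sum>x\<in>?X. (T x)\<^sup>2) \<le> n / 4" by (simp add: norm2_on_def n_def)
  \<comment> \<open>The weights match the gap: each of the two terms sums to at most
    \<open>n / 4\<close>, which bounds the inner product by \<open>n / 2\<close>.\<close>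
  have "(\<Sum>x\<in>?X. \<phi> x * T x) \<le> (\<Sum>x\<in>?X. (\<phi> x)\<^sup>2 / 4 + (T x)\<^sup>2)"
  proof (rule sum_mono)
    fix x
    have "0 \<le> (\<phi> x / 2 - T x)\<^sup>2" by simp
    then show "\<phi> x * T x \<le> (\<phi> x)\<^sup>2 / 4 + (T x)\<^sup>2" by (simp add: power2_diff power_divide)
  qed
  also have "\<dots> \<le> n / 2" using T by (simp add: sum.distrib n_def flip: sum_divide_distrib)
  finally have ip: "(\<Sum>x\<in>?X. \<phi> x * T x) \<le> n / 2" .
  have "(\<Sum>x\<in>?X. (\<phi> x - \<phi> (x \<otimes> g i))\<^sup>2) = 2 * n - 2 * (\<Sum>x\<in>?X. \<phi> x * \<phi> (x \<otimes> g i))" if "i \<in> I" for i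
  proof -
    have "(\<Sum>x\<in>?X. (\<phi> (x \<otimes> g i))\<^sup>2) = n" unfolding n_def by (rule sum_right_translate) (use g that in blast)
    then show ?thesis
      by (simp add: power2_diff sum.distrib sum_subtractf n_def mult.assoc flip: sum_distrib_left)
  qed
  then have "(\<Sum>i\<in>I. \<Sum>x\<in>?X. (\<phi> x - \<phi> (x \<otimes> g i))\<^sup>2)
      = real (card I) * (2 * n) - 2 * (\<Sum>i\<in>I. \<Sum>x\<in>?X. \<phi> x * \<phi> (x \<otimes> g i))"
    by (simp add: sum_subtractf sum_distrib_left)
  also have "(\<Sum>i\<in>I. \<Sum>x\<in>?X. \<phi> x * \<phi> (x \<otimes> g i)) = (\<Sum>x\<in>?X. \<phi> x * (\<Sum>i\<in>I. \<phi> (x \<otimes> g i)))"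
    unfolding sum_distrib_left by (rule sum.swap)
  also have "\<dots> = real (card I) * (\<Sum>x\<in>?X. \<phi> x * T x)"
    unfolding sum_distrib_left[of "real (card I)"] T_def using cI by (intro sum.cong refl) simp
  finally have "(\<Sum>i\<in>I. \<Sum>x\<in>?X. (\<phi> x - \<phi> (x \<otimes> g i))\<^sup>2) = real (card I) * (2 * n - 2 * (\<Sum>x\<in>?X. \<phi> x * T x))"
    by (simp add: algebra_simps)
  moreover have "real (card I) * n \<le> real (card I) * (2 * n - 2 * (\<Sum>x\<in>?X. \<phi> x * T x))"
    using ip cI by (intro mult_left_mono) auto
  ultimately show ?thesis by (simp add: n_def)
qed

text \<open>The increment of \<open>f\<close> along \<open>z [^] k\<close> sums to zero over every
  orbit, so the gap applies to it although \<open>f\<close> is arbitrary. Left translation commutes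
  with the walk, hence the energy of the increment is at most four times that of
  \<open>f\<close>.\<close>

lemma poincare_squares:
  fixes f :: "'a \<Rightarrow> real"
  shows "real (card I) * (\<Sum>x\<in>carrier G. (f (z [^] (k :: nat) \<otimes> x) - f x)\<^sup>2)
    \<le> 4 * (\<Sum>i\<in>I. \<Sum>x\<in>carrier G. (f x - f (x \<otimes> g i))\<^sup>2)"
proof -
  let ?X = "carrier G"
  define \<phi> where "\<phi> x = f (z [^] k \<otimes> x) - f x" for x
  have comm: "z [^] k \<otimes> (z [^] i \<otimes> x) = z [^] i \<otimes> (z [^] k \<otimes> x)" if "x \<in> ?X" for i :: nat and x
    using z that by (simp only: m_assoc[symmetric] nat_pow_closed nat_pow_mult add.commute)
  have "(\<Sum>i<13. \<phi> (z [^] (i :: nat) \<otimes> x)) = 0" if x: "x \<in> ?X" for x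
    using sum_orbit_shift[OF x, of f k] by (simp add: \<phi>_def sum_subtractf comm[OF x])
  then have "real (card I) * (\<Sum>x\<in>?X. (\<phi> x)\<^sup>2) \<le> (\<Sum>i\<in>I. \<Sum>x\<in>?X. (\<phi> x - \<phi> (x \<otimes> g i))\<^sup>2)"
    by (rule gap_energy)
  also have "\<dots> \<le> (\<Sum>i\<in>I. 4 * (\<Sum>x\<in>?X. (f x - f (x \<otimes> g i))\<^sup>2))"
  proof (rule sum_mono)
    fix i assume "i \<in> I"
    then have gi: "g i \<in> ?X" using g by blast
    have "(\<Sum>x\<in>?X. (\<phi> x - \<phi> (x \<otimes> g i))\<^sup>2)
        \<le> (\<Sum>x\<in>?X. 2 * (f (z [^] k \<otimes> x) - f (z [^] k \<otimes> x \<otimes> g i))\<^sup>2 + 2 * (f x - f (x \<otimes> g i))\<^sup>2)"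
    proof (rule sum_mono)
      fix x assume x: "x \<in> ?X"
      define A where "A = f (z [^] k \<otimes> x) - f (z [^] k \<otimes> x \<otimes> g i)"
      define B where "B = f x - f (x \<otimes> g i)"
      have "\<phi> x - \<phi> (x \<otimes> g i) = A - B" using z x gi by (simp add: \<phi>_def A_def B_def m_assoc)
      moreover have "0 \<le> (A + B)\<^sup>2" by simp
      then have "(A - B)\<^sup>2 \<le> 2 * A\<^sup>2 + 2 * B\<^sup>2" by (simp add: power2_diff power2_sum)
      ultimately show "(\<phi> x - \<phi> (x \<otimes> g i))\<^sup>2 \<le> 2 * (f (z [^] k \<otimes> x) - f (z [^] k \<otimes> x \<otimes> g i))\<^sup>2 + 2 * (f x - f (x \<otimes> g i))\<^sup>2"
        by (simp add: A_def B_def)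
    qed
    also have "\<dots> = 2 * (\<Sum>x\<in>?X. (f (z [^] k \<otimes> x) - f (z [^] k \<otimes> x \<otimes> g i))\<^sup>2) + 2 * (\<Sum>x\<in>?X. (f x - f (x \<otimes> g i))\<^sup>2)"
      by (simp add: sum.distrib sum_distrib_left)
    also have "(\<Sum>x\<in>?X. (f (z [^] k \<otimes> x) - f (z [^] k \<otimes> x \<otimes> g i))\<^sup>2) = (\<Sum>x\<in>?X. (f x - f (x \<otimes> g i))\<^sup>2)"
      by (rule sum_left_translate[of "z [^] k" "\<lambda>x. (f x - f (x \<otimes> g i))\<^sup>2"]) (use z in simp)
    finally show "(\<Sum>x\<in>?X. (\<phi> x - \<phi> (x \<otimes> g i))\<^sup>2) \<le> 4 * (\<Sum>x\<in>?X. (f x - f (x \<otimes> g i))\<^sup>2)" by simp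
  qed
  also have "\<dots> = 4 * (\<Sum>i\<in>I. \<Sum>x\<in>?X. (f x - f (x \<otimes> g i))\<^sup>2)" by (rule sum_distrib_left[symmetric])
  finally show ?thesis by (simp add: \<phi>_def)
qed

text \<open>For an indicator function squares of differences equal their absolute values, so
  \<open>poincare_squares\<close> provides the hypothesis of \<open>coarea_sum\<close>.\<close>

lemma poincare_abs:
  fixes h :: "'a \<Rightarrow> real"
  shows "(\<Sum>x\<in>carrier G. \<bar>h (z [^] (k :: nat) \<otimes> x) - h x\<bar>)
    \<le> 4 / real (card I) * (\<Sum>(i, x)\<in>I \<times> carrier G. \<bar>h x - h (x \<otimes> g i)\<bar>)"
proof -
  let ?X = "carrier G"
  have cI: "0 < real (card I)" using I by (simp add: card_gt_0_iff)
  have "(\<Sum>x\<in>?X. \<bar>h (z [^] k \<otimes> x) - h x\<bar>)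
    \<le> 4 / real (card I) * (\<Sum>q\<in>I \<times> ?X. \<bar>h (snd q) - h (snd q \<otimes> g (fst q))\<bar>)"
  proof (rule coarea_sum[OF fin])
    fix A :: "'a set"
    let ?f = "indicator A :: 'a \<Rightarrow> real"
    have sq: "(?f x - ?f y)\<^sup>2 = \<bar>?f x - ?f y\<bar>" for x y by (auto simp: indicator_def)
    have "real (card I) * (\<Sum>x\<in>?X. \<bar>?f (z [^] k \<otimes> x) - ?f x\<bar>) \<le> 4 * (\<Sum>i\<in>I. \<Sum>x\<in>?X. \<bar>?f x - ?f (x \<otimes> g i)\<bar>)"
      using poincare_squares[of ?f k] by (simp only: sq)
    then show "(\<Sum>x\<in>?X. \<bar>?f (z [^] k \<otimes> x) - ?f x\<bar>)
      \<le> 4 / real (card I) * (\<Sum>q\<in>I \<times> ?X. \<bar>?f (snd q) - ?f (snd q \<otimes> g (fst q))\<bar>)"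
      using cI by (simp add: sum.cartesian_product case_prod_beta field_simps)
  qed (use z g in auto)
  then show ?thesis by (simp add: case_prod_beta)
qed

text \<open>On a \<open>z\<close>-orbit the function \<open>x \<mapsto> F (z x) - F x\<close> sums to zero and so changes sign; this
  bounds its values by the oscillation of its signed \<open>p\<close>-th power along the orbit.\<close>

lemma poincare_powr:
  fixes F :: "'a \<Rightarrow> real"
  assumes p: "1 \<le> p"
  shows "(\<Sum>x\<in>carrier G. \<bar>F (z \<otimes> x) - F x\<bar> powr p)
    \<le> poincare_const p / real (card I) * (\<Sum>(i, x)\<in>I \<times> carrier G. \<bar>F x - F (x \<otimes> g i)\<bar> powr p)"
proof -
  let ?X = "carrier G"
  define n where "n = real (nat \<lceil>p\<rceil>)"
  \<comment> \<open>208 is \<open>4 * 52\<close>, where 52 is 13 orbit points times the constant 4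
    of \<open>poincare_abs\<close>. By Bernoulli's inequality the error fraction is then at most
    1/208, and its total contribution is half of \<open>S\<close>, which can be absorbed.\<close>
  define \<delta> where "\<delta> = 1 / (208 * n)"
  have n: "1 \<le> n" "p \<le> n" using p by (auto simp: n_def)
  have cI: "0 < real (card I)" using I by (simp add: card_gt_0_iff)
  have d: "0 < \<delta>" "\<delta> < 1" using n by (auto simp: \<delta>_def)
  have dp: "1 - (1 - \<delta>) powr p \<le> 1 / 208"
  proof -
    have "1 + real (nat \<lceil>p\<rceil>) * (- \<delta>) \<le> (1 + (- \<delta>)) ^ nat \<lceil>p\<rceil>"
      using d by (intro Bernoulli_inequality) auto
    also have "\<dots> = (1 - \<delta>) powr n" using d by (simp add: n_def powr_realpow)
    also have "\<dots> \<le> (1 - \<delta>) powr p" using d n by (intro powr_mono') auto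
    finally have "1 + n * (- \<delta>) \<le> (1 - \<delta>) powr p" by (simp only: n_def)
    moreover have "n * (- \<delta>) = - (1 / 208)" using n by (simp add: \<delta>_def)
    ultimately show ?thesis by linarith
  qed
  define U where "U x = F (z \<otimes> x) - F x" for x
  define h where "h x = signed_powr p (U x)" for x
  define S where "S = (\<Sum>x\<in>?X. \<bar>U x\<bar> powr p)"
  define E where "E = (\<Sum>(i, x)\<in>I \<times> ?X. \<bar>U x - U (x \<otimes> g i)\<bar> powr p)"
  define K where "K = 2 * (1 / \<delta>) powr p"
  have K0: "0 \<le> K" by (simp add: K_def)
  have orbit: "\<bar>h x\<bar> \<le> (\<Sum>k<13. \<bar>h (z [^] (k :: nat) \<otimes> x) - h x\<bar>)" if x: "x \<in> ?X" for x
  proof -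
    have "(\<Sum>k<13. U (z [^] (k :: nat) \<otimes> x)) = 0"
    proof -
      have "z \<otimes> (z [^] k \<otimes> x) = z [^] k \<otimes> (z [^] (1 :: nat) \<otimes> x)" for k :: nat
      proof -
        have "z \<otimes> (z [^] k \<otimes> x) = z [^] Suc k \<otimes> x"
          unfolding nat_pow_Suc2[OF z(1)] using z x by (simp only: m_assoc nat_pow_closed)
        also have "\<dots> = z [^] k \<otimes> (z [^] (1 :: nat) \<otimes> x)"
          using z x by (simp add: m_assoc)
        finally show ?thesis .
      qed
      then show ?thesis using sum_orbit_shift[OF x, of F 1] by (simp add: U_def sum_subtractf)
    qed
    have "\<exists>k<13. U (z [^] (k :: nat) \<otimes> x) * U x \<le> 0"
    proof (rule ccontr)
      assume "\<not> (\<exists>k<13. U (z [^] (k :: nat) \<otimes> x) * U x \<le> 0)"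
      then have "0 < (\<Sum>k<13. U (z [^] (k :: nat) \<otimes> x) * U x)"
        by (intro sum_pos) (auto simp: not_le lessThan_empty_iff)
      also have "\<dots> = (\<Sum>k<13. U (z [^] (k :: nat) \<otimes> x)) * U x" by (rule sum_distrib_right[symmetric])
      finally show False using \<open>(\<Sum>k<13. U (z [^] (k :: nat) \<otimes> x)) = 0\<close> by simp
    qed
    then obtain k :: nat where k: "k < 13" "U (z [^] k \<otimes> x) * U x \<le> 0" by blast
    have "h (z [^] k \<otimes> x) * h x = (\<bar>U (z [^] k \<otimes> x)\<bar> powr p * \<bar>U x\<bar> powr p) * sgn (U (z [^] k \<otimes> x) * U x)"
      by (simp add: h_def signed_powr_def sgn_mult)
    also have "\<dots> \<le> 0" using k(2) by (intro mult_nonneg_nonpos) (auto simp: sgn_if)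
    finally have "\<bar>h x\<bar> \<le> \<bar>h (z [^] k \<otimes> x) - h x\<bar>" by (auto simp: mult_le_0_iff)
    also have "\<dots> \<le> (\<Sum>k<13. \<bar>h (z [^] (k :: nat) \<otimes> x) - h x\<bar>)"
      by (rule member_le_sum) (use k in auto)
    finally show ?thesis .
  qed
  have "S = (\<Sum>x\<in>?X. \<bar>h x\<bar>)" by (simp add: S_def h_def abs_signed_powr)
  also have "\<dots> \<le> (\<Sum>x\<in>?X. \<Sum>k<13. \<bar>h (z [^] (k :: nat) \<otimes> x) - h x\<bar>)" by (rule sum_mono) (rule orbit)
  also have "\<dots> = (\<Sum>k<13. \<Sum>x\<in>?X. \<bar>h (z [^] (k :: nat) \<otimes> x) - h x\<bar>)" by (rule sum.swap)
  also have "\<dots> \<le> (\<Sum>k<(13::nat). 4 / real (card I) * (\<Sum>(i, x)\<in>I \<times> ?X. \<bar>h x - h (x \<otimes> g i)\<bar>))"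
    by (rule sum_mono) (rule poincare_abs)
  also have "\<dots> = 52 / real (card I) * (\<Sum>(i, x)\<in>I \<times> ?X. \<bar>h x - h (x \<otimes> g i)\<bar>)" by simp
  also have "(\<Sum>(i, x)\<in>I \<times> ?X. \<bar>h x - h (x \<otimes> g i)\<bar>)
      \<le> (\<Sum>(i, x)\<in>I \<times> ?X. 1 / 208 * (\<bar>U x\<bar> powr p + \<bar>U (x \<otimes> g i)\<bar> powr p) + K * \<bar>U x - U (x \<otimes> g i)\<bar> powr p)"
  proof (rule sum_mono, clarify)
    fix i x
    show "\<bar>h x - h (x \<otimes> g i)\<bar> \<le> 1 / 208 * (\<bar>U x\<bar> powr p + \<bar>U (x \<otimes> g i)\<bar> powr p) + K * \<bar>U x - U (x \<otimes> g i)\<bar> powr p"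
      unfolding K_def h_def by (rule signed_powr_diff[OF p d dp])
  qed
  also have "\<dots> = 1 / 208 * (\<Sum>(i, x)\<in>I \<times> ?X. \<bar>U x\<bar> powr p + \<bar>U (x \<otimes> g i)\<bar> powr p) + K * E"
    unfolding E_def sum_distrib_left sum.distrib[symmetric] by (rule sum.cong) auto
  also have "(\<Sum>(i, x)\<in>I \<times> ?X. \<bar>U x\<bar> powr p + \<bar>U (x \<otimes> g i)\<bar> powr p) = real (card I) * (2 * S)"
  proof -
    have "(\<Sum>x\<in>?X. \<bar>U (x \<otimes> g i)\<bar> powr p) = S" if "i \<in> I" for i
      unfolding S_def by (rule sum_right_translate) (use g that in blast)
    then show ?thesis by (simp add: sum.cartesian_product[symmetric] sum.distrib S_def)
  qed
  finally have "S \<le> 52 / real (card I) * (1 / 208 * (real (card I) * (2 * S)) + K * E)"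
    using cI by (simp add: divide_right_mono)
  also have "\<dots> = S / 2 + 52 * K / real (card I) * E" using cI by (simp add: field_simps)
  finally have S: "S \<le> 104 * K / real (card I) * E" by simp
  have "E \<le> 2 * 2 powr p * (\<Sum>(i, x)\<in>I \<times> ?X. \<bar>F x - F (x \<otimes> g i)\<bar> powr p)"
  proof -
    have "E \<le> (\<Sum>(i, x)\<in>I \<times> ?X. 2 powr p * (\<bar>F (z \<otimes> x) - F (z \<otimes> x \<otimes> g i)\<bar> powr p + \<bar>F x - F (x \<otimes> g i)\<bar> powr p))"
      unfolding E_def
    proof (rule sum_mono, clarify)
      fix i x assume "i \<in> I" "x \<in> ?X"
      then have "U x - U (x \<otimes> g i) = (F (z \<otimes> x) - F (z \<otimes> x \<otimes> g i)) - (F x - F (x \<otimes> g i))"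
        using g z by (simp add: U_def m_assoc image_subset_iff)
      then show "\<bar>U x - U (x \<otimes> g i)\<bar> powr p \<le> 2 powr p * (\<bar>F (z \<otimes> x) - F (z \<otimes> x \<otimes> g i)\<bar> powr p + \<bar>F x - F (x \<otimes> g i)\<bar> powr p)"
        by (simp only:) (rule abs_diff_powr_le[OF p])
    qed
    also have "\<dots> = 2 powr p * ((\<Sum>i\<in>I. \<Sum>x\<in>?X. \<bar>F (z \<otimes> x) - F (z \<otimes> x \<otimes> g i)\<bar> powr p)
        + (\<Sum>i\<in>I. \<Sum>x\<in>?X. \<bar>F x - F (x \<otimes> g i)\<bar> powr p))"
      by (simp add: sum.cartesian_product[symmetric] sum.distrib flip: sum_distrib_left)
    also have "(\<Sum>i\<in>I. \<Sum>x\<in>?X. \<bar>F (z \<otimes> x) - F (z \<otimes> x \<otimes> g i)\<bar> powr p) = (\<Sum>i\<in>I. \<Sum>x\<in>?X. \<bar>F x - F (x \<otimes> g i)\<bar> powr p)"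
      by (intro sum.cong refl sum_left_translate[of z "\<lambda>x. \<bar>F x - F (x \<otimes> g _)\<bar> powr p"] z)
    finally show ?thesis by (simp add: sum.cartesian_product mult_ac)
  qed
  then have "104 * K / real (card I) * E
      \<le> 104 * K / real (card I) * (2 * 2 powr p * (\<Sum>(i, x)\<in>I \<times> ?X. \<bar>F x - F (x \<otimes> g i)\<bar> powr p))"
    using K0 cI by (intro mult_left_mono) auto
  also have "\<dots> = poincare_const p / real (card I) * (\<Sum>(i, x)\<in>I \<times> ?X. \<bar>F x - F (x \<otimes> g i)\<bar> powr p)"
    by (simp add: poincare_const_def K_def \<delta>_def n_def)
  finally show ?thesis using S by (simp add: S_def U_def)
qed

end

end

end

section \<open>The spectral gap of congruence quotients relative to a small subgroup\<close>

text \<open>Put \<open>L = t * log 5 13\<close> and \<open>M = 600 * m\<close>. The first summand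
  requires \<open>M\<close> above \<open>2 * L\<close>, the second requires
  \<open>7 / 4 * (M - L)\<close> below \<open>M\<close>, both with a margin. The window
  \<open>2 * L < M < 7 / 3 * L\<close> would be empty with 2 in place of
  \<open>7 / 4\<close>.\<close>

lemma walk_length_choice:
  fixes K :: real
  assumes K: "0 < K"
  shows "\<exists>t0. \<forall>t\<ge>t0. \<exists>m>0. K * 13 ^ (2 * t) * (601 ^ (2 * m) * 4 ^ m / 5 ^ (600 * m))
      * (1 + real (m * 600) * (576 / 13 ^ (2 * t) * (5 ^ (m * 600) / 13 ^ t) powr (7 / 4))) \<le> 1"
proof -
  define c where "c = log 5 (1152 * K)"
  obtain t0 :: nat where t0: "max 600 (20 * (600 + c)) \<le> real t0" using real_arch_simple by blast
  have "\<exists>m>0. K * 13 ^ (2 * t) * (601 ^ (2 * m) * 4 ^ m / 5 ^ (600 * m))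
      * (1 + real (m * 600) * (576 / 13 ^ (2 * t) * (5 ^ (m * 600) / 13 ^ t) powr (7 / 4))) \<le> 1"
    if t: "t0 \<le> t" for t
  proof -
    define L where "L = real t * log 5 13"
    have l1: "1 \<le> log 5 (13 :: real)" by simp
    have "real t * 1 \<le> L" unfolding L_def using l1 by (intro mult_left_mono) auto
    moreover have "real t0 \<le> real t" using t by simp
    ultimately have L: "600 \<le> L" "20 * (600 + c) \<le> L" using t0 by linarith+
    \<comment> \<open>So \<open>600 * m\<close> is about \<open>2.2 * L\<close>, inside the
      window.\<close>
    define m where "m = nat \<lfloor>11 / 3000 * L\<rfloor>"
    have "real m = real_of_int \<lfloor>11 / 3000 * L\<rfloor>" using L by (simp add: m_def)
    then have m: "3000 * real m \<le> 11 * L" "11 * L < 3000 * real m + 3000" by linarith+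
    have m0: "0 < m" using m L by (intro Nat.gr0I) simp
    have Q: "(13 :: real) ^ k = 5 powr (real k * log 5 13)" for k
    proof -
      have "(5 :: real) powr (log 5 13 * real k) = (5 powr log 5 13) powr real k" by (rule powr_powr[symmetric])
      then show ?thesis by (simp add: powr_realpow mult.commute)
    qed
    have F: "(5 :: real) ^ k = 5 powr real k" for k by (simp add: powr_realpow)
    define x where "x = (5 :: real) powr (2 * L - 600 * real m)"
    define X where "X = 576 * (5 :: real) powr (7 / 4 * (600 * real m - L) - 2 * L)"
    have X: "576 / 13 ^ (2 * t) * (5 ^ (m * 600) / 13 ^ t) powr (7 / 4) = X"
    proof -
      have "(5 ^ (m * 600) / 13 ^ t :: real) = 5 powr (600 * real m - L)"
        unfolding Q F L_def powr_diff by (simp add: mult.commute)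
      then have "(5 ^ (m * 600) / 13 ^ t :: real) powr (7 / 4) = 5 powr (7 / 4 * (600 * real m - L))"
        by (simp add: powr_powr mult.commute)
      moreover have "(13 :: real) ^ (2 * t) = 5 powr (2 * L)" unfolding Q L_def by (simp add: mult.assoc)
      ultimately show ?thesis by (simp add: X_def powr_diff)
    qed
    have x: "13 ^ (2 * t) * (601 ^ (2 * m) * 4 ^ m / 5 ^ (600 * m)) = (601 ^ (2 * m) * 4 ^ m :: real) * x"
    proof -
      have "(13 :: real) ^ (2 * t) = 5 powr (2 * L)" unfolding Q L_def by (simp add: mult.assoc)
      moreover have "(5 :: real) ^ (600 * m) = 5 powr (600 * real m)" unfolding F by simp
      ultimately show ?thesis by (simp add: x_def powr_diff)
    qed
    have X0: "0 \<le> X" and x0: "0 \<le> x" by (simp_all add: X_def x_def)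
    have "1 + real m * 600 \<le> (1 + 600 :: real) ^ m" by (rule Bernoulli_inequality) simp
    then have b1: "1 + real (m * 600) \<le> (601 :: real) ^ m" by simp
    \<comment> \<open>The losses per step amount to \<open>601 ^ 3 * 4 \<le> 5 ^ 13\<close>, an
      exponent of 13 against the 600 that a step gains. This fits into the margins of the
      window.\<close>
    have b2: "(601 :: real) ^ (2 * m) * 4 ^ m * 601 ^ m \<le> 5 powr (13 * real m)"
    proof -
      have "(601 :: real) ^ (2 * m) * 4 ^ m * 601 ^ m = (601 ^ 2 * 4 * 601) ^ m"
        by (simp only: power_mult power_mult_distrib)
      also have "\<dots> \<le> (5 ^ 13) ^ m" by (rule power_mono) simp_all
      also have "\<dots> = 5 ^ (13 * m)" by (rule power_mult[symmetric])
      also have "\<dots> = 5 powr real (13 * m)" by (rule F)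
      also have "real (13 * m) = 13 * real m" by simp
      finally show ?thesis .
    qed
    have "K * 13 ^ (2 * t) * (601 ^ (2 * m) * 4 ^ m / 5 ^ (600 * m)) * (1 + real (m * 600) * X)
        = K * ((601 ^ (2 * m) * 4 ^ m) * x) * (1 + real (m * 600) * X)"
      by (simp only: mult.assoc[of K "13 ^ (2 * t)"] x)
    also have "\<dots> \<le> K * ((601 ^ (2 * m) * 4 ^ m) * x) * (601 ^ m * (1 + X))"
    proof -
      have "1 + real (m * 600) * X \<le> (1 + real (m * 600)) * (1 + X)" using X0 by (simp add: algebra_simps)
      also have "\<dots> \<le> 601 ^ m * (1 + X)" using b1 X0 by (intro mult_right_mono) auto
      finally show ?thesis using K x0 by (intro mult_left_mono) auto
    qed
    also have "\<dots> = K * (601 ^ (2 * m) * 4 ^ m * 601 ^ m) * (x * (1 + X))" by (simp only: mult_ac)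
    also have "\<dots> \<le> K * 5 powr (13 * real m) * (x * (1 + X))"
      using b2 K x0 X0 by (intro mult_right_mono mult_left_mono) auto
    also have "\<dots> = K * (5 powr (13 * real m + (2 * L - 600 * real m))
        + 576 * 5 powr (13 * real m + ((2 * L - 600 * real m) + (7 / 4 * (600 * real m - L) - 2 * L))))"
      unfolding x_def X_def powr_add by (simp add: algebra_simps)
    also have "\<dots> \<le> K * (576 * 5 powr (600 - L / 20) + 576 * 5 powr (600 - L / 20))"
    proof -
      have "(5 :: real) powr (13 * real m + (2 * L - 600 * real m)) \<le> 5 powr (600 - L / 20)"
        using m L by (intro powr_mono) auto
      moreover have "(5 :: real) powr (13 * real m + ((2 * L - 600 * real m) + (7 / 4 * (600 * real m - L) - 2 * L)))
          \<le> 5 powr (600 - L / 20)"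
        using m L by (intro powr_mono) (auto simp: field_simps)
      moreover have "(5 :: real) powr (600 - L / 20) \<le> 576 * 5 powr (600 - L / 20)" by simp
      ultimately show ?thesis using K by (intro mult_left_mono add_mono) linarith+
    qed
    also have "\<dots> = (1152 * K) * 5 powr (600 - L / 20)" by simp
    also have "\<dots> = 5 powr (c + (600 - L / 20))" using K by (simp add: c_def powr_add)
    also have "\<dots> \<le> 5 powr 0" using L by (intro powr_mono) auto
    finally show ?thesis using m0 X by (intro exI[of _ m]) simp
  qed
  then show ?thesis by blast
qed

lemma (in group) eq_rcosets_iff:
  assumes "N \<lhd> G" "x \<in> carrier G" "y \<in> carrier G"
  shows "N #> x = N #> y \<longleftrightarrow> x \<otimes> inv y \<in> N"
proof -
  interpret N: normal N G by (rule assms(1))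
  show ?thesis
  proof
    assume "N #> x = N #> y"
    then have "x \<in> N #> y" using rcos_self[OF assms(2) N.subgroup_axioms] by simp
    then show "x \<otimes> inv y \<in> N" using N.rcos_module_imp[OF is_group assms(3)] by blast
  next
    assume "x \<otimes> inv y \<in> N"
    then have "x \<in> N #> y" using N.rcos_module_rev[OF is_group assms(3,2)] by blast
    then show "N #> x = N #> y" using repr_independence[OF _ assms(3) N.subgroup_axioms] by metis
  qed
qed

lemma (in group) normal_Int:
  assumes "N \<lhd> G" "M \<lhd> G"
  shows "N \<inter> M \<lhd> G"
  using assms unfolding normal_inv_iff by (auto intro: subgroups_Inter_pair)

lemma (in group) rcosets_Int_bound:
  assumes N: "N \<lhd> G" and M: "M \<lhd> G" "finite (rcosets M)" and T: "finite T"
    and f: "\<And>x. x \<in> carrier G \<Longrightarrow> f x \<in> T"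
      "\<And>x y. x \<in> carrier G \<Longrightarrow> y \<in> carrier G \<Longrightarrow> f x = f y \<Longrightarrow> x \<otimes> inv y \<in> N"
  shows "finite (rcosets (N \<inter> M))" "card (rcosets (N \<inter> M)) \<le> card T * card (rcosets M)"
proof -
  have sg: "subgroup (N \<inter> M) G" using normal_Int[OF N M(1)] by (simp add: normal_imp_subgroup)
  have 1: "(f x, M #> x) \<in> T \<times> rcosets M" if "x \<in> carrier G" for x
    using f(1) that rcosetsI[of M x] M(1) normal_imp_subgroup subgroup.subset by blast
  have 2: "x \<otimes> inv y \<in> N \<inter> M"
    if "x \<in> carrier G" "y \<in> carrier G" "(f x, M #> x) = (f y, M #> y)" for x y
    using that f(2) eq_rcosets_iff[OF M(1)] by blast
  show "finite (rcosets (N \<inter> M))"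
    by (rule rcosets_finite_invariant(1)[OF sg _ 1 2]) (use T M in auto)
  have "card (rcosets (N \<inter> M)) \<le> card (T \<times> rcosets M)"
    by (rule rcosets_finite_invariant(2)[OF sg _ 1 2]) (use T M in auto)
  then show "card (rcosets (N \<inter> M)) \<le> card T * card (rcosets M)" by (simp add: card_cartesian_product)
qed

lemma (in group) list_prod_rcosets:
  assumes "N \<lhd> G" "set vs \<subseteq> carrier G"
  shows "list_prod (G Mod N) (map ((#>) N) vs) = N #> list_prod G vs"
  using assms(2)
proof (induction vs)
  case Nil
  interpret N: normal N G by (rule assms(1))
  show ?case by (simp add: FactGroup_def coset_mult_one N.subset)
next
  case (Cons v vs)
  interpret N: normal N G by (rule assms(1))
  show ?case using Cons list_prod_closed[of vs] by (simp add: FactGroup_def N.rcos_sum)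
qed

lemma sphere_words_nonempty:
  assumes "finite B" "B \<noteq> {}"
  shows "sphere_words B n \<noteq> {}"
proof (cases n)
  case 0
  then have "[] \<in> sphere_words B n" by (simp add: sphere_words_def carrier_free_group)
  then show ?thesis by blast
next
  case (Suc m)
  have "0 < card B" using assms by (simp add: card_gt_0_iff)
  then have "card (sphere_words B n) \<noteq> 0"
    unfolding Suc card_sphere_words[OF assms(1)] by simp
  then show ?thesis by auto
qed

abbreviation steps :: "(nat \<times> bool) list set" where
  "steps \<equiv> sphere_words {0, 1, 2} 600"

lemma steps_F3: "w \<in> steps \<longleftrightarrow> w \<in> carrier F3 \<and> length w = 600"
  by (simp add: sphere_words_def F3_def)

lemma finite_cong_ker_Int:
  assumes "R \<lhd> F3" "finite (rcosets\<^bsub>F3\<^esub> R)" "0 < t"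
  shows "finite (rcosets\<^bsub>F3\<^esub> (cong_ker t \<inter> R))"
    "card (rcosets\<^bsub>F3\<^esub> (cong_ker t \<inter> R)) \<le> 4 * 13 ^ (3 * t) * card (rcosets\<^bsub>F3\<^esub> R)"
proof -
  interpret group F3 by (rule group_F3)
  note b = rcosets_Int_bound[OF normal_cong_ker assms(1,2) card_normal_forms(1)[of t],
      of "coset_form t", OF coset_form(1)[OF assms(3)] coset_form_eq[OF assms(3)]]
  show "finite (rcosets\<^bsub>F3\<^esub> (cong_ker t \<inter> R))" by (rule b(1))
  have "card (rcosets\<^bsub>F3\<^esub> (cong_ker t \<inter> R)) \<le> card (normal_forms t) * card (rcosets\<^bsub>F3\<^esub> R)"
    by (rule b(2))
  also have "\<dots> \<le> 4 * 13 ^ (3 * t) * card (rcosets\<^bsub>F3\<^esub> R)"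
    by (intro mult_right_mono card_normal_forms(2)) simp
  finally show "card (rcosets\<^bsub>F3\<^esub> (cong_ker t \<inter> R)) \<le> 4 * 13 ^ (3 * t) * card (rcosets\<^bsub>F3\<^esub> R)" .
qed

text \<open>Equal products in the quotient are products in the free group that differ by an element
  of \<open>N\<close>. As \<open>N\<close> lies in \<open>cong_ker t\<close>, the count of kernel
  words bounds them, uniformly in \<open>R\<close>.\<close>

lemma card_equal_products_le:
  assumes R: "R \<lhd> F3" and t: "0 < t"
  defines "N \<equiv> cong_ker t \<inter> R"
  shows "real (card {p \<in> word_lists steps m \<times> word_lists steps m.
      list_prod (F3 Mod N) (map ((#>\<^bsub>F3\<^esub>) N) (fst p)) = list_prod (F3 Mod N) (map ((#>\<^bsub>F3\<^esub>) N) (snd p))})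
    \<le> real (card steps) ^ (2 * m) * (601 ^ (2 * m) / 5 ^ (600 * m))
      * (1 + real (m * 600) * (576 / 13 ^ (2 * t) * (5 ^ (m * 600) / 13 ^ t) powr (7 / 4)))"
proof -
  interpret group F3 by (rule group_F3)
  let ?W = "word_lists steps m"
  define s where "s = 1 / sqrt (5 :: real)"
  have s: "0 < s" "s\<^sup>2 = 1 / 5" by (simp_all add: s_def power_divide)
  have N: "N \<lhd> F3" unfolding N_def by (rule normal_Int[OF normal_cong_ker R])
  have lp: "list_prod F3 vs \<in> carrier F3" "set vs \<subseteq> carrier F3" if "vs \<in> ?W" for vs
    using that steps_F3 by (auto simp: word_lists_def intro!: list_prod_closed)
  have eq: "{p \<in> ?W \<times> ?W. list_prod (F3 Mod N) (map ((#>\<^bsub>F3\<^esub>) N) (fst p)) = list_prod (F3 Mod N) (map ((#>\<^bsub>F3\<^esub>) N) (snd p))}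
      = {p \<in> ?W \<times> ?W. \<exists>\<gamma>\<in>N. list_prod F3 (fst p) = \<gamma> \<otimes>\<^bsub>F3\<^esub> list_prod F3 (snd p)}"
  proof (rule Collect_cong, rule conj_cong[OF refl])
    fix p assume "p \<in> ?W \<times> ?W"
    then have p: "fst p \<in> ?W" "snd p \<in> ?W" by auto
    note l1 = lp[OF p(1)] and l2 = lp[OF p(2)]
    have "list_prod (F3 Mod N) (map ((#>\<^bsub>F3\<^esub>) N) (fst p)) = list_prod (F3 Mod N) (map ((#>\<^bsub>F3\<^esub>) N) (snd p))
      \<longleftrightarrow> list_prod F3 (fst p) \<otimes>\<^bsub>F3\<^esub> inv\<^bsub>F3\<^esub> list_prod F3 (snd p) \<in> N"
      by (simp add: list_prod_rcosets[OF N] l1 l2 eq_rcosets_iff[OF N])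
    also have "\<dots> \<longleftrightarrow> (\<exists>\<gamma>\<in>N. list_prod F3 (fst p) = \<gamma> \<otimes>\<^bsub>F3\<^esub> list_prod F3 (snd p))"
    proof
      assume "list_prod F3 (fst p) \<otimes>\<^bsub>F3\<^esub> inv\<^bsub>F3\<^esub> list_prod F3 (snd p) \<in> N"
      moreover have "list_prod F3 (fst p) = list_prod F3 (fst p) \<otimes>\<^bsub>F3\<^esub> inv\<^bsub>F3\<^esub> list_prod F3 (snd p) \<otimes>\<^bsub>F3\<^esub> list_prod F3 (snd p)"
        using l1(1) l2(1) by (simp add: m_assoc)
      ultimately show "\<exists>\<gamma>\<in>N. list_prod F3 (fst p) = \<gamma> \<otimes>\<^bsub>F3\<^esub> list_prod F3 (snd p)" by blast
    next
      assume "\<exists>\<gamma>\<in>N. list_prod F3 (fst p) = \<gamma> \<otimes>\<^bsub>F3\<^esub> list_prod F3 (snd p)"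
      then obtain \<gamma> where g: "\<gamma> \<in> N" "list_prod F3 (fst p) = \<gamma> \<otimes>\<^bsub>F3\<^esub> list_prod F3 (snd p)" by blast
      have "\<gamma> \<in> carrier F3" using g(1) N normal_imp_subgroup subgroup.subset by blast
      then show "list_prod F3 (fst p) \<otimes>\<^bsub>F3\<^esub> inv\<^bsub>F3\<^esub> list_prod F3 (snd p) \<in> N"
        using g l2(1) by (simp add: m_assoc)
    qed
    finally show "list_prod (F3 Mod N) (map ((#>\<^bsub>F3\<^esub>) N) (fst p)) = list_prod (F3 Mod N) (map ((#>\<^bsub>F3\<^esub>) N) (snd p))
      \<longleftrightarrow> (\<exists>\<gamma>\<in>N. list_prod F3 (fst p) = \<gamma> \<otimes>\<^bsub>F3\<^esub> list_prod F3 (snd p))" .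
  qed
  have Nsub: "N \<subseteq> carrier (free_group {0, 1, 2})"
    using N normal_imp_subgroup subgroup.subset unfolding F3_def by blast
  have "real (card {p \<in> ?W \<times> ?W. \<exists>\<gamma>\<in>N. list_prod F3 (fst p) = \<gamma> \<otimes>\<^bsub>F3\<^esub> list_prod F3 (snd p)})
    \<le> (real (Suc 600) * real (card steps) * s ^ 600) ^ (2 * m)
       * (\<Sum>\<gamma> | \<gamma> \<in> N \<and> length \<gamma> \<le> 2 * (m * 600). s ^ length \<gamma>)"
    unfolding F3_def by (rule card_word_list_pairs_le[OF _ _ _ _ _ Nsub]) (use s in auto)
  also have "\<dots> \<le> (real (Suc 600) * real (card steps) * s ^ 600) ^ (2 * m)
       * (\<Sum>\<gamma> | \<gamma> \<in> cong_ker t \<and> length \<gamma> \<le> 2 * (m * 600). s ^ length \<gamma>)"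
  proof (intro mult_left_mono sum_mono2)
    show "finite {\<gamma>. \<gamma> \<in> cong_ker t \<and> length \<gamma> \<le> 2 * (m * 600)}"
      by (rule finite_subset[OF _ finite_F3_length[of "2 * (m * 600)"]]) (auto simp: cong_ker_def)
  qed (use s in \<open>auto simp: N_def\<close>)
  also have "\<dots> \<le> (real (Suc 600) * real (card steps) * s ^ 600) ^ (2 * m)
      * (1 + real (m * 600) * (576 / 13 ^ (2 * t) * (5 ^ (m * 600) / 13 ^ t) powr (7 / 4)))"
    using s by (intro mult_left_mono sum_cong_ker_potential[OF t s]) auto
  also have "(real (Suc 600) * real (card steps) * s ^ 600) ^ (2 * m)
      = real (card steps) ^ (2 * m) * (601 ^ (2 * m) / 5 ^ (600 * m))"
  proof -
    have "(s ^ 600) ^ (2 * m) = (s\<^sup>2) ^ (600 * m)" by (simp only: power_mult[symmetric]) (simp add: mult_ac)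
    then show ?thesis by (simp add: power_mult_distrib s power_divide mult_ac)
  qed
  finally show ?thesis unfolding eq .
qed

text \<open>The index of \<open>R\<close> enters only through constants that a large
  \<open>t\<close> outweighs. Therefore a cover can be prescribed first and the congruence level
  chosen afterwards.\<close>

theorem relative_poincare:
  assumes R: "R \<lhd> F3" and fin: "finite (rcosets\<^bsub>F3\<^esub> R)"
  shows "\<exists>t0>0. \<forall>t\<ge>t0. \<exists>\<zeta>\<in>R. \<zeta> \<notin> cong_ker t \<and> (\<forall>p\<ge>1. \<forall>F :: _ \<Rightarrow> real.
    (\<Sum>X\<in>carrier (F3 Mod (cong_ker t \<inter> R)).
        \<bar>F (((cong_ker t \<inter> R) #>\<^bsub>F3\<^esub> \<zeta>) \<otimes>\<^bsub>F3 Mod (cong_ker t \<inter> R)\<^esub> X) - F X\<bar> powr p)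
    \<le> poincare_const p / real (card steps) * (\<Sum>(w, X)\<in>steps \<times> carrier (F3 Mod (cong_ker t \<inter> R)).
        \<bar>F X - F (X \<otimes>\<^bsub>F3 Mod (cong_ker t \<inter> R)\<^esub> ((cong_ker t \<inter> R) #>\<^bsub>F3\<^esub> w))\<bar> powr p))"
proof -
  interpret F: group F3 by (rule group_F3)
  obtain J where J: "\<And>t. J + 2 \<le> t \<Longrightarrow> \<exists>r\<in>R. \<exists>\<kappa> :: nat.
    (\<forall>k :: nat. r [^]\<^bsub>F3\<^esub> k \<in> cong_ker t \<longleftrightarrow> 13 ^ (t - J) dvd k) \<and>
    proj_cong t (word_quat ([(0, True)] \<otimes>\<^bsub>F3\<^esub> r)) (word_quat (r [^]\<^bsub>F3\<^esub> \<kappa> \<otimes>\<^bsub>F3\<^esub> [(0, True)])) \<and>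
    169 dvd int \<kappa> - 11"
    using metacyclic_pair[OF R fin] by blast
  define d where "d = card (rcosets\<^bsub>F3\<^esub> R)"
  have Rsub: "R \<subseteq> carrier F3" using R normal_imp_subgroup subgroup.subset by blast
  have "R #>\<^bsub>F3\<^esub> \<one>\<^bsub>F3\<^esub> \<in> rcosets\<^bsub>F3\<^esub> R" by (intro F.rcosetsI Rsub F.one_closed)
  then have d0: "0 < d" using fin by (auto simp: d_def card_gt_0_iff)
  \<comment> \<open>Chosen so that the bound \<open>4 * 13 ^ (3 * t) * d\<close> for the order of
    the quotient is \<open>K * 13 ^ (2 * t)\<close> times the multiplicity
    \<open>13 ^ (t - J - 1)\<close>.\<close>
  define K where "K = 4 * real d * 13 ^ (J + 1)"
  have K: "0 < K" using d0 by (simp add: K_def)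
  obtain t1 where t1: "\<And>t. t1 \<le> t \<Longrightarrow> \<exists>m>0. K * 13 ^ (2 * t) * (601 ^ (2 * m) * 4 ^ m / 5 ^ (600 * m))
      * (1 + real (m * 600) * (576 / 13 ^ (2 * t) * (5 ^ (m * 600) / 13 ^ t) powr (7 / 4))) \<le> 1"
    using walk_length_choice[OF K] by blast
  show ?thesis
  proof (rule exI[of _ "max t1 (J + 2)"], intro conjI allI impI)
    show "0 < max t1 (J + 2)" by simp
  next
    fix t assume t: "max t1 (J + 2) \<le> t"
    then have tJ: "J + 2 \<le> t" by simp
    define N where "N = cong_ker t \<inter> R"
    define H where "H = F3 Mod N"
    have N: "N \<lhd> F3" unfolding N_def by (rule F.normal_Int[OF normal_cong_ker R])
    interpret N: normal N F3 by (rule N)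
    interpret H: group H unfolding H_def by (rule N.factorgroup_is_group)
    have Hc: "N #>\<^bsub>F3\<^esub> x \<in> carrier H" if "x \<in> carrier F3" for x
      using that by (auto simp: H_def FactGroup_def RCOSETS_def)
    have Hm: "(N #>\<^bsub>F3\<^esub> x) \<otimes>\<^bsub>H\<^esub> (N #>\<^bsub>F3\<^esub> y) = N #>\<^bsub>F3\<^esub> (x \<otimes>\<^bsub>F3\<^esub> y)"
      if "x \<in> carrier F3" "y \<in> carrier F3" for x y
      using that by (simp add: H_def FactGroup_def N.rcos_sum)
    have H1: "\<one>\<^bsub>H\<^esub> = N" by (simp add: H_def FactGroup_def)
    have Hp: "(N #>\<^bsub>F3\<^esub> x) [^]\<^bsub>H\<^esub> (k :: nat) = N #>\<^bsub>F3\<^esub> (x [^]\<^bsub>F3\<^esub> k)" if "x \<in> carrier F3" for x k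
      by (induction k) (use that in \<open>auto simp: H1 Hm F.coset_mult_one N.subset\<close>)
    have Hone: "N #>\<^bsub>F3\<^esub> x = \<one>\<^bsub>H\<^esub> \<longleftrightarrow> x \<in> N" if "x \<in> carrier F3" for x
      unfolding H1 using that F.coset_join1 F.coset_join2 N.subset N.subgroup_axioms by blast
    have finH: "finite (carrier H)" and cardH: "real (card (carrier H)) \<le> 4 * 13 ^ (3 * t) * real d"
    proof -
      have "0 < t" using tJ by simp
      note b = finite_cong_ker_Int[OF R fin this]
      show "finite (carrier H)" using b(1) by (simp add: H_def N_def FactGroup_def)
      have "real (card (rcosets\<^bsub>F3\<^esub> (cong_ker t \<inter> R))) \<le> real (4 * 13 ^ (3 * t) * card (rcosets\<^bsub>F3\<^esub> R))"
        using b(2) by (simp only: of_nat_le_iff)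
      then show "real (card (carrier H)) \<le> 4 * 13 ^ (3 * t) * real d"
        by (simp add: H_def N_def FactGroup_def d_def)
    qed
    obtain r \<kappa> where r: "r \<in> R" "\<And>k :: nat. r [^]\<^bsub>F3\<^esub> k \<in> cong_ker t \<longleftrightarrow> 13 ^ (t - J) dvd k"
      and rk: "proj_cong t (word_quat ([(0, True)] \<otimes>\<^bsub>F3\<^esub> r)) (word_quat (r [^]\<^bsub>F3\<^esub> \<kappa> \<otimes>\<^bsub>F3\<^esub> [(0, True)]))"
      and k11: "169 dvd int \<kappa> - 11"
      using J[OF tJ] by blast
    have rc: "r \<in> carrier F3" using r(1) Rsub by blast
    have rR: "r [^]\<^bsub>F3\<^esub> (k :: nat) \<in> R" for k
      by (induction k) (use r(1) R normal_imp_subgroup in \<open>auto intro: subgroup.one_closed subgroup.m_closed\<close>)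
    define a where "a = [(0 :: nat, True)]"
    have ac: "a \<in> carrier F3" by (simp add: a_def carrier_F3 reduced_word_Cons)
    define s where "s = t - J"
    have s: "0 < s" using tJ by (simp add: s_def)
    define u where "u = N #>\<^bsub>F3\<^esub> r"
    \<comment> \<open>The last nontrivial power of \<open>r\<close> along powers of 13. A function
      of mean zero on its orbits has only components with \<open>b\<close> prime to 13.\<close>
    define \<zeta> where "\<zeta> = r [^]\<^bsub>F3\<^esub> (13 ^ (s - 1) :: nat)"
    have uc: "u \<in> carrier H" using Hc[OF rc] by (simp add: u_def)
    have u1: "u [^]\<^bsub>H\<^esub> (13 ^ s :: nat) = \<one>\<^bsub>H\<^esub>"
      unfolding u_def Hp[OF rc] using rR r(2)[of "13 ^ s"] rc by (subst Hone) (auto simp: N_def s_def)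
    have zeq: "u [^]\<^bsub>H\<^esub> (13 ^ (s - 1) :: nat) = N #>\<^bsub>F3\<^esub> \<zeta>" unfolding u_def \<zeta>_def by (rule Hp[OF rc])
    have au: "(N #>\<^bsub>F3\<^esub> a) \<otimes>\<^bsub>H\<^esub> u = u [^]\<^bsub>H\<^esub> \<kappa> \<otimes>\<^bsub>H\<^esub> (N #>\<^bsub>F3\<^esub> a)"
    proof -
      let ?x = "a \<otimes>\<^bsub>F3\<^esub> r" and ?y = "r [^]\<^bsub>F3\<^esub> \<kappa> \<otimes>\<^bsub>F3\<^esub> a"
      have xy: "?x \<in> carrier F3" "?y \<in> carrier F3" using ac rc by auto
      have "?x \<otimes>\<^bsub>F3\<^esub> inv\<^bsub>F3\<^esub> ?y \<in> cong_ker t"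
        using rk cong_ker_iff_cong[OF xy] by (simp add: a_def)
      \<comment> \<open>Modulo \<open>R\<close> the relation is automatic: \<open>r\<close> and its
        powers lie in the normal subgroup \<open>R\<close>, and both sides reduce to
        \<open>a\<close>.\<close>
      moreover have "?x \<otimes>\<^bsub>F3\<^esub> inv\<^bsub>F3\<^esub> ?y \<in> R"
      proof -
        have "?x \<otimes>\<^bsub>F3\<^esub> inv\<^bsub>F3\<^esub> ?y = (a \<otimes>\<^bsub>F3\<^esub> r \<otimes>\<^bsub>F3\<^esub> inv\<^bsub>F3\<^esub> a) \<otimes>\<^bsub>F3\<^esub> inv\<^bsub>F3\<^esub> (r [^]\<^bsub>F3\<^esub> \<kappa>)"
          using ac rc by (simp add: F.inv_mult_group F.m_assoc)
        moreover have "a \<otimes>\<^bsub>F3\<^esub> r \<otimes>\<^bsub>F3\<^esub> inv\<^bsub>F3\<^esub> a \<in> R" using R r(1) ac by (simp add: F.normal_inv_iff)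
        moreover have "inv\<^bsub>F3\<^esub> (r [^]\<^bsub>F3\<^esub> \<kappa>) \<in> R"
          by (rule subgroup.m_inv_closed[OF normal_imp_subgroup[OF R] rR])
        ultimately show ?thesis by (simp only: subgroup.m_closed[OF normal_imp_subgroup[OF R]])
      qed
      ultimately have "N #>\<^bsub>F3\<^esub> ?x = N #>\<^bsub>F3\<^esub> ?y" using F.eq_rcosets_iff[OF N xy] by (simp add: N_def)
      then show ?thesis unfolding u_def Hp[OF rc] using ac rc by (simp add: Hm)
    qed
    define D where "D = (13 :: nat) ^ (s - 1)"
    have Dinj: "i = i'" if "i < D" "i' < D" "[\<kappa> ^ i = \<kappa> ^ i'] (mod 13 ^ s)" for i i'
    proof -
      have aux: "j = j'" if "j \<le> j'" "j' < D" "[\<kappa> ^ j = \<kappa> ^ j'] (mod 13 ^ s)" for j j'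
      proof -
        have "D dvd j' - j" unfolding D_def by (rule power_kappa_cong[OF k11 that(3,1)])
        then show ?thesis using that by (metis diff_is_0_eq' dvd_imp_le le_antisym less_imp_diff_less not_less zero_less_diff)
      qed
      show ?thesis using aux[of i i'] aux[of i' i] that cong_sym by (metis nat_le_linear)
    qed
    let ?g = "\<lambda>w. N #>\<^bsub>F3\<^esub> w"
    have st: "finite steps" "steps \<noteq> {}" "?g ` steps \<subseteq> carrier H"
    proof -
      show fs: "finite steps" by (simp add: finite_sphere_words)
      show "steps \<noteq> {}" by (rule sphere_words_nonempty) auto
      show "?g ` steps \<subseteq> carrier H" using steps_F3 Hc by auto
    qed
    have sym: "bij_betw inv_word steps steps" "\<And>w. w \<in> steps \<Longrightarrow> ?g (inv_word w) = inv\<^bsub>H\<^esub> (?g w)"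
    proof -
      have i: "inv_word w \<in> steps" "inv_word (inv_word w) = w" if "w \<in> steps" for w
      proof -
        show "inv_word w \<in> steps" using that by (simp add: sphere_words_def inv_word_carrier)
        show "inv_word (inv_word w) = w" by (simp add: inv_word_def rev_map o_def)
      qed
      show "bij_betw inv_word steps steps"
        by (rule bij_betw_byWitness[where f' = inv_word]) (use i in auto)
      show "?g (inv_word w) = inv\<^bsub>H\<^esub> (?g w)" if "w \<in> steps" for w
      proof -
        have w: "w \<in> carrier F3" using that steps_F3 by simp
        have "inv_word w \<otimes>\<^bsub>F3\<^esub> w = \<one>\<^bsub>F3\<^esub>" using F.l_inv[OF w] inv_F3[OF w] by simp
        then have "?g (inv_word w) \<otimes>\<^bsub>H\<^esub> ?g w = \<one>\<^bsub>H\<^esub>"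
          using w F.inv_closed[OF w] by (simp add: inv_F3 Hm H1 F.coset_mult_one N.subset)
        then show ?thesis using w F.inv_closed[OF w] Hc by (intro H.inv_equality[symmetric]) (auto simp: inv_F3)
      qed
    qed
    obtain m where m: "0 < m" "K * 13 ^ (2 * t) * (601 ^ (2 * m) * 4 ^ m / 5 ^ (600 * m))
      * (1 + real (m * 600) * (576 / 13 ^ (2 * t) * (5 ^ (m * 600) / 13 ^ t) powr (7 / 4))) \<le> 1"
      using t1[of t] t by auto
    define X where "X = 1 + real (m * 600) * (576 / 13 ^ (2 * t) * (5 ^ (m * 600) / 13 ^ t) powr (7 / 4))"
    have X0: "0 \<le> X" unfolding X_def by (intro add_nonneg_nonneg mult_nonneg_nonneg divide_nonneg_nonneg) auto
    let ?\<mu> = "H.walk_weight steps ?g m"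
    have cs: "0 < real (card steps)" using st by (simp add: card_gt_0_iff)
    have wsum: "(\<Sum>h\<in>carrier H. (?\<mu> h)\<^sup>2) \<le> 601 ^ (2 * m) / 5 ^ (600 * m) * X"
    proof -
      have "0 < t" using tJ by simp
      from card_equal_products_le[OF R this, of m, folded N_def H_def X_def]
      have "real (card {p \<in> word_lists steps m \<times> word_lists steps m. list_prod H (map ?g (fst p)) = list_prod H (map ?g (snd p))})
          / real (card steps) ^ (2 * m) \<le> 601 ^ (2 * m) / 5 ^ (600 * m) * X"
        using cs by (simp add: divide_le_eq mult_ac)
      then show ?thesis unfolding H.sum_walk_weight_squared[OF finH st] .
    qed
    \<comment> \<open>Order, collision probability and multiplicity meet here; the choice of
      \<open>m\<close> leaves exactly the contraction \<open>(1 / 4) ^ m\<close> that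
      \<open>walk_gap\<close> turns into 1/4 for one step.\<close>
    have tight: "real (card (carrier H)) * (\<Sum>h\<in>carrier H. (?\<mu> h)\<^sup>2) \<le> (1 / 4) ^ m * real D"
    proof -
      have "real (card (carrier H)) * (\<Sum>h\<in>carrier H. (?\<mu> h)\<^sup>2)
          \<le> (4 * 13 ^ (3 * t) * real d) * (601 ^ (2 * m) / 5 ^ (600 * m) * X)"
        using cardH wsum X0 by (intro mult_mono) (auto intro: sum_nonneg)
      also have "\<dots> = (1 / 4) ^ m * real D * (K * 13 ^ (2 * t) * (601 ^ (2 * m) * 4 ^ m / 5 ^ (600 * m)) * X)"
      proof -
        have e: "(13 :: real) ^ (3 * t) = 13 ^ (s - 1) * 13 ^ (J + 1) * 13 ^ (2 * t)"
        proof -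
          have "3 * t = (s - 1) + (J + 1) + 2 * t" using tJ by (simp add: s_def)
          then show ?thesis by (simp only: power_add)
        qed
        have "(1 / 4) ^ m * 4 ^ m = (1 :: real)" by (simp flip: power_mult_distrib)
        then have "(1 / 4) ^ m * real D * (K * 13 ^ (2 * t) * (601 ^ (2 * m) * 4 ^ m / 5 ^ (600 * m)) * X)
            = real D * (K * 13 ^ (2 * t) * (601 ^ (2 * m) / 5 ^ (600 * m)) * X)"
        proof -
          have "c * D' * (K * Q * (A * c' / B) * X) = (c * c') * (D' * (K * Q * (A / B) * X))"
            for c c' D' Q A B :: real by simp
          then show ?thesis using \<open>(1 / 4) ^ m * 4 ^ m = (1 :: real)\<close> by simp
        qed
        then show ?thesis by (simp add: K_def D_def e)
      qed
      also have "\<dots> \<le> (1 / 4) ^ m * real D * 1"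
        using m(2) unfolding X_def[symmetric] by (intro mult_left_mono) auto
      finally show ?thesis by simp
    qed
    have gap: "norm2_on (carrier H) (H.walk steps ?g f) \<le> 1 / 4 * norm2_on (carrier H) f"
      if avg: "\<And>x. x \<in> carrier H \<Longrightarrow> (\<Sum>i<13. f ((N #>\<^bsub>F3\<^esub> \<zeta>) [^]\<^bsub>H\<^esub> (i :: nat) \<otimes>\<^bsub>H\<^esub> x)) = 0" for f
    proof (rule H.walk_gap[OF finH st sym m(1)])
      have "real D * norm2_on (carrier H) (H.conv ?\<mu> f)
          \<le> real (card (carrier H)) * (\<Sum>h\<in>carrier H. (?\<mu> h)\<^sup>2) * norm2_on (carrier H) f"
        by (rule H.conv_quasirandom[OF finH uc u1 s Hc[OF ac] au Dinj])
          (assumption | (unfold zeq, rule avg, assumption))+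
      also have "\<dots> \<le> (1 / 4) ^ m * real D * norm2_on (carrier H) f"
        using tight by (intro mult_right_mono) auto
      finally have "real D * norm2_on (carrier H) (H.conv ?\<mu> f) \<le> real D * ((1 / 4) ^ m * norm2_on (carrier H) f)"
        by (simp add: mult_ac)
      then have "norm2_on (carrier H) (H.conv ?\<mu> f) \<le> (1 / 4) ^ m * norm2_on (carrier H) f"
        by (simp add: D_def)
      moreover have "norm2_on (carrier H) ((H.walk steps ?g ^^ m) f) = norm2_on (carrier H) (H.conv ?\<mu> f)"
        unfolding norm2_on_def by (intro sum.cong refl) (simp only: H.walk_power_eq_conv[OF finH st])
      ultimately show "norm2_on (carrier H) ((H.walk steps ?g ^^ m) f) \<le> (1 / 4) ^ m * norm2_on (carrier H) f"
        by simp
    qed auto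
    have zc: "\<zeta> \<in> carrier F3" using rc by (simp add: \<zeta>_def)
    have z13: "(N #>\<^bsub>F3\<^esub> \<zeta>) [^]\<^bsub>H\<^esub> (13 :: nat) = \<one>\<^bsub>H\<^esub>"
    proof -
      have "(u [^]\<^bsub>H\<^esub> (13 ^ (s - 1) :: nat)) [^]\<^bsub>H\<^esub> (13 :: nat) = u [^]\<^bsub>H\<^esub> (13 ^ s :: nat)"
        using uc s by (simp add: H.nat_pow_pow power_eq_if[of 13 s] mult.commute)
      then show ?thesis using zeq u1 by simp
    qed
    have "\<zeta> \<notin> cong_ker t"
      unfolding \<zeta>_def r(2) s_def[symmetric] using s by (simp add: nat_dvd_not_less power_strict_increasing)
    moreover have "\<zeta> \<in> R" unfolding \<zeta>_def by (rule rR)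
    moreover have "(\<Sum>X\<in>carrier H. \<bar>F ((N #>\<^bsub>F3\<^esub> \<zeta>) \<otimes>\<^bsub>H\<^esub> X) - F X\<bar> powr p)
      \<le> poincare_const p / real (card steps) * (\<Sum>(w, X)\<in>steps \<times> carrier H. \<bar>F X - F (X \<otimes>\<^bsub>H\<^esub> (N #>\<^bsub>F3\<^esub> w))\<bar> powr p)"
      if "1 \<le> p" for p and F :: "(nat \<times> bool) list set \<Rightarrow> real"
      by (rule H.poincare_powr[OF finH st Hc[OF zc] z13 gap that]) auto
    ultimately show "\<exists>\<zeta>\<in>R. \<zeta> \<notin> cong_ker t \<and> (\<forall>p\<ge>1. \<forall>F :: _ \<Rightarrow> real.
      (\<Sum>X\<in>carrier (F3 Mod (cong_ker t \<inter> R)).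
        \<bar>F (((cong_ker t \<inter> R) #>\<^bsub>F3\<^esub> \<zeta>) \<otimes>\<^bsub>F3 Mod (cong_ker t \<inter> R)\<^esub> X) - F X\<bar> powr p)
      \<le> poincare_const p / real (card steps) * (\<Sum>(w, X)\<in>steps \<times> carrier (F3 Mod (cong_ker t \<inter> R)).
        \<bar>F X - F (X \<otimes>\<^bsub>F3 Mod (cong_ker t \<inter> R)\<^esub> ((cong_ker t \<inter> R) #>\<^bsub>F3\<^esub> w))\<bar> powr p))"
      unfolding H_def N_def by blast
  qed
qed

section \<open>Random cuts\<close>

definition sdiff :: "'e set \<Rightarrow> 'e set \<Rightarrow> 'e set" where
  "sdiff A B = (A - B) \<union> (B - A)"

lemma finite_sdiff [simp]: "finite A \<Longrightarrow> finite B \<Longrightarrow> finite (sdiff A B)"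
  by (simp add: sdiff_def)

lemma even_card_sdiff:
  assumes "finite A" "finite B"
  shows "even (card (sdiff A B)) \<longleftrightarrow> (even (card A) \<longleftrightarrow> even (card B))"
proof -
  have "card (sdiff A B) = card (A - B) + card (B - A)"
    unfolding sdiff_def using assms by (intro card_Un_disjoint) auto
  moreover have "card A = card (A - B) + card (A \<inter> B)" "card B = card (B - A) + card (A \<inter> B)"
    using assms card_Diff_subset_Int[of A B] card_Diff_subset_Int[of B A]
      card_Int_Diff[of A B] card_Int_Diff[of B A] by (simp_all add: Int_commute)
  ultimately show ?thesis by presburger
qed

lemma odd_card_Int_sdiff:
  assumes "finite A" "finite B"
  shows "odd (card (T \<inter> sdiff A B)) \<longleftrightarrow> (odd (card (T \<inter> A)) \<noteq> odd (card (T \<inter> B)))"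
proof -
  have "T \<inter> sdiff A B = sdiff (T \<inter> A) (T \<inter> B)" by (auto simp: sdiff_def)
  then show ?thesis using even_card_sdiff[of "T \<inter> A" "T \<inter> B"] assms by simp
qed

definition cut_weight :: "real \<Rightarrow> 'e set \<Rightarrow> 'e set \<Rightarrow> real" where
  "cut_weight t E T = t ^ card T * (1 - t) ^ card (E - T)"

text \<open>The expectation factorises over the walls: a wall in \<open>D\<close> contributes
  \<open>- t + (1 - t)\<close>, every other one \<open>t + (1 - t)\<close>.\<close>

lemma sum_cut_weight_sign:
  assumes "finite E" "D \<subseteq> E"
  shows "(\<Sum>T\<in>Pow E. cut_weight t E T * (- 1) ^ card (T \<inter> D)) = (1 - 2 * t) ^ card D"
proof -
  have fD: "finite D" using assms finite_subset by blast
  have "(\<Prod>e\<in>E. (if e \<in> D then - t else t) + (1 - t))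
      = (\<Sum>T\<in>Pow E. (\<Prod>e\<in>T. if e \<in> D then - t else t) * (\<Prod>e\<in>E - T. 1 - t))"
    by (rule prod_add[OF assms(1)])
  also have "\<dots> = (\<Sum>T\<in>Pow E. cut_weight t E T * (- 1) ^ card (T \<inter> D))"
  proof (rule sum.cong[OF refl])
    fix T assume "T \<in> Pow E"
    then have fT: "finite T" using assms(1) finite_subset by blast
    have "(\<Prod>e\<in>T. if e \<in> D then - t else t) = (\<Prod>e\<in>T. t * (if e \<in> D then - 1 else 1))"
      by (rule prod.cong) auto
    also have "\<dots> = t ^ card T * (\<Prod>e\<in>T. if e \<in> D then - 1 else 1)" by (simp add: prod.distrib)
    also have "(\<Prod>e\<in>T. if e \<in> D then - 1 else 1 :: real) = (- 1) ^ card (T \<inter> D)"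
      using fT by (simp add: prod.If_cases Int_def)
    finally show "(\<Prod>e\<in>T. if e \<in> D then - t else t) * (\<Prod>e\<in>E - T. 1 - t)
        = cut_weight t E T * (- 1) ^ card (T \<inter> D)" by (simp add: cut_weight_def)
  qed
  also have "(\<Prod>e\<in>E. (if e \<in> D then - t else t) + (1 - t)) = (\<Prod>e\<in>E. if e \<in> D then 1 - 2 * t else 1)"
    by (rule prod.cong) auto
  also have "\<dots> = (1 - 2 * t) ^ card D"
    using assms by (simp add: prod.If_cases Int_absorb1)
  finally show ?thesis by simp
qed

lemma sum_cut_weight: "finite E \<Longrightarrow> (\<Sum>T\<in>Pow E. cut_weight t E T) = 1"
  using sum_cut_weight_sign[of E "{}" t] by simp

lemma cut_probability:
  assumes "finite E" "D \<subseteq> E"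
  shows "(\<Sum>T\<in>Pow E. cut_weight t E T * (if odd (card (T \<inter> D)) then 1 else 0)) = (1 - (1 - 2 * t) ^ card D) / 2"
proof -
  have "(if odd (card (T \<inter> D)) then 1 else 0) = (1 - (- 1) ^ card (T \<inter> D)) / (2 :: real)" for T by simp
  then have "(\<Sum>T\<in>Pow E. cut_weight t E T * (if odd (card (T \<inter> D)) then 1 else 0))
      = (\<Sum>T\<in>Pow E. (cut_weight t E T - cut_weight t E T * (- 1) ^ card (T \<inter> D)) / 2)"
    by (intro sum.cong refl) (simp only: right_diff_distrib times_divide_eq_right mult_1_right)
  also have "\<dots> = (1 - (1 - 2 * t) ^ card D) / 2"
    unfolding sum_divide_distrib[symmetric] sum_subtractf sum_cut_weight[OF assms(1)] sum_cut_weight_sign[OF assms] ..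
  finally show ?thesis .
qed

text \<open>Each wall is selected independently with probability \<open>t\<close>, and the cut consists of the points
  lying on an odd number of selected walls: far apart points are separated with probability close to
  one half, nearby points rarely.\<close>

lemma exists_cut:
  fixes p :: "'v \<Rightarrow> real" and v :: "'v \<Rightarrow> 'e set"
  assumes V: "finite V" and p: "\<And>x. x \<in> V \<Longrightarrow> 0 \<le> p x" and m: "m = (\<Sum>x\<in>V. p x)" "0 < m"
    and v: "\<And>x. x \<in> V \<Longrightarrow> finite (v x)"
    and Nb: "\<And>x. x \<in> V \<Longrightarrow> Nb x \<subseteq> V" "\<And>x. x \<in> V \<Longrightarrow> real (card (Nb x)) \<le> K"
      "\<And>x y. x \<in> V \<Longrightarrow> y \<in> Nb x \<Longrightarrow> real (card (sdiff (v x) (v y))) \<le> L"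
    and KL: "0 < K" "0 < L" and t: "0 < t" "t \<le> 1 / 2" "(1 - 2 * t) ^ r \<le> 1 / 2" and e: "0 < \<epsilon>"
    and far: "\<And>x. x \<in> V \<Longrightarrow> \<epsilon> * m \<le> (\<Sum>y | y \<in> V \<and> r \<le> card (sdiff (v x) (v y)). p y)"
  shows "\<exists>A\<subseteq>V. \<epsilon> * m\<^sup>2 / 16 \<le> sum p A * sum p (V - A) \<and>
    sum p {x \<in> V. \<exists>y\<in>Nb x. (x \<in> A) \<noteq> (y \<in> A)} \<le> 4 * K * L * t / \<epsilon> * m"
proof -
  define E where "E = (\<Union>x\<in>V. v x)"
  have fE: "finite E" unfolding E_def using V v by blast
  define D where "D x y = sdiff (v x) (v y)" for x y
  have DE: "D x y \<subseteq> E" if "x \<in> V" "y \<in> V" for x y using that by (auto simp: D_def E_def sdiff_def)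
  let ?w = "cut_weight t E"
  have w0: "0 \<le> ?w T" for T using t by (simp add: cut_weight_def)
  define A where "A T = {x \<in> V. odd (card (T \<inter> v x))}" for T
  have sep: "odd (card (T \<inter> D x y)) \<longleftrightarrow> (x \<in> A T) \<noteq> (y \<in> A T)" if "x \<in> V" "y \<in> V" for T x y
    using odd_card_Int_sdiff[OF v[OF that(1)] v[OF that(2)]] that by (simp add: A_def D_def)
  define b where "b T x y = (if odd (card (T \<inter> D x y)) then 1 else 0 :: real)" for T x y
  have b0: "0 \<le> b T x y" for T x y by (simp add: b_def)
  define P where "P x y = (\<Sum>T\<in>Pow E. ?w T * b T x y)" for x y
  have P: "P x y = (1 - (1 - 2 * t) ^ card (D x y)) / 2" if "x \<in> V" "y \<in> V" for x y
    unfolding P_def b_def by (rule cut_probability[OF fE DE[OF that]])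
  have P0: "0 \<le> P x y" for x y unfolding P_def using w0 b0 by (intro sum_nonneg mult_nonneg_nonneg)
  have Pnear: "P x y \<le> t * L" if "x \<in> V" "y \<in> Nb x" for x y
  proof -
    have y: "y \<in> V" using Nb(1) that by blast
    have "1 + real (card (D x y)) * (- (2 * t)) \<le> (1 + (- (2 * t))) ^ card (D x y)"
      by (rule Bernoulli_inequality) (use t in simp)
    then have "1 - 2 * (t * real (card (D x y))) \<le> (1 - 2 * t) ^ card (D x y)" by (simp add: mult.left_commute mult.commute)
    then have "P x y \<le> t * real (card (D x y))" unfolding P[OF that(1) y] by (simp add: field_simps)
    also have "\<dots> \<le> t * L" using Nb(3)[OF that] t by (intro mult_left_mono) (auto simp: D_def)
    finally show ?thesis .
  qed
  have Pfar: "1 / 4 \<le> P x y" if "x \<in> V" "y \<in> V" "r \<le> card (D x y)" for x y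
  proof -
    have "(1 - 2 * t) ^ card (D x y) \<le> (1 - 2 * t) ^ r" using that(3) t by (intro power_decreasing) auto
    then show ?thesis using P[OF that(1,2)] t(3) by simp
  qed
  \<comment> \<open>The factor 2 makes this the mass of the ordered pairs that the cut
    separates.\<close>
  define Q where "Q T = 2 * (sum p (A T) * sum p (V - A T))" for T
  define Bd where "Bd T = {x \<in> V. \<exists>y\<in>Nb x. (x \<in> A T) \<noteq> (y \<in> A T)}" for T
  have Q: "Q T = (\<Sum>x\<in>V. \<Sum>y\<in>V. p x * p y * b T x y)" for T
  proof -
    have AV: "A T \<subseteq> V" by (auto simp: A_def)
    let ?i = "\<lambda>x. if x \<in> A T then 1 else 0 :: real"
    have sA: "sum p (A T) = (\<Sum>x\<in>V. p x * ?i x)"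
      using V AV by (simp add: if_distrib[of "(*) _"] sum.If_cases Int_absorb1 cong: if_cong)
    have sC: "sum p (V - A T) = (\<Sum>x\<in>V. p x * (1 - ?i x))"
    proof -
      have "(\<Sum>x\<in>V. p x * (1 - ?i x)) = (\<Sum>x\<in>V. if x \<in> V - A T then p x else 0)" by (rule sum.cong) auto
      also have "\<dots> = sum p (V \<inter> (V - A T))" using V by (rule sum.inter_restrict[symmetric])
      also have "V \<inter> (V - A T) = V - A T" by auto
      finally show ?thesis by simp
    qed
    have "p x * p y * b T x y = (p x * ?i x) * (p y * (1 - ?i y)) + (p x * (1 - ?i x)) * (p y * ?i y)"
      if "x \<in> V" "y \<in> V" for x y
      using sep[OF that, of T] by (auto simp: b_def)
    then have "(\<Sum>x\<in>V. \<Sum>y\<in>V. p x * p y * b T x y)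
        = (\<Sum>x\<in>V. \<Sum>y\<in>V. (p x * ?i x) * (p y * (1 - ?i y)) + (p x * (1 - ?i x)) * (p y * ?i y))"
      by (intro sum.cong refl)
    also have "\<dots> = (\<Sum>x\<in>V. p x * ?i x) * (\<Sum>y\<in>V. p y * (1 - ?i y)) + (\<Sum>x\<in>V. p x * (1 - ?i x)) * (\<Sum>y\<in>V. p y * ?i y)"
      by (simp only: sum.distrib sum_product)
    also have "\<dots> = Q T" by (simp only: sA[symmetric] sC[symmetric] Q_def) simp
    finally show ?thesis by simp
  qed
  have EQ: "\<epsilon> * m\<^sup>2 / 4 \<le> (\<Sum>T\<in>Pow E. ?w T * Q T)"
  proof -
    have "(\<Sum>T\<in>Pow E. ?w T * Q T) = (\<Sum>T\<in>Pow E. \<Sum>x\<in>V. \<Sum>y\<in>V. p x * p y * (?w T * b T x y))"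
      unfolding Q sum_distrib_left by (intro sum.cong refl) simp
    also have "\<dots> = (\<Sum>x\<in>V. \<Sum>T\<in>Pow E. \<Sum>y\<in>V. p x * p y * (?w T * b T x y))" by (rule sum.swap)
    also have "\<dots> = (\<Sum>x\<in>V. \<Sum>y\<in>V. \<Sum>T\<in>Pow E. p x * p y * (?w T * b T x y))"
      by (intro sum.cong refl sum.swap)
    also have "\<dots> = (\<Sum>x\<in>V. \<Sum>y\<in>V. p x * p y * P x y)" by (simp only: P_def sum_distrib_left)
    also have "\<dots> \<ge> (\<Sum>x\<in>V. p x * (\<epsilon> * m / 4))"
    proof (rule sum_mono)
      fix x assume x: "x \<in> V"
      have "\<epsilon> * m / 4 \<le> (\<Sum>y | y \<in> V \<and> r \<le> card (D x y). p y) / 4"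
        using far[OF x] by (simp add: D_def)
      also have "\<dots> = (\<Sum>y | y \<in> V \<and> r \<le> card (D x y). p y * (1 / 4))" by (simp add: sum_divide_distrib)
      also have "\<dots> \<le> (\<Sum>y | y \<in> V \<and> r \<le> card (D x y). p y * P x y)"
        using Pfar[OF x] p by (intro sum_mono mult_left_mono) auto
      also have "\<dots> \<le> (\<Sum>y\<in>V. p y * P x y)"
        using V P0 p by (intro sum_mono2) auto
      finally have "p x * (\<epsilon> * m / 4) \<le> p x * (\<Sum>y\<in>V. p y * P x y)" using p[OF x] by (intro mult_left_mono)
      then show "p x * (\<epsilon> * m / 4) \<le> (\<Sum>y\<in>V. p x * p y * P x y)" by (simp add: sum_distrib_left mult.assoc)
    qed
    also have "(\<Sum>x\<in>V. p x * (\<epsilon> * m / 4)) = sum p V * (\<epsilon> * m / 4)" by (rule sum_distrib_right[symmetric])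
    also have "\<dots> = \<epsilon> * m\<^sup>2 / 4" by (simp add: m(1) power2_eq_square)
    finally show ?thesis .
  qed
  have EB: "(\<Sum>T\<in>Pow E. ?w T * sum p (Bd T)) \<le> K * L * t * m"
  proof -
    have "sum p (Bd T) \<le> (\<Sum>x\<in>V. p x * (\<Sum>y\<in>Nb x. b T x y))" for T
    proof -
      have "sum p (Bd T) \<le> (\<Sum>x\<in>Bd T. p x * (\<Sum>y\<in>Nb x. b T x y))"
      proof (rule sum_mono)
        fix x assume x: "x \<in> Bd T"
        then obtain y where y: "y \<in> Nb x" "(x \<in> A T) \<noteq> (y \<in> A T)" and xV: "x \<in> V" by (auto simp: Bd_def)
        then have "b T x y = 1" using sep[OF xV, of y T] Nb(1)[OF xV] by (auto simp: b_def)
        moreover have "finite (Nb x)" using Nb(1)[OF xV] V finite_subset by blast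
        ultimately have "1 \<le> (\<Sum>y\<in>Nb x. b T x y)" using member_le_sum[of y "Nb x" "b T x"] y(1) b0 by simp
        then show "p x \<le> p x * (\<Sum>y\<in>Nb x. b T x y)" using mult_left_mono[of 1 _ "p x"] p[OF xV] by simp
      qed
      also have "\<dots> \<le> (\<Sum>x\<in>V. p x * (\<Sum>y\<in>Nb x. b T x y))"
        using V p b0 by (intro sum_mono2) (auto simp: Bd_def intro!: mult_nonneg_nonneg sum_nonneg)
      finally show ?thesis .
    qed
    then have "(\<Sum>T\<in>Pow E. ?w T * sum p (Bd T)) \<le> (\<Sum>T\<in>Pow E. ?w T * (\<Sum>x\<in>V. p x * (\<Sum>y\<in>Nb x. b T x y)))"
      using w0 by (intro sum_mono mult_left_mono)
    also have "\<dots> = (\<Sum>T\<in>Pow E. \<Sum>x\<in>V. p x * (\<Sum>y\<in>Nb x. ?w T * b T x y))"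
      unfolding sum_distrib_left by (intro sum.cong refl) simp
    also have "\<dots> = (\<Sum>x\<in>V. \<Sum>T\<in>Pow E. p x * (\<Sum>y\<in>Nb x. ?w T * b T x y))" by (rule sum.swap)
    also have "\<dots> = (\<Sum>x\<in>V. p x * (\<Sum>y\<in>Nb x. P x y))"
      unfolding P_def by (simp only: sum.swap[of _ "Pow E"] sum_distrib_left[symmetric])
    also have "\<dots> \<le> (\<Sum>x\<in>V. p x * (K * (t * L)))"
    proof (intro sum_mono mult_left_mono)
      fix x assume x: "x \<in> V"
      have "(\<Sum>y\<in>Nb x. P x y) \<le> (\<Sum>y\<in>Nb x. t * L)" by (rule sum_mono) (rule Pnear[OF x])
      also have "\<dots> = real (card (Nb x)) * (t * L)" by simp
      also have "\<dots> \<le> K * (t * L)" using Nb(2)[OF x] t KL by (intro mult_right_mono) auto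
      finally show "(\<Sum>y\<in>Nb x. P x y) \<le> K * (t * L)" .
    qed (rule p)
    also have "\<dots> = sum p V * (K * (t * L))" by (rule sum_distrib_right[symmetric])
    also have "\<dots> = K * L * t * m" by (simp add: m(1))
    finally show ?thesis .
  qed
  \<comment> \<open>A multiplier: scaled by \<open>l\<close>, the expected boundary uses up at most
    half of the lower bound \<open>EQ\<close> for the expected separated mass, so some
    \<open>T\<close> retains the other half.\<close>
  define l where "l = \<epsilon> * m / (8 * K * L * t)"
  have l0: "0 < l" using e m KL t by (simp add: l_def)
  have "\<exists>T\<in>Pow E. \<epsilon> * m\<^sup>2 / 8 \<le> Q T - l * sum p (Bd T)"
  proof (rule ccontr)
    assume "\<not> ?thesis"
    then have lt: "Q T - l * sum p (Bd T) < \<epsilon> * m\<^sup>2 / 8" if "T \<in> Pow E" for T using that by (meson not_le)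
    have "(\<Sum>T\<in>Pow E. ?w T * (Q T - l * sum p (Bd T))) < (\<Sum>T\<in>Pow E. ?w T * (\<epsilon> * m\<^sup>2 / 8))"
    proof (rule sum_strict_mono_ex1)
      show "\<forall>T\<in>Pow E. ?w T * (Q T - l * sum p (Bd T)) \<le> ?w T * (\<epsilon> * m\<^sup>2 / 8)"
        using lt w0 by (blast intro: mult_left_mono less_imp_le)
      have "\<exists>T\<in>Pow E. ?w T \<noteq> 0"
      proof (rule ccontr)
        assume "\<not> (\<exists>T\<in>Pow E. ?w T \<noteq> 0)"
        then have "(\<Sum>T\<in>Pow E. ?w T) = 0" by (intro sum.neutral) blast
        then show False using sum_cut_weight[OF fE, of t] by simp
      qed
      then obtain T where "T \<in> Pow E" "?w T \<noteq> 0" by blast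
      then have "?w T * (Q T - l * sum p (Bd T)) < ?w T * (\<epsilon> * m\<^sup>2 / 8)"
        using w0[of T] by (intro mult_strict_left_mono lt) (auto simp: less_le)
      then show "\<exists>T\<in>Pow E. ?w T * (Q T - l * sum p (Bd T)) < ?w T * (\<epsilon> * m\<^sup>2 / 8)"
        using \<open>T \<in> Pow E\<close> by blast
    qed (use fE in simp)
    also have "\<dots> = \<epsilon> * m\<^sup>2 / 8" by (simp only: sum_distrib_right[symmetric] sum_cut_weight[OF fE] mult_1)
    also have "(\<Sum>T\<in>Pow E. ?w T * (Q T - l * sum p (Bd T)))
        = (\<Sum>T\<in>Pow E. ?w T * Q T) - l * (\<Sum>T\<in>Pow E. ?w T * sum p (Bd T))"
      unfolding right_diff_distrib sum_subtractf sum_distrib_left by (simp add: mult.left_commute)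
    finally have "(\<Sum>T\<in>Pow E. ?w T * Q T) - l * (\<Sum>T\<in>Pow E. ?w T * sum p (Bd T)) < \<epsilon> * m\<^sup>2 / 8" .
    moreover have "l * (\<Sum>T\<in>Pow E. ?w T * sum p (Bd T)) \<le> l * (K * L * t * m)"
      using EB l0 by (intro mult_left_mono) auto
    moreover have "l * (K * L * t * m) = \<epsilon> * m\<^sup>2 / 8"
      using KL t by (simp add: l_def power2_eq_square field_simps)
    ultimately show False using EQ by linarith
  qed
  then obtain T where T: "\<epsilon> * m\<^sup>2 / 8 \<le> Q T - l * sum p (Bd T)" by blast
  have AV: "A T \<subseteq> V" by (auto simp: A_def)
  have B0: "0 \<le> sum p (Bd T)" using p by (intro sum_nonneg) (auto simp: Bd_def)
  have "0 \<le> l * sum p (Bd T)" using l0 B0 by simp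
  then have 1: "\<epsilon> * m\<^sup>2 / 16 \<le> sum p (A T) * sum p (V - A T)" using T by (simp add: Q_def)
  have ms: "sum p (A T) + sum p (V - A T) = m"
    using sum.subset_diff[OF AV V, of p] m(1) by simp
  \<comment> \<open>The separated mass has this bound for any cut; hence a positive difference also
    limits the boundary of the chosen one.\<close>
  have "Q T \<le> m\<^sup>2 / 2"
  proof -
    have "0 \<le> (sum p (A T) - sum p (V - A T))\<^sup>2" by simp
    then show ?thesis unfolding Q_def ms[symmetric] by (simp add: power2_eq_square algebra_simps)
  qed
  moreover have "0 < \<epsilon> * m\<^sup>2 / 8" using e m by simp
  ultimately have "l * sum p (Bd T) \<le> m\<^sup>2 / 2" using T by linarith
  then have "sum p (Bd T) \<le> m\<^sup>2 / 2 / l" using l0 by (simp add: field_simps)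
  also have "m\<^sup>2 / 2 / l = 4 * K * L * t / \<epsilon> * m"
    using e m KL t by (simp add: l_def power2_eq_square field_simps)
  finally have 2: "sum p (Bd T) \<le> 4 * K * L * t / \<epsilon> * m" .
  show ?thesis using AV 1 2 by (intro exI[of _ "A T"]) (simp add: Bd_def)
qed

text \<open>Items are added until the threshold \<open>s\<close> is reached; the last one overshoots
  by at most \<open>h\<close>.\<close>

lemma exists_balanced_union:
  fixes p :: "'i \<Rightarrow> real"
  assumes I: "finite I" and p: "\<And>i. i \<in> I \<Longrightarrow> 0 \<le> p i" "\<And>i. i \<in> I \<Longrightarrow> p i \<le> h" and s: "s \<le> sum p I" "0 \<le> s"
    and h: "0 \<le> h"
  shows "\<exists>J\<subseteq>I. s \<le> sum p J \<and> sum p J \<le> s + h"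
  using I p s(1)
proof (induction I rule: finite_induct)
  case empty
  have "s = 0" using empty(3) s(2) by (simp only: sum.empty)
  then show ?case using h by (intro exI[of _ "{}"]) simp
next
  case (insert i I)
  have si: "sum p (insert i I) = p i + sum p I" using insert.hyps by (rule sum.insert)
  show ?case
  proof (cases "s \<le> sum p I")
    case True
    then have "\<exists>J\<subseteq>I. s \<le> sum p J \<and> sum p J \<le> s + h"
      by (intro insert.IH insert.prems(1,2)) simp_all
    then show ?thesis by (meson subset_insertI2)
  next
    case False
    have "p i \<le> h" by (rule insert.prems(2)) simp
    then have "s \<le> sum p (insert i I)" "sum p (insert i I) \<le> s + h"
      using insert.prems(3) False unfolding si by linarith+
    then show ?thesis by (intro exI[of _ "insert i I"]) simp
  qed
qed

section \<open>Spaces with walls contain no expanders\<close>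

text \<open>If every point had mass \<open>\<epsilon> * m\<close> at wall distance at least
  \<open>r\<close>, \<open>exists_cut\<close> would apply. The smaller side of its cut has mass at
  least \<open>\<epsilon> / 16 * m\<close>, and \<open>small\<close> keeps the boundary below what
  expansion demands of that side.\<close>

lemma expander_concentration:
  fixes p :: "'v \<Rightarrow> real" and v :: "'v \<Rightarrow> 'e set"
  assumes V: "finite V" and p: "\<And>x. x \<in> V \<Longrightarrow> 0 \<le> p x" and m: "m = sum p V" "0 < m"
    and v: "\<And>x. x \<in> V \<Longrightarrow> finite (v x)"
    and Nb: "\<And>x. x \<in> V \<Longrightarrow> Nb x \<subseteq> V" "\<And>x. x \<in> V \<Longrightarrow> real (card (Nb x)) \<le> K"
      "\<And>x y. x \<in> V \<Longrightarrow> y \<in> Nb x \<Longrightarrow> real (card (sdiff (v x) (v y))) \<le> L"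
    and KL: "0 < K" "0 < L" and t: "0 < t" "t \<le> 1 / 2" "(1 - 2 * t) ^ r \<le> 1 / 2" and e: "0 < \<epsilon>" and c: "0 < c"
    and small: "4 * K * L * t / \<epsilon> \<le> c * (\<epsilon> / 16)"
    and expansion: "\<And>A. A \<subseteq> V \<Longrightarrow> \<epsilon> / 16 * m \<le> sum p A \<Longrightarrow> sum p A \<le> m / 2 \<Longrightarrow>
      c * sum p A < sum p {x \<in> V - A. \<exists>y\<in>Nb x. y \<in> A}"
  shows "\<exists>x\<in>V. (1 - \<epsilon>) * m < sum p {y \<in> V. card (sdiff (v x) (v y)) < r}"
proof (rule ccontr)
  assume contr: "\<not> ?thesis"
  have "\<epsilon> * m \<le> (\<Sum>y | y \<in> V \<and> r \<le> card (sdiff (v x) (v y)). p y)" if x: "x \<in> V" for x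
  proof -
    let ?N = "{y \<in> V. card (sdiff (v x) (v y)) < r}"
    have "V - ?N = {y. y \<in> V \<and> r \<le> card (sdiff (v x) (v y))}" by auto
    moreover have "sum p V = sum p (V - ?N) + sum p ?N" by (rule sum.subset_diff) (use V in auto)
    moreover have "sum p ?N \<le> m - \<epsilon> * m" using contr x by (auto simp: not_less left_diff_distrib)
    ultimately show ?thesis using m(1) by simp
  qed
  with V p m v Nb KL t e have "\<exists>A\<subseteq>V. \<epsilon> * m\<^sup>2 / 16 \<le> sum p A * sum p (V - A) \<and>
      sum p {x \<in> V. \<exists>y\<in>Nb x. (x \<in> A) \<noteq> (y \<in> A)} \<le> 4 * K * L * t / \<epsilon> * m"
    by (rule exists_cut)
  then obtain A where A: "A \<subseteq> V" "\<epsilon> * m\<^sup>2 / 16 \<le> sum p A * sum p (V - A)"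
    and bd: "sum p {x \<in> V. \<exists>y\<in>Nb x. (x \<in> A) \<noteq> (y \<in> A)} \<le> 4 * K * L * t / \<epsilon> * m" by auto
  have False if B: "B \<subseteq> V" "sum p B \<le> m / 2" "\<epsilon> * m\<^sup>2 / 16 \<le> sum p B * sum p (V - B)"
    "{x \<in> V - B. \<exists>y\<in>Nb x. y \<in> B} \<subseteq> {x \<in> V. \<exists>y\<in>Nb x. (x \<in> A) \<noteq> (y \<in> A)}" for B
  proof -
    have B0: "0 \<le> sum p B" using p B(1) by (intro sum_nonneg) auto
    have "sum p (V - B) \<le> m" unfolding m(1) using V p by (intro sum_mono2) auto
    then have "sum p B * sum p (V - B) \<le> sum p B * m" using B0 by (rule mult_left_mono)
    with B(3) have "(\<epsilon> / 16 * m) * m \<le> sum p B * m" by (simp add: power2_eq_square)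
    then have l: "\<epsilon> / 16 * m \<le> sum p B" using m(2) by (rule mult_right_le_imp_le)
    have "c * sum p B < sum p {x \<in> V - B. \<exists>y\<in>Nb x. y \<in> B}" by (rule expansion[OF B(1) l B(2)])
    also have "\<dots> \<le> sum p {x \<in> V. \<exists>y\<in>Nb x. (x \<in> A) \<noteq> (y \<in> A)}" using V p B(4) by (intro sum_mono2) auto
    also have "\<dots> \<le> c * (\<epsilon> / 16) * m" using bd small m(2) by (meson less_imp_le mult_right_mono order_trans)
    also have "\<dots> = c * (\<epsilon> / 16 * m)" by simp
    also have "\<dots> \<le> c * sum p B" using l c by (intro mult_left_mono) auto
    finally show False by simp
  qed
  note F = this
  have ms: "sum p A + sum p (V - A) = m" using sum.subset_diff[OF A(1) V, of p] m(1) by simp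
  show False
  proof (cases "sum p A \<le> m / 2")
    case True
    show False by (rule F[OF A(1) True A(2)]) auto
  next
    case False
    \<comment> \<open>The boundary in \<open>exists_cut\<close> does not distinguish the sides of
      the cut, so the complement can take the place of \<open>A\<close>.\<close>
    have VA: "V - (V - A) = A" using A(1) by auto
    show False
      by (rule F[of "V - A"]) (use False ms A Nb(1) in \<open>auto simp: VA mult.commute\<close>)
  qed
qed

text \<open>Otherwise components of mass at most \<open>m / 4\<close> can be united to a set of mass
  between \<open>m / 4\<close> and \<open>m / 2\<close>. Its neighbours lie outside
  \<open>A\<close>, where the mass is below \<open>c / 4 * m\<close>, too little for
  expansion.\<close>

lemma expander_large_component:
  fixes p :: "'v \<Rightarrow> real"
  assumes V: "finite V" and p: "\<And>x. x \<in> V \<Longrightarrow> 0 \<le> p x" and m: "m = sum p V" "0 < m"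
    and sym: "\<And>x y. x \<in> V \<Longrightarrow> y \<in> Nb x \<Longrightarrow> x \<in> Nb y"
    and c: "0 < c" "c \<le> 1" and A: "A \<subseteq> V" "(1 - c / 4) * m < sum p A"
    and expansion: "\<And>B. B \<subseteq> V \<Longrightarrow> 1 / 4 * m \<le> sum p B \<Longrightarrow> sum p B \<le> m / 2 \<Longrightarrow>
      c * sum p B < sum p {x \<in> V - B. \<exists>y\<in>Nb x. y \<in> B}"
  shows "\<exists>x\<in>A. m / 4 < sum p ({(x, y). x \<in> A \<and> y \<in> A \<and> y \<in> Nb x}\<^sup>* `` {x})"
proof (rule ccontr)
  assume contr: "\<not> ?thesis"
  let ?r = "{(x, y). x \<in> A \<and> y \<in> A \<and> y \<in> Nb x}"
  define C where "C x = ?r\<^sup>* `` {x}" for x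
  have fA: "finite A" using A(1) V finite_subset by blast
  have rs: "sym ?r"
  proof (rule symI)
    fix x y assume "(x, y) \<in> ?r"
    then show "(y, x) \<in> ?r" using sym[of x y] A(1) by auto
  qed
  have symC: "(y, x) \<in> ?r\<^sup>*" if "(x, y) \<in> ?r\<^sup>*" for x y
    using symD[OF sym_rtrancl[OF rs] that] .
  have CA: "C x \<subseteq> A" if "x \<in> A" for x
  proof
    fix y assume "y \<in> C x"
    then have "(x, y) \<in> ?r\<^sup>*" by (simp add: C_def)
    then show "y \<in> A" using that by (induction rule: rtrancl_induct) auto
  qed
  have Ceq: "C x = C y" if "y \<in> C x" for x y
  proof -
    have xy: "(x, y) \<in> ?r\<^sup>*" using that by (simp add: C_def)
    show ?thesis unfolding C_def Image_singleton
      using rtrancl_trans[OF xy] rtrancl_trans[OF symC[OF xy]] by (intro Collect_cong) (rule iffI)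
  qed
  have CI: "x \<in> C x" for x by (simp add: C_def)
  have UC: "\<Union> (C ` A) = A" using CA CI by blast
  have disj: "pairwise disjnt (C ` A)"
  proof (rule pairwiseI)
    fix i j assume "i \<in> C ` A" "j \<in> C ` A" "i \<noteq> j"
    then obtain x y where xy: "i = C x" "j = C y" "C x \<noteq> C y" by blast
    have "\<not> (z \<in> C x \<and> z \<in> C y)" for z using Ceq[of z x] Ceq[of z y] xy(3) by metis
    then show "disjnt i j" unfolding xy(1,2) disjnt_iff by blast
  qed
  have sumU: "sum p (\<Union> J) = sum (sum p) J" if "J \<subseteq> C ` A" for J
  proof -
    have 1: "\<forall>i\<in>J. finite i"
    proof
      fix i assume "i \<in> J"
      then have "i \<subseteq> A" using that CA by blast
      then show "finite i" using fA by (rule finite_subset)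
    qed
    have 2: "\<forall>i\<in>J. \<forall>j\<in>J. i \<noteq> j \<longrightarrow> i \<inter> j = {}"
      using pairwise_subset[OF disj that] by (simp add: pairwise_def disjnt_def)
    show ?thesis using sum.Union_disjoint[OF 1 2] by (simp add: comp_def)
  qed
  have "\<exists>J\<subseteq>C ` A. m / 4 \<le> sum (sum p) J \<and> sum (sum p) J \<le> m / 4 + m / 4"
  proof (rule exists_balanced_union[of "C ` A" "sum p" "m / 4" "m / 4"])
    show "finite (C ` A)" using fA by simp
    fix i assume "i \<in> C ` A"
    then obtain x where x: "x \<in> A" "i = C x" by blast
    show "0 \<le> sum p i" unfolding x(2) by (intro sum_nonneg p subsetD[OF A(1)] subsetD[OF CA[OF x(1)]])
    show "sum p i \<le> m / 4" using contr x(1) unfolding x(2) C_def by (meson not_le)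
  next
    have "m / 4 \<le> (1 - c / 4) * m" using c m(2) mult_right_mono[of "1 / 4" "1 - c / 4" m] by simp
    then show "m / 4 \<le> sum (sum p) (C ` A)" using A(2) sumU[of "C ` A"] UC by simp
  qed (use m(2) in simp_all)
  then obtain J where J: "J \<subseteq> C ` A" "m / 4 \<le> sum p (\<Union> J)" "sum p (\<Union> J) \<le> m / 2"
    using sumU by auto
  have JA: "\<Union> J \<subseteq> A" using J(1) UC by blast
  have "{x \<in> V - \<Union> J. \<exists>y\<in>Nb x. y \<in> \<Union> J} \<subseteq> V - A"
  proof
    fix x assume x: "x \<in> {x \<in> V - \<Union> J. \<exists>y\<in>Nb x. y \<in> \<Union> J}"
    then have xV: "x \<in> V" by simp
    obtain y i where y: "y \<in> Nb x" "y \<in> i" "i \<in> J" using x by blast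
    obtain z where z: "i = C z" "z \<in> A" using y(3) J(1) by blast
    have "x \<notin> A"
    proof
      assume "x \<in> A"
      moreover have "y \<in> A" using y JA by blast
      ultimately have "(y, x) \<in> ?r" using sym[OF xV y(1)] by simp
      then have "x \<in> C z" using y(2) unfolding z(1) C_def by (auto intro: rtrancl_into_rtrancl)
      then show False using x y(3) z(1) by blast
    qed
    then show "x \<in> V - A" using xV by simp
  qed
  then have "sum p {x \<in> V - \<Union> J. \<exists>y\<in>Nb x. y \<in> \<Union> J} \<le> sum p (V - A)"
    using V p by (intro sum_mono2) auto
  also have "\<dots> = m - sum p A" using sum.subset_diff[OF A(1) V, of p] m(1) by simp
  also have "\<dots> \<le> c / 4 * m" using A(2) by (simp add: left_diff_distrib)
  also have "\<dots> \<le> c * sum p (\<Union> J)" using J(2) c by (simp add: mult_left_mono)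
  also have "\<dots> < sum p {x \<in> V - \<Union> J. \<exists>y\<in>Nb x. y \<in> \<Union> J}"
    by (rule expansion) (use JA A(1) J in auto)
  finally show False by simp
qed

lemma card_sdiff_triangle:
  assumes "finite A" "finite B" "finite C"
  shows "card (sdiff A C) \<le> card (sdiff A B) + card (sdiff B C)"
proof -
  have "card (sdiff A C) \<le> card (sdiff A B \<union> sdiff B C)"
    by (rule card_mono) (use assms in \<open>auto simp: sdiff_def\<close>)
  also have "\<dots> \<le> card (sdiff A B) + card (sdiff B C)" by (rule card_Un_le)
  finally show ?thesis .
qed

lemma sdiff_commute: "sdiff A B = sdiff B A"
  by (auto simp: sdiff_def)

text \<open>Over a finite nonempty set the infimum is a minimum and hence attained. Nonemptiness
  matters, as the infimum of the empty set of reals is an arbitrary value.\<close>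

lemma outer_boundary_subset:
  assumes "finite A" "A \<noteq> {}"
  shows "outer_boundary X d R A \<subseteq> {x \<in> X - A. \<exists>y\<in>A. d x y \<le> R}"
proof
  fix x assume x: "x \<in> outer_boundary X d R A"
  have "(INF a\<in>A. d x a) = Min (d x ` A)" using assms by (intro cInf_eq_Min) auto
  also have "\<dots> \<in> d x ` A" using assms by (intro Min_in) auto
  finally show "x \<in> {x \<in> X - A. \<exists>y\<in>A. d x y \<le> R}" using x by (auto simp: outer_boundary_def)
qed

theorem no_weakly_contained_expanders:
  fixes Xs :: "nat \<Rightarrow> 'a set" and c :: "nat \<Rightarrow> 'a \<Rightarrow> 'e set" and g :: "nat \<Rightarrow> real"
  assumes cdu: "coarse_disjoint_union Xs ds X d" and fin: "\<And>n. finite (Xs n)"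
    and cf: "\<And>n x. x \<in> Xs n \<Longrightarrow> finite (c n x)"
    and c_le: "\<And>n x y. x \<in> Xs n \<Longrightarrow> y \<in> Xs n \<Longrightarrow> real (card (sdiff (c n x) (c n y))) \<le> ds n x y"
    and c_eq: "\<And>n x y. x \<in> Xs n \<Longrightarrow> y \<in> Xs n \<Longrightarrow> ds n x y < g n \<Longrightarrow> real (card (sdiff (c n x) (c n y))) = ds n x y"
    and g: "filterlim g at_top sequentially"
  shows "\<not> weakly_contains_some_expanders X d"
proof
  assume "weakly_contains_some_expanders X d"
  then obtain Z :: "nat \<Rightarrow> nat set" and dZ \<mu> f where exp: "measured_asymptotic_expanders Z dZ \<mu>"
    and geo: "uniformly_bounded_geometry Z dZ" and f: "measured_weak_embedding Z dZ \<mu> X d f"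
    by (auto simp: weakly_contains_some_expanders_def measured_weakly_contains_def)
  have fm: "finite (Z n)" "Metric_space (Z n) (dZ n)" "sets (\<mu> n) = Pow (Z n)"
      "finite_measure (\<mu> n)" "measure (\<mu> n) (Z n) > 0" for n
    using exp by (auto simp: measured_asymptotic_expanders_def finite_measured_metric_spaces_def less_le)
  obtain \<rho> where \<rho>: "\<And>n x y. x \<in> Z n \<Longrightarrow> y \<in> Z n \<Longrightarrow> d (f n x) (f n y) \<le> \<rho> (dZ n x y)"
      and \<rho>c: "control_function \<rho>"
    using f unfolding measured_weak_embedding_def by metis
  have fX: "f n x \<in> X" if "x \<in> Z n" for n x using f that by (auto simp: measured_weak_embedding_def)
  have lim: "(\<lambda>n. SUP x\<in>Z n. measure (\<mu> n) {y \<in> Z n. d (f n x) (f n y) \<le> R} / measure (\<mu> n) (Z n))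
      \<longlonglongrightarrow> 0" if "0 < R" for R
    using f that by (simp add: measured_weak_embedding_def)
  have X: "X = (SIGMA n:UNIV. Xs n)" and MX: "Metric_space X d"
    and dn: "\<And>n x y. x \<in> Xs n \<Longrightarrow> y \<in> Xs n \<Longrightarrow> d (n, x) (n, y) = ds n x y"
    and far: "\<And>R. \<exists>K. \<forall>n m. n \<noteq> m \<and> K \<le> n + m \<longrightarrow> (\<forall>x\<in>Xs n. \<forall>y\<in>Xs m. R \<le> d (n, x) (m, y))"
    using cdu by (auto simp: coarse_disjoint_union_def)
  interpret X: Metric_space X d by (rule MX)
  have meas: "measure (\<mu> n) A = (\<Sum>x\<in>A. measure (\<mu> n) {x})" if "A \<subseteq> Z n" for n A
    by (rule finite_measure.finite_measure_eq_sum_singleton[OF fm(4)])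
      (use that fm(3) finite_subset[OF that fm(1)] in auto)
  have \<rho>m: "\<rho> s \<le> \<rho> R" if "0 \<le> s" "s \<le> R" for s R
    using \<rho>c that unfolding control_function_def mono_on_def by auto
  have exp\<alpha>: "\<exists>c R. 0 < c \<and> c < 1 \<and> 0 < R \<and> (\<forall>n A. A \<subseteq> Z n \<longrightarrow>
      \<alpha> * measure (\<mu> n) (Z n) \<le> (\<Sum>x\<in>A. measure (\<mu> n) {x}) \<longrightarrow>
      (\<Sum>x\<in>A. measure (\<mu> n) {x}) \<le> measure (\<mu> n) (Z n) / 2 \<longrightarrow>
      c * (\<Sum>x\<in>A. measure (\<mu> n) {x}) < (\<Sum>x | x \<in> Z n - A \<and> (\<exists>y\<in>{y \<in> Z n. dZ n x y \<le> R}. y \<in> A). measure (\<mu> n) {x}))"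
    if \<alpha>: "0 < \<alpha>" "\<alpha> \<le> 1 / 2" for \<alpha>
  proof -
    obtain c R where cR: "0 < c" "c < 1" "0 < R"
      and *: "\<And>n A. A \<subseteq> Z n \<Longrightarrow> \<alpha> * measure (\<mu> n) (Z n) \<le> measure (\<mu> n) A \<Longrightarrow>
          measure (\<mu> n) A \<le> 1/2 * measure (\<mu> n) (Z n) \<Longrightarrow>
          measure (\<mu> n) (outer_boundary (Z n) (dZ n) R A) > c * measure (\<mu> n) A"
      using exp \<alpha> unfolding measured_asymptotic_expanders_def by metis
    have "c * (\<Sum>x\<in>A. measure (\<mu> n) {x}) < (\<Sum>x | x \<in> Z n - A \<and> (\<exists>y\<in>{y \<in> Z n. dZ n x y \<le> R}. y \<in> A). measure (\<mu> n) {x})"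
      if A: "A \<subseteq> Z n" "\<alpha> * measure (\<mu> n) (Z n) \<le> (\<Sum>x\<in>A. measure (\<mu> n) {x})"
        "(\<Sum>x\<in>A. measure (\<mu> n) {x}) \<le> measure (\<mu> n) (Z n) / 2" for n A
    proof -
      have "0 < \<alpha> * measure (\<mu> n) (Z n)" using \<alpha>(1) fm(5) by simp
      then have "A \<noteq> {}" using A(2) by auto
      moreover have "finite A" using A(1) fm(1) finite_subset by blast
      ultimately have "outer_boundary (Z n) (dZ n) R A \<subseteq> {x \<in> Z n - A. \<exists>y\<in>A. dZ n x y \<le> R}"
        by (intro outer_boundary_subset)
      also have "\<dots> \<subseteq> {x \<in> Z n - A. \<exists>y\<in>{y \<in> Z n. dZ n x y \<le> R}. y \<in> A}" using A(1) by blast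
      finally have sub: "outer_boundary (Z n) (dZ n) R A \<subseteq> {x \<in> Z n - A. \<exists>y\<in>{y \<in> Z n. dZ n x y \<le> R}. y \<in> A}" .
      have "c * measure (\<mu> n) A < measure (\<mu> n) (outer_boundary (Z n) (dZ n) R A)"
        by (rule *[OF A(1)]) (use A meas[OF A(1)] in simp_all)
      also have "\<dots> = (\<Sum>x\<in>outer_boundary (Z n) (dZ n) R A. measure (\<mu> n) {x})"
        by (rule meas) (auto simp: outer_boundary_def)
      also have "\<dots> \<le> (\<Sum>x | x \<in> Z n - A \<and> (\<exists>y\<in>{y \<in> Z n. dZ n x y \<le> R}. y \<in> A). measure (\<mu> n) {x})"
        using sub fm(1) by (intro sum_mono2) auto
      finally show ?thesis using meas[OF A(1)] by simp
    qed
    then show ?thesis using cR by blast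
  qed
  obtain c1 R1 where c1: "0 < c1" "c1 < 1" "0 < R1" and ex1: "\<And>n A. A \<subseteq> Z n \<Longrightarrow>
      1 / 4 * measure (\<mu> n) (Z n) \<le> (\<Sum>x\<in>A. measure (\<mu> n) {x}) \<Longrightarrow>
      (\<Sum>x\<in>A. measure (\<mu> n) {x}) \<le> measure (\<mu> n) (Z n) / 2 \<Longrightarrow>
      c1 * (\<Sum>x\<in>A. measure (\<mu> n) {x}) < (\<Sum>x | x \<in> Z n - A \<and> (\<exists>y\<in>{y \<in> Z n. dZ n x y \<le> R1}. y \<in> A). measure (\<mu> n) {x})"
    using exp\<alpha>[of "1 / 4"] by auto
  \<comment> \<open>The order of choices matters: expansion at scale 1/4 fixes \<open>c1\<close>;
    \<open>expander_large_component\<close> asks for concentration on all but the fraction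
    \<open>c1 / 4\<close> of the mass; expansion at the finer scale \<open>\<epsilon> / 16\<close>
    then fixes \<open>c2\<close>.\<close>
  define \<epsilon> where "\<epsilon> = c1 / 4"
  have e: "0 < \<epsilon>" "\<epsilon> < 1 / 4" using c1 by (auto simp: \<epsilon>_def)
  obtain c2 R2 where c2: "0 < c2" "c2 < 1" "0 < R2" and ex2: "\<And>n A. A \<subseteq> Z n \<Longrightarrow>
      \<epsilon> / 16 * measure (\<mu> n) (Z n) \<le> (\<Sum>x\<in>A. measure (\<mu> n) {x}) \<Longrightarrow>
      (\<Sum>x\<in>A. measure (\<mu> n) {x}) \<le> measure (\<mu> n) (Z n) / 2 \<Longrightarrow>
      c2 * (\<Sum>x\<in>A. measure (\<mu> n) {x}) < (\<Sum>x | x \<in> Z n - A \<and> (\<exists>y\<in>{y \<in> Z n. dZ n x y \<le> R2}. y \<in> A). measure (\<mu> n) {x})"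
    using exp\<alpha>[of "\<epsilon> / 16"] e by auto
  obtain K0 :: nat where K0: "\<And>n x. x \<in> Z n \<Longrightarrow> card {y \<in> Z n. dZ n x y \<le> R2} \<le> K0"
    using geo c2(3) unfolding uniformly_bounded_geometry_def by blast
  define K where "K = real K0 + 1"
  define L where "L = max 1 (max (\<rho> R1) (\<rho> R2))"
  have KL: "0 < K" "0 < L" by (auto simp: K_def L_def)
  \<comment> \<open>The second argument of \<open>min\<close> yields the hypothesis
    \<open>small\<close> of \<open>expander_concentration\<close>; the first keeps
    \<open>1 - 2 * t\<close> strictly between 0 and 1, so that its powers tend to 0.\<close>
  define t where "t = min (1 / 4) (c2 * (\<epsilon> / 16) * \<epsilon> / (4 * K * L))"
  have t: "0 < t" "t \<le> 1 / 4" using KL c2 e by (auto simp: t_def)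
  have "4 * K * L * t \<le> 4 * K * L * (c2 * (\<epsilon> / 16) * \<epsilon> / (4 * K * L))"
    using KL by (intro mult_left_mono) (auto simp: t_def)
  also have "\<dots> = c2 * (\<epsilon> / 16) * \<epsilon>" using KL by simp
  finally have small: "4 * K * L * t / \<epsilon> \<le> c2 * (\<epsilon> / 16)" using e by (simp add: pos_divide_le_eq)
  obtain r where r: "(1 - 2 * t) ^ r \<le> 1 / 2"
    using real_arch_pow_inv[of "1 / 2" "1 - 2 * t"] t by (auto intro: less_imp_le)
  obtain k1 where k1: "\<And>n m x y. n \<noteq> m \<Longrightarrow> k1 \<le> n + m \<Longrightarrow> x \<in> Xs n \<Longrightarrow> y \<in> Xs m \<Longrightarrow> L + 1 \<le> d (n, x) (m, y)"
    using far[of "L + 1"] by blast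
  \<comment> \<open>From level \<open>k2\<close> on, a point within \<open>2 * r\<close> that moves
    by at most \<open>L\<close> remains below the scale at which walls measure the distance
    exactly.\<close>
  obtain k2 where k2: "\<And>k. k2 \<le> k \<Longrightarrow> 2 * real r + L + 1 \<le> g k"
    using g[unfolded filterlim_at_top] by (auto simp: eventually_sequentially)
  define k0 where "k0 = max k1 k2"
  \<comment> \<open>Levels below \<open>k0\<close> are collapsed to the empty set of walls. Every
    later level gets \<open>r\<close> additional walls \<open>(k, Inr j)\<close> of its own, which
    separate it from all other levels and cancel within the level.\<close>
  define v where "v = (\<lambda>(k, h). if k0 \<le> k then (\<lambda>e. (k, Inl e)) ` c k h \<union> (\<lambda>j. (k, Inr j)) ` {..<r} else {} :: (nat \<times> ('e + nat)) set)"
  have vf: "finite (v y)" if "y \<in> X" for y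
    using that cf by (auto simp: X v_def)
  have same: "card (sdiff (v (k, h)) (v (k, h'))) = (if k0 \<le> k then card (sdiff (c k h) (c k h')) else 0)" for k h h'
  proof (cases "k0 \<le> k")
    case True
    have "sdiff (v (k, h)) (v (k, h')) = (\<lambda>e. (k, Inl e)) ` sdiff (c k h) (c k h')"
      using True by (auto simp: v_def sdiff_def)
    then show ?thesis using True by (simp add: card_image inj_on_def)
  qed (simp add: v_def sdiff_def)
  have diff: "r \<le> card (sdiff (v (k, h)) (v (k', h')))"
    if "k \<noteq> k'" "k0 \<le> k \<or> k0 \<le> k'" "(k, h) \<in> X" "(k', h') \<in> X" for k k' h h'
  proof -
    have *: "r \<le> card (sdiff (v (k, h)) (v (k', h')))" if "k0 \<le> k" "k \<noteq> k'" "(k, h) \<in> X" "(k', h') \<in> X" for k k' h h'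
    proof -
      have "r = card ((\<lambda>j. (k, Inr j :: 'e + nat)) ` {..<r})" by (simp add: card_image inj_on_def)
      also have "\<dots> \<le> card (sdiff (v (k, h)) (v (k', h')))"
      proof (rule card_mono)
        show "finite (sdiff (v (k, h)) (v (k', h')))" using that(3,4) by (intro finite_sdiff vf)
        show "(\<lambda>j. (k, Inr j)) ` {..<r} \<subseteq> sdiff (v (k, h)) (v (k', h'))"
          using that(1,2) by (auto simp: v_def sdiff_def)
      qed
      finally show ?thesis .
    qed
    show ?thesis using *[of k k' h h'] *[of k' k h' h] that by (auto simp: sdiff_commute)
  qed
  have near: "real (card (sdiff (v y) (v y'))) \<le> L" if y: "y \<in> X" "y' \<in> X" "d y y' \<le> L" for y y'
  proof -
    obtain k h k' h' where [simp]: "y = (k, h)" "y' = (k', h')" by fastforce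
    have h: "h \<in> Xs k" "h' \<in> Xs k'" using y by (auto simp: X)
    show ?thesis
    proof (cases "k = k'")
      case True
      then show ?thesis using c_le[OF h(1), of h'] h(2) y(3) dn[OF h(1), of h'] KL by (simp add: same)
    next
      case False
      then have "\<not> k1 \<le> k + k'" using k1[OF False _ h] y(3) by auto
      then show ?thesis using KL by (simp add: v_def k0_def sdiff_def)
    qed
  qed
  define W where "W = (SIGMA k:{..<k0}. Xs k)"
  have fW: "finite W" unfolding W_def using fin by blast
  \<comment> \<open>One radius for both cases: the diameter of the collapsed levels, and the spread
    \<open>2 * r\<close> of a chain inside one later level. The added 1 makes it positive.\<close>
  define R where "R = Max (insert (2 * real r + 1) ((\<lambda>(y, y'). d y y') ` (W \<times> W)))"
  have R: "2 * real r + 1 \<le> R" "\<And>y y'. y \<in> W \<Longrightarrow> y' \<in> W \<Longrightarrow> d y y' \<le> R"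
    unfolding R_def using fW by (auto intro!: Max_ge)
  have "eventually (\<lambda>n. (SUP x\<in>Z n. measure (\<mu> n) {y \<in> Z n. d (f n x) (f n y) \<le> R} / measure (\<mu> n) (Z n)) < 1 / 4) sequentially"
    using R(1) by (intro order_tendstoD(2)[OF lim]) auto
  then obtain n where n: "(SUP x\<in>Z n. measure (\<mu> n) {y \<in> Z n. d (f n x) (f n y) \<le> R} / measure (\<mu> n) (Z n)) < 1 / 4"
    by (auto simp: eventually_sequentially)
  define p where "p x = measure (\<mu> n) {x}" for x
  define m where "m = measure (\<mu> n) (Z n)"
  have m: "m = sum p (Z n)" "0 < m" unfolding m_def p_def using meas[of "Z n" n] fm(5)[of n] by blast+
  have p: "0 \<le> p x" for x by (simp add: p_def)
  have conc: "sum p {y \<in> Z n. d (f n x) (f n y) \<le> R} < m / 4" if x: "x \<in> Z n" for x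
  proof -
    have "measure (\<mu> n) {y \<in> Z n. d (f n x) (f n y) \<le> R} / measure (\<mu> n) (Z n)
        \<le> (SUP x\<in>Z n. measure (\<mu> n) {y \<in> Z n. d (f n x) (f n y) \<le> R} / measure (\<mu> n) (Z n))"
      using x fm(1) by (intro cSUP_upper) auto
    then have "measure (\<mu> n) {y \<in> Z n. d (f n x) (f n y) \<le> R} / m < 1 / 4" using n unfolding m_def by (rule le_less_trans)
    then show ?thesis using m(2) meas[of "{y \<in> Z n. d (f n x) (f n y) \<le> R}" n] by (simp add: p_def pos_divide_less_eq)
  qed
  have dZ0: "0 \<le> dZ n x y" for x y using Metric_space.nonneg[OF fm(2)] .
  have dZs: "dZ n x y = dZ n y x" for x y using Metric_space.commute[OF fm(2)] .
  have dL: "d (f n x) (f n y) \<le> L" if "x \<in> Z n" "y \<in> Z n" "dZ n x y \<le> R1 \<or> dZ n x y \<le> R2" for x y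
    using \<rho>[OF that(1,2)] \<rho>m[OF dZ0, of x y R1] \<rho>m[OF dZ0, of x y R2] that(3) by (auto simp: L_def)
  have "\<exists>x\<in>Z n. (1 - \<epsilon>) * m < sum p {y \<in> Z n. card (sdiff (v (f n x)) (v (f n y))) < r}"
  proof (rule expander_concentration[where c = c2 and Nb = "\<lambda>x. {y \<in> Z n. dZ n x y \<le> R2}" and K = K and L = L and t = t])
    show "real (card {y \<in> Z n. dZ n x y \<le> R2}) \<le> K" if "x \<in> Z n" for x
      using K0[OF that] by (simp add: K_def)
    show "real (card (sdiff (v (f n x)) (v (f n y)))) \<le> L" if "x \<in> Z n" "y \<in> {y \<in> Z n. dZ n x y \<le> R2}" for x y
      using that by (intro near fX dL) auto
    show "c2 * sum p A < sum p {x \<in> Z n - A. \<exists>y\<in>{y \<in> Z n. dZ n x y \<le> R2}. y \<in> A}"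
      if "A \<subseteq> Z n" "\<epsilon> / 16 * m \<le> sum p A" "sum p A \<le> m / 2" for A
      using ex2[of A n] that by (simp add: p_def m_def)
  qed (use fm(1) p m vf fX KL t r e c2 small in auto)
  then obtain x0 where x0: "x0 \<in> Z n" and big: "(1 - \<epsilon>) * m < sum p {y \<in> Z n. card (sdiff (v (f n x0)) (v (f n y))) < r}"
    by blast
  define A where "A = {y \<in> Z n. card (sdiff (v (f n x0)) (v (f n y))) < r}"
  have AZ: "A \<subseteq> Z n" by (auto simp: A_def)
  obtain k h where kh: "f n x0 = (k, h)" by fastforce
  have khX: "(k, h) \<in> X" using fX[OF x0] kh by simp
  show False
  proof (cases "k0 \<le> k")
    case False
    have "A \<subseteq> {y \<in> Z n. d (f n x0) (f n y) \<le> R}"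
    proof
      fix y assume y: "y \<in> A"
      obtain k' h' where kh': "f n y = (k', h')" by fastforce
      have yX: "(k', h') \<in> X" using fX[of y n] kh' y AZ by auto
      have "\<not> k0 \<le> k'"
      proof
        assume k': "k0 \<le> k'"
        then have "k \<noteq> k'" using False by blast
        from diff[OF this _ khX yX] k' show False using y by (simp add: A_def kh kh')
      qed
      then have "d (f n x0) (f n y) \<le> R" using False khX yX by (intro R(2)) (auto simp: W_def X kh kh')
      then show "y \<in> {y \<in> Z n. d (f n x0) (f n y) \<le> R}" using y AZ by auto
    qed
    then have "sum p A \<le> sum p {y \<in> Z n. d (f n x0) (f n y) \<le> R}"
      using fm(1) p by (intro sum_mono2) auto
    also have "\<dots> < m / 4" by (rule conc[OF x0])
    also have "\<dots> \<le> (1 - \<epsilon>) * m" using e m(2) mult_right_mono[of "1 / 4" "1 - \<epsilon>" m] by simp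
    finally show False using big by (simp add: A_def)
  next
    case True
    have A: "\<exists>h'. f n y = (k, h') \<and> h' \<in> Xs k \<and> card (sdiff (c k h) (c k h')) \<le> r" if y: "y \<in> A" for y
    proof -
      obtain k' h' where kh': "f n y = (k', h')" by fastforce
      have yX: "(k', h') \<in> X" using fX[of y n] kh' y AZ by auto
      have lt: "card (sdiff (v (k, h)) (v (k', h'))) < r" using y by (simp add: A_def kh kh')
      then have "k' = k" using diff[of k k' h h'] khX yX True by auto
      then show ?thesis using lt yX kh' True by (auto simp: same X)
    qed
    let ?r = "{(x, y). x \<in> A \<and> y \<in> A \<and> y \<in> {y \<in> Z n. dZ n x y \<le> R1}}"
    have "\<exists>x\<in>A. m / 4 < sum p (?r\<^sup>* `` {x})"
    proof (rule expander_large_component[where V = "Z n" and c = c1 and m = m])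
      show "c1 * sum p B < sum p {x \<in> Z n - B. \<exists>y\<in>{y \<in> Z n. dZ n x y \<le> R1}. y \<in> B}"
        if "B \<subseteq> Z n" "1 / 4 * m \<le> sum p B" "sum p B \<le> m / 2" for B
        using ex1[of B n] that by (simp add: p_def m_def)
      show "(1 - c1 / 4) * m < sum p A" using big by (simp add: A_def \<epsilon>_def)
    qed (use fm(1) p m c1 AZ dZs in auto)
    then obtain x where x: "x \<in> A" and xb: "m / 4 < sum p (?r\<^sup>* `` {x})" by blast
    \<comment> \<open>The bound does not grow along the chain: after one more step the distance is
      still below \<open>g k\<close>, so it equals the number of separating walls, and this is at
      most \<open>2 * r\<close> because both ends are within \<open>r\<close> walls of
      \<open>h\<close>.\<close>
    have comp: "y \<in> A \<and> d (f n x) (f n y) \<le> 2 * real r" if "(x, y) \<in> ?r\<^sup>*" for y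
      using that
    proof (induction rule: rtrancl_induct)
      case base
      have "d (f n x) (f n x) = 0" using fX[of x n] x AZ by auto
      then show ?case using x by simp
    next
      case (step y z)
      have yz: "y \<in> A" "z \<in> A" "dZ n y z \<le> R1" using step.hyps(2) by auto
      obtain hx where hx: "f n x = (k, hx)" "hx \<in> Xs k" "card (sdiff (c k h) (c k hx)) \<le> r" using A[OF x] by blast
      obtain hz where hz: "f n z = (k, hz)" "hz \<in> Xs k" "card (sdiff (c k h) (c k hz)) \<le> r" using A[OF yz(2)] by blast
      have "d (f n x) (f n z) \<le> d (f n x) (f n y) + d (f n y) (f n z)"
        using x yz AZ by (intro X.triangle fX) auto
      also have "\<dots> \<le> 2 * real r + L" using step.IH yz AZ dL[of y z] by (intro add_mono) auto
      finally have "ds k hx hz < g k" using k2[of k] True dn[OF hx(2) hz(2)] by (simp add: hx hz k0_def)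
      then have "d (f n x) (f n z) = real (card (sdiff (c k hx) (c k hz)))"
        using c_eq[OF hx(2) hz(2)] dn[OF hx(2) hz(2)] by (simp add: hx hz)
      also have "card (sdiff (c k hx) (c k hz)) \<le> card (sdiff (c k hx) (c k h)) + card (sdiff (c k h) (c k hz))"
        using khX hx hz by (intro card_sdiff_triangle cf) (auto simp: X)
      then have "real (card (sdiff (c k hx) (c k hz))) \<le> 2 * real r"
        using hx(3) hz(3) by (simp add: sdiff_commute[of "c k hx"])
      finally show ?case using yz by simp
    qed
    have "sum p (?r\<^sup>* `` {x}) \<le> sum p {y \<in> Z n. d (f n x) (f n y) \<le> R}"
    proof (rule sum_mono2)
      show "?r\<^sup>* `` {x} \<subseteq> {y \<in> Z n. d (f n x) (f n y) \<le> R}"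
      proof
        fix y assume "y \<in> ?r\<^sup>* `` {x}"
        then have "y \<in> A \<and> d (f n x) (f n y) \<le> 2 * real r" by (intro comp) (simp only: Image_singleton mem_Collect_eq)
        then show "y \<in> {y \<in> Z n. d (f n x) (f n y) \<le> R}" using AZ R(1) by auto
      qed
    qed (use fm(1) p in auto)
    also have "\<dots> < m / 4" using x AZ by (intro conc) auto
    finally show False using xb by simp
  qed
qed

section \<open>The wall space of a quotient of a free group\<close>

text \<open>\<open>h\<close> assigns to every letter an element of a group. The \<open>b\<close>-labelled edge from \<open>v\<close> to
  \<open>v \<otimes> h (b, True)\<close> of the Cayley graph is encoded as \<open>(v, b)\<close>, and \<open>crossed w\<close> is the set of edges
  that the path spelled by \<open>w\<close> from \<open>\<one>\<close> crosses an odd number of times.\<close>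

locale letter_map = group G for G :: "('a, 'm) monoid_scheme" (structure) +
  fixes h :: "'l \<times> bool \<Rightarrow> 'a"
  assumes letter_closed [simp]: "h l \<in> carrier G"
    and letter_inv: "h (inv_letter l) = inv h l"
begin

definition word_value :: "('l \<times> bool) list \<Rightarrow> 'a" where
  "word_value w = foldr (\<lambda>l x. h l \<otimes> x) w \<one>"

lemma word_value_simps [simp]:
  "word_value [] = \<one>" "word_value (l # w) = h l \<otimes> word_value w"
  by (simp_all add: word_value_def)

lemma word_value_closed [simp]: "word_value w \<in> carrier G"
  by (induction w) auto

lemma word_value_append: "word_value (u @ v) = word_value u \<otimes> word_value v"
  by (induction u) (auto simp: m_assoc)

text \<open>An edge must get the same name in both directions, so an inverse letter records the
  vertex to which it leads instead of the one from which it starts.\<close>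

definition letter_edge :: "'l \<times> bool \<Rightarrow> 'a \<times> 'l" where
  "letter_edge l = (if snd l then \<one> else h l, fst l)"

definition shift :: "'a \<Rightarrow> ('a \<times> 'l) set \<Rightarrow> ('a \<times> 'l) set" where
  "shift x E = (\<lambda>(v, b). (x \<otimes> v, b)) ` E"

primrec crossed :: "('l \<times> bool) list \<Rightarrow> ('a \<times> 'l) set" where
  "crossed [] = {}"
| "crossed (l # w) = sdiff {letter_edge l} (shift (h l) (crossed w))"

lemma inj_on_shift: "x \<in> carrier G \<Longrightarrow> inj_on (\<lambda>(v, b). (x \<otimes> v, b)) (carrier G \<times> UNIV)"
  by (auto simp: inj_on_def)

lemma shift_subset: "x \<in> carrier G \<Longrightarrow> E \<subseteq> carrier G \<times> B \<Longrightarrow> shift x E \<subseteq> carrier G \<times> B"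
  by (auto simp: shift_def)

lemma shift_empty [simp]: "shift x {} = {}" "shift x E = {} \<longleftrightarrow> E = {}"
  by (simp_all add: shift_def)

lemma shift_one: "E \<subseteq> carrier G \<times> UNIV \<Longrightarrow> shift \<one> E = E"
  unfolding shift_def by (force simp: image_iff)

lemma shift_shift:
  "x \<in> carrier G \<Longrightarrow> y \<in> carrier G \<Longrightarrow> E \<subseteq> carrier G \<times> UNIV \<Longrightarrow> shift x (shift y E) = shift (x \<otimes> y) E"
  unfolding shift_def image_image by (intro image_cong refl) (auto simp: m_assoc)

lemma shift_sdiff:
  assumes "x \<in> carrier G" "D \<subseteq> carrier G \<times> UNIV" "E \<subseteq> carrier G \<times> UNIV"
  shows "shift x (sdiff D E) = sdiff (shift x D) (shift x E)"
  unfolding shift_def sdiff_def image_Un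
  using assms by (simp add: inj_on_image_set_diff[OF inj_on_shift[OF assms(1)]] Diff_subset[THEN subset_trans])

lemma card_shift: "x \<in> carrier G \<Longrightarrow> E \<subseteq> carrier G \<times> UNIV \<Longrightarrow> card (shift x E) = card E"
  unfolding shift_def by (intro card_image inj_on_subset[OF inj_on_shift])

lemma letter_edge_closed: "letter_edge l \<in> carrier G \<times> {fst l}"
  by (simp add: letter_edge_def)

lemma crossed_subset: "crossed w \<subseteq> carrier G \<times> fst ` set w"
proof (induction w)
  case (Cons l w)
  have "shift (h l) (crossed w) \<subseteq> carrier G \<times> fst ` set w" by (rule shift_subset[OF _ Cons]) simp
  then show ?case using letter_edge_closed[of l] by (auto simp: sdiff_def)
qed simp

lemma crossed_closed: "crossed w \<subseteq> carrier G \<times> UNIV"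
  using crossed_subset by blast

lemma finite_crossed [simp]: "finite (crossed w)"
  by (induction w) (simp_all add: shift_def)

lemma sdiff_simps [simp]:
  "sdiff {} E = E" "sdiff E {} = E" "sdiff E E = {}" "sdiff D (sdiff D E) = E"
  by (auto simp: sdiff_def)

lemma sdiff_assoc: "sdiff (sdiff C D) E = sdiff C (sdiff D E)"
  by (auto simp: sdiff_def)

lemma shift_letter_edge: "shift (h l) {letter_edge (inv_letter l)} = {letter_edge l}"
  using letter_inv[of l] by (cases l) (auto simp: shift_def letter_edge_def inv_letter_def)

text \<open>Going back along the edge just crossed removes it from the symmetric difference, so
  \<open>crossed\<close> is insensitive to free reduction.\<close>

lemma crossed_cons_reduce: "crossed (cons_reduce k w) = sdiff {letter_edge k} (shift (h k) (crossed w))"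
proof (cases w)
  case (Cons l w')
  show ?thesis
  proof (cases "l = inv_letter k")
    case True
    have "{letter_edge l} \<subseteq> carrier G \<times> UNIV" using letter_edge_closed[of l] by auto
    moreover have "shift (h l) (crossed w') \<subseteq> carrier G \<times> UNIV" by (intro shift_subset crossed_closed) simp
    ultimately have "shift (h k) (crossed w) = sdiff {letter_edge k} (shift (h k) (shift (h l) (crossed w')))"
      unfolding Cons crossed.simps True by (simp add: shift_sdiff shift_letter_edge)
    also have "shift (h k) (shift (h l) (crossed w')) = crossed w'"
      using crossed_closed by (simp add: shift_shift shift_one True letter_inv)
    finally show ?thesis using True Cons by simp
  qed (simp add: Cons)
qed simp

text \<open>The cocycle identity for mod 2 chains: the path of the second word starts at the
  endpoint of the first.\<close>

lemma crossed_mult: "crossed (foldr cons_reduce u v) = sdiff (crossed u) (shift (word_value u) (crossed v))"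
proof (induction u)
  case Nil
  show ?case by (simp add: shift_one crossed_closed)
next
  case (Cons l u)
  have "shift (h l) (sdiff (crossed u) (shift (word_value u) (crossed v)))
      = sdiff (shift (h l) (crossed u)) (shift (word_value (l # u)) (crossed v))"
    by (simp add: shift_sdiff shift_shift crossed_closed shift_subset)
  then show ?case by (simp add: crossed_cons_reduce Cons sdiff_assoc)
qed

lemma card_crossed_le: "card (crossed w) \<le> length w"
proof (induction w)
  case (Cons l w)
  have "card (crossed (l # w)) \<le> card (insert (letter_edge l) (shift (h l) (crossed w)))"
    by (rule card_mono) (auto simp: sdiff_def shift_def)
  also have "\<dots> \<le> Suc (card (crossed w))"
    using card_insert_le_m1[of "Suc (card (crossed w))" "shift (h l) (crossed w)" "letter_edge l"]
      card_shift[OF letter_closed crossed_closed, of l w] by simp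
  finally show ?case using Cons by simp
qed simp

lemma mem_crossed:
  "e \<in> crossed w \<Longrightarrow> \<exists>u k v. w = u @ k # v \<and> e \<in> shift (word_value u) {letter_edge k}"
proof (induction w arbitrary: e)
  case (Cons l w)
  show ?case
  proof (cases "e = letter_edge l")
    case True
    have "{letter_edge l} \<subseteq> carrier G \<times> UNIV" using letter_edge_closed[of l] by auto
    then show ?thesis using True shift_one by (intro exI[of _ "[]"] exI[of _ l] exI[of _ w]) simp
  next
    case False
    then obtain e' where e': "e' \<in> crossed w" "e \<in> shift (h l) {e'}" using Cons.prems by (auto simp: sdiff_def shift_def)
    obtain u k v where w: "w = u @ k # v" "e' \<in> shift (word_value u) {letter_edge k}" using Cons.IH[OF e'(1)] by blast
    have "{letter_edge k} \<subseteq> carrier G \<times> UNIV" using letter_edge_closed[of k] by auto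
    moreover have "e \<in> shift (h l) (shift (word_value u) {letter_edge k})" using e'(2) w(2) by (auto simp: shift_def)
    ultimately have "e \<in> shift (word_value (l # u)) {letter_edge k}" by (simp add: shift_shift)
    then show ?thesis using w(1) by (intro exI[of _ "l # u"] exI[of _ k] exI[of _ v]) simp
  qed
qed simp

text \<open>If the first edge recurred, the path between the two crossings would close up: in the
  same direction \<open>l # u\<close> has trivial value, in opposite directions some subword has, or
  the path backtracks at once, which a reduced word does not.\<close>

lemma card_crossed:
  assumes "reduced_word w" "\<And>u v x. w = u @ v @ x \<Longrightarrow> v \<noteq> [] \<Longrightarrow> word_value v \<noteq> \<one>"
  shows "card (crossed w) = length w"
  using assms
proof (induction w)
  case (Cons l w)
  have IH: "card (crossed w) = length w"
  proof (rule Cons.IH)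
    show "reduced_word w" using Cons.prems(1) by (simp add: reduced_word_Cons)
    show "word_value v \<noteq> \<one>" if "w = u @ v @ x" "v \<noteq> []" for u v x
      using Cons.prems(2)[of "l # u" v x] that by simp
  qed
  have "letter_edge l \<notin> shift (h l) (crossed w)"
  proof
    assume "letter_edge l \<in> shift (h l) (crossed w)"
    then obtain e where e: "e \<in> crossed w" "letter_edge l \<in> shift (h l) {e}" by (auto simp: shift_def)
    obtain u k v where w: "w = u @ k # v" "e \<in> shift (word_value u) {letter_edge k}" using mem_crossed[OF e(1)] by blast
    have n1: "word_value (l # u) \<noteq> \<one>" using Cons.prems(2)[of "[]" "l # u" "k # v"] w(1) by simp
    have n2: "word_value (l # u @ [k]) \<noteq> \<one>" using Cons.prems(2)[of "[]" "l # u @ [k]" v] w(1) by simp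
    have n3: "word_value u \<noteq> \<one> \<or> u = []" using Cons.prems(2)[of "[l]" u "k # v"] w(1) by auto
    have n4: "u = [] \<Longrightarrow> k \<noteq> inv_letter l" using Cons.prems(1) w(1) by (auto simp: reduced_word_Cons)
    have kl: "fst k = fst l" "(if snd l then \<one> else h l) = h l \<otimes> (word_value u \<otimes> (if snd k then \<one> else h k))"
      using e(2) w(2) by (auto simp: shift_def letter_edge_def)
    show False
    proof (cases "snd l = snd k")
      case True
      then have "k = l" using kl(1) by (simp add: prod_eq_iff)
      then have "h l \<otimes> word_value u = \<one>"
        using kl(2) by (cases "snd l") (simp_all add: m_assoc[symmetric] r_cancel_one')
      then show False using n1 by simp
    next
      case False
      then have k: "k = inv_letter l" using kl(1) by (simp add: prod_eq_iff inv_letter_def)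
      show False
      proof (cases "snd l")
        case True
        then show False using kl(2) n2 False by (simp add: word_value_append)
      next
        case sl: False
        then have "word_value u = \<one>" using kl(2) False by (simp add: l_cancel_one')
        then show False using n3 n4 k by blast
      qed
    qed
  qed
  then have "crossed (l # w) = insert (letter_edge l) (shift (h l) (crossed w))" by (auto simp: sdiff_def)
  moreover have "finite (shift (h l) (crossed w))" by (simp add: shift_def)
  ultimately show ?case
    using IH card_shift[OF letter_closed crossed_closed, of l w] \<open>letter_edge l \<notin> shift (h l) (crossed w)\<close> by simp
qed simp

end

section \<open>Word lengths and covers for quotients of free groups\<close>

definition generators :: "'a set \<Rightarrow> ('a \<times> bool) list set" where
  "generators B = (\<lambda>b. [(b, True)]) ` B"

lemma tl_free_group: "l # w \<in> carrier (free_group B) \<Longrightarrow> fst l \<in> B \<and> w \<in> carrier (free_group B)"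
  by (simp add: carrier_free_group reduced_word_Cons)

lemma free_group_Cons:
  assumes "l # w \<in> carrier (free_group B)"
  shows "[l] \<otimes>\<^bsub>free_group B\<^esub> w = l # w"
  using assms foldr_reduced_append[of "[l]" w] by (simp add: carrier_free_group)

lemma letter_free_group: "fst l \<in> B \<Longrightarrow> [l] \<in> carrier (free_group B)"
  by (simp add: carrier_free_group reduced_word_Cons)

lemma infix_free_group: "u @ v @ x \<in> carrier (free_group B) \<Longrightarrow> v \<in> carrier (free_group B)"
  by (auto simp: carrier_free_group reduced_word_def successively_append_iff)

lemma generate_generators: "generate (free_group B) (generators B) = carrier (free_group B)"
proof
  interpret group "free_group B" by (rule group_free_group)
  have "generators B \<subseteq> carrier (free_group B)" by (auto simp: generators_def intro!: letter_free_group)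
  then show "generate (free_group B) (generators B) \<subseteq> carrier (free_group B)" by (rule generate_incl)
  show "carrier (free_group B) \<subseteq> generate (free_group B) (generators B)"
  proof
    fix w assume "w \<in> carrier (free_group B)"
    then show "w \<in> generate (free_group B) (generators B)"
    proof (induction w)
      case Nil
      then show ?case using generate.one[of "free_group B" "generators B"] by simp
    next
      case (Cons l w)
      note lw = tl_free_group[OF Cons.prems]
      obtain b s where l: "l = (b, s)" by fastforce
      have g: "[(b, True)] \<in> generators B" using lw l by (auto simp: generators_def)
      have "[l] \<in> generate (free_group B) (generators B)"
      proof (cases s)
        case True
        then show ?thesis using generate.incl[OF g] l by simp
      next
        case False
        have "inv\<^bsub>free_group B\<^esub> [(b, True)] = [l]"
          using lw l False inv_free_group[OF letter_free_group, of "(b, True)" B] by (simp add: inv_word_def inv_letter_def)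
        then show ?thesis using generate.inv[OF g] by metis
      qed
      then show ?case using generate.eng[of "[l]" "free_group B" "generators B" w] Cons.IH lw free_group_Cons[OF Cons.prems] by simp
    qed
  qed
qed

locale free_quotient =
  fixes B :: "'b set" and N :: "('b \<times> bool) list set"
  assumes normal_N: "N \<lhd> free_group B"
begin

sublocale N: normal N "free_group B"
  by (rule normal_N)

abbreviation coset :: "('b \<times> bool) list \<Rightarrow> ('b \<times> bool) list set" where
  "coset w \<equiv> N #>\<^bsub>free_group B\<^esub> w"

abbreviation Q :: "('b \<times> bool) list set monoid" where
  "Q \<equiv> free_group B Mod N"

declare mult_FactGroup [simp del] one_FactGroup [simp del]

text \<open>Letters outside \<open>B\<close> go to the identity, since \<open>letter_map\<close>
  demands a value for every letter.\<close>

definition letter_coset :: "'b \<times> bool \<Rightarrow> ('b \<times> bool) list set" where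
  "letter_coset l = (if fst l \<in> B then coset [l] else N)"

lemma letter_coset_eq: "fst l \<in> B \<Longrightarrow> letter_coset l = coset [l]"
  by (simp add: letter_coset_def)

lemma group_Q: "group Q"
  by (rule N.factorgroup_is_group)

lemma coset_closed [simp]: "w \<in> carrier (free_group B) \<Longrightarrow> coset w \<in> carrier Q"
  by (auto simp: FactGroup_def RCOSETS_def)

lemma coset_mult: "u \<in> carrier (free_group B) \<Longrightarrow> v \<in> carrier (free_group B) \<Longrightarrow>
    coset u \<otimes>\<^bsub>Q\<^esub> coset v = coset (u \<otimes>\<^bsub>free_group B\<^esub> v)"
  by (simp add: FactGroup_def N.rcos_sum)

lemma one_Q: "\<one>\<^bsub>Q\<^esub> = N"
  by (simp add: FactGroup_def)

lemma coset_one: "coset [] = N"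
  using N.coset_mult_one[OF N.subset] by simp

lemma coset_inv: "w \<in> carrier (free_group B) \<Longrightarrow> inv\<^bsub>Q\<^esub> coset w = coset (inv\<^bsub>free_group B\<^esub> w)"
proof -
  interpret Q: group Q by (rule group_Q)
  assume w: "w \<in> carrier (free_group B)"
  have "coset (inv\<^bsub>free_group B\<^esub> w) \<otimes>\<^bsub>Q\<^esub> coset w = \<one>\<^bsub>Q\<^esub>"
    using coset_mult[OF N.inv_closed[OF w] w] N.l_inv[OF w] coset_one one_Q by simp
  then show ?thesis by (rule Q.inv_equality) (use w in simp_all)
qed

lemma carrier_Q: "X \<in> carrier Q \<Longrightarrow> \<exists>w\<in>carrier (free_group B). coset w = X"
  by (auto simp: FactGroup_def RCOSETS_def)

lemma coset_eq_iff: "u \<in> carrier (free_group B) \<Longrightarrow> v \<in> carrier (free_group B) \<Longrightarrow>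
    coset u = coset v \<longleftrightarrow> u \<otimes>\<^bsub>free_group B\<^esub> inv\<^bsub>free_group B\<^esub> v \<in> N"
  by (rule N.eq_rcosets_iff[OF normal_N])

lemma coset_eq_one_iff: "w \<in> carrier (free_group B) \<Longrightarrow> coset w = N \<longleftrightarrow> w \<in> N"
  using coset_eq_iff[of w "[]"] coset_one N.inv_one N.r_one[of w] N.one_closed by (simp del: mult_free_group)

lemma letter_map_Q: "letter_map Q letter_coset"
proof -
  interpret Q: group Q by (rule group_Q)
  show ?thesis
  proof
    fix l :: "'b \<times> bool"
    show "letter_coset l \<in> carrier Q"
      using Q.one_closed by (auto simp: letter_coset_def letter_free_group one_Q)
    show "letter_coset (inv_letter l) = inv\<^bsub>Q\<^esub> letter_coset l"
    proof (cases "fst l \<in> B")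
      case True
      have "inv\<^bsub>free_group B\<^esub> [l] = [inv_letter l]" using inv_free_group[OF letter_free_group[OF True]] by (simp add: inv_word_def)
      then show ?thesis using True coset_inv[OF letter_free_group[OF True]] by (simp add: letter_coset_def)
    qed (use Q.inv_one in \<open>simp add: letter_coset_def one_Q\<close>)
  qed
qed

sublocale letter_map Q letter_coset
  by (rule letter_map_Q)

lemma word_value_eq: "w \<in> carrier (free_group B) \<Longrightarrow> word_value w = coset w"
proof (induction w)
  case Nil
  then show ?case by (simp add: one_Q coset_one)
next
  case (Cons l w)
  note lw = tl_free_group[OF Cons.prems]
  have "word_value (l # w) = coset [l] \<otimes>\<^bsub>Q\<^esub> coset w" using lw Cons.IH by (simp add: letter_coset_eq)
  also have "\<dots> = coset (l # w)"
    using lw coset_mult[OF letter_free_group] free_group_Cons[OF Cons.prems] by metis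
  finally show ?case .
qed

lemma word_value_letters:
  "fst ` set w \<subseteq> B \<Longrightarrow> word_value w = coset (foldr cons_reduce w [])"
proof (induction w)
  case Nil
  then show ?case by (simp add: one_Q coset_one)
next
  case (Cons l w)
  have c: "foldr cons_reduce w [] \<in> carrier (free_group B)"
    using Cons.prems letters_foldr[of w "[]"] by (auto simp: carrier_free_group reduced_foldr)
  have "word_value (l # w) = coset [l] \<otimes>\<^bsub>Q\<^esub> coset (foldr cons_reduce w [])"
    using Cons by (simp add: letter_coset_eq)
  also have "\<dots> = coset (foldr cons_reduce (l # w) [])" using Cons.prems c coset_mult[OF letter_free_group c] by simp
  finally show ?case .
qed

section \<open>The word metric of the quotient\<close>

definition quotient_length :: "('b \<times> bool) list set \<Rightarrow> nat" where
  "quotient_length X = word_length Q (coset ` generators B) X"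

lemma letter_coset_generators:
  "coset ` generators B \<union> m_inv Q ` coset ` generators B = letter_coset ` {l. fst l \<in> B}"
proof -
  have "letter_coset (b, False) = inv\<^bsub>Q\<^esub> coset [(b, True)]" if "b \<in> B" for b
    using letter_inv[of "(b, True)"] that by (simp add: inv_letter_def letter_coset_eq)
  moreover have "{l. fst l \<in> B} = (\<lambda>b. (b, True)) ` B \<union> (\<lambda>b. (b, False)) ` B"
    by (auto simp: image_iff)
  moreover have "letter_coset (b, True) = coset [(b, True)]" if "b \<in> B" for b
    using that by (simp add: letter_coset_eq)
  ultimately show ?thesis
    by (simp add: generators_def image_Un image_image cong: image_cong)
qed

lemma letter_list:
  assumes "set ws \<subseteq> letter_coset ` {l. fst l \<in> B}"
  shows "\<exists>w. fst ` set w \<subseteq> B \<and> ws = map letter_coset w"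
proof -
  have "ws \<in> lists (letter_coset ` {l. fst l \<in> B})" using assms by auto
  then have "ws \<in> map letter_coset ` lists {l. fst l \<in> B}" by (simp only: lists_image)
  then show ?thesis by auto
qed

lemma quotient_length_le:
  assumes "fst ` set w \<subseteq> B" "word_value w = X"
  shows "quotient_length X \<le> length w"
  unfolding quotient_length_def word_length_def letter_coset_generators
  by (rule Least_le, rule exI[of _ "map letter_coset w"])
    (use assms in \<open>auto simp: word_value_def foldr_map comp_def\<close>)

text \<open>A shortest expression may be freely reduced: this keeps the coset and does not lengthen
  the word. Geodesics of the quotient are therefore spelled by reduced words.\<close>

lemma quotient_length_attained:
  assumes "X \<in> carrier Q"
  shows "\<exists>w\<in>carrier (free_group B). coset w = X \<and> length w = quotient_length X"
proof -
  obtain w0 where w0: "w0 \<in> carrier (free_group B)" "coset w0 = X" using carrier_Q[OF assms] by blast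
  let ?P = "\<lambda>k. \<exists>ws. length ws = k \<and> set ws \<subseteq> letter_coset ` {l. fst l \<in> B} \<and> foldr (\<lambda>x y. x \<otimes>\<^bsub>Q\<^esub> y) ws \<one>\<^bsub>Q\<^esub> = X"
  have "?P (length w0)"
    by (rule exI[of _ "map letter_coset w0"])
      (use w0 word_value_eq[OF w0(1)] in \<open>auto simp: word_value_def foldr_map comp_def carrier_free_group\<close>)
  then have "?P (quotient_length X)"
    unfolding quotient_length_def word_length_def letter_coset_generators by (rule LeastI)
  then obtain ws where ws: "length ws = quotient_length X" "set ws \<subseteq> letter_coset ` {l. fst l \<in> B}"
      "foldr (\<lambda>x y. x \<otimes>\<^bsub>Q\<^esub> y) ws \<one>\<^bsub>Q\<^esub> = X" by blast
  obtain u where u: "fst ` set u \<subseteq> B" "ws = map letter_coset u" using letter_list[OF ws(2)] by blast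
  define w where "w = foldr cons_reduce u []"
  have w: "w \<in> carrier (free_group B)"
    using u(1) letters_foldr[of u "[]"] by (auto simp: carrier_free_group reduced_foldr w_def)
  have "coset w = X"
    using word_value_letters[OF u(1)] ws(3) u(2) by (simp add: w_def word_value_def foldr_map comp_def)
  moreover have "length w \<le> quotient_length X" using length_foldr_le[of u "[]"] ws(1) u(2) by (simp add: w_def)
  moreover have "quotient_length X \<le> length w"
    by (rule quotient_length_le) (use w \<open>coset w = X\<close> word_value_eq in \<open>auto simp: carrier_free_group\<close>)
  ultimately show ?thesis using w by (intro bexI[of _ w]) auto
qed

lemma quotient_length_coset: "w \<in> carrier (free_group B) \<Longrightarrow> quotient_length (coset w) \<le> length w"
  by (rule quotient_length_le) (auto simp: word_value_eq carrier_free_group)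

lemma quotient_length_eq_0: "X \<in> carrier Q \<Longrightarrow> quotient_length X = 0 \<longleftrightarrow> X = \<one>\<^bsub>Q\<^esub>"
  using quotient_length_attained[of X] quotient_length_coset[of "[]"] by (force simp: coset_one one_Q carrier_free_group)

lemma quotient_length_inv:
  assumes "X \<in> carrier Q"
  shows "quotient_length (inv\<^bsub>Q\<^esub> X) \<le> quotient_length X"
proof -
  obtain w where w: "w \<in> carrier (free_group B)" "coset w = X" "length w = quotient_length X"
    using quotient_length_attained[OF assms] by blast
  have "inv\<^bsub>Q\<^esub> X = coset (inv_word w)" using coset_inv[OF w(1)] w(2) inv_free_group[OF w(1)] by simp
  then show ?thesis using quotient_length_coset[OF inv_word_carrier[OF w(1)]] w(3) by simp
qed

lemma quotient_length_mult:
  assumes "X \<in> carrier Q" "Y \<in> carrier Q"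
  shows "quotient_length (X \<otimes>\<^bsub>Q\<^esub> Y) \<le> quotient_length X + quotient_length Y"
proof -
  obtain v where v: "v \<in> carrier (free_group B)" "coset v = X" "length v = quotient_length X"
    using quotient_length_attained[OF assms(1)] by blast
  obtain w where w: "w \<in> carrier (free_group B)" "coset w = Y" "length w = quotient_length Y"
    using quotient_length_attained[OF assms(2)] by blast
  have "X \<otimes>\<^bsub>Q\<^esub> Y = coset (v \<otimes>\<^bsub>free_group B\<^esub> w)" using coset_mult[OF v(1) w(1)] v(2) w(2) by simp
  moreover have "quotient_length (coset (v \<otimes>\<^bsub>free_group B\<^esub> w)) \<le> length (v \<otimes>\<^bsub>free_group B\<^esub> w)"
    using v(1) w(1) by (intro quotient_length_coset N.m_closed)
  ultimately show ?thesis using length_foldr_le[of v w] v(3) w(3) by simp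
qed

definition quotient_dist :: "('b \<times> bool) list set \<Rightarrow> ('b \<times> bool) list set \<Rightarrow> real" where
  "quotient_dist = word_metric Q (coset ` generators B)"

lemma quotient_dist_eq: "quotient_dist X Y = real (quotient_length (inv\<^bsub>Q\<^esub> X \<otimes>\<^bsub>Q\<^esub> Y))"
  by (simp add: quotient_dist_def word_metric_def quotient_length_def)

lemma quotient_dist_commute:
  assumes "X \<in> carrier Q" "Y \<in> carrier Q"
  shows "quotient_dist X Y = quotient_dist Y X"
proof -
  have le: "quotient_length (inv\<^bsub>Q\<^esub> X \<otimes>\<^bsub>Q\<^esub> Y) \<le> quotient_length (inv\<^bsub>Q\<^esub> Y \<otimes>\<^bsub>Q\<^esub> X)"
    if "X \<in> carrier Q" "Y \<in> carrier Q" for X Y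
    using quotient_length_inv[of "inv\<^bsub>Q\<^esub> Y \<otimes>\<^bsub>Q\<^esub> X"] that by (simp add: inv_mult_group)
  show ?thesis using le[OF assms] le[OF assms(2,1)] by (simp add: quotient_dist_eq)
qed

lemma quotient_dist_eq_0:
  assumes "X \<in> carrier Q" "Y \<in> carrier Q"
  shows "quotient_dist X Y = 0 \<longleftrightarrow> X = Y"
proof -
  have "quotient_dist X Y = 0 \<longleftrightarrow> inv\<^bsub>Q\<^esub> X \<otimes>\<^bsub>Q\<^esub> Y = \<one>\<^bsub>Q\<^esub>"
    using assms quotient_length_eq_0[of "inv\<^bsub>Q\<^esub> X \<otimes>\<^bsub>Q\<^esub> Y"] by (simp add: quotient_dist_eq)
  also have "\<dots> \<longleftrightarrow> X = Y"
    using assms by (metis inv_closed inv_equality inv_inv l_inv)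
  finally show ?thesis .
qed

lemma quotient_dist_triangle:
  assumes "X \<in> carrier Q" "Y \<in> carrier Q" "Z \<in> carrier Q"
  shows "quotient_dist X Z \<le> quotient_dist X Y + quotient_dist Y Z"
proof -
  have "inv\<^bsub>Q\<^esub> X \<otimes>\<^bsub>Q\<^esub> Z = inv\<^bsub>Q\<^esub> X \<otimes>\<^bsub>Q\<^esub> ((Y \<otimes>\<^bsub>Q\<^esub> inv\<^bsub>Q\<^esub> Y) \<otimes>\<^bsub>Q\<^esub> Z)"
    using assms by simp
  also have "\<dots> = (inv\<^bsub>Q\<^esub> X \<otimes>\<^bsub>Q\<^esub> Y) \<otimes>\<^bsub>Q\<^esub> (inv\<^bsub>Q\<^esub> Y \<otimes>\<^bsub>Q\<^esub> Z)"
    using assms by (simp only: m_assoc inv_closed m_closed)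
  finally show ?thesis
    using quotient_length_mult[of "inv\<^bsub>Q\<^esub> X \<otimes>\<^bsub>Q\<^esub> Y" "inv\<^bsub>Q\<^esub> Y \<otimes>\<^bsub>Q\<^esub> Z"] assms
    by (simp add: quotient_dist_eq)
qed

lemma quotient_dist_nonneg: "0 \<le> quotient_dist X Y"
  by (simp add: quotient_dist_eq)

text \<open>The regular cover of the Cayley graph of the quotient by \<open>N\<close> whose deck group is the mod 2
  homology of that graph.\<close>

definition cover :: "('b \<times> bool) list set" where
  "cover = {w \<in> N. crossed w = {}}"

lemma crossed_inv:
  assumes "w \<in> carrier (free_group B)"
  shows "sdiff (crossed w) (shift (coset w) (crossed (inv\<^bsub>free_group B\<^esub> w))) = {}"
  using crossed_mult[of w "inv\<^bsub>free_group B\<^esub> w"] N.r_inv[OF assms] word_value_eq[OF assms] by simp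

text \<open>The pair of \<open>coset\<close> and \<open>crossed\<close> is a complete invariant for
  the cosets of \<open>cover\<close>. Normality follows by comparing invariants, finite index
  because the pairs range over a finite set.\<close>

lemma mem_cover_iff:
  assumes "x \<in> carrier (free_group B)" "y \<in> carrier (free_group B)"
  shows "x \<otimes>\<^bsub>free_group B\<^esub> inv\<^bsub>free_group B\<^esub> y \<in> cover \<longleftrightarrow> coset x = coset y \<and> crossed x = crossed y"
proof -
  let ?y' = "inv\<^bsub>free_group B\<^esub> y"
  have y': "?y' \<in> carrier (free_group B)" using assms by simp
  have xy: "crossed (x \<otimes>\<^bsub>free_group B\<^esub> ?y') = sdiff (crossed x) (shift (coset x) (crossed ?y'))"
    using crossed_mult[of x ?y'] word_value_eq[OF assms(1)] by simp
  have eq: "sdiff D E = {} \<longleftrightarrow> D = E" for D E :: "(('b \<times> bool) list set \<times> 'b) set"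
    by (auto simp: sdiff_def)
  have "crossed y = shift (coset y) (crossed ?y')" using crossed_inv[OF assms(2)] eq by blast
  then show ?thesis
    unfolding cover_def using coset_eq_iff[OF assms] xy eq by (auto simp del: mult_free_group)
qed

lemma cover_subset: "cover \<subseteq> N"
  by (auto simp: cover_def)

lemma normal_cover: "cover \<lhd> free_group B"
proof -
  have one: "coset [] = \<one>\<^bsub>Q\<^esub>" using coset_one one_Q by simp
  have cov: "w \<in> cover \<longleftrightarrow> coset w = \<one>\<^bsub>Q\<^esub> \<and> crossed w = {}" if "w \<in> carrier (free_group B)" for w
    using coset_eq_one_iff[OF that] by (simp add: cover_def one_Q)
  have C: "cover \<subseteq> carrier (free_group B)" using cover_subset N.subset by blast
  have mult: "coset (u \<otimes>\<^bsub>free_group B\<^esub> v) = coset u \<otimes>\<^bsub>Q\<^esub> coset v"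
      "crossed (u \<otimes>\<^bsub>free_group B\<^esub> v) = sdiff (crossed u) (shift (coset u) (crossed v))"
    if "u \<in> carrier (free_group B)" "v \<in> carrier (free_group B)" for u v
    using that coset_mult crossed_mult word_value_eq by simp_all
  have inv: "coset (inv\<^bsub>free_group B\<^esub> u) = inv\<^bsub>Q\<^esub> coset u"
    "crossed u = shift (coset u) (crossed (inv\<^bsub>free_group B\<^esub> u))" if "u \<in> carrier (free_group B)" for u
    using coset_inv[OF that] crossed_inv[OF that] by (auto simp: sdiff_def)
  have sub: "subgroup cover (free_group B)"
  proof (rule N.subgroupI)
    show "cover \<noteq> {}" using cov[of "[]"] one by (auto simp: carrier_free_group)
    show "inv\<^bsub>free_group B\<^esub> u \<in> cover" if "u \<in> cover" for u
    proof -
      have u: "u \<in> carrier (free_group B)" using that C by blast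
      have "crossed (inv\<^bsub>free_group B\<^esub> u) = {}" using inv(2)[OF u] cov[OF u] that by simp
      then show ?thesis using inv(1)[OF u] cov[OF u] cov[OF N.inv_closed[OF u]] that by simp
    qed
    show "u \<otimes>\<^bsub>free_group B\<^esub> v \<in> cover" if "u \<in> cover" "v \<in> cover" for u v
    proof -
      have uv: "u \<in> carrier (free_group B)" "v \<in> carrier (free_group B)" using that C by auto
      show ?thesis
        using cov[OF uv(1)] cov[OF uv(2)] cov[OF N.m_closed[OF uv]] mult[OF uv] that by (simp del: mult_free_group)
    qed
  qed (rule C)
  have "x \<otimes>\<^bsub>free_group B\<^esub> u \<otimes>\<^bsub>free_group B\<^esub> inv\<^bsub>free_group B\<^esub> x \<in> cover"
    if x: "x \<in> carrier (free_group B)" and u: "u \<in> cover" for x u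
  proof -
    have uc: "u \<in> carrier (free_group B)" using u C by blast
    have "coset (x \<otimes>\<^bsub>free_group B\<^esub> u) = coset x" "crossed (x \<otimes>\<^bsub>free_group B\<^esub> u) = crossed x"
      using mult[OF x uc] cov[OF uc] u coset_closed[OF x] by (simp_all del: mult_free_group coset_closed)
    then show ?thesis using mem_cover_iff[of "x \<otimes>\<^bsub>free_group B\<^esub> u" x] x uc N.m_closed by blast
  qed
  then show ?thesis unfolding N.normal_inv_iff using sub by blast
qed

lemma finite_cover:
  assumes "finite B" "finite (rcosets\<^bsub>free_group B\<^esub> N)"
  shows "finite (rcosets\<^bsub>free_group B\<^esub> cover)"
proof -
  let ?T = "carrier Q \<times> Pow (carrier Q \<times> B)"
  have "finite ?T" using assms by (simp add: FactGroup_def)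
  moreover have "(coset x, crossed x) \<in> ?T" if "x \<in> carrier (free_group B)" for x
    using crossed_subset[of x] coset_closed[OF that] that by (auto simp: carrier_free_group)
  ultimately show ?thesis
    using normal_imp_subgroup[OF normal_cover] mem_cover_iff
    by (intro N.rcosets_finite_invariant(1)[where T = ?T and f = "\<lambda>x. (coset x, crossed x)"]) auto
qed

text \<open>The displacement at the coset of \<open>x\<close> is the length of the conjugate of
  \<zeta> by \<open>x\<close>, which lies in \<open>K\<close> by normality and not in
  \<open>N\<close>. A shortest word for it is therefore a nonempty element of
  \<open>K\<close>.\<close>

lemma displacement_ge:
  assumes K: "K \<lhd> free_group B" "N \<subseteq> K" and girth: "\<And>w. w \<in> K \<Longrightarrow> w \<noteq> [] \<Longrightarrow> g \<le> real (length w)"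
    and z: "\<zeta> \<in> K" "\<zeta> \<notin> N" and X: "X \<in> carrier Q"
  shows "g \<le> quotient_dist (coset \<zeta> \<otimes>\<^bsub>Q\<^esub> X) X"
proof -
  interpret K: normal K "free_group B" by (rule K(1))
  have zc: "\<zeta> \<in> carrier (free_group B)" using z(1) K.subset by blast
  obtain x where x: "x \<in> carrier (free_group B)" "coset x = X" using carrier_Q[OF X] by blast
  have X': "inv\<^bsub>Q\<^esub> X \<otimes>\<^bsub>Q\<^esub> (coset \<zeta> \<otimes>\<^bsub>Q\<^esub> X) \<in> carrier Q" using X coset_closed[OF zc] by simp
  obtain w where w: "w \<in> carrier (free_group B)" "coset w = inv\<^bsub>Q\<^esub> X \<otimes>\<^bsub>Q\<^esub> (coset \<zeta> \<otimes>\<^bsub>Q\<^esub> X)"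
      "length w = quotient_length (inv\<^bsub>Q\<^esub> X \<otimes>\<^bsub>Q\<^esub> (coset \<zeta> \<otimes>\<^bsub>Q\<^esub> X))"
    using quotient_length_attained[OF X'] by blast
  define u where "u = inv\<^bsub>free_group B\<^esub> x \<otimes>\<^bsub>free_group B\<^esub> \<zeta> \<otimes>\<^bsub>free_group B\<^esub> x"
  have u: "u \<in> carrier (free_group B)" using x(1) zc by (simp add: u_def del: mult_free_group)
  have uK: "u \<in> K" unfolding u_def using K.inv_op_closed1[OF x(1) z(1)] .
  have cu: "coset u = coset w"
    unfolding u_def w(2) using x zc coset_inv[OF x(1)] m_assoc[OF inv_closed[OF X] coset_closed[OF zc] X]
    by (simp add: coset_mult[symmetric] del: mult_free_group)
  then have "w \<otimes>\<^bsub>free_group B\<^esub> inv\<^bsub>free_group B\<^esub> u \<in> K" using coset_eq_iff[OF w(1) u] K(2) by auto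
  then have "w \<otimes>\<^bsub>free_group B\<^esub> inv\<^bsub>free_group B\<^esub> u \<otimes>\<^bsub>free_group B\<^esub> u \<in> K" using uK by (rule K.m_closed)
  then have wK: "w \<in> K" using w(1) u N.r_one[OF w(1)] by (simp add: N.m_assoc del: mult_free_group)
  have "w \<noteq> []"
  proof
    assume "w = []"
    then have "\<one>\<^bsub>Q\<^esub> = inv\<^bsub>Q\<^esub> X \<otimes>\<^bsub>Q\<^esub> (coset \<zeta> \<otimes>\<^bsub>Q\<^esub> X)" using w(2) by (simp add: coset_one one_Q)
    then have "X \<otimes>\<^bsub>Q\<^esub> \<one>\<^bsub>Q\<^esub> = X \<otimes>\<^bsub>Q\<^esub> (inv\<^bsub>Q\<^esub> X \<otimes>\<^bsub>Q\<^esub> (coset \<zeta> \<otimes>\<^bsub>Q\<^esub> X))" by simp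
    then have "coset \<zeta> \<otimes>\<^bsub>Q\<^esub> X = X"
      using X m_closed[OF coset_closed[OF zc] X] m_assoc[OF X inv_closed[OF X], of "coset \<zeta> \<otimes>\<^bsub>Q\<^esub> X", symmetric]
      by simp
    then have "coset \<zeta> = N" using X coset_closed[OF zc] one_Q by (metis r_cancel_one)
    then show False using z(2) coset_eq_one_iff[OF zc] by simp
  qed
  then have "g \<le> real (length w)" using girth wK by blast
  also have "\<dots> = quotient_dist X (coset \<zeta> \<otimes>\<^bsub>Q\<^esub> X)" by (simp add: quotient_dist_eq w(3))
  finally show ?thesis using quotient_dist_commute[OF X m_closed[OF coset_closed[OF zc] X]] by simp
qed

lemma quotient_dist_right_mult:
  assumes "X \<in> carrier Q" "w \<in> carrier (free_group B)"
  shows "quotient_dist X (X \<otimes>\<^bsub>Q\<^esub> coset w) \<le> real (length w)"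
proof -
  have "inv\<^bsub>Q\<^esub> X \<otimes>\<^bsub>Q\<^esub> (X \<otimes>\<^bsub>Q\<^esub> coset w) = coset w"
    using assms coset_closed[OF assms(2)] by (simp add: m_assoc[symmetric])
  then show ?thesis using quotient_length_coset[OF assms(2)] by (simp add: quotient_dist_eq)
qed

end

text \<open>For a normal subgroup inside the cover, the set of edges crossed by a path depends only on the
  coset of its label. Along short paths no edge is crossed twice, so that the number of edges which
  separate nearby points is their distance.\<close>

locale covered_quotient = P: free_quotient B P + free_quotient B N
  for B :: "'b set" and N P +
  assumes P_subset: "P \<subseteq> cover"
begin

definition wall_set :: "('b \<times> bool) list set \<Rightarrow> (('b \<times> bool) list set \<times> 'b) set" where
  "wall_set X = crossed (SOME w. w \<in> carrier (free_group B) \<and> P.coset w = X)"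

lemma finite_wall_set: "finite (wall_set X)"
  by (simp add: wall_set_def)

lemma card_wall_sets:
  assumes X: "X \<in> carrier P.Q" "Y \<in> carrier P.Q"
    and v: "v \<in> carrier (free_group B)" "P.coset v = inv\<^bsub>P.Q\<^esub> X \<otimes>\<^bsub>P.Q\<^esub> Y"
  shows "card (sdiff (wall_set X) (wall_set Y)) = card (crossed v)"
proof -
  define x where "x = (SOME w. w \<in> carrier (free_group B) \<and> P.coset w = X)"
  define y where "y = (SOME w. w \<in> carrier (free_group B) \<and> P.coset w = Y)"
  have x: "x \<in> carrier (free_group B)" "P.coset x = X"
    using someI_ex[of "\<lambda>w. w \<in> carrier (free_group B) \<and> P.coset w = X"] P.carrier_Q[OF X(1)] by (auto simp: x_def)
  have y: "y \<in> carrier (free_group B)" "P.coset y = Y"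
    using someI_ex[of "\<lambda>w. w \<in> carrier (free_group B) \<and> P.coset w = Y"] P.carrier_Q[OF X(2)] by (auto simp: y_def)
  define u where "u = inv\<^bsub>free_group B\<^esub> x \<otimes>\<^bsub>free_group B\<^esub> y"
  have u: "u \<in> carrier (free_group B)" using x(1) y(1) by (simp add: u_def del: mult_free_group)
  have "P.coset u = P.coset v"
    using P.coset_mult[of "inv\<^bsub>free_group B\<^esub> x" y] P.coset_inv[OF x(1)] x y v(2) by (simp add: u_def del: mult_free_group)
  then have "u \<otimes>\<^bsub>free_group B\<^esub> inv\<^bsub>free_group B\<^esub> v \<in> cover" using P.coset_eq_iff[OF u v(1)] P_subset by blast
  then have uv: "crossed u = crossed v" using mem_cover_iff[OF u v(1)] by blast
  have "y = x \<otimes>\<^bsub>free_group B\<^esub> u"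
    using x(1) y(1) P.N.m_assoc[OF x(1) P.N.inv_closed[OF x(1)] y(1)] P.N.r_inv[OF x(1)] P.N.l_one[OF y(1)]
    unfolding u_def by metis
  then have "crossed y = sdiff (crossed x) (shift (word_value x) (crossed v))" using crossed_mult[of x u] uv by simp
  then have "sdiff (wall_set X) (wall_set Y) = shift (word_value x) (crossed v)" by (simp add: wall_set_def x_def y_def)
  then show ?thesis by (simp add: card_shift crossed_closed)
qed

lemma card_wall_sets_le:
  assumes "X \<in> carrier P.Q" "Y \<in> carrier P.Q"
  shows "real (card (sdiff (wall_set X) (wall_set Y))) \<le> P.quotient_dist X Y"
proof -
  obtain v where v: "v \<in> carrier (free_group B)" "P.coset v = inv\<^bsub>P.Q\<^esub> X \<otimes>\<^bsub>P.Q\<^esub> Y"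
      "length v = P.quotient_length (inv\<^bsub>P.Q\<^esub> X \<otimes>\<^bsub>P.Q\<^esub> Y)"
    using P.quotient_length_attained[of "inv\<^bsub>P.Q\<^esub> X \<otimes>\<^bsub>P.Q\<^esub> Y"] assms by auto
  then show ?thesis using card_wall_sets[OF assms v(1,2)] card_crossed_le[of v] by (simp add: P.quotient_dist_eq)
qed

lemma card_wall_sets_eq:
  assumes X: "X \<in> carrier P.Q" "Y \<in> carrier P.Q" and g: "P.quotient_dist X Y < g"
    and girth: "\<And>w. w \<in> N \<Longrightarrow> w \<noteq> [] \<Longrightarrow> g \<le> real (length w)"
  shows "real (card (sdiff (wall_set X) (wall_set Y))) = P.quotient_dist X Y"
proof -
  obtain v where v: "v \<in> carrier (free_group B)" "P.coset v = inv\<^bsub>P.Q\<^esub> X \<otimes>\<^bsub>P.Q\<^esub> Y"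
      "length v = P.quotient_length (inv\<^bsub>P.Q\<^esub> X \<otimes>\<^bsub>P.Q\<^esub> Y)"
    using P.quotient_length_attained[of "inv\<^bsub>P.Q\<^esub> X \<otimes>\<^bsub>P.Q\<^esub> Y"] X by auto
  have "card (crossed v) = length v"
  proof (rule card_crossed)
    show "reduced_word v" using v(1) by (simp add: carrier_free_group)
    fix a b c assume abc: "v = a @ b @ c" "b \<noteq> []"
    then have b: "b \<in> carrier (free_group B)" using infix_free_group v(1) by blast
    have "real (length b) < g" using g v(3) abc(1) by (simp add: P.quotient_dist_eq)
    then have "b \<notin> N" using girth[of b] abc(2) by auto
    then show "word_value b \<noteq> \<one>\<^bsub>Q\<^esub>" using word_value_eq[OF b] coset_eq_one_iff[OF b] by (simp add: one_Q)
  qed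
  then show ?thesis using card_wall_sets[OF X v(1,2)] v(3) by (simp add: P.quotient_dist_eq)
qed

end

section \<open>Coarse disjoint unions\<close>

lemma coarse_disjoint_union_exists:
  fixes Xs :: "nat \<Rightarrow> 'a set" and ds :: "nat \<Rightarrow> 'a \<Rightarrow> 'a \<Rightarrow> real"
  assumes fin: "\<And>n. finite (Xs n)" and nonneg: "\<And>n x y. 0 \<le> ds n x y"
    and sym: "\<And>n x y. x \<in> Xs n \<Longrightarrow> y \<in> Xs n \<Longrightarrow> ds n x y = ds n y x"
    and zero: "\<And>n x y. x \<in> Xs n \<Longrightarrow> y \<in> Xs n \<Longrightarrow> ds n x y = 0 \<longleftrightarrow> x = y"
    and tri: "\<And>n x y z. x \<in> Xs n \<Longrightarrow> y \<in> Xs n \<Longrightarrow> z \<in> Xs n \<Longrightarrow> ds n x z \<le> ds n x y + ds n y z"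
  shows "\<exists>d. coarse_disjoint_union Xs ds (SIGMA n:UNIV. Xs n) d"
proof -
  \<comment> \<open>The double sum dominates the diameter of the piece, which gives the triangle
    inequality for detours through another piece; \<open>real n + 1\<close> sends the distances
    between pieces to infinity.\<close>
  define D where "D n = real n + 1 + (\<Sum>x\<in>Xs n. \<Sum>y\<in>Xs n. ds n x y)" for n
  have Dn: "real n + 1 \<le> D n" for n unfolding D_def using nonneg by (simp add: sum_nonneg)
  have Dds: "ds n x y \<le> D n" if "x \<in> Xs n" "y \<in> Xs n" for n x y
  proof -
    have "ds n x y \<le> (\<Sum>y\<in>Xs n. ds n x y)" using that fin nonneg by (intro member_le_sum) auto
    also have "\<dots> \<le> (\<Sum>x\<in>Xs n. \<Sum>y\<in>Xs n. ds n x y)"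
      using that fin nonneg by (intro member_le_sum[where f = "\<lambda>x. \<Sum>y\<in>Xs n. ds n x y"]) (auto intro: sum_nonneg)
    finally show ?thesis by (simp add: D_def)
  qed
  \<comment> \<open>\<open>Metric_space\<close> asks for symmetry of the distance at all points, but
    \<open>ds\<close> is only known to be symmetric on the pieces; hence the value 0
    elsewhere.\<close>
  define d where "d = (\<lambda>(n, x) (m, y). if x \<in> Xs n \<and> y \<in> Xs m then (if n = m then ds n x y else D n + D m) else 0)"
  have D0: "0 < D n" for n using Dn[of n] by linarith
  have "Metric_space (SIGMA n:UNIV. Xs n) d"
  proof
    fix x y z :: "nat \<times> 'a"
    show "0 \<le> d x y" using nonneg D0 by (auto simp: d_def less_imp_le add_pos_pos split: prod.splits)
    show "d x y = d y x" using sym by (auto simp: d_def split: prod.splits)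
    show "d x y = 0 \<longleftrightarrow> x = y" if "x \<in> (SIGMA n:UNIV. Xs n)" "y \<in> (SIGMA n:UNIV. Xs n)"
    proof -
      have "D n + D m \<noteq> 0" for n m using D0[of n] D0[of m] by linarith
      then show ?thesis using that zero by (auto simp: d_def split: if_splits)
    qed
    show "d x z \<le> d x y + d y z"
      if "x \<in> (SIGMA n:UNIV. Xs n)" "y \<in> (SIGMA n:UNIV. Xs n)" "z \<in> (SIGMA n:UNIV. Xs n)"
    proof -
      obtain i a j b k c where xyz: "x = (i, a)" "y = (j, b)" "z = (k, c)" by (metis surj_pair)
      have abc: "a \<in> Xs i" "b \<in> Xs j" "c \<in> Xs k" using that xyz by auto
      have "ds i a c \<le> D i + D j + (D j + D k)" if "i = k"
        using Dds[OF abc(1), of c] abc(3) that D0[of i] D0[of j] by simp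
      moreover have "D i + D k \<le> ds i a b + (D j + D k)" if "i = j" using nonneg[of i a b] that by simp
      moreover have "D i + D k \<le> D i + D j + ds j b c" if "j = k" using nonneg[of j b c] that by simp
      moreover have "D i + D k \<le> D i + D j + (D j + D k)" using D0[of j] by simp
      moreover have "ds i a c \<le> ds i a b + ds j b c" if "i = j" "j = k" using tri[of a i b c] abc that by simp
      ultimately show ?thesis using abc unfolding xyz d_def by (cases "i = j"; cases "j = k"; cases "i = k") simp_all
    qed
  qed
  moreover have "\<exists>K. \<forall>n m. n \<noteq> m \<and> K \<le> n + m \<longrightarrow> (\<forall>x\<in>Xs n. \<forall>y\<in>Xs m. R \<le> d (n, x) (m, y))" for R
  proof (intro exI allI impI ballI)
    fix n m x y assume *: "n \<noteq> m \<and> nat \<lceil>R\<rceil> \<le> n + m" and xy: "x \<in> Xs n" "y \<in> Xs m"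
    have "R \<le> real (nat \<lceil>R\<rceil>)" by (rule real_nat_ceiling_ge)
    also have "\<dots> \<le> real n + real m" using * by (simp flip: of_nat_add)
    also have "\<dots> \<le> D n + D m" using Dn[of n] Dn[of m] by linarith
    finally show "R \<le> d (n, x) (m, y)" using * xy by (simp add: d_def)
  qed
  ultimately show ?thesis unfolding coarse_disjoint_union_def by (intro exI[of _ d]) (auto simp: d_def)
qed

section \<open>A box space of the free group\<close>

lemma carrier_normal: "group G \<Longrightarrow> carrier G \<lhd> G"
  by (simp add: group.normal_inv_iff group.subgroup_self group.is_monoid monoid.m_closed)

abbreviation cong_cover :: "nat \<Rightarrow> (nat \<times> bool) list set" where
  "cong_cover n \<equiv> free_quotient.cover {0, 1, 2} (cong_ker n)"

lemma free_quotient_F3: "free_quotient {0, 1, 2} N \<longleftrightarrow> N \<lhd> F3"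
  by (simp only: free_quotient_def F3_def)

lemma finite_cong_ker: "0 < t \<Longrightarrow> finite (rcosets\<^bsub>F3\<^esub> (cong_ker t))"
proof -
  interpret group F3 by (rule group_F3)
  assume "0 < t"
  moreover have "finite (rcosets\<^bsub>F3\<^esub> (carrier F3))"
    using rcosets_finite_invariant(1)[OF subgroup_self, of "{()}" "\<lambda>_. ()"] by simp
  moreover have "cong_ker t \<inter> carrier F3 = cong_ker t" by (auto simp: cong_ker_def)
  ultimately show ?thesis using finite_cong_ker_Int(1)[OF carrier_normal[OF group_F3]] by metis
qed

text \<open>Covers of different levels are not compared with each other; intersecting them makes the
  sequence decrease. Levels start at 1 because finite index is established for positive
  levels.\<close>

primrec deep_cover :: "nat \<Rightarrow> (nat \<times> bool) list set" where
  "deep_cover 0 = cong_cover 1"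
| "deep_cover (Suc n) = deep_cover n \<inter> cong_cover (Suc (Suc n))"

lemma cong_cover:
  shows "cong_cover n \<lhd> F3" "cong_cover n \<subseteq> cong_ker n" "0 < n \<Longrightarrow> finite (rcosets\<^bsub>F3\<^esub> (cong_cover n))"
proof -
  have fq: "free_quotient {0, 1, 2} (cong_ker n)" by (simp only: free_quotient_F3 normal_cong_ker)
  show "cong_cover n \<lhd> F3" unfolding F3_def by (rule free_quotient.normal_cover[OF fq])
  show "cong_cover n \<subseteq> cong_ker n" by (rule free_quotient.cover_subset[OF fq])
  show "finite (rcosets\<^bsub>F3\<^esub> (cong_cover n))" if "0 < n"
    using free_quotient.finite_cover[OF fq] finite_cong_ker[OF that] unfolding F3_def by simp
qed

lemma (in group) finite_rcosets_Int:
  assumes "M \<lhd> G" "N \<lhd> G" "finite (rcosets M)" "finite (rcosets N)"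
  shows "finite (rcosets (M \<inter> N))"
proof (rule rcosets_Int_bound(1)[OF assms(1,2,4,3)])
  show "M #> x \<in> rcosets M" if "x \<in> carrier G" for x using that by (auto simp: RCOSETS_def)
  show "x \<otimes> inv y \<in> M" if "x \<in> carrier G" "y \<in> carrier G" "M #> x = M #> y" for x y
    using eq_rcosets_iff[OF assms(1) that(1,2)] that(3) by blast
qed

lemma deep_cover:
  "deep_cover n \<lhd> F3" "finite (rcosets\<^bsub>F3\<^esub> (deep_cover n))" "deep_cover n \<subseteq> cong_cover (Suc n)"
proof (induction n)
  case 0
  show "deep_cover 0 \<lhd> F3" "finite (rcosets\<^bsub>F3\<^esub> (deep_cover 0))" "deep_cover 0 \<subseteq> cong_cover (Suc 0)"
    using cong_cover(1,3)[of 1] by simp_all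
next
  case (Suc n)
  interpret group F3 by (rule group_F3)
  show "deep_cover (Suc n) \<lhd> F3" unfolding deep_cover.simps by (rule normal_Int[OF Suc(1) cong_cover(1)])
  show "finite (rcosets\<^bsub>F3\<^esub> (deep_cover (Suc n)))"
    unfolding deep_cover.simps by (rule finite_rcosets_Int[OF Suc(1) cong_cover(1) Suc(2) cong_cover(3)]) simp
qed auto

text \<open>A crude form of \<open>cong_ker_length\<close>, with 13 replaced by 5: linear growth in
  \<open>n\<close> is enough.\<close>

lemma girth_cong_ker:
  assumes "w \<in> cong_ker n" "w \<noteq> []"
  shows "2 * n \<le> length w"
proof (rule ccontr)
  assume "\<not> ?thesis"
  then have "(5 :: int) ^ length w < 5 ^ (2 * n)" by (intro power_strict_increasing) auto
  also have "\<dots> \<le> 13 ^ (2 * n)" by (rule power_mono) auto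
  finally show False using cong_ker_length[OF assms] by linarith
qed

definition displacement_bound :: "(nat \<times> bool) list set \<Rightarrow> (nat \<times> bool) list \<Rightarrow> bool" where
  "displacement_bound N \<zeta> \<longleftrightarrow> (\<forall>p\<ge>1. \<forall>F :: (nat \<times> bool) list set \<Rightarrow> real.
    (\<Sum>X\<in>carrier (F3 Mod N). \<bar>F ((N #>\<^bsub>F3\<^esub> \<zeta>) \<otimes>\<^bsub>F3 Mod N\<^esub> X) - F X\<bar> powr p)
    \<le> poincare_const p / real (card steps) * (\<Sum>(w, X)\<in>steps \<times> carrier (F3 Mod N).
        \<bar>F X - F (X \<otimes>\<^bsub>F3 Mod N\<^esub> (N #>\<^bsub>F3\<^esub> w))\<bar> powr p))"

lemma box_sequence:
  "\<exists>N. \<forall>n. N n \<lhd> F3 \<and> finite (rcosets\<^bsub>F3\<^esub> (N n)) \<and> N (Suc n) \<subseteq> N n \<and> N n \<subseteq> cong_cover (Suc n) \<and>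
    (\<exists>\<zeta>\<in>cong_ker (Suc n). \<zeta> \<notin> N n \<and> displacement_bound (N n) \<zeta>)"
proof -
  interpret group F3 by (rule group_F3)
  have "\<forall>n. \<exists>t0>0. \<forall>t\<ge>t0. \<exists>\<zeta>\<in>deep_cover n. \<zeta> \<notin> cong_ker t \<and> displacement_bound (cong_ker t \<inter> deep_cover n) \<zeta>"
    unfolding displacement_bound_def using relative_poincare[OF deep_cover(1,2)] by blast
  then obtain t0 where t0: "\<And>n. 0 < t0 n" "\<And>n t. t0 n \<le> t \<Longrightarrow>
      \<exists>\<zeta>\<in>deep_cover n. \<zeta> \<notin> cong_ker t \<and> displacement_bound (cong_ker t \<inter> deep_cover n) \<zeta>"
    by metis
  \<comment> \<open>Partial sums dominate each threshold and increase, as the nesting of the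
    subgroups requires.\<close>
  define t where "t n = (\<Sum>i\<le>n. t0 i)" for n
  have t: "t0 n \<le> t n" "t n \<le> t (Suc n)" for n unfolding t_def by (auto intro: member_le_sum)
  have t_pos: "0 < t n" for n using t(1)[of n] t0(1)[of n] by linarith
  have "\<exists>\<zeta>\<in>cong_ker (Suc n). \<zeta> \<notin> cong_ker (t n) \<inter> deep_cover n \<and> displacement_bound (cong_ker (t n) \<inter> deep_cover n) \<zeta>" for n
    using t0(2)[OF t(1)] deep_cover(3)[of n] cong_cover(2)[of "Suc n"] by blast
  moreover have "cong_ker (t n) \<inter> deep_cover n \<lhd> F3" for n
    by (rule normal_Int[OF normal_cong_ker deep_cover(1)])
  moreover have "finite (rcosets\<^bsub>F3\<^esub> (cong_ker (t n) \<inter> deep_cover n))" for n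
    by (rule finite_cong_ker_Int(1)[OF deep_cover(1,2) t_pos])
  moreover have "cong_ker (t (Suc n)) \<inter> deep_cover (Suc n) \<subseteq> cong_ker (t n) \<inter> deep_cover n" for n
    using cong_ker_mono[OF t(2)] by auto
  moreover have "cong_ker (t n) \<inter> deep_cover n \<subseteq> cong_cover (Suc n)" for n using deep_cover(3) by blast
  ultimately show ?thesis by (intro exI[of _ "\<lambda>n. cong_ker (t n) \<inter> deep_cover n"]) simp
qed

section \<open>Maps to Lebesgue spaces\<close>

lemma Lp_diff_integrable:
  assumes "f \<in> Lp_funs M p" "g \<in> Lp_funs M p" "0 \<le> p"
  shows "integrable M (\<lambda>z. \<bar>f z - g z\<bar> powr p)"
proof (rule Bochner_Integration.integrable_bound)
  show "integrable M (\<lambda>z. 2 powr p * (\<bar>f z\<bar> powr p + \<bar>g z\<bar> powr p))"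
    using assms by (auto simp: Lp_funs_def)
  show "(\<lambda>z. \<bar>f z - g z\<bar> powr p) \<in> borel_measurable M"
    using assms by (auto simp: Lp_funs_def)
  have "\<bar>a - b\<bar> powr p \<le> 2 powr p * (\<bar>a\<bar> powr p + \<bar>b\<bar> powr p)" for a b :: real
  proof -
    have "\<bar>a - b\<bar> powr p \<le> (2 * max \<bar>a\<bar> \<bar>b\<bar>) powr p" by (rule powr_mono2) (use assms(3) in auto)
    also have "\<dots> = 2 powr p * max \<bar>a\<bar> \<bar>b\<bar> powr p" by (rule powr_mult)
    also have "\<dots> \<le> 2 powr p * (\<bar>a\<bar> powr p + \<bar>b\<bar> powr p)" by (intro mult_left_mono) (auto simp: max_def)
    finally show ?thesis .
  qed
  then show "AE z in M. norm (\<bar>f z - g z\<bar> powr p) \<le> norm (2 powr p * (\<bar>f z\<bar> powr p + \<bar>g z\<bar> powr p))"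
    by auto
qed

lemma Lp_dist_powr:
  assumes "1 \<le> p"
  shows "Lp_dist M p f g powr p = (\<integral>z. \<bar>f z - g z\<bar> powr p \<partial>M)"
proof -
  have "0 \<le> (\<integral>z. \<bar>f z - g z\<bar> powr p \<partial>M)" by (rule integral_nonneg_AE) simp
  then show ?thesis using assms by (simp add: Lp_dist_def powr_powr)
qed

text \<open>Both sides are sums of \<open>p\<close>-th powers of norms, so the inequality for real
  functions can be applied at each point of the measure space and integrated.\<close>

lemma displacement_bound_Lp:
  assumes db: "displacement_bound N \<zeta>" and N: "N \<lhd> F3" and z: "\<zeta> \<in> carrier F3" and p: "1 \<le> p"
    and f: "\<And>X. X \<in> carrier (F3 Mod N) \<Longrightarrow> f X \<in> Lp_funs M p"
  shows "(\<Sum>X\<in>carrier (F3 Mod N). Lp_dist M p (f ((N #>\<^bsub>F3\<^esub> \<zeta>) \<otimes>\<^bsub>F3 Mod N\<^esub> X)) (f X) powr p)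
    \<le> poincare_const p / real (card steps) * (\<Sum>(w, X)\<in>steps \<times> carrier (F3 Mod N).
        Lp_dist M p (f X) (f (X \<otimes>\<^bsub>F3 Mod N\<^esub> (N #>\<^bsub>F3\<^esub> w))) powr p)"
proof -
  let ?Q = "F3 Mod N"
  interpret N: normal N F3 by (rule N)
  interpret Q: group ?Q by (rule N.factorgroup_is_group)
  have cl: "N #>\<^bsub>F3\<^esub> w \<in> carrier ?Q" if "w \<in> carrier F3" for w
    using that by (auto simp: FactGroup_def RCOSETS_def)
  have int: "integrable M (\<lambda>z. \<bar>f X z - f Y z\<bar> powr p)" if "X \<in> carrier ?Q" "Y \<in> carrier ?Q" for X Y
    using that p by (intro Lp_diff_integrable f) auto
  have zX: "(N #>\<^bsub>F3\<^esub> \<zeta>) \<otimes>\<^bsub>?Q\<^esub> X \<in> carrier ?Q" if "X \<in> carrier ?Q" for X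
    by (rule Q.m_closed[OF cl[OF z] that])
  have wX: "X \<otimes>\<^bsub>?Q\<^esub> (N #>\<^bsub>F3\<^esub> w) \<in> carrier ?Q" if "X \<in> carrier ?Q" "w \<in> steps" for X w
    using that by (intro Q.m_closed cl) (simp_all only: steps_F3)
  have iL: "integrable M (\<lambda>z. \<Sum>X\<in>carrier ?Q. \<bar>f ((N #>\<^bsub>F3\<^esub> \<zeta>) \<otimes>\<^bsub>?Q\<^esub> X) z - f X z\<bar> powr p)"
    by (intro Bochner_Integration.integrable_sum int zX)
  have iR0: "integrable M (\<lambda>z. case wX of (w, X) \<Rightarrow> \<bar>f X z - f (X \<otimes>\<^bsub>?Q\<^esub> (N #>\<^bsub>F3\<^esub> w)) z\<bar> powr p)"
    if wX': "wX \<in> steps \<times> carrier ?Q" for wX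
  proof -
    obtain w X where *: "wX = (w, X)" "w \<in> steps" "X \<in> carrier ?Q" using wX' by (rule SigmaE)
    show ?thesis unfolding *(1) prod.case by (rule int[OF *(3) wX[OF *(3,2)]])
  qed
  have iR: "integrable M (\<lambda>z. \<Sum>(w, X)\<in>steps \<times> carrier ?Q. \<bar>f X z - f (X \<otimes>\<^bsub>?Q\<^esub> (N #>\<^bsub>F3\<^esub> w)) z\<bar> powr p)"
    by (intro Bochner_Integration.integrable_sum iR0)
  have "(\<Sum>X\<in>carrier ?Q. Lp_dist M p (f ((N #>\<^bsub>F3\<^esub> \<zeta>) \<otimes>\<^bsub>?Q\<^esub> X)) (f X) powr p)
      = (\<integral>z. (\<Sum>X\<in>carrier ?Q. \<bar>f ((N #>\<^bsub>F3\<^esub> \<zeta>) \<otimes>\<^bsub>?Q\<^esub> X) z - f X z\<bar> powr p) \<partial>M)"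
    unfolding Lp_dist_powr[OF p] by (intro Bochner_Integration.integral_sum[symmetric] int zX)
  also have "\<dots> \<le> (\<integral>z. poincare_const p / real (card steps) *
      (\<Sum>(w, X)\<in>steps \<times> carrier ?Q. \<bar>f X z - f (X \<otimes>\<^bsub>?Q\<^esub> (N #>\<^bsub>F3\<^esub> w)) z\<bar> powr p) \<partial>M)"
  proof (rule integral_mono[OF iL])
    show "(\<Sum>X\<in>carrier ?Q. \<bar>f ((N #>\<^bsub>F3\<^esub> \<zeta>) \<otimes>\<^bsub>?Q\<^esub> X) z - f X z\<bar> powr p) \<le> poincare_const p / real (card steps) *
      (\<Sum>(w, X)\<in>steps \<times> carrier ?Q. \<bar>f X z - f (X \<otimes>\<^bsub>?Q\<^esub> (N #>\<^bsub>F3\<^esub> w)) z\<bar> powr p)" for z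
      using db p unfolding displacement_bound_def by (elim allE[of _ p] impE) (auto dest: spec[of _ "\<lambda>X. f X z"])
  qed (intro Bochner_Integration.integrable_mult_right iR)
  also have "\<dots> = poincare_const p / real (card steps) *
      (\<integral>z. (\<Sum>(w, X)\<in>steps \<times> carrier ?Q. \<bar>f X z - f (X \<otimes>\<^bsub>?Q\<^esub> (N #>\<^bsub>F3\<^esub> w)) z\<bar> powr p) \<partial>M)"
    by simp
  also have "(\<integral>z. (\<Sum>(w, X)\<in>steps \<times> carrier ?Q. \<bar>f X z - f (X \<otimes>\<^bsub>?Q\<^esub> (N #>\<^bsub>F3\<^esub> w)) z\<bar> powr p) \<partial>M)
      = (\<Sum>wX\<in>steps \<times> carrier ?Q. (\<integral>z. (case wX of (w, X) \<Rightarrow> \<bar>f X z - f (X \<otimes>\<^bsub>?Q\<^esub> (N #>\<^bsub>F3\<^esub> w)) z\<bar> powr p) \<partial>M))"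
    by (intro Bochner_Integration.integral_sum iR0)
  also have "\<dots> = (\<Sum>(w, X)\<in>steps \<times> carrier ?Q. Lp_dist M p (f X) (f (X \<otimes>\<^bsub>?Q\<^esub> (N #>\<^bsub>F3\<^esub> w))) powr p)"
    by (intro sum.cong refl) (auto simp: Lp_dist_powr[OF p])
  finally show ?thesis .
qed

lemma box_space_main:
  "\<exists>X d. box_space F3 X d \<and> (\<forall>p\<ge>1. \<not> coarsely_embeds_into_Lp X d p) \<and> \<not> weakly_contains_some_expanders X d"
proof -
  obtain N where N: "\<And>n. N n \<lhd> F3" "\<And>n. finite (rcosets\<^bsub>F3\<^esub> (N n))" "\<And>n. N (Suc n) \<subseteq> N n"
      "\<And>n. N n \<subseteq> cong_cover (Suc n)"
      "\<And>n. \<exists>\<zeta>\<in>cong_ker (Suc n). \<zeta> \<notin> N n \<and> displacement_bound (N n) \<zeta>"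
    using box_sequence by metis
  have fq: "free_quotient {0, 1, 2} (N n)" for n by (simp only: free_quotient_F3 N(1))
  have cq: "covered_quotient {0, 1, 2} (cong_ker (Suc n)) (N n)" for n
    unfolding covered_quotient_def covered_quotient_axioms_def
    by (simp only: free_quotient_F3 N(1,4) normal_cong_ker)
  have Ncong: "N n \<subseteq> cong_ker (Suc n)" for n using N(4) cong_cover(2) by blast
  define Xs where "Xs n = carrier (F3 Mod N n)" for n
  define ds where "ds n = word_metric (F3 Mod N n) ((\<lambda>s. N n #>\<^bsub>F3\<^esub> s) ` generators {0, 1, 2})" for n
  have ds: "ds n = free_quotient.quotient_dist {0, 1, 2} (N n)" for n
    unfolding ds_def free_quotient.quotient_dist_def[OF fq] F3_def ..
  have fin: "finite (Xs n)" for n using N(2) by (simp add: Xs_def FactGroup_def)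
  have "\<exists>d. coarse_disjoint_union Xs ds (SIGMA n:UNIV. Xs n) d"
    using fin unfolding ds Xs_def F3_def
    by (rule coarse_disjoint_union_exists)
      (rule free_quotient.quotient_dist_nonneg[OF fq] free_quotient.quotient_dist_commute[OF fq]
        free_quotient.quotient_dist_eq_0[OF fq] free_quotient.quotient_dist_triangle[OF fq]; assumption)+
  then obtain d where d: "coarse_disjoint_union Xs ds (SIGMA n:UNIV. Xs n) d" by blast
  let ?X = "SIGMA n:UNIV. Xs n"
  have dn: "d (n, x) (n, y) = ds n x y" if "x \<in> Xs n" "y \<in> Xs n" for n x y
    using d that by (simp add: coarse_disjoint_union_def)
  have dm: "Metric_space ?X d" using d by (simp add: coarse_disjoint_union_def)
  have box: "box_space F3 ?X d"
    unfolding box_space_def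
  proof (intro exI[of _ "generators {0, 1, 2}"] exI[of _ N] conjI allI)
    show "finite_generating_set F3 (generators {0, 1, 2})"
      unfolding finite_generating_set_def F3_def using generate_generators[of "{0, 1, 2 :: nat}"]
      by (auto simp: generators_def intro!: letter_free_group)
    show "finite_index_normal (N n) F3" for n using N(1,2) by (simp add: finite_index_normal_def)
    show "N (Suc n) \<subseteq> N n" for n by (rule N(3))
    show "coarse_disjoint_union (\<lambda>n. carrier (F3 Mod N n))
          (\<lambda>n. word_metric (F3 Mod N n) ((\<lambda>s. N n #>\<^bsub>F3\<^esub> s) ` generators {0, 1, 2})) ?X d"
      using d unfolding Xs_def ds_def .
    have "[] \<in> N n" for n
      using subgroup.one_closed[OF normal_imp_subgroup[OF N(1)[of n]]] by (simp add: one_F3)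
    moreover have "w = []" if "\<And>n. w \<in> N n" for w
    proof (rule ccontr)
      assume "w \<noteq> []"
      \<comment> \<open>At the level \<open>length w\<close> the girth already exceeds the length of
        \<open>w\<close>.\<close>
      then have "2 * Suc (length w) \<le> length w"
        using that[of "length w"] Ncong[of "length w"] by (intro girth_cong_ker) blast+
      then show False by simp
    qed
    ultimately show "(\<Inter>n. N n) = {\<one>\<^bsub>F3\<^esub>}" unfolding one_F3 by blast
  qed
  have "\<not> coarsely_embeds_into_Lp ?X d p" if p: "1 \<le> p" for p
  proof
    assume "coarsely_embeds_into_Lp ?X d p"
    then obtain M :: "(nat \<times> (nat \<times> bool) list set \<Rightarrow> real) measure" and f
      where "coarse_embedding ?X d (Lp_funs M p) (Lp_dist M p) f"
      by (auto simp: coarsely_embeds_into_Lp_def)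
    then obtain \<rho>1 \<rho>2 where f: "\<And>x. x \<in> ?X \<Longrightarrow> f x \<in> Lp_funs M p"
      and \<rho>: "control_function \<rho>1" "control_function \<rho>2"
      and emb: "\<And>x y. x \<in> ?X \<Longrightarrow> y \<in> ?X \<Longrightarrow> \<rho>1 (d x y) \<le> Lp_dist M p (f x) (f y)"
        "\<And>x y. x \<in> ?X \<Longrightarrow> y \<in> ?X \<Longrightarrow> Lp_dist M p (f x) (f y) \<le> \<rho>2 (d x y)"
      unfolding coarse_embedding_def by blast
    have mono: "\<rho>1 s \<le> \<rho>1 t" "\<rho>2 s \<le> \<rho>2 t" "0 \<le> \<rho>1 s" if "0 \<le> s" "s \<le> t" for s t
      using \<rho> that by (auto simp: control_function_def mono_on_def)
    \<comment> \<open>Summing over the whole level makes the bound independent of \<open>n\<close>: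
      \<open>?H\<close> displacements of at least \<open>2 * Suc n\<close> stand against
      \<open>card steps * ?H\<close> moves by at most 600, and both counts cancel. So \<rho>1 would
      be bounded.\<close>
    have "\<rho>1 (real (2 * Suc n)) \<le> (poincare_const p * \<rho>2 600 powr p) powr (1 / p)" for n
    proof -
      obtain \<zeta> where z: "\<zeta> \<in> cong_ker (Suc n)" "\<zeta> \<notin> N n" "displacement_bound (N n) \<zeta>" using N(5) by blast
      let ?Q = "F3 Mod N n"
      interpret N: normal "N n" F3 by (rule N(1))
      interpret Q: group ?Q by (rule N.factorgroup_is_group)
      have zc: "\<zeta> \<in> carrier F3" using z(1) by (auto simp: cong_ker_def)
      have cl: "N n #>\<^bsub>F3\<^esub> w \<in> carrier ?Q" if "w \<in> carrier F3" for w
        using that by (auto simp: FactGroup_def RCOSETS_def)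
      have X: "(n, X) \<in> ?X" if "X \<in> carrier ?Q" for X using that by (simp add: Xs_def)
      let ?H = "real (card (carrier ?Q))"
      have H: "0 < ?H" using fin[of n] Q.one_closed by (auto simp: Xs_def card_gt_0_iff)
      have S: "0 < real (card steps)"
        using sphere_words_nonempty[of "{0, 1, 2 :: nat}" 600] finite_sphere_words[of "{0, 1, 2 :: nat}" 600]
        by (simp add: card_gt_0_iff)
      have cancel: "a / s * (s * h * b) = h * (a * b)" if "0 < s" for a b h s :: real
        using that by (simp add: field_simps)
      have "?H * \<rho>1 (real (2 * Suc n)) powr p = (\<Sum>X\<in>carrier ?Q. \<rho>1 (real (2 * Suc n)) powr p)" by simp
      also have "\<dots> \<le> (\<Sum>X\<in>carrier ?Q. Lp_dist M p (f (n, (N n #>\<^bsub>F3\<^esub> \<zeta>) \<otimes>\<^bsub>?Q\<^esub> X)) (f (n, X)) powr p)"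
      proof (rule sum_mono)
        fix X assume Xc: "X \<in> carrier ?Q"
        have ZX: "(N n #>\<^bsub>F3\<^esub> \<zeta>) \<otimes>\<^bsub>?Q\<^esub> X \<in> carrier ?Q" by (rule Q.m_closed[OF cl[OF zc] Xc])
        have "real (2 * Suc n) \<le> ds n ((N n #>\<^bsub>F3\<^esub> \<zeta>) \<otimes>\<^bsub>?Q\<^esub> X) X"
          unfolding ds F3_def
        proof (rule free_quotient.displacement_ge[OF fq])
          show "cong_ker (Suc n) \<lhd> free_group {0, 1, 2}" using normal_cong_ker by (simp only: F3_def)
          show "X \<in> carrier (free_group {0, 1, 2} Mod N n)" using Xc by (simp only: F3_def)
          show "real (2 * Suc n) \<le> real (length w)" if "w \<in> cong_ker (Suc n)" "w \<noteq> []" for w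
            unfolding of_nat_le_iff by (rule girth_cong_ker[OF that])
        qed (use Ncong z in blast)+
        also have "\<dots> = d (n, (N n #>\<^bsub>F3\<^esub> \<zeta>) \<otimes>\<^bsub>?Q\<^esub> X) (n, X)" using dn ZX Xc unfolding Xs_def by metis
        finally have "\<rho>1 (real (2 * Suc n)) \<le> \<rho>1 (d (n, (N n #>\<^bsub>F3\<^esub> \<zeta>) \<otimes>\<^bsub>?Q\<^esub> X) (n, X))"
          by (intro mono) simp_all
        also have "\<dots> \<le> Lp_dist M p (f (n, (N n #>\<^bsub>F3\<^esub> \<zeta>) \<otimes>\<^bsub>?Q\<^esub> X)) (f (n, X))" by (intro emb X ZX Xc)
        finally show "\<rho>1 (real (2 * Suc n)) powr p \<le> Lp_dist M p (f (n, (N n #>\<^bsub>F3\<^esub> \<zeta>) \<otimes>\<^bsub>?Q\<^esub> X)) (f (n, X)) powr p"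
          using p by (intro powr_mono2 mono(3)[of _ "real (2 * Suc n)"]) auto
      qed
      also have "\<dots> \<le> poincare_const p / real (card steps) * (\<Sum>(w, X)\<in>steps \<times> carrier ?Q.
          Lp_dist M p (f (n, X)) (f (n, X \<otimes>\<^bsub>?Q\<^esub> (N n #>\<^bsub>F3\<^esub> w))) powr p)"
        by (rule displacement_bound_Lp[OF z(3) N(1) zc p]) (rule f[OF X])
      also have "\<dots> \<le> poincare_const p / real (card steps) * (\<Sum>(w, X)\<in>steps \<times> carrier ?Q. \<rho>2 600 powr p)"
      proof (intro mult_left_mono sum_mono)
        fix wX assume "wX \<in> steps \<times> carrier ?Q"
        then obtain w X where wX: "wX = (w, X)" "w \<in> steps" "X \<in> carrier ?Q" by (rule SigmaE)
        have w: "w \<in> carrier F3" "length w = 600" using wX(2) unfolding steps_F3 by auto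
        have Xw: "X \<otimes>\<^bsub>?Q\<^esub> (N n #>\<^bsub>F3\<^esub> w) \<in> carrier ?Q" by (rule Q.m_closed[OF wX(3) cl[OF w(1)]])
        have "d (n, X) (n, X \<otimes>\<^bsub>?Q\<^esub> (N n #>\<^bsub>F3\<^esub> w)) = ds n X (X \<otimes>\<^bsub>?Q\<^esub> (N n #>\<^bsub>F3\<^esub> w))"
          using dn Xw wX(3) unfolding Xs_def by metis
        also have "\<dots> \<le> real (length w)"
          using free_quotient.quotient_dist_right_mult[OF fq, of X n w] wX(3) w(1) unfolding ds F3_def by blast
        finally have le: "d (n, X) (n, X \<otimes>\<^bsub>?Q\<^esub> (N n #>\<^bsub>F3\<^esub> w)) \<le> 600" using w(2) by simp
        have "0 \<le> d (n, X) (n, X \<otimes>\<^bsub>?Q\<^esub> (N n #>\<^bsub>F3\<^esub> w))"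
          by (rule Metric_space.nonneg[OF dm])
        then have "Lp_dist M p (f (n, X)) (f (n, X \<otimes>\<^bsub>?Q\<^esub> (N n #>\<^bsub>F3\<^esub> w))) \<le> \<rho>2 600"
          using emb(2)[OF X[OF wX(3)] X[OF Xw]] mono(2)[OF _ le] by linarith
        then show "(case wX of (w, X) \<Rightarrow> Lp_dist M p (f (n, X)) (f (n, X \<otimes>\<^bsub>?Q\<^esub> (N n #>\<^bsub>F3\<^esub> w))) powr p)
            \<le> (case wX of (w, X) \<Rightarrow> \<rho>2 600 powr p)"
          unfolding wX(1) prod.case using p by (intro powr_mono2) (auto simp: Lp_dist_def)
      qed (simp add: poincare_const_def)
      also have "(\<Sum>(w, X)\<in>steps \<times> carrier ?Q. \<rho>2 600 powr p) = real (card steps) * ?H * \<rho>2 600 powr p"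
        by (simp only: case_prod_unfold sum_constant card_cartesian_product of_nat_mult)
      also have "poincare_const p / real (card steps) * (real (card steps) * ?H * \<rho>2 600 powr p)
          = ?H * (poincare_const p * \<rho>2 600 powr p)"
        using cancel[OF S] .
      finally have "\<rho>1 (real (2 * Suc n)) powr p \<le> poincare_const p * \<rho>2 600 powr p"
        using H by (simp only: mult_le_cancel_left_pos)
      then have "(\<rho>1 (real (2 * Suc n)) powr p) powr (1 / p) \<le> (poincare_const p * \<rho>2 600 powr p) powr (1 / p)"
        using p by (intro powr_mono2) auto
      moreover have "(\<rho>1 (real (2 * Suc n)) powr p) powr (1 / p) = \<rho>1 (real (2 * Suc n))"
        using p mono(3)[of "real (2 * Suc n)" "real (2 * Suc n)"] by (simp add: powr_powr)
      ultimately show ?thesis by simp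
    qed
    note bound = this
    have "\<rho>1 s \<le> (poincare_const p * \<rho>2 600 powr p) powr (1 / p)" if "0 \<le> s" for s
    proof -
      have "s \<le> real (nat \<lceil>s\<rceil>)" by (rule real_nat_ceiling_ge)
      also have "\<dots> \<le> real (2 * Suc (nat \<lceil>s\<rceil>))" by simp
      finally have "\<rho>1 s \<le> \<rho>1 (real (2 * Suc (nat \<lceil>s\<rceil>)))" by (rule mono(1)[OF that])
      then show ?thesis using bound[of "nat \<lceil>s\<rceil>"] by (rule order_trans)
    qed
    then have "bdd_above (\<rho>1 ` {0..})" by (intro bdd_aboveI2) simp
    then show False using \<rho>(1) by (simp add: control_function_def)
  qed
  moreover have "\<not> weakly_contains_some_expanders ?X d"
  proof (rule no_weakly_contained_expanders[OF d fin])
    show "finite (covered_quotient.wall_set {0, 1, 2} (cong_ker (Suc n)) (N n) x)" if "x \<in> Xs n" for n x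
      by (rule covered_quotient.finite_wall_set[OF cq])
    show "real (card (sdiff (covered_quotient.wall_set {0, 1, 2} (cong_ker (Suc n)) (N n) x)
        (covered_quotient.wall_set {0, 1, 2} (cong_ker (Suc n)) (N n) y))) \<le> ds n x y"
      if "x \<in> Xs n" "y \<in> Xs n" for n x y
      using covered_quotient.card_wall_sets_le[OF cq] that unfolding ds Xs_def F3_def by blast
    show "real (card (sdiff (covered_quotient.wall_set {0, 1, 2} (cong_ker (Suc n)) (N n) x)
        (covered_quotient.wall_set {0, 1, 2} (cong_ker (Suc n)) (N n) y))) = ds n x y"
      if "x \<in> Xs n" "y \<in> Xs n" "ds n x y < real (2 * Suc n)" for n x y
      using that unfolding ds Xs_def F3_def
    proof (rule covered_quotient.card_wall_sets_eq[OF cq])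
      show "real (2 * Suc n) \<le> real (length w)" if "w \<in> cong_ker (Suc n)" "w \<noteq> []" for w
        unfolding of_nat_le_iff by (rule girth_cong_ker[OF that])
    qed
    show "filterlim (\<lambda>n. real (2 * Suc n)) at_top sequentially"
      by (rule filterlim_at_top_mono[OF filterlim_real_sequentially]) simp
  qed
  ultimately have "\<forall>p\<ge>1. \<not> coarsely_embeds_into_Lp ?X d p" "\<not> weakly_contains_some_expanders ?X d" by blast+
  with box show ?thesis by (intro exI conjI)
qed

theorem theorem6:
  shows "(\<exists>(\<Gamma> :: (nat \<times> bool) list monoid) X d.
            group \<Gamma> \<and> (\<exists>S. finite_generating_set \<Gamma> S) \<and> residually_finite \<Gamma> \<and>
            box_space \<Gamma> X d \<and>
            (\<forall>p\<ge>1. \<not> coarsely_embeds_into_Lp X d p) \<and>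
            \<not> weakly_contains_some_expanders X d)
       \<and> (\<exists>X d. box_space (free_group {0, 1, 2 :: nat}) X d \<and>
            (\<forall>p\<ge>1. \<not> coarsely_embeds_into_Lp X d p) \<and>
            \<not> weakly_contains_some_expanders X d)"
proof -
  obtain X d where Xd: "box_space F3 X d" "\<forall>p\<ge>1. \<not> coarsely_embeds_into_Lp X d p"
      "\<not> weakly_contains_some_expanders X d"
    using box_space_main by blast
  obtain S and N :: "nat \<Rightarrow> (nat \<times> bool) list set" where S: "finite_generating_set F3 S" and N: "\<And>n. finite_index_normal (N n) F3" "(\<Inter>n. N n) = {\<one>\<^bsub>F3\<^esub>}"
    using Xd(1) unfolding box_space_def by blast
  have "residually_finite F3"
    unfolding residually_finite_def
  proof (intro ballI impI)
    fix g assume "g \<noteq> \<one>\<^bsub>F3\<^esub>"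
    then obtain n where "g \<notin> N n" using N(2) by blast
    then show "\<exists>N. finite_index_normal N F3 \<and> g \<notin> N" using N(1) by blast
  qed
  then have "group F3 \<and> (\<exists>S. finite_generating_set F3 S) \<and> residually_finite F3 \<and> box_space F3 X d \<and>
      (\<forall>p\<ge>1. \<not> coarsely_embeds_into_Lp X d p) \<and> \<not> weakly_contains_some_expanders X d"
    using Xd S group_F3 by (intro conjI exI)
  then show ?thesis unfolding F3_def by (intro conjI[OF exI[of _ "free_group {0, 1, 2}"]] exI[of _ X] exI[of _ d]) simp_all
qed

end
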